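(* Let $N\ge1$, $l\ge0$. The algebra $\mathcal H_N^{l,+}$ is generated over $\mathbb C[Z_1^{\pm1},\dots,Z_l^{\pm1},q^{\pm1},\mathbf t^{\pm1}]$ by $T_i$ ($1\le i\le N-1$) and $X_i$, $D_i:=D_i^{(l)}$, $Y_i$ ($1\le i\le N$) with the following defining relations. (1) $(T_i-\mathbf t)(T_i+\mathbf t^{-1})=0$; $T_iT_{i+1}T_i=T_{i+1}T_iT_{i+1}$; $T_iT_j=T_jT_i$ for $|i-j|\ge2$; $T_iX_iT_i=X_{i+1}$; $T_iX_j=X_jT_i$ for $j\neq i,i+1$; $T_iY_iT_i=Y_{i+1}$; $T_iY_j=Y_jT_i$ for $j\neq i,i+1$; $[X_i,X_j]=0$; $[Y_i,Y_j]=0$. (2) With $J_N=T_1\cdots T_{N-2}T_{N-1}^2T_{N-2}\cdots T_1$: $$X_iY_j=Y_jX_iT_{j-1}^{-1}\cdots T_{i+1}^{-1}T_i^2T_{i+1}\cdots T_{j-1}\quad(i<j),$$ $$Y_iX_j=T_{j-1}\cdots T_{i+1}T_i^{-2}T_{i+1}^{-1}\cdots T_{j-1}^{-1}X_jY_i\quad(i<j),$$ $$Y_iT_{i-1}^{-1}\cdots T_1^{-2}\cdots T_{i-1}^{-1}X_i=q\,X_iT_i\cdots T_{N-1}^2\cdots T_iY_i,$$ $$[D_i,D_j]=0,$$ $$T_i^{-1}D_iT_i^{-1}=D_{i+1},\qquad [T_j,D_i]=0\ \text{ for } j\ne i-1,i,$$ $$D_iY_j=Y_jT_{j-1}^{-1}\cdots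 T_{i+1}^{-1}T_i^{-2}T_{i+1}\cdots T_{j-1}D_i\quad(i<j),$$ $$D_jT_{j-1}\cdots T_{i+1}T_i^2T_{i+1}^{-1}\cdots T_{j-1}^{-1}Y_i=Y_iD_j\quad(i<j),$$ $$D_iY_iT_{i-1}^{-1}\cdots T_1^{-2}\cdots T_{i-1}^{-1}=q\,T_i\cdots T_{N-1}^2\cdots T_iY_iD_i,$$ $$X_1D_1=(Y_1-Z_1)\cdots(Y_1-Z_l),\qquad D_1X_1=(qJ_NY_1-Z_1)\cdots(qJ_NY_1-Z_l),$$ $$[D_1,X_2]=(\mathbf t^{-1}-\mathbf t)\sum_{r=1}^l(qJ_NY_1-Z_1)\cdots(qJ_NY_1-Z_{r-1})\,Y_2T_1^{-2}(Y_2T_1^{-2}-Z_{r+1})\cdots(Y_2T_1^{-2}-Z_l)\,T_1.$$ The algebra $\mathcal H_N^l$ is defined by the same generators and relations, adding the condition that the $Y_i$ are invertible.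
   Context: $q,\mathbf t,Z_1,\dots,Z_l$ are invertible central variables, $t=\mathbf t^2$. The DAHA $\mathcal H_N$ is the algebra over $\mathbb C[q^{\pm1},\mathbf t^{\pm1}]$ generated by invertible $X_i,Y_i$ ($1\le i\le N$) and $T_i$ ($1\le i\le N-1$) with relations: $(T_i-\mathbf t)(T_i+\mathbf t^{-1})=0$; $T_iT_{i+1}T_i=T_{i+1}T_iT_{i+1}$; $T_iT_j=T_jT_i$ for $|i-j|\ge2$; $T_iX_iT_i=X_{i+1}$; $T_iX_j=X_jT_i$ for $j\ne i,i+1$; $T_iY_iT_i=Y_{i+1}$; $T_iY_j=Y_jT_i$ for $j\neq i,i+1$; $X_1^{-1}Y_2^{-1}X_1Y_2=T_1^2$; $Y_i\tilde X=q\tilde XY_i$; $X_i\tilde Y=q^{-1}\tilde YX_i$; $[X_i,X_j]=0$; $[Y_i,Y_j]=0$, where $\tilde X=\prod_iX_i$, $\tilde Y=\prod_iY_i$. Let $\pi=X_1T_1\cdots T_{N-1}$. The cyclotomic DAHA $\mathcal H_N^l$ is the subalgebra of $\mathcal H_N[Z_1^{\pm1},\dots,Z_l^{\pm1}]$ generated by $T_i$ ($1\le i\le N-1$), $Y_i^{\pm1}$ ($1\le i\le N$), $\pi$ and $\pi^{-1}\prod_{i=1}^l(Y_1-Z_i)$. Put $D_1^{(l)}=X_1^{-1}(Y_1-Z_1)\cdots(Y_1-Z_l)$ and $D_i^{(l)}=T_{i-1}^{-1}\cdots T_1^{-1}D_1^{(l)}T_1^{-1}\cdots T_{i-1}^{-1}$.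 The unlocalized version $\mathcal H_N^{l,+}$ is the subalgebra generated by all $T_i$, $X_i$, $D_i^{(l)}$ and $Y_i$ (without $Y_i^{-1}$); $\mathcal H_N^l$ is generated by the same elements together with the $Y_i^{-1}$. Notation: $T_{i-1}^{-1}\cdots T_1^{-2}\cdots T_{i-1}^{-1}$ means $T_{i-1}^{-1}\cdots T_2^{-1}T_1^{-2}T_2^{-1}\cdots T_{i-1}^{-1}$ (equal to $1$ for $i=1$); $T_i\cdots T_{N-1}^2\cdots T_i$ means $T_i\cdots T_{N-2}T_{N-1}^2T_{N-2}\cdots T_i$ (equal to $1$ for $i=N$); $J_1=1$. Relations involving indices larger than $N$ are absent. *)

theory Defs
  imports
    Complex_Main
    "HOL-Library.Poly_Mapping"
    "HOL-Algebra.QuotRing"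
    "HOL-Algebra.Generated_Rings"
begin

section \<open>Free algebras and presentations\<close>

datatype 'g fword = Word (letters: "'g list")

instantiation fword :: (type) monoid_add
begin

definition zero_fword :: "'a fword" where
  "0 = Word []"

definition plus_fword :: "'a fword \<Rightarrow> 'a fword \<Rightarrow> 'a fword" where
  "u + v = Word (letters u @ letters v)"

instance
  by intro_classes (simp_all add: zero_fword_def plus_fword_def)

end

text \<open>
  With words as exponents, the convolution product of \<^typ>\<open>'g fword \<Rightarrow>\<^sub>0 'k\<close> is the product of the
  free associative algebra on \<^typ>\<open>'g\<close> over \<^typ>\<open>'k\<close>, in which the scalars are central.
\<close>

type_synonym ('g, 'k) falg = "'g fword \<Rightarrow>\<^sub>0 'k"

definition scal :: "'k::comm_ring_1 \<Rightarrow> ('g, 'k) falg" where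
  "scal c = Poly_Mapping.single 0 c"

definition gen :: "'g \<Rightarrow> ('g, 'k::comm_ring_1) falg" where
  "gen g = Poly_Mapping.single (Word [g]) 1"

text \<open>The free algebra over the subring \<open>K\<close> of \<^typ>\<open>'k\<close> on the set \<open>G\<close> of generators.\<close>

definition free_algebra :: "'k::comm_ring_1 set \<Rightarrow> 'g set \<Rightarrow> ('g, 'k) falg ring" where
  "free_algebra K G =
    \<lparr>carrier = {p. \<forall>w\<in>Poly_Mapping.keys p. Poly_Mapping.lookup p w \<in> K \<and> set (letters w) \<subseteq> G},
     mult = (*), one = 1, zero = 0, add = (+)\<rparr>"

text \<open>A relation \<open>a = b\<close> is encoded as the pair \<open>(a, b)\<close>; the ideal is two-sided.\<close>

definition rel_ideal ::
  "'k::comm_ring_1 set \<Rightarrow> 'g set \<Rightarrow> (('g, 'k) falg \<times> ('g, 'k) falg) set \<Rightarrow> ('g, 'k) falg set" where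
  "rel_ideal K G R = genideal (free_algebra K G) {a - b | a b. (a, b) \<in> R}"

definition presented ::
  "'k::comm_ring_1 set \<Rightarrow> 'g set \<Rightarrow> (('g, 'k) falg \<times> ('g, 'k) falg) set \<Rightarrow> ('g, 'k) falg set ring" where
  "presented K G R = free_algebra K G Quot rel_ideal K G R"

definition pclass ::
  "'k::comm_ring_1 set \<Rightarrow> 'g set \<Rightarrow> (('g, 'k) falg \<times> ('g, 'k) falg) set
    \<Rightarrow> ('g, 'k) falg \<Rightarrow> ('g, 'k) falg set" where
  "pclass K G R p = rel_ideal K G R +>\<^bsub>free_algebra K G\<^esub> p"

text \<open>
  \<open>B\<close> is a ring which is a \<open>K\<close>-algebra through \<open>\<sigma>\<close>, and \<open>v g\<close> is the element of \<open>B\<close> named by the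
  generator \<open>g\<close>. The predicate says that \<open>B\<close> is generated over \<open>K\<close> by the elements \<open>v g\<close> with
  \<open>R\<close> as defining relations.
\<close>

definition has_presentation ::
  "('b, 'm) ring_scheme \<Rightarrow> 'k::comm_ring_1 set \<Rightarrow> ('k \<Rightarrow> 'b) \<Rightarrow> 'g set \<Rightarrow> ('g \<Rightarrow> 'b)
    \<Rightarrow> (('g, 'k) falg \<times> ('g, 'k) falg) set \<Rightarrow> bool" where
  "has_presentation B K \<sigma> G v R \<longleftrightarrow>
    (\<exists>h \<in> ring_iso (presented K G R) B.
       (\<forall>c\<in>K. h (pclass K G R (scal c)) = \<sigma> c) \<and>
       (\<forall>g\<in>G. h (pclass K G R (gen g)) = v g))"


section \<open>Laurent polynomials\<close>

text \<open>
  Laurent polynomials are finitely supported functions on integer exponent vectors.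
  \<^term>\<open>lvar v k\<close> is the \<open>k\<close>-th power of the variable \<open>v\<close>.
\<close>

definition lvar :: "'v \<Rightarrow> int \<Rightarrow> ('v \<Rightarrow>\<^sub>0 int) \<Rightarrow>\<^sub>0 'k::comm_ring_1" where
  "lvar v k = Poly_Mapping.single (Poly_Mapping.single v k) 1"

datatype qt_var = Var_q | Var_t

type_synonym qt_laurent = "(qt_var \<Rightarrow>\<^sub>0 int) \<Rightarrow>\<^sub>0 complex"

text \<open>
  \<open>\<complex>[Z\<^sub>1\<^sup>\<plusminus>\<^sup>1, \<dots>, Z\<^sub>l\<^sup>\<plusminus>\<^sup>1, q\<^sup>\<plusminus>\<^sup>1, \<^bold>t\<^sup>\<plusminus>\<^sup>1]\<close> as the ring of Laurent polynomials in \<open>Z\<^sub>1, \<dots>, Z\<^sub>l\<close> over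
  \<open>\<complex>[q\<^sup>\<plusminus>\<^sup>1, \<^bold>t\<^sup>\<plusminus>\<^sup>1]\<close>: the type has variables \<open>Z\<^sub>r\<close> for all natural numbers \<open>r\<close>, and
  \<open>Zqt_coeffs l\<close> is the subring in which only \<open>Z\<^sub>1, \<dots>, Z\<^sub>l\<close> occur.
\<close>

type_synonym Zqt_laurent = "(nat \<Rightarrow>\<^sub>0 int) \<Rightarrow>\<^sub>0 qt_laurent"

definition Zqt_coeffs :: "nat \<Rightarrow> Zqt_laurent set" where
  "Zqt_coeffs l = {c. \<forall>m\<in>Poly_Mapping.keys c. Poly_Mapping.keys m \<subseteq> {1..l}}"

text \<open>\<open>R[Z\<^sub>1\<^sup>\<plusminus>\<^sup>1, \<dots>, Z\<^sub>l\<^sup>\<plusminus>\<^sup>1]\<close> with central variables, for a possibly noncommutative ring \<open>R\<close>.\<close>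

definition laurent_ring :: "nat \<Rightarrow> ('a, 'm) ring_scheme \<Rightarrow> ((nat \<Rightarrow>\<^sub>0 int) \<Rightarrow> 'a) ring" where
  "laurent_ring l R =
    \<lparr>carrier = {f. (\<forall>m. f m \<in> carrier R) \<and> finite {m. f m \<noteq> \<zero>\<^bsub>R\<^esub>} \<and>
                   (\<forall>m. f m \<noteq> \<zero>\<^bsub>R\<^esub> \<longrightarrow> Poly_Mapping.keys m \<subseteq> {1..l})},
     mult = (\<lambda>f g m. \<Oplus>\<^bsub>R\<^esub>a\<in>{a. f a \<noteq> \<zero>\<^bsub>R\<^esub>}. f a \<otimes>\<^bsub>R\<^esub> g (m - a)),
     one = (\<lambda>m. if m = 0 then \<one>\<^bsub>R\<^esub> else \<zero>\<^bsub>R\<^esub>),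
     zero = (\<lambda>m. \<zero>\<^bsub>R\<^esub>),
     add = (\<lambda>f g m. f m \<oplus>\<^bsub>R\<^esub> g m)\<rparr>"


section \<open>The double affine Hecke algebra\<close>

text \<open>
  One type of generator names serves both algebras: \<open>D\<close> does not occur in the DAHA, and the
  inverses of the \<open>X\<^sub>i\<close> do not occur in the presentations of the cyclotomic algebras. No names for
  the inverses of the \<open>T\<^sub>i\<close> are needed, see \<open>T_inv_relator\<close> below.
\<close>

datatype generator = Gen_T nat | Gen_X nat | Gen_Xinv nat | Gen_Y nat | Gen_Yinv nat | Gen_D nat

type_synonym 'k relations = "((generator, 'k) falg \<times> (generator, 'k) falg) set"

abbreviation T :: "nat \<Rightarrow> (generator, 'k::comm_ring_1) falg" where "T i \<equiv> gen (Gen_T i)"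
abbreviation X :: "nat \<Rightarrow> (generator, 'k::comm_ring_1) falg" where "X i \<equiv> gen (Gen_X i)"
abbreviation Xinv :: "nat \<Rightarrow> (generator, 'k::comm_ring_1) falg" where "Xinv i \<equiv> gen (Gen_Xinv i)"
abbreviation Y :: "nat \<Rightarrow> (generator, 'k::comm_ring_1) falg" where "Y i \<equiv> gen (Gen_Y i)"
abbreviation Yinv :: "nat \<Rightarrow> (generator, 'k::comm_ring_1) falg" where "Yinv i \<equiv> gen (Gen_Yinv i)"
abbreviation D :: "nat \<Rightarrow> (generator, 'k::comm_ring_1) falg" where "D i \<equiv> gen (Gen_D i)"

text \<open>
  The relations common to the DAHA and to the presentations of the cyclotomic algebras; the
  arguments \<open>t\<close> and \<open>t'\<close> stand for \<open>\<^bold>t\<close> and its inverse in the respective ring of scalars.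
\<close>

definition affine_rels :: "'k::comm_ring_1 \<Rightarrow> 'k \<Rightarrow> nat \<Rightarrow> 'k relations" where
  "affine_rels t t' N =
     {((T i - scal t) * (T i + scal t'), 0) | i. i \<in> {1..<N}}
   \<union> {(T i * T (i+1) * T i, T (i+1) * T i * T (i+1)) | i. 1 \<le> i \<and> i + 1 < N}
   \<union> {(T i * T j, T j * T i) | i j. i \<in> {1..<N} \<and> j \<in> {1..<N} \<and> (i + 2 \<le> j \<or> j + 2 \<le> i)}
   \<union> {(T i * X i * T i, X (i+1)) | i. i \<in> {1..<N}}
   \<union> {(T i * X j, X j * T i) | i j. i \<in> {1..<N} \<and> j \<in> {1..N} \<and> j \<noteq> i \<and> j \<noteq> i + 1}
   \<union> {(T i * Y i * T i, Y (i+1)) | i. i \<in> {1..<N}}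
   \<union> {(T i * Y j, Y j * T i) | i j. i \<in> {1..<N} \<and> j \<in> {1..N} \<and> j \<noteq> i \<and> j \<noteq> i + 1}
   \<union> {(X i * X j, X j * X i) | i j. i \<in> {1..N} \<and> j \<in> {1..N}}
   \<union> {(Y i * Y j, Y j * Y i) | i j. i \<in> {1..N} \<and> j \<in> {1..N}}"

definition X_inverse_rels :: "nat \<Rightarrow> 'k::comm_ring_1 relations" where
  "X_inverse_rels N =
     {(X i * Xinv i, 1) | i. i \<in> {1..N}} \<union> {(Xinv i * X i, 1) | i. i \<in> {1..N}}"

definition Y_inverse_rels :: "nat \<Rightarrow> 'k::comm_ring_1 relations" where
  "Y_inverse_rels N =
     {(Y i * Yinv i, 1) | i. i \<in> {1..N}} \<union> {(Yinv i * Y i, 1) | i. i \<in> {1..N}}"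

definition daha_gens :: "nat \<Rightarrow> generator set" where
  "daha_gens N =
     Gen_T ` {1..<N} \<union> Gen_X ` {1..N} \<union> Gen_Xinv ` {1..N} \<union> Gen_Y ` {1..N} \<union> Gen_Yinv ` {1..N}"

definition X_tilde :: "nat \<Rightarrow> (generator, 'k::comm_ring_1) falg" where
  "X_tilde N = prod_list (map X [1..<N+1])"

definition Y_tilde :: "nat \<Rightarrow> (generator, 'k::comm_ring_1) falg" where
  "Y_tilde N = prod_list (map Y [1..<N+1])"

definition daha_rels :: "nat \<Rightarrow> qt_laurent relations" where
  "daha_rels N =
     affine_rels (lvar Var_t 1) (lvar Var_t (-1)) N \<union> X_inverse_rels N \<union> Y_inverse_rels N
   \<union> (if 2 \<le> N then {(Xinv 1 * Yinv 2 * X 1 * Y 2, T 1 ^ 2)} else {})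
   \<union> {(Y i * X_tilde N, scal (lvar Var_q 1) * X_tilde N * Y i) | i. i \<in> {1..N}}
   \<union> {(X i * Y_tilde N, scal (lvar Var_q (-1)) * Y_tilde N * X i) | i. i \<in> {1..N}}"

definition daha :: "nat \<Rightarrow> (generator, qt_laurent) falg set ring" where
  "daha N = presented UNIV (daha_gens N) (daha_rels N)"

definition daha_class :: "nat \<Rightarrow> (generator, qt_laurent) falg \<Rightarrow> (generator, qt_laurent) falg set" where
  "daha_class N p = pclass UNIV (daha_gens N) (daha_rels N) p"


section \<open>The cyclotomic double affine Hecke algebra\<close>

type_synonym daha_Z_elem = "(nat \<Rightarrow>\<^sub>0 int) \<Rightarrow> (generator, qt_laurent) falg set"

definition daha_Z :: "nat \<Rightarrow> nat \<Rightarrow> daha_Z_elem ring" where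
  "daha_Z N l = laurent_ring l (daha N)"

definition hT :: "nat \<Rightarrow> nat \<Rightarrow> daha_Z_elem" where
  "hT N i = (\<lambda>m. daha_class N (if m = 0 then T i else 0))"

definition hX :: "nat \<Rightarrow> nat \<Rightarrow> daha_Z_elem" where
  "hX N i = (\<lambda>m. daha_class N (if m = 0 then X i else 0))"

definition hY :: "nat \<Rightarrow> nat \<Rightarrow> daha_Z_elem" where
  "hY N i = (\<lambda>m. daha_class N (if m = 0 then Y i else 0))"

text \<open>The structure map of \<^term>\<open>daha_Z N l\<close> as an algebra over \<^term>\<open>Zqt_coeffs l\<close>.\<close>

definition hscal :: "nat \<Rightarrow> Zqt_laurent \<Rightarrow> daha_Z_elem" where
  "hscal N c = (\<lambda>m. daha_class N (scal (Poly_Mapping.lookup c m)))"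

definition ring_prod_list :: "('a, 'm) ring_scheme \<Rightarrow> 'a list \<Rightarrow> 'a" where
  "ring_prod_list R xs = foldr (\<lambda>x y. x \<otimes>\<^bsub>R\<^esub> y) xs \<one>\<^bsub>R\<^esub>"

text \<open>\<open>(Y\<^sub>1 - Z\<^sub>1) \<cdots> (Y\<^sub>1 - Z\<^sub>l)\<close>\<close>

definition hYZ :: "nat \<Rightarrow> nat \<Rightarrow> daha_Z_elem" where
  "hYZ N l = ring_prod_list (daha_Z N l)
     (map (\<lambda>r. hY N 1 \<ominus>\<^bsub>daha_Z N l\<^esub> hscal N (lvar r 1)) [1..<l+1])"

definition hD :: "nat \<Rightarrow> nat \<Rightarrow> nat \<Rightarrow> daha_Z_elem" where
  "hD N l i = ring_prod_list (daha_Z N l)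
     (map (\<lambda>k. inv\<^bsub>daha_Z N l\<^esub> hT N k) (rev [1..<i])
      @ [inv\<^bsub>daha_Z N l\<^esub> hX N 1 \<otimes>\<^bsub>daha_Z N l\<^esub> hYZ N l]
      @ map (\<lambda>k. inv\<^bsub>daha_Z N l\<^esub> hT N k) [1..<i])"

definition hpi :: "nat \<Rightarrow> nat \<Rightarrow> daha_Z_elem" where
  "hpi N l = ring_prod_list (daha_Z N l) (hX N 1 # map (hT N) [1..<N])"

definition cyc_daha :: "nat \<Rightarrow> nat \<Rightarrow> daha_Z_elem ring" where
  "cyc_daha N l = (daha_Z N l)\<lparr>carrier := generate_ring (daha_Z N l)
     (hscal N ` Zqt_coeffs l \<union> hT N ` {1..<N} \<union> hY N ` {1..N}
      \<union> (\<lambda>i. inv\<^bsub>daha_Z N l\<^esub> hY N i) ` {1..N}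
      \<union> {hpi N l, inv\<^bsub>daha_Z N l\<^esub> hpi N l \<otimes>\<^bsub>daha_Z N l\<^esub> hYZ N l})\<rparr>"

definition cyc_daha_plus :: "nat \<Rightarrow> nat \<Rightarrow> daha_Z_elem ring" where
  "cyc_daha_plus N l = (daha_Z N l)\<lparr>carrier := generate_ring (daha_Z N l)
     (hscal N ` Zqt_coeffs l \<union> hT N ` {1..<N} \<union> hX N ` {1..N} \<union> hD N l ` {1..N} \<union> hY N ` {1..N})\<rparr>"


section \<open>Generators and relations of the cyclotomic algebras\<close>

text \<open>\<open>Xinv\<close> is not among the generators of the presentations; its value is a dummy.\<close>

fun cyc_value :: "nat \<Rightarrow> nat \<Rightarrow> generator \<Rightarrow> daha_Z_elem" where
  "cyc_value N l (Gen_T i) = hT N i"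
| "cyc_value N l (Gen_X i) = hX N i"
| "cyc_value N l (Gen_Xinv i) = undefined"
| "cyc_value N l (Gen_Y i) = hY N i"
| "cyc_value N l (Gen_Yinv i) = inv\<^bsub>daha_Z N l\<^esub> hY N i"
| "cyc_value N l (Gen_D i) = hD N l i"

definition cyc_plus_gens :: "nat \<Rightarrow> generator set" where
  "cyc_plus_gens N = Gen_T ` {1..<N} \<union> Gen_X ` {1..N} \<union> Gen_D ` {1..N} \<union> Gen_Y ` {1..N}"

definition cyc_gens :: "nat \<Rightarrow> generator set" where
  "cyc_gens N = cyc_plus_gens N \<union> Gen_Yinv ` {1..N}"

definition cq :: Zqt_laurent where "cq = Poly_Mapping.single 0 (lvar Var_q 1)"
definition ct :: Zqt_laurent where "ct = Poly_Mapping.single 0 (lvar Var_t 1)"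
definition ct' :: Zqt_laurent where "ct' = Poly_Mapping.single 0 (lvar Var_t (-1))"

text \<open>
  \<open>T\<^sub>i\<^sup>-\<^sup>1\<close> in a relation stands for \<open>T\<^sub>i - \<^bold>t + \<^bold>t\<^sup>-\<^sup>1\<close>, which the quadratic relation forces to be the
  inverse of \<open>T\<^sub>i\<close>.
\<close>

definition Tinv :: "nat \<Rightarrow> (generator, Zqt_laurent) falg" where
  "Tinv i = T i - scal ct + scal ct'"

lemma scal_add: "scal a + scal b = scal (a + b)"
  by (simp add: scal_def single_add)

lemma scal_mult: "scal a * scal b = scal (a * b)"
  by (simp add: scal_def mult_single)

lemma scal_one: "scal 1 = 1"
  by (simp add: scal_def)

lemma scal_gen_commute: "scal a * gen g = gen g * scal a"
  by (simp add: scal_def gen_def mult_single)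

lemma ct_inverse: "ct * ct' = 1" "ct' * ct = 1"
  by (simp_all add: ct_def ct'_def lvar_def mult_single flip: single_add)

lemma T_inv_relator:
  "T i * Tinv i - 1 = (T i - scal ct) * (T i + scal ct')"
  "Tinv i * T i - 1 = (T i - scal ct) * (T i + scal ct')"
  using scal_gen_commute[of ct "Gen_T i"] scal_gen_commute[of ct' "Gen_T i"]
  by (simp_all add: Tinv_def algebra_simps scal_mult ct_inverse scal_one)

text \<open>
  In the index ranges below, \<open>T_up a b\<close> is \<open>[T\<^sub>a, \<dots>, T\<^sub>b\<^sub>-\<^sub>1]\<close> and \<open>T_down a b\<close> is \<open>[T\<^sub>b\<^sub>-\<^sub>1, \<dots>, T\<^sub>a]\<close>,
  empty if \<open>b \<le> a\<close>, and similarly for the inverses.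
\<close>

definition T_up :: "nat \<Rightarrow> nat \<Rightarrow> (generator, Zqt_laurent) falg list" where
  "T_up a b = map T [a..<b]"

definition T_down :: "nat \<Rightarrow> nat \<Rightarrow> (generator, Zqt_laurent) falg list" where
  "T_down a b = map T (rev [a..<b])"

definition Tinv_up :: "nat \<Rightarrow> nat \<Rightarrow> (generator, Zqt_laurent) falg list" where
  "Tinv_up a b = map Tinv [a..<b]"

definition Tinv_down :: "nat \<Rightarrow> nat \<Rightarrow> (generator, Zqt_laurent) falg list" where
  "Tinv_down a b = map Tinv (rev [a..<b])"

text \<open>\<open>T\<^sub>i \<cdots> T\<^sub>N\<^sub>-\<^sub>1\<^sup>2 \<cdots> T\<^sub>i\<close>; the case \<open>i = 1\<close> is \<open>J\<^sub>N\<close>.\<close>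

definition T_loop :: "nat \<Rightarrow> nat \<Rightarrow> (generator, Zqt_laurent) falg" where
  "T_loop N i = prod_list (T_up i N @ T_down i N)"

abbreviation J :: "nat \<Rightarrow> (generator, Zqt_laurent) falg" where
  "J N \<equiv> T_loop N 1"

text \<open>\<open>T\<^sub>i\<^sub>-\<^sub>1\<^sup>-\<^sup>1 \<cdots> T\<^sub>1\<^sup>-\<^sup>2 \<cdots> T\<^sub>i\<^sub>-\<^sub>1\<^sup>-\<^sup>1\<close>\<close>

definition Tinv_loop :: "nat \<Rightarrow> (generator, Zqt_laurent) falg" where
  "Tinv_loop i = prod_list (Tinv_down 1 i @ Tinv_up 1 i)"

text \<open>\<open>(a - Z\<^sub>m) \<cdots> (a - Z\<^sub>n)\<close>, equal to \<open>1\<close> if \<open>n < m\<close>\<close>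

definition minus_Z_prod ::
  "(generator, Zqt_laurent) falg \<Rightarrow> nat \<Rightarrow> nat \<Rightarrow> (generator, Zqt_laurent) falg" where
  "minus_Z_prod a m n = prod_list (map (\<lambda>r. a - scal (lvar r 1)) [m..<n+1])"

definition cyc_rels :: "nat \<Rightarrow> nat \<Rightarrow> Zqt_laurent relations" where
  "cyc_rels N l =
     affine_rels ct ct' N
   \<union> {(X i * Y j,
       Y j * X i * prod_list (Tinv_down (i+1) j @ [T i ^ 2] @ T_up (i+1) j))
      | i j. 1 \<le> i \<and> i < j \<and> j \<le> N}
   \<union> {(Y i * X j,
       prod_list (T_down (i+1) j @ [Tinv i ^ 2] @ Tinv_up (i+1) j) * X j * Y i)
      | i j. 1 \<le> i \<and> i < j \<and> j \<le> N}
   \<union> {(Y i * Tinv_loop i * X i, scal cq * X i * T_loop N i * Y i) | i. i \<in> {1..N}}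
   \<union> {(D i * D j, D j * D i) | i j. i \<in> {1..N} \<and> j \<in> {1..N}}
   \<union> {(Tinv i * D i * Tinv i, D (i+1)) | i. i \<in> {1..<N}}
   \<union> {(T j * D i, D i * T j) | i j. i \<in> {1..N} \<and> j \<in> {1..<N} \<and> j + 1 \<noteq> i \<and> j \<noteq> i}
   \<union> {(D i * Y j,
       Y j * prod_list (Tinv_down (i+1) j @ [Tinv i ^ 2] @ T_up (i+1) j) * D i)
      | i j. 1 \<le> i \<and> i < j \<and> j \<le> N}
   \<union> {(D j * prod_list (T_down (i+1) j @ [T i ^ 2] @ Tinv_up (i+1) j) * Y i,
       Y i * D j)
      | i j. 1 \<le> i \<and> i < j \<and> j \<le> N}
   \<union> {(D i * Y i * Tinv_loop i, scal cq * T_loop N i * Y i * D i) | i. i \<in> {1..N}}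
   \<union> {(X 1 * D 1, minus_Z_prod (Y 1) 1 l)}
   \<union> {(D 1 * X 1, minus_Z_prod (scal cq * J N * Y 1) 1 l)}
   \<union> (if 2 \<le> N then
       {(D 1 * X 2 - X 2 * D 1,
         scal (ct' - ct) *
           (\<Sum>r = 1..l. minus_Z_prod (scal cq * J N * Y 1) 1 (r - 1)
                         * (Y 2 * Tinv 1 ^ 2)
                         * minus_Z_prod (Y 2 * Tinv 1 ^ 2) (r + 1) l * T 1))}
      else {})"

end

theory Submission
  imports Defs
    "HOL-Library.Multiset"
    "HOL-Computational_Algebra.Fraction_Field"
    "HOL-Computational_Algebra.Polynomial_FPS"
begin

text \<open>
  Every relation holds in the DAHA: the relations between \<open>X\<^sub>i\<close> and \<open>Y\<^sub>j\<close> follow from the one for \<open>X\<^sub>1, Y\<^sub>2\<close> by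
  conjugation with the braid generators and from the commutation of \<open>Y\<^sub>1\<close> with the product of all \<open>X\<^sub>i\<close>,
  and the relations for \<open>D\<^sub>i\<close> follow from \<open>D\<^sub>1 = X\<^sub>1\<^sup>-\<^sup>1 \<Prod>(Y\<^sub>1 - Z\<^sub>r)\<close>.

  Conversely, the relations rewrite every element of the presented algebra as a combination of the ordered
  products of a monomial in the \<open>X\<^sub>i\<close> and \<open>D\<^sub>i\<close> which contains at most one of \<open>X\<^sub>i\<close> and \<open>D\<^sub>i\<close> for each \<open>i\<close>, a
  monomial in the \<open>Y\<^sub>i\<close>, and a reduced word in the \<open>T\<^sub>i\<close>. These products are linearly independent in the
  DAHA. To see this, let the DAHA act by Demazure--Lusztig operators on functions on a lattice of points on which
  the \<open>Y\<^sub>i\<close> act by multiplication with \<open>q\<^sup>k \<xi>\<^sub>j\<close>, with coefficients in the formal power series in \<open>t - 1\<close>. At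
  \<open>t = 1\<close> the \<open>T\<^sub>i\<close> permute the coordinates, while \<open>X\<^sub>i\<close> and \<open>D\<^sub>i\<close> shift them in opposite directions with
  nonzero weights, so that different ordered products with the same \<open>Y\<close>-part move a delta function to different points.
\<close>

text \<open>The obstacle is that no basis of the DAHA is known beforehand, so injectivity is decided
  in a single module. A kernel element is congruent modulo the relations to a combination of ordered
  products; it suffices that the module satisfies the DAHA relations and forces the coefficients of
  such a combination to vanish. Ordered products with the same X, D and T parts move a delta
  function to the same point whatever their Y part is. They are told apart by the values of the
  Y-monomials there, which is why the \<xi>_j are independent of q and the Z_r. Independence of the
  Z_r in turn keeps the weights of the D_i, products of q^k \<xi>_j - Z_r, away from 0. Specializing
  t = 1 outright would lose coefficients divisible by t - 1; power series allow these factors to be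
  divided out. A second obstacle is formal: the rings of the theorem have explicit carriers, while
  long noncommutative computations need a ring type. Relations are therefore verified in a type that
  contains the required quotients and are carried back through a surjection from a free
  algebra.\<close>

declare One_nat_def [simp del]

subsection \<open>Hecke algebras\<close>

lemma mult_right_cong: "a = b \<Longrightarrow> a * x = b * (x::'r::semigroup_mult)"
  by simp

lemma prod_list_commute:
  fixes a :: "'r::monoid_mult"
  assumes "\<And>x. x \<in> set xs \<Longrightarrow> a * x = x * a"
  shows "a * prod_list xs = prod_list xs * a"
  using assms by (induction xs) (simp_all, metis mult.assoc)

lemma prod_list_inverse:
  fixes f g :: "'i \<Rightarrow> 'r::monoid_mult"
  assumes "\<And>x. x \<in> set xs \<Longrightarrow> f x * g x = 1"
  shows "prod_list (map f xs) * prod_list (map g (rev xs)) = 1"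
  using assms
proof (induction xs)
  case (Cons x xs)
  have "prod_list (map f (x # xs)) * prod_list (map g (rev (x # xs)))
    = f x * (prod_list (map f xs) * prod_list (map g (rev xs))) * g x"
    by (simp add: mult.assoc)
  then show ?case using Cons by simp
qed simp

text \<open>Stated for abstract \<open>a\<close>, \<open>b\<close> with two-sided inverses, so that
  exchanging the two letters makes every identity available for neighbouring generators in both
  orders.\<close>

lemma braid_conj_aux:
  fixes a :: "'r::monoid_mult"
  assumes "a * b * a = b * a * b" "a * a' = 1" "a' * a = 1" "b * b' = 1" "b' * b = 1"
  shows "a * b * a' = b' * a * b" "a' * b' * a = b * a' * b'" "a' * b' * a' = b' * a' * b'"
proof -
  show 1: "a * b * a' = b' * a * b"
  proof -
    have "a * b * a' = b' * (b * a * b) * a'" using assms(5) by (simp flip: mult.assoc)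
    also have "\<dots> = b' * (a * b * a) * a'" by (simp only: assms(1))
    finally show ?thesis by (simp add: assms mult.assoc)
  qed
  show 2: "a' * b' * a = b * a' * b'"
  proof -
    have "b * a' * b' = a' * (a * b * a') * b'" using assms(3) by (simp flip: mult.assoc)
    also have "\<dots> = a' * (b' * a * b) * b'" by (simp only: 1)
    finally show ?thesis using assms(4) by (simp add: mult.assoc)
  qed
  show "a' * b' * a' = b' * a' * b'"
  proof -
    have "b' * a' * b' = b' * (b * a' * b') * a'" using 2[symmetric] assms(2) by (simp add: mult.assoc)
    also have "\<dots> = (b' * b) * (a' * b' * a')" by (simp only: mult.assoc)
    finally show ?thesis by (simp add: assms)
  qed
qed

text \<open>\<open>t\<close> and \<open>t'\<close> are central ring elements rather than scalars of
  a fixed field, because the locale is interpreted in two quotient rings, in a ring of operators,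
  and for the inverses of the \<open>T i\<close> themselves.\<close>

locale hecke =
  fixes N :: nat and T :: "nat \<Rightarrow> 'r::ring_1" and t t' :: 'r
  assumes t_central: "t * x = x * t" and t'_central: "t' * x = x * t'" and tt': "t * t' = 1"
    and quad: "i \<in> {1..<N} \<Longrightarrow> (T i - t) * (T i + t') = 0"
    and braid: "1 \<le> i \<Longrightarrow> Suc i < N \<Longrightarrow> T i * T (Suc i) * T i = T (Suc i) * T i * T (Suc i)"
    and far: "i \<in> {1..<N} \<Longrightarrow> j \<in> {1..<N} \<Longrightarrow> i + 2 \<le> j \<Longrightarrow> T i * T j = T j * T i"
begin

definition Ti :: "nat \<Rightarrow> 'r" where "Ti i = T i - t + t'"

lemma t't: "t' * t = 1"
  using tt' t_central by metis

lemma T_Ti: "i \<in> {1..<N} \<Longrightarrow> T i * Ti i = 1" and Ti_T: "i \<in> {1..<N} \<Longrightarrow> Ti i * T i = 1"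
  using quad[of i] t_central[of "T i"] t'_central[of "T i"] tt'
  by (simp_all add: Ti_def algebra_simps)

lemma T_Ti_l: "i \<in> {1..<N} \<Longrightarrow> T i * (Ti i * x) = x"
  and Ti_T_l: "i \<in> {1..<N} \<Longrightarrow> Ti i * (T i * x) = x"
  by (simp_all add: T_Ti Ti_T flip: mult.assoc)

lemma T_square: "i \<in> {1..<N} \<Longrightarrow> T i * T i = 1 + (t - t') * T i"
  using T_Ti[of i] t_central[of "T i"] t'_central[of "T i"]
  by (simp add: Ti_def algebra_simps)

lemma far': "i \<in> {1..<N} \<Longrightarrow> j \<in> {1..<N} \<Longrightarrow> i + 2 \<le> j \<or> j + 2 \<le> i \<Longrightarrow> T i * T j = T j * T i"
  using far by metis

lemma far_Ti: "i \<in> {1..<N} \<Longrightarrow> j \<in> {1..<N} \<Longrightarrow> i + 2 \<le> j \<or> j + 2 \<le> i \<Longrightarrow> T i * Ti j = Ti j * T i"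
  using far'[of i j] t_central[of "T i"] t'_central[of "T i"] by (simp add: Ti_def algebra_simps)

lemma commute_Ti: "T i * x = x * T i \<Longrightarrow> Ti i * x = x * Ti i"
  using t_central[of x] t'_central[of x] by (simp add: Ti_def algebra_simps)

lemma commute_inverse:
  assumes "i \<in> {1..<N}" "Ti i * x = x * Ti i"
  shows "T i * x = x * T i"
proof -
  have "T i * (Ti i * x) * T i = T i * (x * Ti i) * T i" by (simp add: assms)
  then show ?thesis using assms(1) by (simp add: mult.assoc Ti_T T_Ti_l)
qed

lemma braid_conj:
  assumes "1 \<le> i" "Suc i < N"
  shows "T i * T (Suc i) * Ti i = Ti (Suc i) * T i * T (Suc i)"
    and "T (Suc i) * T i * Ti (Suc i) = Ti i * T (Suc i) * T i"
    and "Ti i * Ti (Suc i) * T i = T (Suc i) * Ti i * Ti (Suc i)"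
    and "Ti (Suc i) * Ti i * T (Suc i) = T i * Ti (Suc i) * Ti i"
    and "Ti i * Ti (Suc i) * Ti i = Ti (Suc i) * Ti i * Ti (Suc i)"
proof -
  have r: "i \<in> {1..<N}" "Suc i \<in> {1..<N}" using assms by auto
  note inv = T_Ti[OF r(1)] Ti_T[OF r(1)] T_Ti[OF r(2)] Ti_T[OF r(2)]
  note b = braid[OF assms]
  show "T i * T (Suc i) * Ti i = Ti (Suc i) * T i * T (Suc i)" "T (Suc i) * T i * Ti (Suc i) = Ti i * T (Suc i) * T i"
    using braid_conj_aux[OF b inv] braid_conj_aux[OF b[symmetric] inv(3,4,1,2)] by auto
  show "Ti i * Ti (Suc i) * T i = T (Suc i) * Ti i * Ti (Suc i)" "Ti (Suc i) * Ti i * T (Suc i) = T i * Ti (Suc i) * Ti i"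
    "Ti i * Ti (Suc i) * Ti i = Ti (Suc i) * Ti i * Ti (Suc i)"
    using braid_conj_aux[OF b inv] braid_conj_aux[OF b[symmetric] inv(3,4,1,2)] by auto
qed

text \<open>Inverting all \<open>T i\<close> exchanges \<open>t\<close> and \<open>t'\<close>: as
  \<open>Ti i - t' = T i - t\<close> and \<open>Ti i + t = T i + t'\<close>, the quadratic relation
  is literally the same. Families with A_{i+1} = T_i^{-1} A_i T_i^{-1}, such as the D_i and the
  inverses of the X_i, are thereby covered by what is proved for A_{i+1} = T_i A_i T_i.\<close>

lemma hecke_inverse: "hecke N Ti t' t"
proof
  show "t' * x = x * t'" "t * x = x * t" for x by (rule t'_central t_central)+
  show "t' * t = 1" by (rule t't)
  fix i assume "i \<in> {1..<N}"
  then show "(Ti i - t') * (Ti i + t) = 0"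
    using quad[of i] t_central[of "T i"] t'_central[of "T i"]
    by (simp add: Ti_def algebra_simps)
next
  fix i assume "1 \<le> i" "Suc i < N"
  then show "Ti i * Ti (Suc i) * Ti i = Ti (Suc i) * Ti i * Ti (Suc i)" by (rule braid_conj)
next
  fix i j assume "i \<in> {1..<N}" "j \<in> {1..<N}" "i + 2 \<le> j"
  then show "Ti i * Ti j = Ti j * Ti i" using commute_Ti far_Ti by metis
qed

lemma inverse_Ti: "hecke.Ti Ti t' t = T"
  by (simp add: fun_eq_iff hecke.Ti_def[OF hecke_inverse] Ti_def)

text \<open>The suffix \<open>i\<close> inverts every letter but keeps the order of the indices, so
  \<open>downi a b\<close> is inverse to \<open>up a b\<close>, and \<open>upi a b\<close> to
  \<open>down a b\<close>.\<close>

definition up :: "nat \<Rightarrow> nat \<Rightarrow> 'r" where "up a b = prod_list (map T [a..<b])"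
definition down :: "nat \<Rightarrow> nat \<Rightarrow> 'r" where "down a b = prod_list (map T (rev [a..<b]))"
definition upi :: "nat \<Rightarrow> nat \<Rightarrow> 'r" where "upi a b = prod_list (map Ti [a..<b])"
definition downi :: "nat \<Rightarrow> nat \<Rightarrow> 'r" where "downi a b = prod_list (map Ti (rev [a..<b]))"

lemma up_empty [simp]: "up a a = 1" "down a a = 1" "upi a a = 1" "downi a a = 1"
  by (simp_all add: up_def down_def upi_def downi_def)

lemma up_Suc:
  assumes "a \<le> b"
  shows "up a (Suc b) = up a b * T b" "down a (Suc b) = T b * down a b"
    "upi a (Suc b) = upi a b * Ti b" "downi a (Suc b) = Ti b * downi a b"
  using assms by (simp_all add: up_def down_def upi_def downi_def)

lemma up_rec:
  assumes "a < b"
  shows "up a b = T a * up (Suc a) b" "down a b = down (Suc a) b * T a"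
    "upi a b = Ti a * upi (Suc a) b" "downi a b = downi (Suc a) b * Ti a"
  using assms by (simp_all add: up_def down_def upi_def downi_def upt_conv_Cons)

lemma up_inverse:
  assumes "1 \<le> a" "b \<le> N"
  shows "up a b * downi a b = 1" "downi a b * up a b = 1" "down a b * upi a b = 1" "upi a b * down a b = 1"
proof -
  have r: "x \<in> {1..<N}" if "x \<in> set [a..<b]" for x using that assms by auto
  have r': "x \<in> {1..<N}" if "x \<in> set (rev [a..<b])" for x using that assms by auto
  show "up a b * downi a b = 1" "upi a b * down a b = 1"
    unfolding up_def downi_def upi_def down_def
    by (rule prod_list_inverse; use r T_Ti Ti_T in blast)+
  show "downi a b * up a b = 1" "down a b * upi a b = 1"
    unfolding up_def downi_def upi_def down_def
    using prod_list_inverse[of "rev [a..<b]" Ti T] prod_list_inverse[of "rev [a..<b]" T Ti] r' T_Ti Ti_T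
    by (simp_all)
qed

lemma commute_up:
  assumes "\<And>k. a \<le> k \<Longrightarrow> k < b \<Longrightarrow> T k * x = x * T k"
  shows "up a b * x = x * up a b" "down a b * x = x * down a b"
    "upi a b * x = x * upi a b" "downi a b * x = x * downi a b"
proof -
  have 1: "x * T k = T k * x" and 2: "x * Ti k = Ti k * x" if "k \<in> set [a..<b]" for k
    using assms commute_Ti that by fastforce+
  show "up a b * x = x * up a b" "down a b * x = x * down a b"
    "upi a b * x = x * upi a b" "downi a b * x = x * downi a b"
    unfolding up_def down_def upi_def downi_def
    by (rule prod_list_commute[symmetric]; use 1 2 in auto)+
qed

lemma up_split:
  assumes "a \<le> k" "k \<le> b"
  shows "up a b = up a k * up k b" "down a b = down k b * down a k"
    "upi a b = upi a k * upi k b" "downi a b = downi k b * downi a k"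
  using upt_add_eq_append[OF assms(1), of "b - k"] assms
  by (simp_all add: up_def down_def upi_def downi_def)

text \<open>Only the letters \<open>T k\<close> and \<open>T (Suc k)\<close> of the run matter. The
  others commute with the letter that passes, and the braid relation raises its index by
  one.\<close>

lemma T_up_shift:
  assumes "1 \<le> a" "a \<le> k" "Suc k < b" "b \<le> N"
  shows "up a b * T k = T (Suc k) * up a b"
proof -
  have split: "up a b = up a k * (T k * (T (Suc k) * up (Suc (Suc k)) b))"
    using assms up_split[of a k b] up_rec(1)[of k b] up_rec(1)[of "Suc k" b] by simp
  have c1: "up (Suc (Suc k)) b * T k = T k * up (Suc (Suc k)) b"
    by (rule commute_up(1)) (use assms in \<open>auto intro!: far'\<close>)
  have c2: "up a k * T (Suc k) = T (Suc k) * up a k"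
    by (rule commute_up(1)) (use assms in \<open>auto intro!: far'\<close>)
  have b: "T k * T (Suc k) * T k = T (Suc k) * T k * T (Suc k)"
    using braid[of k] assms by simp
  have "up a b * T k = up a k * ((T k * T (Suc k) * T k) * up (Suc (Suc k)) b)"
    unfolding split by (simp add: mult.assoc c1)
  also have "\<dots> = (up a k * T (Suc k)) * (T k * (T (Suc k) * up (Suc (Suc k)) b))"
    unfolding b by (simp only: mult.assoc)
  also have "\<dots> = T (Suc k) * up a b"
    unfolding c2 split by (simp only: mult.assoc)
  finally show ?thesis .
qed

lemma down_T_shift:
  assumes "1 \<le> a" "a \<le> k" "Suc k < b" "b \<le> N"
  shows "T k * down a b = down a b * T (Suc k)"
proof -
  have split: "down a b = down (Suc (Suc k)) b * T (Suc k) * T k * down a k"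
    using assms up_split[of a k b] up_rec(2)[of k b] up_rec(2)[of "Suc k" b] by (simp add: mult.assoc)
  have c1: "down (Suc (Suc k)) b * T k = T k * down (Suc (Suc k)) b"
    by (rule commute_up(2)) (use assms in \<open>auto intro!: far'\<close>)
  have c2: "down a k * T (Suc k) = T (Suc k) * down a k"
    by (rule commute_up(2)) (use assms in \<open>auto intro!: far'\<close>)
  have b: "T k * T (Suc k) * T k = T (Suc k) * T k * T (Suc k)"
    using braid[of k] assms by simp
  have "T k * down a b = down (Suc (Suc k)) b * (T k * T (Suc k) * T k) * down a k"
    unfolding split c1 mult.assoc[symmetric] by (simp only: c1)
  also have "\<dots> = down (Suc (Suc k)) b * T (Suc k) * T k * (T (Suc k) * down a k)"
    unfolding b by (simp only: mult.assoc)
  also have "\<dots> = down a b * T (Suc k)"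
    unfolding c2[symmetric] split by (simp only: mult.assoc)
  finally show ?thesis .
qed

end

text \<open>Common shape of the X_i and the Y_i and, over the inverted Hecke algebra, of the D_i and
  of the inverses of the X_i and Y_i.\<close>

locale hecke_family = hecke N T t t'
  for N and T :: "nat \<Rightarrow> 'r::ring_1" and t t' +
  fixes A :: "nat \<Rightarrow> 'r"
  assumes TAT: "i \<in> {1..<N} \<Longrightarrow> T i * A i * T i = A (Suc i)"
    and TA: "i \<in> {1..<N} \<Longrightarrow> j \<in> {1..N} \<Longrightarrow> j \<noteq> i \<Longrightarrow> j \<noteq> Suc i \<Longrightarrow> T i * A j = A j * T i"
begin

lemma T_A: "i \<in> {1..<N} \<Longrightarrow> T i * A i = A (Suc i) * Ti i"
  and A_T: "i \<in> {1..<N} \<Longrightarrow> A i * T i = Ti i * A (Suc i)"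
  using T_Ti[of i] Ti_T[of i] by (simp_all add: mult.assoc Ti_T_l flip: TAT)

lemma T_A_Suc: "i \<in> {1..<N} \<Longrightarrow> T i * A (Suc i) = A i * T i + (t - t') * A (Suc i)"
  using A_T[of i] by (simp add: Ti_def algebra_simps)

lemma A_Suc_T: "i \<in> {1..<N} \<Longrightarrow> A (Suc i) * T i = T i * A i + (t - t') * A (Suc i)"
  using T_A[of i] t_central[of "A (Suc i)"] t'_central[of "A (Suc i)"]
  by (simp add: Ti_def algebra_simps)

lemma A_down_up:
  assumes "1 \<le> a" "a \<le> b" "b \<le> N"
  shows "A b = down a b * A a * up a b"
  using assms(2,1,3)
proof (induction b rule: dec_induct)
  case (step b)
  then have "A (Suc b) = T b * (down a b * A a * up a b) * T b"
    using TAT[of b] by simp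
  then show ?case using step by (simp add: up_Suc mult.assoc)
qed simp

lemma commute_above:
  assumes "1 \<le> i" "i < a" "b \<le> N"
  shows "up a b * A i = A i * up a b" "down a b * A i = A i * down a b"
    "upi a b * A i = A i * upi a b" "downi a b * A i = A i * downi a b"
  by (rule commute_up; use assms TA in auto)+

lemma commute_below:
  assumes "1 \<le> a" "b < i" "i \<le> N"
  shows "up a b * A i = A i * up a b" "down a b * A i = A i * down a b"
    "upi a b * A i = A i * upi a b" "downi a b * A i = A i * downi a b"
  by (rule commute_up; use assms TA in auto)+

lemma inverse_family:
  assumes "\<And>i. i \<in> {1..N} \<Longrightarrow> A i * B i = 1" "\<And>i. i \<in> {1..N} \<Longrightarrow> B i * A i = 1"
  shows "hecke_family N Ti t' t B"
proof -
  interpret H: hecke N Ti t' t by (rule hecke_inverse)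
  show ?thesis
  proof
    fix i assume i: "i \<in> {1..<N}"
    then have r: "i \<in> {1..N}" "Suc i \<in> {1..N}" by auto
    have "(Ti i * B i * Ti i) * A (Suc i) = Ti i * (B i * (Ti i * T i) * A i) * T i"
      unfolding TAT[OF i, symmetric] by (simp only: mult.assoc)
    then have 1: "(Ti i * B i * Ti i) * A (Suc i) = 1" using assms(2)[OF r(1)] Ti_T[OF i] by simp
    then have "(Ti i * B i * Ti i) * (A (Suc i) * B (Suc i)) = B (Suc i)"
      by (simp flip: mult.assoc)
    then show "Ti i * B i * Ti i = B (Suc i)" using assms(1)[OF r(2)] by simp
  next
    fix i j assume i: "i \<in> {1..<N}" and j: "j \<in> {1..N}" "j \<noteq> i" "j \<noteq> Suc i"
    have "B j * (Ti i * A j) * B j = B j * (A j * Ti i) * B j"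
      by (simp only: commute_Ti[OF TA[OF i j]])
    then show "Ti i * B j = B j * Ti i"
      using assms[OF j(1)] by (simp add: mult.assoc) (simp flip: mult.assoc)
  qed
qed

text \<open>For j >= 2 the letter T_j commutes with A_1, so A_{j+1} = T_j A_j T_j inherits
  commutation with A_1 from A_j. The same step in the first index, with T_i commuting with A_j for i
  + 1 < j, reaches all pairs.\<close>

lemma commute_from_first_two:
  assumes "2 \<le> N \<Longrightarrow> A 1 * A 2 = A 2 * A 1" "i \<in> {1..N}" "j \<in> {1..N}"
  shows "A i * A j = A j * A i"
proof -
  have first: "A 1 * A j = A j * A 1" if "2 \<le> j" "j \<le> N" for j
    using that
  proof (induction j rule: dec_induct)
    case (step j)
    have c: "T j * A 1 = A 1 * T j" by (rule TA) (use step in auto)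
    have Aj: "A (Suc j) = T j * A j * T j" using TAT[of j] step by simp
    have IH: "A 1 * A j = A j * A 1" using step by simp
    have "A 1 * A (Suc j) = (T j * A 1) * A j * T j"
      unfolding Aj c by (simp only: mult.assoc)
    also have "\<dots> = T j * A j * (A 1 * T j)"
      unfolding mult.assoc[of _ "A 1"] IH by (simp only: mult.assoc)
    also have "\<dots> = A (Suc j) * A 1" unfolding Aj c[symmetric] by (simp only: mult.assoc)
    finally show ?case .
  qed (use assms in simp)
  have less: "A i * A j = A j * A i" if "1 \<le> i" "i < j" "j \<le> N" for i j
    using that
  proof (induction i rule: dec_induct)
    case base then show ?case using first[of j] by simp
  next
    case (step i)
    have c: "T i * A j = A j * T i" by (rule TA) (use step in auto)
    have "A (Suc i) * A j = T i * (A i * A j) * T i"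
      using TAT[of i] step.hyps step.prems by (simp add: mult.assoc c flip: TAT)
    also have "\<dots> = T i * (A j * A i) * T i" using step.IH step by simp
    also have "\<dots> = (T i * A j) * A i * T i" by (simp only: mult.assoc)
    also have "\<dots> = A j * A (Suc i)" unfolding c using step TAT[of i] by (simp add: mult.assoc)
    finally show ?case .
  qed
  show ?thesis using less[of i j] less[of j i] assms by (cases i j rule: linorder_cases) auto
qed

text \<open>T_i A_i = A_{i+1} T_i^{-1} and T_i^{-1} A_{i+1} = A_i T_i: passing both letters restores
  T_i. Symmetric expressions in neighbours are the ones that T_i does not disturb.\<close>

lemma T_commute_pair:
  assumes "i \<in> {1..<N}" "A i * A (Suc i) = A (Suc i) * A i"
  shows "T i * (A (Suc i) * A i) = A (Suc i) * A i * T i"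
proof -
  have "T i * (A i * A (Suc i)) = A (Suc i) * (Ti i * A (Suc i))"
    using T_A[OF assms(1)] by (simp flip: mult.assoc)
  then show ?thesis using assms by (simp add: mult.assoc flip: A_T)
qed

end

text \<open>A family is determined by A_1. For j < i every letter of \<open>A j\<close> commutes
  with T_i. For j > i + 1 the letter T_i slides through \<open>down 1 j\<close> becoming T_{i+1},
  passes A_1 by assumption, and slides through \<open>up 1 j\<close> becoming T_i again.\<close>

lemma (in hecke) hecke_familyI:
  assumes A: "\<And>i. i \<in> {1..N} \<Longrightarrow> A i = down 1 i * A 1 * up 1 i"
    and A1: "\<And>i. 2 \<le> i \<Longrightarrow> i < N \<Longrightarrow> T i * A 1 = A 1 * T i"
  shows "hecke_family N T t t' A"
proof
  fix i assume i: "i \<in> {1..<N}"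
  then have "A i = down 1 i * A 1 * up 1 i" "A (Suc i) = down 1 (Suc i) * A 1 * up 1 (Suc i)"
    by (intro A; simp)+
  then show "T i * A i * T i = A (Suc i)" using i by (simp add: up_Suc mult.assoc)
next
  fix i j assume i: "i \<in> {1..<N}" and j: "j \<in> {1..N}" "j \<noteq> i" "j \<noteq> Suc i"
  show "T i * A j = A j * T i"
  proof (cases "j < i")
    case True
    have c: "down 1 j * T i = T i * down 1 j" "up 1 j * T i = T i * up 1 j"
      by (rule commute_up; use True i j in \<open>auto intro!: far'\<close>)+
    have "T i * A j = down 1 j * (T i * A 1) * up 1 j"
      using A[OF j(1)] by (simp add: c flip: mult.assoc)
    also have "\<dots> = down 1 j * A 1 * (up 1 j * T i)"
      using A1[of i] True i j by (simp add: c mult.assoc)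
    finally show ?thesis using A[OF j(1)] by (simp add: mult.assoc)
  next
    case False
    then have ij: "Suc i < j" using j i by auto
    have "T i * A j = (T i * down 1 j) * A 1 * up 1 j"
      using A[OF j(1)] by (simp add: mult.assoc)
    also have "\<dots> = down 1 j * (T (Suc i) * A 1) * up 1 j"
      using down_T_shift[of 1 i j] ij i j by (simp add: mult.assoc)
    also have "\<dots> = down 1 j * A 1 * (T (Suc i) * up 1 j)"
      using A1[of "Suc i"] ij i j by (simp add: mult.assoc)
    also have "\<dots> = A j * T i"
      using T_up_shift[of 1 i j] ij i j A[OF j(1)] by (simp add: mult.assoc)
    finally show ?thesis .
  qed
qed

text \<open>\<open>cross\<close> is the relation X_1^{-1} Y_2^{-1} X_1 Y_2 = T_1^2 solved for X_1
  Y_2, a form free of inverses.\<close>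

locale hecke_cross = X: hecke_family N T t t' X + Y: hecke_family N T t t' Y
  for N and T :: "nat \<Rightarrow> 'r::ring_1" and t t' and X Y :: "nat \<Rightarrow> 'r" +
  assumes cross: "2 \<le> N \<Longrightarrow> X 1 * Y 2 = Y 2 * X 1 * (T 1 * T 1)"
begin

lemma X_Y_above:
  assumes "X i * Y (Suc i) = Y (Suc i) * X i * (T i * T i)" "1 \<le> i" "i < j" "j \<le> N"
  shows "X i * Y j = Y j * X i * (X.downi (Suc i) j * (T i * T i) * X.up (Suc i) j)"
proof -
  let ?d = "X.down (Suc i) j" and ?u = "X.up (Suc i) j" and ?e = "X.downi (Suc i) j"
  have Yj: "Y j = ?d * Y (Suc i) * ?u" using Y.A_down_up[of "Suc i" j] assms by simp
  have c: "?d * X i = X i * ?d" "?e * X i = X i * ?e"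
    using X.commute_above[of i "Suc i" j] assms by auto
  have ue: "?u * ?e = 1" using X.up_inverse[of "Suc i" j] assms by simp
  have "X i * Y j = ?d * (X i * Y (Suc i)) * ?u" unfolding Yj by (simp add: c flip: mult.assoc)
  also have "\<dots> = ?d * Y (Suc i) * (?u * ?e) * X i * (T i * T i) * ?u"
    unfolding assms(1) by (simp add: ue mult.assoc)
  also have "\<dots> = Y j * (?e * X i) * (T i * T i) * ?u" unfolding Yj by (simp only: mult.assoc)
  finally show ?thesis by (simp add: c mult.assoc)
qed

lemma X_Y_Suc:
  assumes "1 \<le> i" "Suc i \<le> N"
  shows "X i * Y (Suc i) = Y (Suc i) * X i * (T i * T i)"
  using assms
proof (induction i rule: dec_induct)
  case base
  then show ?case using cross by (simp add: numeral_2_eq_2)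
next
  case (step i)
  let ?a = "T i" and ?b = "T (Suc i)" and ?a' = "X.Ti i" and ?b' = "X.Ti (Suc i)"
  have i: "i \<in> {1..<N}" "Suc i \<in> {1..<N}" using step by auto
  have *: "X i * Y (Suc (Suc i)) = Y (Suc (Suc i)) * X i * (?b' * (?a * ?a) * ?b)"
    using X_Y_above[of i "Suc (Suc i)"] step by (simp add: X.up_Suc)
  have c: "?a * Y (Suc (Suc i)) = Y (Suc (Suc i)) * ?a"
    by (rule Y.TA) (use step in auto)
  have b: "?a * ?b * ?a' = ?b' * ?a * ?b"
    using X.braid_conj(1)[of i] step by simp
  \<comment> \<open>T_{i+1}^{-1} T_i^2 T_{i+1} is the square of T_{i+1}^{-1} T_i T_{i+1} = T_i
    T_{i+1} T_i^{-1}, hence equals T_i T_{i+1}^2 T_i^{-1}.\<close>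
  have "?b' * (?a * ?a) * ?b = (?b' * ?a * ?b) * (?b' * ?a * ?b)"
    by (simp add: mult.assoc X.T_Ti_l[OF i(2)])
  also have "\<dots> = ?a * (?b * ?b) * ?a'"
    unfolding b[symmetric] by (simp add: mult.assoc X.Ti_T_l[OF i(1)])
  finally have sq: "?b' * (?a * ?a) * ?b * ?a = ?a * (?b * ?b)"
    by (simp add: mult.assoc X.Ti_T[OF i(1)])
  have "X (Suc i) * Y (Suc (Suc i)) = ?a * (X i * Y (Suc (Suc i))) * ?a"
    unfolding X.TAT[OF i(1), symmetric] by (simp only: mult.assoc c)
  also have "\<dots> = (?a * Y (Suc (Suc i))) * X i * (?b' * (?a * ?a) * ?b * ?a)"
    unfolding * by (simp only: mult.assoc)
  also have "\<dots> = Y (Suc (Suc i)) * X (Suc i) * (?b * ?b)"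
    unfolding c sq X.TAT[OF i(1), symmetric] by (simp only: mult.assoc)
  finally show ?case .
qed

lemma X_Y:
  assumes "1 \<le> i" "i < j" "j \<le> N"
  shows "X i * Y j = Y j * X i * (X.downi (Suc i) j * (T i * T i) * X.up (Suc i) j)"
  by (rule X_Y_above[OF X_Y_Suc]) (use assms in auto)

lemma Y_X_Suc:
  assumes "1 \<le> i" "Suc i \<le> N"
  shows "Y i * X (Suc i) = X.Ti i * X.Ti i * X (Suc i) * Y i"
proof -
  have i: "i \<in> {1..<N}" using assms by auto
  have "X i * (T i * Y i * T i) = (T i * Y i * T i) * X i * (T i * T i)"
    using X_Y_Suc[OF assms] unfolding Y.TAT[OF i] .
  then have "X.Ti i * (X i * (T i * Y i * T i)) * X.Ti i
      = X.Ti i * ((T i * Y i * T i) * X i * (T i * T i)) * X.Ti i" by simp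
  then have "X.Ti i * X i * T i * Y i = Y i * (T i * X i * T i)"
    by (simp add: mult.assoc X.Ti_T_l[OF i] X.T_Ti[OF i])
  then show ?thesis
    unfolding X.TAT[OF i, symmetric] by (simp add: mult.assoc X.Ti_T_l[OF i])
qed

lemma Y_X:
  assumes "1 \<le> i" "i < j" "j \<le> N"
  shows "Y i * X j = X.down (Suc i) j * (X.Ti i * X.Ti i) * X.upi (Suc i) j * X j * Y i"
proof -
  let ?d = "X.down (Suc i) j" and ?u = "X.up (Suc i) j" and ?v = "X.upi (Suc i) j"
  have Xj: "X j = ?d * X (Suc i) * ?u" using X.A_down_up[of "Suc i" j] assms by simp
  have c: "?d * Y i = Y i * ?d" "?u * Y i = Y i * ?u"
    using Y.commute_above[of i "Suc i" j] assms by auto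
  have vd: "?v * ?d = 1" using X.up_inverse[of "Suc i" j] assms by simp
  have "Y i * X j = ?d * (Y i * X (Suc i)) * ?u" unfolding Xj by (simp add: c flip: mult.assoc)
  also have "\<dots> = ?d * (X.Ti i * X.Ti i) * (?v * ?d) * X (Suc i) * (Y i * ?u)"
    using Y_X_Suc[of i] assms by (simp add: vd mult.assoc)
  also have "\<dots> = ?d * (X.Ti i * X.Ti i) * ?v * X j * Y i"
    unfolding Xj c(2)[symmetric] by (simp only: mult.assoc)
  finally show ?thesis .
qed

text \<open>
  Moving \<open>Y\<^sub>1\<close> through \<open>X\<^sub>2, X\<^sub>3, \<dots>\<close> produces factors \<open>g\<^sub>j\<close> to the left of \<open>X\<^sub>j\<close>; collected on
  the far left they become factors \<open>h\<^sub>j\<close> whose product telescopes.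
\<close>

definition "gfac j = X.down 2 j * (X.Ti 1 * X.Ti 1) * X.upi 2 j"
definition "hfac j = X.downi 2 j * (X.Ti 1 * X.Ti 1) * X.up 2 j"

text \<open>T_1^{-2} conjugated by T_2, ..., T_{j-1} equals T_{j-1}^{-2} conjugated by T_1, ...,
  T_{j-2}: the same braid of strands 1 and j, built from either end. Only the second form
  telescopes.\<close>

lemma hfac_eq:
  assumes "2 \<le> j" "j \<le> N"
  shows "hfac j = X.up 1 (j - 1) * (X.Ti (j - 1) * X.Ti (j - 1)) * X.downi 1 (j - 1)"
  using assms
proof (induction j rule: dec_induct)
  case base
  have "X.up 1 1 = 1" "X.downi 1 1 = 1" "(2::nat) - 1 = 1" by simp_all
  then show ?case by (simp only: hfac_def X.up_empty mult.left_neutral mult.right_neutral)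
next
  case (step j)
  define i where "i = j - 1"
  have j: "j = Suc i" and i: "1 \<le> i" "Suc i < N" using step unfolding i_def by auto
  then have r: "i \<in> {1..<N}" "Suc i \<in> {1..<N}" by auto
  let ?a = "T i" and ?b = "T (Suc i)" and ?a' = "X.Ti i" and ?b' = "X.Ti (Suc i)"
  have b: "?b' * ?a' * ?b = ?a * ?b' * ?a'" using X.braid_conj(4)[of i] i by simp
  have far: "X.up 1 i * ?b = ?b * X.up 1 i" "X.downi 1 i * ?b = ?b * X.downi 1 i"
    by (rule X.commute_up; use i in \<open>auto intro!: X.far'\<close>)+
  have far': "X.up 1 i * ?b' = ?b' * X.up 1 i"
    using X.commute_Ti[OF far(1)[symmetric]] by simp
  have "?b' * (?a' * ?a') * ?b = (?b' * ?a' * ?b) * (?b' * ?a' * ?b)"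
    by (simp add: mult.assoc X.T_Ti_l[OF r(2)])
  also have "\<dots> = ?a * (?b' * ?b') * ?a'"
    unfolding b by (simp add: mult.assoc X.Ti_T_l[OF r(1)])
  finally have sq: "?b' * (?a' * ?a') * ?b = ?a * (?b' * ?b') * ?a'" .
  have "hfac (Suc j) = ?b' * hfac j * ?b"
    using step.hyps by (simp add: hfac_def X.up_Suc j mult.assoc)
  also have "hfac j = X.up 1 i * (?a' * ?a') * X.downi 1 i"
    using step by (simp add: j)
  also have "?b' * \<dots> * ?b = (?b' * X.up 1 i) * (?a' * ?a') * (X.downi 1 i * ?b)"
    by (simp only: mult.assoc)
  also have "\<dots> = X.up 1 i * (?b' * (?a' * ?a') * ?b) * X.downi 1 i"
    unfolding far far'[symmetric] by (simp only: mult.assoc)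
  also have "\<dots> = X.up 1 j * (?b' * ?b') * X.downi 1 j"
    unfolding sq j using i by (simp add: X.up_Suc mult.assoc)
  finally show ?case by (simp add: j)
qed

definition "Xs a b = prod_list (map X [a..<b])"

lemma Xs_Suc: "a \<le> b \<Longrightarrow> Xs a (Suc b) = Xs a b * X b"
  by (simp add: Xs_def)

text \<open>\<open>gfac (Suc j)\<close> is T_j \<open>gfac j\<close> T_j^{-1}. On its left X_j T_j =
  T_j^{-1} X_{j+1}, on its right T_j^{-1} X_{j+1} = X_j T_j. The T_j now at the end passes the
  invariant product X_j X_{j+1}, and T_j^{-1} \<open>hfac j\<close> T_j is
  \<open>hfac (Suc j)\<close>.\<close>

lemma Xs_g:
  assumes XX: "\<And>i j. i \<in> {1..N} \<Longrightarrow> j \<in> {1..N} \<Longrightarrow> X i * X j = X j * X i"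
    and "2 \<le> j" "j \<le> N"
  shows "Xs 2 j * gfac j * X j = hfac j * Xs 2 (Suc j)"
  using assms(2,3)
proof (induction j rule: dec_induct)
  case base
  then show ?case by (simp add: gfac_def hfac_def Xs_def)
next
  case (step j)
  let ?T = "T j" and ?T' = "X.Ti j"
  have r: "j \<in> {1..<N}" using step by auto
  have XT: "X j * ?T = ?T' * X (Suc j)" by (rule X.A_T[OF r])
  have pair: "?T * (X (Suc j) * X j) = X (Suc j) * X j * ?T"
    by (rule X.T_commute_pair[OF r]) (use XX r in auto)
  have cXs: "?T * Xs 2 j = Xs 2 j * ?T"
    unfolding Xs_def by (rule prod_list_commute) (use step in \<open>auto intro!: X.TA\<close>)
  have cX: "X (Suc j) * gfac j = gfac j * X (Suc j)"
  proof -
    have 1: "X (Suc j) * X.Ti 1 = X.Ti 1 * X (Suc j)"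
      using X.TA[of 1 "Suc j"] step X.commute_Ti by auto
    have 2: "X.down 2 j * X (Suc j) = X (Suc j) * X.down 2 j" "X.upi 2 j * X (Suc j) = X (Suc j) * X.upi 2 j"
      using X.commute_below[of 2 j "Suc j"] step by auto
    note c = 1[THEN mult_right_cong, unfolded mult.assoc]
      2(1)[symmetric, THEN mult_right_cong, unfolded mult.assoc] 2(2)[symmetric]
    show ?thesis unfolding gfac_def mult.assoc by (simp only: c)
  qed
  have "Xs 2 (Suc j) * gfac (Suc j) * X (Suc j)
      = Xs 2 j * (X j * ?T) * gfac j * (?T' * X (Suc j))"
    using step by (simp add: Xs_Suc gfac_def X.up_Suc mult.assoc)
  also have "\<dots> = ?T' * Xs 2 j * (X (Suc j) * gfac j) * X j * ?T"
    unfolding XT[symmetric] unfolding XT X.commute_Ti[OF cXs] by (simp add: XT mult.assoc X.commute_Ti[OF cXs])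
  also have "\<dots> = ?T' * (Xs 2 j * gfac j) * (X (Suc j) * X j) * ?T"
    unfolding cX by (simp only: mult.assoc)
  also have "\<dots> = ?T' * (Xs 2 j * gfac j) * (X j * X (Suc j)) * ?T"
    using XX r by simp
  also have "\<dots> = ?T' * (Xs 2 j * gfac j * X j) * X (Suc j) * ?T"
    by (simp only: mult.assoc)
  also have "\<dots> = ?T' * hfac j * Xs 2 j * (X j * X (Suc j)) * ?T"
    using step by (simp add: Xs_Suc mult.assoc)
  also have "\<dots> = ?T' * hfac j * (Xs 2 j * ?T) * (X j * X (Suc j))"
    using pair XX[of j "Suc j"] r by (simp add: mult.assoc)
  also have "\<dots> = hfac (Suc j) * Xs 2 (Suc (Suc j))"
    using step unfolding cXs[symmetric] by (simp add: Xs_Suc hfac_def X.up_Suc mult.assoc)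
  finally show ?case .
qed

text \<open>Each new factor \<open>hfac (Suc j)\<close> begins with \<open>up 1 j\<close>, which
  cancels the trailing \<open>downi 1 j\<close> collected so far. For j = N the collected factor is
  the inverse of J_N; this is how J_N enters the relation between Y_1 and X_1.\<close>

lemma Y1_Xs:
  assumes XX: "\<And>i j. i \<in> {1..N} \<Longrightarrow> j \<in> {1..N} \<Longrightarrow> X i * X j = X j * X i"
    and "1 \<le> j" "j \<le> N"
  shows "Y 1 * Xs 2 (Suc j) = X.upi 1 j * X.downi 1 j * Xs 2 (Suc j) * Y 1"
  using assms(2,3)
proof (induction j rule: dec_induct)
  case base
  then show ?case by (simp add: Xs_def)
next
  case (step j)
  have IH: "Y 1 * Xs 2 (Suc j) = X.upi 1 j * X.downi 1 j * Xs 2 (Suc j) * Y 1"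
    using step by simp
  have "Y 1 * Xs 2 (Suc (Suc j)) = (Y 1 * Xs 2 (Suc j)) * X (Suc j)"
    using step.hyps by (simp add: Xs_Suc mult.assoc)
  also have "\<dots> = X.upi 1 j * X.downi 1 j * Xs 2 (Suc j) * (Y 1 * X (Suc j))"
    unfolding IH by (simp only: mult.assoc)
  also have "\<dots> = X.upi 1 j * X.downi 1 j * (Xs 2 (Suc j) * gfac (Suc j) * X (Suc j)) * Y 1"
    using Y_X[of 1 "Suc j"] step by (simp add: gfac_def mult.assoc numeral_2_eq_2)
  also have "\<dots> = X.upi 1 j * X.downi 1 j * (hfac (Suc j) * Xs 2 (Suc (Suc j))) * Y 1"
    using Xs_g[OF XX, of "Suc j"] step by simp
  also have "\<dots> = X.upi 1 j * (X.downi 1 j * X.up 1 j) * (X.Ti j * X.Ti j) * X.downi 1 j * Xs 2 (Suc (Suc j)) * Y 1"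
    using hfac_eq[of "Suc j"] step by (simp add: mult.assoc)
  also have "\<dots> = X.upi 1 (Suc j) * X.downi 1 (Suc j) * Xs 2 (Suc (Suc j)) * Y 1"
    using X.up_inverse[of 1 j] step by (simp add: X.up_Suc mult.assoc)
  finally show ?case .
qed

end

subsection \<open>Relations in the DAHA\<close>

lemma inverse_commute:
  fixes a :: "'r::monoid_mult"
  assumes "a * b = b * a" "a * a' = 1" "a' * a = 1"
  shows "a' * b = b * a'"
proof -
  have "a' * (a * b) * a' = a' * (b * a) * a'" by (simp only: assms)
  then show ?thesis using assms(2,3) by (simp add: mult.assoc) (simp flip: mult.assoc)
qed

lemma inverse_commute2:
  fixes a :: "'r::monoid_mult"
  assumes "a * b = b * a" "a * a' = 1" "a' * a = 1" "b * b' = 1" "b' * b = 1"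
  shows "a' * b' = b' * a'"
  by (rule inverse_commute[symmetric, OF inverse_commute[symmetric, OF assms(1-3)] assms(4,5)])

definition zprod :: "(nat \<Rightarrow> 'r) \<Rightarrow> 'r \<Rightarrow> nat \<Rightarrow> nat \<Rightarrow> 'r::ring_1" where
  "zprod Z a m n = prod_list (map (\<lambda>r. a - Z r) [m..<Suc n])"

lemma zprod_Suc: "m \<le> Suc n \<Longrightarrow> zprod Z a m (Suc n) = zprod Z a m n * (a - Z (Suc n))"
  by (simp add: zprod_def)

lemma zprod_empty [simp]: "n < m \<Longrightarrow> zprod Z a m n = 1"
  by (simp add: zprod_def)

text \<open>The coefficients are central, so the product follows its argument through
  \<open>s\<close>. With \<open>a = b\<close> this says that whatever commutes with \<open>a\<close>
  commutes with the product.\<close>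

lemma zprod_intertwine:
  assumes "a * s = s * b" "\<And>r x. Z r * x = x * Z r"
  shows "zprod Z a m n * s = s * zprod Z b m n"
proof (induction n)
  case 0
  have "(a - Z 0) * s = s * (b - Z 0)"
    using assms(1) assms(2)[of 0 s] by (simp add: algebra_simps)
  then show ?case by (cases m) (simp_all add: zprod_def)
next
  case (Suc n)
  have 1: "(a - Z r) * s = s * (b - Z r)" for r
    using assms(1) assms(2)[of r s] by (simp add: algebra_simps)
  show ?case
  proof (cases "m \<le> Suc n")
    case True
    have "zprod Z a m (Suc n) * s = (zprod Z a m n * s) * (b - Z (Suc n))"
      using True by (simp add: zprod_Suc mult.assoc 1)
    then show ?thesis using True Suc by (simp add: zprod_Suc mult.assoc)
  qed simp
qed

text \<open>Leibniz rule: the r-th term takes the commutator with the r-th factor, in which the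
  central Z_r drops out. It is the source of the sum in the relation for [D_1, X_2].\<close>

lemma zprod_commutator:
  assumes "\<And>r x. Z r * x = x * Z r"
  shows "zprod Z a 1 n * x - x * zprod Z a 1 n
    = (\<Sum>r = 1..n. zprod Z a 1 (r - 1) * (a * x - x * a) * zprod Z a (Suc r) n)"
proof (induction n)
  case (Suc n)
  let ?z = "Z (Suc n)"
  have last: "zprod Z a 1 (r - 1) * (a * x - x * a) * zprod Z a (Suc r) (Suc n)
    = zprod Z a 1 (r - 1) * (a * x - x * a) * zprod Z a (Suc r) n * (a - ?z)" if "r \<in> {1..n}" for r
    using that by (simp add: zprod_Suc mult.assoc)
  have "(\<Sum>r = 1..Suc n. zprod Z a 1 (r - 1) * (a * x - x * a) * zprod Z a (Suc r) (Suc n))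
    = (\<Sum>r = 1..n. zprod Z a 1 (r - 1) * (a * x - x * a) * zprod Z a (Suc r) n) * (a - ?z)
      + zprod Z a 1 n * (a * x - x * a)"
    using last by (simp add: sum_distrib_right)
  also have "\<dots> = zprod Z a 1 (Suc n) * x - x * zprod Z a 1 (Suc n)"
    unfolding Suc[symmetric] using assms[of "Suc n" x] by (simp add: zprod_Suc algebra_simps)
  finally show ?case by simp
qed simp

locale daha_alg = hecke_cross N T t t' X Y
  for N and T :: "nat \<Rightarrow> 'r::ring_1" and t t' and X Y :: "nat \<Rightarrow> 'r" +
  fixes X' :: "nat \<Rightarrow> 'r" and q :: 'r and Z :: "nat \<Rightarrow> 'r" and l :: nat
  assumes N: "1 \<le> N"
    and XX: "i \<in> {1..N} \<Longrightarrow> j \<in> {1..N} \<Longrightarrow> X i * X j = X j * X i"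
    and YY: "i \<in> {1..N} \<Longrightarrow> j \<in> {1..N} \<Longrightarrow> Y i * Y j = Y j * Y i"
    and XX': "i \<in> {1..N} \<Longrightarrow> X i * X' i = 1" and X'X: "i \<in> {1..N} \<Longrightarrow> X' i * X i = 1"
    and q_central: "q * x = x * q" and Z_central: "Z r * x = x * Z r"
    and YXs: "Y 1 * Xs 1 (Suc N) = q * Xs 1 (Suc N) * Y 1"
begin

definition "P a m n = zprod Z a m n"
definition "Dg i = X.downi 1 i * (X' 1 * P (Y 1) 1 l) * X.upi 1 i"
text \<open>\<open>Loop i\<close> is T_i ... T_{N-1}^2 ... T_i, so that \<open>Loop 1\<close> is
  J_N, and \<open>Linv i\<close> is T_{i-1}^{-1} ... T_1^{-2} ... T_{i-1}^{-1}. Both change by a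
  factor T_i or T_i^{-1} on either side when i grows, which carries the diagonal relations from i to
  i + 1.\<close>

definition "Linv i = X.downi 1 i * X.upi 1 i"
definition "Loop i = X.up i N * X.down i N"

lemma Loop_Suc: "i \<in> {1..<N} \<Longrightarrow> Loop i = T i * Loop (Suc i) * T i"
  by (simp add: Loop_def X.up_rec[of i N] mult.assoc)

lemma Linv_Suc: "1 \<le> i \<Longrightarrow> Linv (Suc i) = X.Ti i * Linv i * X.Ti i"
  by (simp add: Linv_def X.up_Suc mult.assoc)

lemma r1: "1 \<in> {1..N}"
  using N by simp

lemma Xs_inverse: "b \<le> Suc N \<Longrightarrow> 1 \<le> a \<Longrightarrow> \<exists>y. Xs a b * y = 1"
  unfolding Xs_def by (rule exI, rule prod_list_inverse[of _ X X']) (use XX' in auto)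

text \<open>Y_1 commutes with X_1 ... X_N up to q, and with X_2 ... X_N up to the inverse of J_N.
  Cancelling X_2 ... X_N on the right leaves the statement for X_1 alone.\<close>

lemma Y1_X1: "Y 1 * X 1 = q * X 1 * Loop 1 * Y 1"
proof -
  have split: "Xs 1 (Suc N) = X 1 * Xs 2 (Suc N)"
    using N upt_conv_Cons[of 1 "Suc N"] by (simp add: Xs_def del: upt_Suc)
  obtain y where y: "Xs 2 (Suc N) * y = 1" using Xs_inverse[of "Suc N" 2] by auto
  have LL: "Loop 1 * (X.upi 1 N * X.downi 1 N) = 1"
    using X.up_inverse[of 1 N] by (simp add: Loop_def mult.assoc) (simp flip: mult.assoc)
  have s: "Xs 2 (Suc N) * Y 1 = Loop 1 * (Y 1 * Xs 2 (Suc N))"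
    using Y1_Xs[OF XX N order_refl] LL by (simp flip: mult.assoc)
  have "Y 1 * X 1 * Xs 2 (Suc N) = q * X 1 * (Xs 2 (Suc N) * Y 1)"
    using YXs unfolding split by (simp add: mult.assoc)
  then have "(Y 1 * X 1) * (Xs 2 (Suc N) * y) = (q * X 1 * Loop 1 * Y 1) * (Xs 2 (Suc N) * y)"
    unfolding s by (simp flip: mult.assoc)
  then show ?thesis by (simp add: y)
qed

lemma Y_X_diag:
  assumes "i \<in> {1..N}"
  shows "Y i * Linv i * X i = q * X i * Loop i * Y i"
proof -
  have "1 \<le> i" "i \<le> N" using assms by auto
  then show ?thesis
  proof (induction i rule: dec_induct)
    case base
    have "Linv 1 = 1" by (simp add: Linv_def)
    then show ?case using Y1_X1 by simp
  next
    case (step i)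
    then have i: "i \<in> {1..<N}" by auto
    have "Y (Suc i) * Linv (Suc i) * X (Suc i) = T i * (Y i * Linv i * X i) * T i"
      unfolding Linv_Suc[OF step(1)] X.TAT[OF i, symmetric] Y.TAT[OF i, symmetric]
      by (simp add: mult.assoc X.T_Ti_l[OF i] X.Ti_T_l[OF i])
    also have "Y i * Linv i * X i = q * X i * Loop i * Y i" using step by simp
    also have "T i * \<dots> * T i = (q * T i) * X i * (T i * Loop (Suc i) * T i) * Y i * T i"
      unfolding Loop_Suc[OF i] q_central[of "T i"] by (simp only: mult.assoc)
    also have "\<dots> = q * X (Suc i) * Loop (Suc i) * Y (Suc i)"
      unfolding X.TAT[OF i, symmetric] Y.TAT[OF i, symmetric] by (simp only: mult.assoc)
    finally show ?case .
  qed
qed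

sublocale X': hecke_family N X.Ti t' t X'
  by (rule X.inverse_family) (use XX' X'X in auto)

lemma inverse_up: "X'.up = X.upi" "X'.down = X.downi"
  by (simp_all add: fun_eq_iff X'.up_def X.upi_def X'.down_def X.downi_def)

lemma X1'_Y1: "X' 1 * Y 1 = q * Loop 1 * Y 1 * X' 1"
proof -
  have "X' 1 * (Y 1 * X 1) * X' 1 = (q * (X' 1 * X 1)) * Loop 1 * Y 1 * X' 1"
    unfolding Y1_X1 q_central[of "X' 1 * X 1"] q_central[of "X 1"] by (simp only: mult.assoc)
  then show ?thesis using XX'[OF r1] X'X[OF r1] by (simp add: mult.assoc)
qed

lemma X1_Y1: "Y 1 * X 1 = X 1 * (q * Loop 1 * Y 1)"
  unfolding Y1_X1 q_central[of "X 1"] by (simp only: mult.assoc)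

lemma P_commute:
  assumes "a * x = x * a" shows "P a m n * x = x * P a m n"
  unfolding P_def by (rule zprod_intertwine[OF assms Z_central])

text \<open>Y_1 and X_1^{-1} commute with T_2, ..., T_{N-1}, hence so does D_1; the D_i are the
  family it determines over the inverted Hecke algebra.\<close>

sublocale D: hecke_family N X.Ti t' t Dg
proof -
  show "hecke_family N X.Ti t' t Dg"
  proof (rule X'.hecke_familyI)
    show "Dg i = X'.down 1 i * Dg 1 * X'.up 1 i" if "i \<in> {1..N}" for i
      by (simp add: Dg_def inverse_up)
    fix i assume i: "2 \<le> i" "i < N"
    have TY: "X.Ti i * Y 1 = Y 1 * X.Ti i" by (rule X.commute_Ti, rule Y.TA) (use i in auto)
    have TX: "X.Ti i * X' 1 = X' 1 * X.Ti i" by (rule X'.TA) (use i in auto)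
    have TP: "X.Ti i * P (Y 1) 1 l = P (Y 1) 1 l * X.Ti i"
      by (rule P_commute[symmetric]) (simp add: TY)
    show "X.Ti i * Dg 1 = Dg 1 * X.Ti i"
      by (simp add: Dg_def mult.assoc flip: TP) (simp add: TX flip: mult.assoc)
  qed
qed

lemma D1: "Dg 1 = X' 1 * P (Y 1) 1 l"
  by (simp add: Dg_def)

lemma X1_D1: "X 1 * Dg 1 = P (Y 1) 1 l"
  using XX'[OF r1] by (simp add: D1 flip: mult.assoc)

lemma D1_X1: "Dg 1 * X 1 = P (q * Loop 1 * Y 1) 1 l"
proof -
  have "P (Y 1) 1 l * X 1 = X 1 * P (q * Loop 1 * Y 1) 1 l"
    unfolding P_def by (rule zprod_intertwine[OF X1_Y1 Z_central])
  then show ?thesis using X'X[OF r1] by (simp add: D1 mult.assoc) (simp flip: mult.assoc)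
qed

lemma D1_Y1: "Dg 1 * Y 1 = q * Loop 1 * Y 1 * Dg 1"
proof -
  have "Dg 1 * Y 1 = X' 1 * Y 1 * P (Y 1) 1 l"
    using P_commute[of "Y 1" "Y 1" 1 l] by (simp add: D1 mult.assoc)
  then show ?thesis by (simp add: D1 X1'_Y1 mult.assoc)
qed

lemma D_Y_diag:
  assumes "i \<in> {1..N}"
  shows "Dg i * Y i * Linv i = q * Loop i * Y i * Dg i"
proof -
  have "1 \<le> i" "i \<le> N" using assms by auto
  then show ?thesis
  proof (induction i rule: dec_induct)
    case base
    have "Linv 1 = 1" by (simp add: Linv_def)
    then show ?case using D1_Y1 by simp
  next
    case (step i)
    then have i: "i \<in> {1..<N}" by auto
    note c = X.T_Ti_l[OF i] X.Ti_T_l[OF i]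
    have "Dg (Suc i) * Y (Suc i) * Linv (Suc i) = X.Ti i * (Dg i * Y i * Linv i) * X.Ti i"
      unfolding Linv_Suc[OF step(1)] D.TAT[OF i, symmetric] Y.TAT[OF i, symmetric]
      by (simp add: mult.assoc c)
    also have "Dg i * Y i * Linv i = q * Loop i * Y i * Dg i" using step by simp
    also have "X.Ti i * \<dots> * X.Ti i = (q * X.Ti i) * T i * Loop (Suc i) * T i * Y i * Dg i * X.Ti i"
      unfolding Loop_Suc[OF i] q_central[of "X.Ti i"] by (simp only: mult.assoc)
    also have "\<dots> = q * Loop (Suc i) * Y (Suc i) * Dg (Suc i)"
      unfolding D.TAT[OF i, symmetric] Y.TAT[OF i, symmetric] by (simp add: mult.assoc c)
    finally show ?case .
  qed
qed

lemma X'_Y2: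
  assumes "2 \<le> N" shows "X' 1 * Y 2 = Y 2 * (X.Ti 1 * X.Ti 1) * X' 1"
proof -
  have i: "1 \<in> {1..<N}" using assms by auto
  have "X' 1 * (X 1 * Y 2) * (X.Ti 1 * X.Ti 1) * X' 1 = X' 1 * Y 2"
    unfolding cross[OF assms] using XX'[OF r1]
    by (simp add: mult.assoc X.T_Ti_l[OF i])
  then show ?thesis using X'X[OF r1] by (simp flip: mult.assoc)
qed

lemma D_Y_above:
  assumes "Dg i * Y (Suc i) = Y (Suc i) * (X.Ti i * X.Ti i) * Dg i" "1 \<le> i" "i < j" "j \<le> N"
  shows "Dg i * Y j = Y j * (X.downi (Suc i) j * (X.Ti i * X.Ti i) * X.up (Suc i) j) * Dg i"
proof -
  let ?d = "X.down (Suc i) j" and ?u = "X.up (Suc i) j" and ?e = "X.downi (Suc i) j"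
  have Yj: "Y j = ?d * Y (Suc i) * ?u" using Y.A_down_up[of "Suc i" j] assms by simp
  have TD: "T k * Dg i = Dg i * T k" if "Suc i \<le> k" "k < j" for k
    using X.commute_inverse[of k "Dg i"] D.TA[of k i] that assms by auto
  have c: "?d * Dg i = Dg i * ?d" "?u * Dg i = Dg i * ?u"
    by (rule X.commute_up; use TD in auto)+
  have ue: "?u * ?e = 1" using X.up_inverse[of "Suc i" j] assms by simp
  have "Dg i * Y j = ?d * (Dg i * Y (Suc i)) * ?u" unfolding Yj by (simp add: c flip: mult.assoc)
  also have "\<dots> = ?d * Y (Suc i) * (?u * ?e) * (X.Ti i * X.Ti i) * (Dg i * ?u)"
    unfolding assms(1) by (simp add: ue mult.assoc)
  also have "\<dots> = Y j * (?e * (X.Ti i * X.Ti i) * ?u) * Dg i" unfolding Yj c(2)[symmetric] by (simp only: mult.assoc)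
  finally show ?thesis .
qed

lemma D_Y_Suc:
  assumes "1 \<le> i" "Suc i \<le> N"
  shows "Dg i * Y (Suc i) = Y (Suc i) * (X.Ti i * X.Ti i) * Dg i"
  using assms
proof (induction i rule: dec_induct)
  case base
  then have N2: "2 \<le> N" by simp
  have "P (Y 1) 1 l * Y 2 = Y 2 * P (Y 1) 1 l"
    by (rule P_commute) (rule YY; use N2 in simp)
  then have "Dg 1 * Y 2 = (X' 1 * Y 2) * P (Y 1) 1 l" by (simp add: D1 mult.assoc)
  then show ?case unfolding X'_Y2[OF N2] by (simp add: D1 mult.assoc)
next
  case (step i)
  let ?a = "T i" and ?b = "T (Suc i)" and ?a' = "X.Ti i" and ?b' = "X.Ti (Suc i)"
  have i: "i \<in> {1..<N}" "Suc i \<in> {1..<N}" using step by auto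
  have *: "Dg i * Y (Suc (Suc i)) = Y (Suc (Suc i)) * (?b' * (?a' * ?a') * ?b) * Dg i"
    using D_Y_above[of i "Suc (Suc i)"] step by (simp add: X.up_Suc)
  have c: "?a' * Y (Suc (Suc i)) = Y (Suc (Suc i)) * ?a'"
    by (rule X.commute_Ti, rule Y.TA) (use step in auto)
  have b4: "?b' * ?a' * ?b = ?a * ?b' * ?a'" using X.braid_conj(4)[of i] step by simp
  have "?b' * (?a' * ?a') * ?b = (?b' * ?a' * ?b) * (?b' * ?a' * ?b)"
    by (simp add: mult.assoc X.T_Ti_l[OF i(2)])
  also have "\<dots> = ?a * (?b' * ?b') * ?a'"
    unfolding b4 by (simp add: mult.assoc X.Ti_T_l[OF i(1)])
  finally have sq: "?a' * (?b' * (?a' * ?a') * ?b) = ?b' * ?b' * ?a'"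
    by (simp add: mult.assoc X.Ti_T_l[OF i(1)])
  have "Dg (Suc i) * Y (Suc (Suc i)) = ?a' * (Dg i * Y (Suc (Suc i))) * ?a'"
    unfolding D.TAT[OF i(1), symmetric] by (simp only: mult.assoc c)
  also have "\<dots> = (?a' * Y (Suc (Suc i))) * (?b' * (?a' * ?a') * ?b) * Dg i * ?a'"
    unfolding * by (simp only: mult.assoc)
  also have "\<dots> = Y (Suc (Suc i)) * (?a' * (?b' * (?a' * ?a') * ?b)) * Dg i * ?a'"
    unfolding c by (simp only: mult.assoc)
  also have "\<dots> = Y (Suc (Suc i)) * (?b' * ?b') * Dg (Suc i)"
    unfolding sq D.TAT[OF i(1), symmetric] by (simp only: mult.assoc)
  finally show ?case .
qed

lemma D_Y:
  assumes "1 \<le> i" "i < j" "j \<le> N"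
  shows "Dg i * Y j = Y j * (X.downi (Suc i) j * (X.Ti i * X.Ti i) * X.up (Suc i) j) * Dg i"
  by (rule D_Y_above[OF D_Y_Suc]) (use assms in auto)

lemma Y_D:
  assumes "1 \<le> i" "i < j" "j \<le> N"
  shows "Dg j * (X.down (Suc i) j * (T i * T i) * X.upi (Suc i) j) * Y i = Y i * Dg j"
proof -
  let ?d = "X.down (Suc i) j" and ?e = "X.downi (Suc i) j" and ?v = "X.upi (Suc i) j"
  have i: "i \<in> {1..<N}" using assms by auto
  have Dj: "Dg j = ?e * Dg (Suc i) * ?v" using D.A_down_up[of "Suc i" j] assms unfolding inverse_up by simp
  have c: "?e * Y i = Y i * ?e" "?v * Y i = Y i * ?v"
    using Y.commute_above[of i "Suc i" j] assms by auto
  have vd: "?v * ?d = 1" using X.up_inverse[of "Suc i" j] assms by simp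
  have "Dg i * (T i * Y i * T i) = (T i * Y i * T i) * (X.Ti i * X.Ti i) * Dg i"
    using D_Y_Suc[of i] assms unfolding Y.TAT[OF i] by simp
  then have "X.Ti i * (Dg i * (T i * Y i * T i)) * X.Ti i = X.Ti i * ((T i * Y i * T i) * (X.Ti i * X.Ti i) * Dg i) * X.Ti i"
    by simp
  then have "X.Ti i * Dg i * T i * Y i = Y i * (X.Ti i * Dg i * X.Ti i)"
    by (simp add: mult.assoc X.Ti_T_l[OF i] X.T_Ti_l[OF i] X.T_Ti[OF i])
  then have base: "Dg (Suc i) * (T i * T i) * Y i = Y i * Dg (Suc i)"
    unfolding D.TAT[OF i, symmetric] by (simp add: mult.assoc X.Ti_T_l[OF i])
  have "Dg j * (?d * (T i * T i) * ?v) * Y i = ?e * Dg (Suc i) * (?v * ?d) * (T i * T i) * (?v * Y i)"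
    unfolding Dj by (simp only: mult.assoc)
  also have "\<dots> = ?e * (Dg (Suc i) * (T i * T i) * Y i) * ?v"
    unfolding c vd by (simp add: mult.assoc)
  also have "\<dots> = (?e * Y i) * Dg (Suc i) * ?v" unfolding base by (simp only: mult.assoc)
  also have "\<dots> = Y i * Dg j" unfolding c Dj by (simp only: mult.assoc)
  finally show ?thesis .
qed

text \<open>Only D_1 and D_2 matter. Write P for the product of the factors with Z_1, ..., Z_l.
  Since Y_1 X_2^{-1} T_1 = X_2^{-1} T_1 Y_2, and D_2 = X_2^{-1} T_1 P(Y_1) T_1^{-1}, the product D_1
  D_2 becomes X_2^{-1} X_1^{-1} P(Y_2) P(Y_1). This is symmetric in the two indices and commutes
  with T_1, and D_2 D_1 = T_1^{-1} (D_1 D_2) T_1.\<close>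

lemma D_D:
  assumes "i \<in> {1..N}" "j \<in> {1..N}"
  shows "Dg i * Dg j = Dg j * Dg i"
proof (rule D.commute_from_first_two[OF _ assms])
  assume N2: "2 \<le> N"
  then have i: "1 \<in> {1..<N}" and r2: "Suc 1 \<in> {1..N}" by auto
  let ?a = "T 1" and ?a' = "X.Ti 1" and ?P1 = "P (Y 1) 1 l" and ?P2 = "P (Y (Suc 1)) 1 l"
  note c = X.T_Ti_l[OF i] X.Ti_T_l[OF i]
  have Y1X2: "Y 1 * (X' (Suc 1) * ?a) = X' (Suc 1) * ?a * Y (Suc 1)"
  proof -
    have "Y 1 * X (Suc 1) = ?a' * ?a' * X (Suc 1) * Y 1" using Y_X_Suc[of 1] N2 by simp
    then have "X' (Suc 1) * (?a * ?a) * (Y 1 * X (Suc 1)) * X' (Suc 1)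
        = X' (Suc 1) * (?a * ?a) * (?a' * ?a' * X (Suc 1) * Y 1) * X' (Suc 1)" by simp
    also have "\<dots> = (X' (Suc 1) * X (Suc 1)) * Y 1 * X' (Suc 1)"
      by (simp add: mult.assoc c)
    finally have "X' (Suc 1) * (?a * ?a) * Y 1 * (X (Suc 1) * X' (Suc 1)) = (X' (Suc 1) * X (Suc 1)) * Y 1 * X' (Suc 1)"
      by (simp only: mult.assoc)
    then have "X' (Suc 1) * (?a * ?a) * Y 1 = Y 1 * X' (Suc 1)"
      using XX'[OF r2] X'X[OF r2] by simp
    then show ?thesis unfolding Y.TAT[OF i, symmetric] by (simp flip: mult.assoc)
  qed
  have PX: "?P1 * (X' (Suc 1) * ?a) = X' (Suc 1) * ?a * ?P2"
    unfolding P_def by (rule zprod_intertwine[OF Y1X2 Z_central])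
  have D2: "Dg (Suc 1) = X' (Suc 1) * ?a * ?P1 * ?a'"
    unfolding D.TAT[OF i, symmetric] X'.TAT[OF i, symmetric] D1 by (simp add: mult.assoc c X.Ti_T[OF i])
  \<comment> \<open>Each factor (Y_2 - Z_r)(Y_1 - Z_r) is a polynomial in Y_1 + Y_2 and Y_2 Y_1, and
    both of these commute with T_1.\<close>
  have TP: "?a * (P (Y (Suc 1)) 1 n * P (Y 1) 1 n) = (P (Y (Suc 1)) 1 n * P (Y 1) 1 n) * ?a" for n
  proof (induction n)
    case (Suc n)
    let ?z = "Z (Suc n)" and ?y = "Y 1" and ?x = "Y (Suc 1)"
    have yx: "?y * ?x = ?x * ?y" using YY[OF r1 r2] .
    have e: "P ?x 1 (Suc n) * P ?y 1 (Suc n) = (P ?x 1 n * P ?y 1 n) * ((?x - ?z) * (?y - ?z))"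
    proof -
      have "P ?y 1 n * (?x - ?z) = (?x - ?z) * P ?y 1 n"
        by (rule P_commute) (use yx Z_central[of "Suc n" ?y] in \<open>simp add: algebra_simps\<close>)
      then show ?thesis by (simp add: P_def zprod_Suc mult.assoc) (simp flip: mult.assoc)
    qed
    have T1: "?a * (?x * ?y) = ?x * ?y * ?a" by (rule Y.T_commute_pair[OF i yx])
    have T2: "?a * (?x + ?y) = (?x + ?y) * ?a"
      by (simp only: distrib_left distrib_right Y.T_A_Suc[OF i] Y.A_Suc_T[OF i] add.assoc add.commute add.left_commute)
    have ex: "(?x - ?z) * (?y - ?z) = ?x * ?y - ?z * (?x + ?y) + ?z * ?z"
      using Z_central[of "Suc n" ?x] by (simp add: algebra_simps)
    have zT: "?a * (?z * w) = ?z * (?a * w)" for w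
      by (metis Z_central mult.assoc)
    have "?a * ((?x - ?z) * (?y - ?z)) = ?a * (?x * ?y) - ?z * (?a * (?x + ?y)) + ?z * (?a * ?z)"
      unfolding ex by (simp only: right_diff_distrib distrib_left[of ?a "_ - _"] zT)
    also have "\<dots> = ((?x - ?z) * (?y - ?z)) * ?a"
      unfolding ex T1 T2 Z_central[of _ ?a, symmetric] by (simp add: left_diff_distrib distrib_right mult.assoc)
    finally have T3: "?a * ((?x - ?z) * (?y - ?z)) = ((?x - ?z) * (?y - ?z)) * ?a" .
    have "?a * (P ?x 1 (Suc n) * P ?y 1 (Suc n)) = (?a * (P ?x 1 n * P ?y 1 n)) * ((?x - ?z) * (?y - ?z))"
      unfolding e by (simp only: mult.assoc)
    also have "\<dots> = (P ?x 1 n * P ?y 1 n) * (?a * ((?x - ?z) * (?y - ?z)))"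
      unfolding Suc by (simp only: mult.assoc)
    finally show ?case unfolding T3 e by (simp only: mult.assoc)
  qed (simp add: P_def)
  have XX2: "X' 1 * X' (Suc 1) = X' (Suc 1) * X' 1"
    by (rule inverse_commute2[OF XX[OF r1 r2] XX'[OF r1] X'X[OF r1] XX'[OF r2] X'X[OF r2]])
  have TX: "?a' * (X' (Suc 1) * X' 1) = X' (Suc 1) * X' 1 * ?a'"
    by (rule X'.T_commute_pair[OF i XX2])
  have TX2: "?a * (X' (Suc 1) * X' 1) = X' (Suc 1) * X' 1 * ?a"
    by (rule X.commute_inverse[OF i TX])
  have "Dg 1 * Dg (Suc 1) = X' 1 * (?P1 * (X' (Suc 1) * ?a)) * ?P1 * ?a'"
    unfolding D1 D2 by (simp only: mult.assoc)
  also have "\<dots> = X' 1 * X' (Suc 1) * (?a * (?P2 * ?P1)) * ?a'"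
    unfolding PX by (simp only: mult.assoc)
  also have "\<dots> = X' (Suc 1) * X' 1 * (?P2 * ?P1)"
    unfolding TP XX2 by (simp add: mult.assoc X.T_Ti[OF i])
  finally have 12: "Dg 1 * Dg (Suc 1) = X' (Suc 1) * X' 1 * (?P2 * ?P1)" .
  have "Dg (Suc 1) * Dg 1 = ?a' * (Dg 1 * Dg (Suc 1)) * ?a"
    unfolding D.TAT[OF i, symmetric] by (simp add: mult.assoc X.Ti_T[OF i])
  also have "\<dots> = ?a' * (X' (Suc 1) * X' 1 * ((?P2 * ?P1) * ?a))"
    unfolding 12 by (simp only: mult.assoc)
  also have "\<dots> = ?a' * (X' (Suc 1) * X' 1 * ?a) * (?P2 * ?P1)"
    unfolding TP[symmetric] by (simp only: mult.assoc)
  also have "\<dots> = ?a' * (?a * (X' (Suc 1) * X' 1)) * (?P2 * ?P1)"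
    unfolding TX2 by (simp only: mult.assoc)
  also have "\<dots> = Dg 1 * Dg (Suc 1)" unfolding 12 by (simp add: mult.assoc c)
  finally show "Dg 1 * Dg 2 = Dg 2 * Dg 1" by simp
qed

text \<open>D_1 = X_1^{-1} P(Y_1) and X_1^{-1} commutes with X_2, so the Leibniz rule applies with
  [Y_1, X_2] = (t^{-1} - t) X_1 Y_2 T_1^{-1}. Moving X_1^{-1} inwards turns Y_1 into q J_N Y_1 in
  the factors before the r-th; moving T_1^{-1} outwards turns Y_1 into Y_2 T_1^{-2} in those after
  it and leaves T_1 at the end.\<close>

lemma D1_X2:
  assumes N2: "2 \<le> N"
  shows "Dg 1 * X 2 - X 2 * Dg 1
    = (t' - t) * (\<Sum>r = 1..l. P (q * Loop 1 * Y 1) 1 (r - 1) * (Y 2 * (X.Ti 1 * X.Ti 1))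
        * P (Y 2 * (X.Ti 1 * X.Ti 1)) (Suc r) l * T 1)"
proof -
  have i: "1 \<in> {1..<N}" and r2: "2 \<in> {1..N}" and S: "2 = Suc 1" using N2 by auto
  let ?a = "T 1" and ?a' = "X.Ti 1" and ?c = "q * Loop 1 * Y 1" and ?b = "Y 2 * (X.Ti 1 * X.Ti 1)"
  note c = X.T_Ti_l[OF i] X.Ti_T_l[OF i]
  have 1: "Y 1 * X 2 = ?a' * X 1 * Y 2 * ?a'"
    using Y_X_Suc[of 1] N2 unfolding S X.TAT[OF i, symmetric] Y.TAT[OF i, symmetric]
    by (simp add: mult.assoc c X.T_Ti[OF i])
  have 2: "X 2 * Y 1 = ?a * X 1 * Y 2 * ?a'"
    unfolding S X.TAT[OF i, symmetric] Y.TAT[OF i, symmetric] by (simp add: mult.assoc c X.T_Ti[OF i])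
  have E: "Y 1 * X 2 - X 2 * Y 1 = (t' - t) * (X 1 * Y 2 * ?a')"
    unfolding 1 2 X.Ti_def[of 1] by (simp add: algebra_simps)
  have L: "X' 1 * zprod Z (Y 1) 1 n = zprod Z ?c 1 n * X' 1" for n
  proof -
    have "zprod Z (Y 1) 1 n * X 1 = X 1 * zprod Z ?c 1 n"
      by (rule zprod_intertwine[OF X1_Y1 Z_central])
    then have "X' 1 * (zprod Z (Y 1) 1 n * X 1) * X' 1 = X' 1 * (X 1 * zprod Z ?c 1 n) * X' 1" by simp
    then show ?thesis using XX'[OF r1] X'X[OF r1] by (simp add: mult.assoc) (simp flip: mult.assoc)
  qed
  have R: "?a' * zprod Z (Y 1) m n = ?a' * ?a' * zprod Z ?b m n * ?a" for m n
  proof -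
    have "?b * ?a = ?a * Y 1"
      unfolding S Y.TAT[OF i, symmetric] by (simp add: mult.assoc c X.Ti_T[OF i] X.T_Ti[OF i])
    then have "zprod Z ?b m n * ?a = ?a * zprod Z (Y 1) m n"
      by (rule zprod_intertwine) (rule Z_central)
    then show ?thesis by (simp add: mult.assoc c)
  qed
  have tc: "x * (t' - t) = (t' - t) * x" for x
    using X.t_central[of x] X.t'_central[of x] by (simp add: algebra_simps)
  have XX12: "X 2 * X' 1 = X' 1 * X 2"
    by (rule inverse_commute[OF XX[OF r1 r2] XX'[OF r1] X'X[OF r1], symmetric])
  have "Dg 1 * X 2 - X 2 * Dg 1 = X' 1 * (zprod Z (Y 1) 1 l * X 2 - X 2 * zprod Z (Y 1) 1 l)"
    unfolding D1 P_def by (simp add: right_diff_distrib mult.assoc) (simp add: XX12 flip: mult.assoc)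
  also have "\<dots> = (\<Sum>r = 1..l. X' 1 * (zprod Z (Y 1) 1 (r - 1)
      * ((t' - t) * (X 1 * Y 2 * ?a')) * zprod Z (Y 1) (Suc r) l))"
    unfolding zprod_commutator[OF Z_central] E by (simp add: sum_distrib_left)
  also have "\<dots> = (\<Sum>r = 1..l. (t' - t) * (zprod Z ?c 1 (r - 1) * ?b * zprod Z ?b (Suc r) l * T 1))"
  proof (rule sum.cong[OF refl])
    fix r
    have "X' 1 * (zprod Z (Y 1) 1 (r - 1) * ((t' - t) * (X 1 * Y 2 * ?a')) * zprod Z (Y 1) (Suc r) l)
      = (X' 1 * zprod Z (Y 1) 1 (r - 1)) * (t' - t) * X 1 * Y 2 * (?a' * zprod Z (Y 1) (Suc r) l)"
      by (simp only: mult.assoc)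
    also have "\<dots> = (t' - t) * (zprod Z ?c 1 (r - 1) * (X' 1 * X 1) * Y 2 * (?a' * ?a' * zprod Z ?b (Suc r) l * ?a))"
      unfolding L R tc by (simp only: mult.assoc)
    finally show "X' 1 * (zprod Z (Y 1) 1 (r - 1) * ((t' - t) * (X 1 * Y 2 * ?a')) * zprod Z (Y 1) (Suc r) l)
      = (t' - t) * (zprod Z ?c 1 (r - 1) * ?b * zprod Z ?b (Suc r) l * T 1)"
      using X'X[OF r1] by (simp add: mult.assoc)
  qed
  finally show ?thesis unfolding P_def by (simp add: sum_distrib_left)
qed

end

section \<open>Spans with coefficients on the right, generated subrings, and words in Hecke
  generators\<close>

inductive_set lin_span :: "'r::ring_1 set \<Rightarrow> 'r set \<Rightarrow> 'r set" for M W where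
  zero: "0 \<in> lin_span M W"
| add: "m \<in> M \<Longrightarrow> w \<in> W \<Longrightarrow> z \<in> lin_span M W \<Longrightarrow> m * w + z \<in> lin_span M W"

definition add_closed :: "'r::ring_1 set \<Rightarrow> bool" where
  "add_closed S \<longleftrightarrow> 0 \<in> S \<and> (\<forall>x\<in>S. \<forall>y\<in>S. x + y \<in> S) \<and> (\<forall>x\<in>S. - x \<in> S)"

lemma add_closedD:
  assumes "add_closed S"
  shows "0 \<in> S" "x \<in> S \<Longrightarrow> y \<in> S \<Longrightarrow> x + y \<in> S" "x \<in> S \<Longrightarrow> - x \<in> S" "x \<in> S \<Longrightarrow> y \<in> S \<Longrightarrow> x - y \<in> S"
  using assms unfolding add_closed_def by (auto simp: diff_conv_add_uminus simp del: add_uminus_conv_diff)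

lemma lin_span_mult: "m \<in> M \<Longrightarrow> w \<in> W \<Longrightarrow> m * w \<in> lin_span M W"
  using lin_span.add[OF _ _ lin_span.zero] by force

lemma lin_span_plus: "x \<in> lin_span M W \<Longrightarrow> y \<in> lin_span M W \<Longrightarrow> x + y \<in> lin_span M W"
  by (induction rule: lin_span.induct) (auto simp: add.assoc intro: lin_span.add)

lemma lin_span_induct [consumes 1, case_names zero mult plus]:
  assumes "z \<in> lin_span M W" "Q 0" "\<And>m w. m \<in> M \<Longrightarrow> w \<in> W \<Longrightarrow> Q (m * w)"
    "\<And>x y. Q x \<Longrightarrow> Q y \<Longrightarrow> Q (x + y)"
  shows "Q z"
  using assms(1) by (induction rule: lin_span.induct) (auto intro: assms)

lemma lin_span_least:
  assumes "add_closed S" "\<And>m w. m \<in> M \<Longrightarrow> w \<in> W \<Longrightarrow> g * (m * w) \<in> S" "z \<in> lin_span M W"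
  shows "g * z \<in> S"
  using assms(3)
  by (induction rule: lin_span_induct) (auto simp: distrib_left intro: add_closedD[OF assms(1)] assms(2))

lemma lin_span_subset:
  assumes "add_closed S" "\<And>m w. m \<in> M \<Longrightarrow> w \<in> W \<Longrightarrow> m * w \<in> S"
  shows "lin_span M W \<subseteq> S"
  using lin_span_least[of S M W 1] assms by auto

lemma lin_span_right:
  assumes "\<And>w. w \<in> W \<Longrightarrow> w * g \<in> W'" "z \<in> lin_span M W"
  shows "z * g \<in> lin_span M W'"
  using assms(2)
  by (induction rule: lin_span_induct)
    (auto simp: distrib_right mult.assoc intro: lin_span_plus lin_span_mult lin_span.zero assms(1))

lemma lin_span_closed:
  assumes "\<And>w. w \<in> W \<Longrightarrow> - w \<in> W"
  shows "add_closed (lin_span M W)"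
proof -
  have "- z \<in> lin_span M W" if "z \<in> lin_span M W" for z
    using lin_span_right[of W "- 1" W z M] assms that by simp
  then show ?thesis unfolding add_closed_def by (auto intro: lin_span.zero lin_span_plus)
qed

lemma lin_span_mono: "M \<subseteq> M' \<Longrightarrow> W \<subseteq> W' \<Longrightarrow> lin_span M W \<subseteq> lin_span M' W'"
  by (rule subsetI, erule lin_span_induct) (auto intro: lin_span.zero lin_span_plus lin_span_mult)

text \<open>Lets the normal forms for the X and D, for the Y and for the T be proved separately and
  then multiplied together.\<close>

lemma lin_span_assoc:
  assumes "\<And>w. w \<in> W \<Longrightarrow> - w \<in> W"
  shows "lin_span M (lin_span M' W) \<subseteq> lin_span {m * m' | m m'. m \<in> M \<and> m' \<in> M'} W"
proof (rule lin_span_subset[OF lin_span_closed[OF assms]])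
  fix m z assume m: "m \<in> M" and z: "z \<in> lin_span M' W"
  show "m * z \<in> lin_span {m * m' | m m'. m \<in> M \<and> m' \<in> M'} W"
  proof (rule lin_span_least[OF lin_span_closed[OF assms] _ z])
    fix m' w assume "m' \<in> M'" "w \<in> W"
    then have "(m * m') * w \<in> lin_span {m * m' | m m'. m \<in> M \<and> m' \<in> M'} W"
      using m by (intro lin_span_mult) auto
    then show "m * (m' * w) \<in> lin_span {m * m' | m m'. m \<in> M \<and> m' \<in> M'} W" by (simp add: mult.assoc)
  qed
qed

inductive_set subring_gen :: "'r::ring_1 set \<Rightarrow> 'r set" for G where
  one: "1 \<in> subring_gen G"
| gen: "g \<in> G \<Longrightarrow> g \<in> subring_gen G"
| uminus: "x \<in> subring_gen G \<Longrightarrow> - x \<in> subring_gen G"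
| plus: "x \<in> subring_gen G \<Longrightarrow> y \<in> subring_gen G \<Longrightarrow> x + y \<in> subring_gen G"
| times: "x \<in> subring_gen G \<Longrightarrow> y \<in> subring_gen G \<Longrightarrow> x * y \<in> subring_gen G"

lemma subring_gen_zero: "0 \<in> subring_gen G"
  using subring_gen.plus[OF subring_gen.one subring_gen.uminus[OF subring_gen.one]] by (metis add.right_inverse)

lemma subring_gen_closed: "add_closed (subring_gen G)"
  unfolding add_closed_def using subring_gen_zero by (blast intro: subring_gen.intros)

lemma subring_gen_minus: "x \<in> subring_gen G \<Longrightarrow> y \<in> subring_gen G \<Longrightarrow> x - y \<in> subring_gen G"
  using add_closedD(4)[OF subring_gen_closed] .

lemma subring_gen_prod: "(\<And>x. x \<in> set xs \<Longrightarrow> x \<in> subring_gen G) \<Longrightarrow> prod_list xs \<in> subring_gen G"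
  by (induction xs) (auto intro: subring_gen.intros)

lemma subring_gen_sum: "(\<And>x. x \<in> A \<Longrightarrow> f x \<in> subring_gen G) \<Longrightarrow> sum f A \<in> subring_gen G"
  by (induction A rule: infinite_finite_induct) (auto intro: subring_gen.intros subring_gen_zero)

lemma subring_gen_mono:
  assumes "G \<subseteq> subring_gen H" shows "subring_gen G \<subseteq> subring_gen H"
  by (rule subsetI, erule subring_gen.induct) (use assms in \<open>auto intro: subring_gen.intros\<close>)

lemma subring_gen_act:
  assumes S: "add_closed S" and G: "\<And>g z. g \<in> G \<Longrightarrow> z \<in> S \<Longrightarrow> g * z \<in> S"
    and x: "x \<in> subring_gen G" and z: "z \<in> S"
  shows "x * z \<in> S"
  using x z by (induction arbitrary: z rule: subring_gen.induct)
    (auto simp: distrib_right mult.assoc intro: add_closedD[OF S] G)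

text \<open>The span is stable under left multiplication by a generator \<open>g\<close>: in g (m w)
  the product g m is rewritten by assumption, and w is absorbed by the coefficients on the right,
  which form a ring. So it suffices to move single generators past single letters.\<close>

lemma subring_gen_exchange:
  assumes G: "\<And>g a. g \<in> G \<Longrightarrow> a \<in> A \<Longrightarrow> g * a \<in> lin_span A (subring_gen G)"
    and h: "h \<in> subring_gen G" and a: "a \<in> A"
  shows "h * a \<in> lin_span A (subring_gen G)"
proof (rule subring_gen_act[OF _ _ h])
  show cl: "add_closed (lin_span A (subring_gen G))"
    by (rule lin_span_closed) (rule subring_gen.uminus)
  show "a \<in> lin_span A (subring_gen G)"
    using lin_span_mult[OF a subring_gen.one] by simp
  fix g z assume g: "g \<in> G" and z: "z \<in> lin_span A (subring_gen G)"
  show "g * z \<in> lin_span A (subring_gen G)"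
  proof (rule lin_span_least[OF cl _ z])
    fix m w assume "m \<in> A" "w \<in> subring_gen G"
    then show "g * (m * w) \<in> lin_span A (subring_gen G)"
      using lin_span_right[OF _ G[OF g], of w "subring_gen G" m] by (simp add: mult.assoc subring_gen.times)
  qed
qed

lemma prod_list_permute:
  fixes A :: "'i \<Rightarrow> 'r::monoid_mult"
  assumes "\<And>i j. i \<in> I \<Longrightarrow> j \<in> I \<Longrightarrow> A i * A j = A j * A i"
    and "mset xs = mset ys" "set xs \<subseteq> I"
  shows "prod_list (map A xs) = prod_list (map A ys)"
  using assms(2,3)
proof (induction xs arbitrary: ys)
  case (Cons x xs)
  then have "x \<in> set ys" using mset_eq_setD[OF Cons.prems(1)] by auto
  then obtain us vs where ys: "ys = us @ x # vs" by (meson split_list)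
  have IH: "prod_list (map A xs) = prod_list (map A (us @ vs))"
    by (rule Cons.IH) (use Cons.prems ys in auto)
  have "set us \<subseteq> I" using mset_eq_setD[OF Cons.prems(1)] Cons.prems(2) ys by auto
  then have "A x * prod_list (map A us) = prod_list (map A us) * A x"
    using Cons.prems(2) by (intro prod_list_commute) (auto intro: assms(1))
  then show ?case unfolding ys list.map prod_list.Cons IH by (simp flip: mult.assoc)
qed simp

lemma prod_list_remove1:
  fixes A :: "'i \<Rightarrow> 'r::monoid_mult"
  assumes "\<And>i j. i \<in> I \<Longrightarrow> j \<in> I \<Longrightarrow> A i * A j = A j * A i" "i \<in> set xs" "set xs \<subseteq> I"
  shows "prod_list (map A xs) = A i * prod_list (map A (remove1 i xs))"
  using prod_list_permute[OF assms(1), of I, where xs = xs and ys = "i # remove1 i xs"] assms(2,3) by simp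

text \<open>Standard reduced words for the permutations of \<open>n\<close> letters.\<close>

fun perm_words :: "nat \<Rightarrow> nat list set" where
  "perm_words 0 = {[]}"
| "perm_words (Suc n) = {[j..<Suc n] @ u | j u. j \<in> {1..Suc n} \<and> u \<in> perm_words n}"

definition scalar_set :: "'r::ring_1 set \<Rightarrow> bool" where
  "scalar_set K \<longleftrightarrow> add_closed K \<and> 1 \<in> K \<and> (\<forall>k\<in>K. \<forall>k'\<in>K. k * k' \<in> K) \<and> (\<forall>k\<in>K. \<forall>x. k * x = x * k)"

lemma scalar_setD:
  assumes "scalar_set K"
  shows "add_closed K" "1 \<in> K" "k \<in> K \<Longrightarrow> k' \<in> K \<Longrightarrow> k * k' \<in> K" "k \<in> K \<Longrightarrow> k * x = x * k"
  using assms unfolding scalar_set_def by blast+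

lemma lin_span_scalar:
  assumes K: "scalar_set K" and k: "k \<in> K" and W: "\<And>w. w \<in> W \<Longrightarrow> w * k \<in> W"
    and z: "z \<in> lin_span M W"
  shows "k * z \<in> lin_span M W"
  unfolding scalar_setD(4)[OF K k] using lin_span_right[OF W z] .

context hecke
begin

text \<open>A standard word begins with the run T_j ... T_n, followed by a word for fewer letters.
  If i + 1 < j, T_i passes the run; if i + 1 = j, it prolongs the run; if i = j, the quadratic
  relation shortens or keeps it; if j < i, it passes and becomes T_{i-1}. In the two passing cases
  the induction hypothesis takes over.\<close>

lemma lin_span_perm_words:
  assumes K: "scalar_set K" "t \<in> K" "t' \<in> K" and "n \<le> N" "1 \<le> i" "i < n"
    and "z \<in> lin_span ((\<lambda>w. prod_list (map T w)) ` perm_words n) K"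
  shows "T i * z \<in> lin_span ((\<lambda>w. prod_list (map T w)) ` perm_words n) K"
  using assms(4-)
proof (induction n arbitrary: i z)
  case (Suc n)
  let ?S = "\<lambda>n. lin_span ((\<lambda>w. prod_list (map T w)) ` perm_words n) K"
  note K' = scalar_setD[OF K(1)]
  have cl: "add_closed (?S n)" for n by (rule lin_span_closed) (rule add_closedD(3)[OF K'(1)])
  have tt: "t - t' \<in> K" using K add_closedD(4)[OF K'(1)] by blast
  have up: "up j (Suc n) * x \<in> ?S (Suc n)" if j: "j \<in> {1..Suc n}" and x: "x \<in> ?S n" for j x
  proof (rule lin_span_least[OF cl _ x])
    fix m w assume m: "m \<in> (\<lambda>w. prod_list (map T w)) ` perm_words n" and w: "w \<in> K"
    then obtain u where u: "u \<in> perm_words n" "m = prod_list (map T u)" by auto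
    have "up j (Suc n) * m = prod_list (map T ([j..<Suc n] @ u))"
      by (simp only: u up_def map_append prod_list.append)
    moreover have "[j..<Suc n] @ u \<in> perm_words (Suc n)" using j u by (auto simp del: upt_Suc)
    ultimately have "up j (Suc n) * m \<in> (\<lambda>w. prod_list (map T w)) ` perm_words (Suc n)" by blast
    then show "up j (Suc n) * (m * w) \<in> ?S (Suc n)"
      using lin_span_mult w by (metis mult.assoc)
  qed
  have main: "T i * (up j (Suc n) * x) \<in> ?S (Suc n)" if j: "j \<in> {1..Suc n}" and x: "x \<in> ?S n" for j x
  proof -
    consider "Suc i < j" | "Suc i = j" | "i = j" | "j < i" by linarith
    then show ?thesis
    proof cases
      case 1
      then have "up j (Suc n) * T i = T i * up j (Suc n)"
        using Suc.prems by (intro commute_up(1)) (auto intro!: far')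
      then have "T i * (up j (Suc n) * x) = up j (Suc n) * (T i * x)"
        by (simp flip: mult.assoc)
      then show ?thesis using up[OF j] Suc.IH[of i x] Suc.prems x 1 j by simp
    next
      case 2
      then have "T i * (up j (Suc n) * x) = up i (Suc n) * x"
        using up_rec(1)[of i "Suc n"] Suc.prems by (simp add: mult.assoc)
      then show ?thesis using up[of i x] x Suc.prems by simp
    next
      case 3
      then have "T i * (up j (Suc n) * x) = (T i * T i) * (up (Suc i) (Suc n) * x)"
        using up_rec(1)[of i "Suc n"] Suc.prems by (simp add: mult.assoc)
      also have "\<dots> = up (Suc i) (Suc n) * x + (t - t') * (T i * up (Suc i) (Suc n) * x)"
        using T_square[of i] Suc.prems by (simp add: distrib_right mult.assoc)
      also have "T i * up (Suc i) (Suc n) = up i (Suc n)"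
        using up_rec(1)[of i "Suc n"] Suc.prems by simp
      finally have e: "T i * (up j (Suc n) * x) = up (Suc i) (Suc n) * x + (t - t') * (up i (Suc n) * x)" .
      have "(t - t') * (up i (Suc n) * x) \<in> ?S (Suc n)"
        by (rule lin_span_scalar[OF K(1) tt]) (use K'(3) tt up[of i x] x Suc.prems in auto)
      then show ?thesis unfolding e using up[of "Suc i" x] x Suc.prems by (intro lin_span_plus) auto
    next
      case 4
      then have "up j (Suc n) * T (i - 1) = T (Suc (i - 1)) * up j (Suc n)"
        using Suc.prems j by (intro T_up_shift) auto
      then have "T i * (up j (Suc n) * x) = up j (Suc n) * (T (i - 1) * x)"
        using 4 by (simp flip: mult.assoc)
      then show ?thesis using up[OF j] Suc.IH[of "i - 1" x] Suc.prems x 4 j by simp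
    qed
  qed
  show ?case
  proof (rule lin_span_least[OF cl _ Suc.prems(4)])
    fix m w assume m: "m \<in> (\<lambda>w. prod_list (map T w)) ` perm_words (Suc n)" and w: "w \<in> K"
    then obtain j u where u: "u \<in> perm_words n" "m = prod_list (map T ([j..<Suc n] @ u))" and j: "j \<in> {1..Suc n}"
      by (auto simp del: upt_Suc)
    have "m * w = up j (Suc n) * (prod_list (map T u) * w)"
      by (simp only: u up_def map_append prod_list.append mult.assoc)
    then show "T i * (m * w) \<in> ?S (Suc n)"
      using main[OF j, of "prod_list (map T u) * w"] lin_span_mult[of "prod_list (map T u)" _ w K] u w by simp
  qed
qed simp

lemma Nil_perm_words: "[] \<in> perm_words n"
proof (induction n)
  case (Suc n)
  have "[Suc n..<Suc n] @ [] \<in> perm_words (Suc n)"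
    unfolding perm_words.simps using Suc
    by (intro CollectI exI[of _ "Suc n"] exI[of _ "[]"] conjI refl) auto
  then show ?case by simp
qed simp

lemma hecke_span:
  assumes K: "scalar_set K" "t \<in> K" "t' \<in> K"
  shows "subring_gen (K \<union> T ` {1..<N}) \<subseteq> lin_span ((\<lambda>w. prod_list (map T w)) ` perm_words N) K"
proof
  let ?S = "lin_span ((\<lambda>w. prod_list (map T w)) ` perm_words N) K"
  note K' = scalar_setD[OF K(1)]
  fix x assume x: "x \<in> subring_gen (K \<union> T ` {1..<N})"
  have "x * 1 \<in> ?S"
  proof (rule subring_gen_act[OF _ _ x])
    show "add_closed ?S" by (rule lin_span_closed) (rule add_closedD(3)[OF K'(1)])
    have "prod_list (map T []) \<in> (\<lambda>w. prod_list (map T w)) ` perm_words N"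
      using Nil_perm_words by (rule imageI)
    then show "1 \<in> ?S" using lin_span_mult[OF _ K'(2)] by fastforce
    show "g * z \<in> ?S" if "g \<in> K \<union> T ` {1..<N}" "z \<in> ?S" for g z
      using that lin_span_perm_words[OF K order_refl] lin_span_scalar[OF K(1) _ K'(3)] by auto
  qed
  then show "x \<in> ?S" by simp
qed

end

context hecke_family
begin

lemma T_A_span:
  assumes "i \<in> {1..<N}" "j \<in> {1..N}"
    and H: "add_closed H" "1 \<in> H" "T i \<in> H" "t \<in> H" "t' \<in> H"
  shows "T i * A j \<in> lin_span (A ` {1..N}) H" and "Ti i * A j \<in> lin_span (A ` {1..N}) H"
proof -
  have r: "A i \<in> A ` {1..N}" "A (Suc i) \<in> A ` {1..N}" "A j \<in> A ` {1..N}" using assms(1,2) by auto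
  have cl: "add_closed (lin_span (A ` {1..N}) H)" by (rule lin_span_closed) (rule add_closedD(3)[OF H(1)])
  have TiH: "Ti i \<in> H" "t - t' \<in> H" unfolding Ti_def
    using add_closedD(2)[OF H(1) add_closedD(4)[OF H(1) H(3,4)] H(5)] add_closedD(4)[OF H(1) H(4,5)] by simp_all
  consider "j = i" | "j = Suc i" | "j \<noteq> i" "j \<noteq> Suc i" by blast
  then show 1: "T i * A j \<in> lin_span (A ` {1..N}) H"
  proof cases
    case 1
    then show ?thesis using lin_span_mult[OF r(2) TiH(1)] T_A[OF assms(1)] by simp
  next
    case 2
    have "T i * A j = A i * T i + A (Suc i) * (t - t')"
      using 2 T_A_Suc[OF assms(1)] t_central[of "A (Suc i)"] t'_central[of "A (Suc i)"] by (simp add: algebra_simps)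
    then show ?thesis using lin_span_plus[OF lin_span_mult[OF r(1) H(3)] lin_span_mult[OF r(2) TiH(2)]] by simp
  next
    case 3
    then show ?thesis using lin_span_mult[OF r(3) H(3)] TA[OF assms(1,2)] by simp
  qed
  have "Ti i * A j = T i * A j - A j * (t - t')"
    using t_central[of "A j"] t'_central[of "A j"] by (simp add: Ti_def algebra_simps)
  then show "Ti i * A j \<in> lin_span (A ` {1..N}) H"
    using add_closedD(4)[OF cl 1 lin_span_mult[OF r(3) TiH(2)]] by simp
qed

end

section \<open>Exchange rules and commutators in the presented algebra\<close>

locale cyc_alg = X: hecke_family N T t t' X + Y: hecke_family N T t t' Y
    + D: hecke_family N "hecke.Ti T t t'" t' t Dg
  for N and T :: "nat \<Rightarrow> 'r::ring_1" and t t' and X Y Dg :: "nat \<Rightarrow> 'r" +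
  fixes Yi :: "nat \<Rightarrow> 'r" and q q' :: 'r and Z :: "nat \<Rightarrow> 'r" and l :: nat and K :: "'r set" and yinv :: bool
  assumes N: "1 \<le> N"
    and K: "scalar_set K" "t \<in> K" "t' \<in> K" "q \<in> K" "q' \<in> K" "\<And>r. r \<in> {1..l} \<Longrightarrow> Z r \<in> K"
    and q_inverse: "q' * q = 1"
    and XX: "i \<in> {1..N} \<Longrightarrow> j \<in> {1..N} \<Longrightarrow> X i * X j = X j * X i"
    and YY: "i \<in> {1..N} \<Longrightarrow> j \<in> {1..N} \<Longrightarrow> Y i * Y j = Y j * Y i"
    and DD: "i \<in> {1..N} \<Longrightarrow> j \<in> {1..N} \<Longrightarrow> Dg i * Dg j = Dg j * Dg i"
    and Y1_X: "2 \<le> j \<Longrightarrow> j \<le> N \<Longrightarrow> Y 1 * X j = X.down 2 j * (X.Ti 1 * X.Ti 1) * X.upi 2 j * X j * Y 1"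
    and Y1_X1: "Y 1 * X 1 = q * X 1 * (X.up 1 N * X.down 1 N) * Y 1"
    and Y1_D: "2 \<le> j \<Longrightarrow> j \<le> N \<Longrightarrow> Dg j * (X.down 2 j * (T 1 * T 1) * X.upi 2 j) * Y 1 = Y 1 * Dg j"
    and D1_Y1: "Dg 1 * Y 1 = q * (X.up 1 N * X.down 1 N) * Y 1 * Dg 1"
    and X_YN: "i \<in> {1..<N} \<Longrightarrow> X i * Y N = Y N * X i * (X.downi (Suc i) N * (T i * T i) * X.up (Suc i) N)"
    and YN_XN: "Y N * (X.downi 1 N * X.upi 1 N) * X N = q * X N * Y N"
    and D_YN: "i \<in> {1..<N} \<Longrightarrow> Dg i * Y N = Y N * (X.downi (Suc i) N * (X.Ti i * X.Ti i) * X.up (Suc i) N) * Dg i"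
    and DN_YN: "Dg N * Y N * (X.downi 1 N * X.upi 1 N) = q * Y N * Dg N"
    and X1_D1: "X 1 * Dg 1 = zprod Z (Y 1) 1 l"
    and D1_X1: "Dg 1 * X 1 = zprod Z (q * (X.up 1 N * X.down 1 N) * Y 1) 1 l"
    and D1_X2: "2 \<le> N \<Longrightarrow> Dg 1 * X 2 - X 2 * Dg 1
        = (t' - t) * (\<Sum>r = 1..l. zprod Z (q * (X.up 1 N * X.down 1 N) * Y 1) 1 (r - 1) * (Y 2 * (X.Ti 1 * X.Ti 1))
            * zprod Z (Y 2 * (X.Ti 1 * X.Ti 1)) (Suc r) l * T 1)"
    and Y_Yi: "yinv \<Longrightarrow> i \<in> {1..N} \<Longrightarrow> Y i * Yi i = 1" and Yi_Y: "yinv \<Longrightarrow> i \<in> {1..N} \<Longrightarrow> Yi i * Y i = 1"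
begin

definition "hecke_gens = K \<union> T ` {1..<N}"
text \<open>Y_1 yields all Y_i, and Y_N^{-1} all Y_i^{-1}, by multiplication with the T_i. The
  inverse is taken at N because the relations of Y_N invert to rules that end in Y_N^{-1} and have
  their Hecke factor next to X_i or D_i. In Y_1 X_j = g X_j Y_1 the Hecke factor g would be caught
  between Y_1^{-1} and X_j.\<close>

definition "aff_gens = hecke_gens \<union> {Y 1} \<union> (if yinv then {Yi N} else {})"

abbreviation "HH \<equiv> subring_gen hecke_gens"
abbreviation "AA \<equiv> subring_gen aff_gens"

lemma HH_AA: "HH \<subseteq> AA"
  by (rule subring_gen_mono) (auto simp: aff_gens_def intro: subring_gen.gen)

lemma K_HH: "k \<in> K \<Longrightarrow> k \<in> HH"
  by (auto simp: hecke_gens_def intro: subring_gen.gen)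

lemma T_HH: "i \<in> {1..<N} \<Longrightarrow> T i \<in> HH"
  by (auto simp: hecke_gens_def intro: subring_gen.gen)

lemma Ti_HH: "i \<in> {1..<N} \<Longrightarrow> X.Ti i \<in> HH"
  unfolding X.Ti_def by (intro subring_gen.plus subring_gen_minus T_HH K_HH K)

lemma up_HH:
  assumes "1 \<le> a" "b \<le> N"
  shows "X.up a b \<in> HH" "X.down a b \<in> HH" "X.upi a b \<in> HH" "X.downi a b \<in> HH"
  unfolding X.up_def X.down_def X.upi_def X.downi_def
  by (rule subring_gen_prod; use assms in \<open>auto intro!: T_HH Ti_HH\<close>)+

lemma HH_AA': "x \<in> HH \<Longrightarrow> x \<in> AA"
  using HH_AA by blast

lemma Y1_AA: "Y 1 \<in> AA"
  by (auto simp: aff_gens_def intro: subring_gen.gen)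

lemma r1: "1 \<in> {1..N}" and rN: "N \<in> {1..N}"
  using N by simp_all

lemma Y_AA: "i \<in> {1..N} \<Longrightarrow> Y i \<in> AA"
  using Y.A_down_up[of 1 i] up_HH[of 1 i] HH_AA' Y1_AA by (auto intro: subring_gen.times)

lemma Yi_family: "yinv \<Longrightarrow> hecke_family N X.Ti t' t Yi"
  by (rule Y.inverse_family) (use Y_Yi Yi_Y in auto)

lemma Yi_AA:
  assumes yinv "i \<in> {1..N}" shows "Yi i \<in> AA"
proof -
  interpret F: hecke_family N X.Ti t' t Yi by (rule Yi_family[OF assms(1)])
  have "i \<le> N" "1 \<le> i" using assms by auto
  then show ?thesis
  proof (induction i rule: inc_induct)
    case base
    have "Yi N \<in> aff_gens" unfolding aff_gens_def using assms(1) by simp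
    then show ?case by (rule subring_gen.gen)
  next
    case (step i)
    then have i: "i \<in> {1..<N}" by auto
    have "Yi i = T i * Yi (Suc i) * T i"
      unfolding F.TAT[OF i, symmetric] by (simp add: mult.assoc X.T_Ti_l[OF i] X.Ti_T[OF i])
    then show ?case using step HH_AA' T_HH[OF i] by (auto intro: subring_gen.times)
  qed
qed

lemma scalar_closed: "add_closed K"
  using scalar_setD(1)[OF K(1)] .

lemma scalar_HH: "k \<in> K \<Longrightarrow> k * x = x * k"
  using scalar_setD(4)[OF K(1)] .

lemma HH_exchange:
  assumes "hecke_family N T t t' A \<or> hecke_family N X.Ti t' t A" "h \<in> HH" "j \<in> {1..N}"
  shows "h * A j \<in> lin_span (A ` {1..N}) HH"
proof (rule subring_gen_exchange[OF _ assms(2)])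
  fix g a assume g: "g \<in> hecke_gens" and "a \<in> A ` {1..N}"
  then obtain i where a: "a = A i" and i: "i \<in> {1..N}" by auto
  note H = subring_gen_closed[of hecke_gens] subring_gen.one
  show "g * a \<in> lin_span (A ` {1..N}) (subring_gen hecke_gens)"
  proof (cases "g \<in> K")
    case True
    then show ?thesis
      unfolding scalar_HH[OF True, of a] using lin_span_mult[of a "A ` {1..N}" g HH] a i K_HH by simp
  next
    case False
    then obtain k where k: "g = T k" "k \<in> {1..<N}" using g by (auto simp: hecke_gens_def)
    from assms(1) show ?thesis
    proof
      assume "hecke_family N T t t' A"
      then interpret F: hecke_family N T t t' A .
      show ?thesis unfolding a k(1) by (rule F.T_A_span[OF k(2) i H T_HH[OF k(2)] K_HH[OF K(2)] K_HH[OF K(3)]])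
    next
      assume "hecke_family N X.Ti t' t A"
      then interpret F: hecke_family N X.Ti t' t A .
      have "D.Ti k * A i \<in> lin_span (A ` {1..N}) HH"
        by (rule F.T_A_span[OF k(2) i H Ti_HH[OF k(2)] K_HH[OF K(3)] K_HH[OF K(2)]])
      then show ?thesis unfolding a k(1) X.inverse_Ti .
    qed
  qed
qed (use assms(3) in simp)

lemma span_HH_AA: "lin_span M HH \<subseteq> lin_span M AA"
  by (rule lin_span_mono[OF order_refl HH_AA])

lemma span_HH_times:
  assumes "z \<in> lin_span M HH" "y \<in> AA" shows "z * y \<in> lin_span M AA"
  by (rule lin_span_right[OF _ assms(1)]) (use assms(2) HH_AA' in \<open>auto intro: subring_gen.times\<close>)

lemma K_inv: "x * (q * y) = q * (x * y)" "x * (q' * y) = q' * (x * y)"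
  using scalar_HH[OF K(4), of x] scalar_HH[OF K(5), of x] by (simp_all flip: mult.assoc)

lemma q'q: "q' * (q * x) = x"
  using q_inverse by (simp flip: mult.assoc)

text \<open>By \<open>subring_gen_exchange\<close> only Hecke generators, Y_1 and Y_N^{-1} have to
  be moved past a letter. Each relation leaves at most a Hecke element in front of the letter, and
  \<open>HH_exchange\<close> moves that one to the right.\<close>

lemma AA_X:
  assumes "y \<in> AA" "j \<in> {1..N}" shows "y * X j \<in> lin_span (X ` {1..N}) AA"
proof (rule subring_gen_exchange[OF _ assms(1)])
  fix g a assume g: "g \<in> aff_gens" and "a \<in> X ` {1..N}"
  then obtain i where a: "a = X i" and i: "i \<in> {1..N}" by auto
  have HX: "h * X j \<in> lin_span (X ` {1..N}) HH" if "h \<in> HH" "j \<in> {1..N}" for h j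
    using HH_exchange[of X h j] X.hecke_family_axioms that by simp
  consider "g \<in> hecke_gens" | "g = Y 1" | "yinv" "g = Yi N"
    using g by (auto simp: aff_gens_def split: if_splits)
  then show "g * a \<in> lin_span (X ` {1..N}) (subring_gen aff_gens)"
  proof cases
    case 1
    then show ?thesis using HX[of g i] i a span_HH_AA by (auto intro: subring_gen.gen)
  next
    case 2
    show ?thesis
    proof (cases "i = 1")
      case True
      have "Y 1 * X 1 = X 1 * (q * (X.up 1 N * X.down 1 N) * Y 1)"
        unfolding Y1_X1 by (simp only: mult.assoc K_inv(1)[of "X 1"])
      moreover have "q * (X.up 1 N * X.down 1 N) * Y 1 \<in> AA"
        by (intro subring_gen.times Y1_AA HH_AA' K_HH K up_HH) auto
      ultimately show ?thesis using lin_span_mult[of "X 1" "X ` {1..N}"] r1 2 a True by auto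
    next
      case False
      then have "Y 1 * X i = (X.down 2 i * (X.Ti 1 * X.Ti 1) * X.upi 2 i * X i) * Y 1"
        using Y1_X[of i] i by simp
      moreover have "X.down 2 i * (X.Ti 1 * X.Ti 1) * X.upi 2 i \<in> HH"
        by (intro subring_gen.times Ti_HH up_HH) (use i False in auto)
      ultimately show ?thesis using span_HH_times[OF HX Y1_AA] i 2 a by simp
    qed
  next
    case 3
    note inv = Y_Yi[OF 3(1) rN] Yi_Y[OF 3(1) rN]
    have invl: "Y N * (Yi N * x) = x" "Yi N * (Y N * x) = x" for x
      using inv by (simp_all flip: mult.assoc)
    have YiN: "Yi N \<in> AA" by (rule Yi_AA[OF 3(1) rN])
    show ?thesis
    proof (cases "i = N")
      case True
      have "q * (Yi N * X N) = Yi N * (q * X N * Y N) * Yi N"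
        by (simp add: mult.assoc K_inv(1)[of "Yi N"] inv)
      then have "Yi N * X N = q' * (Yi N * (q * X N * Y N)) * Yi N"
        using q'q[of "Yi N * X N"] by (simp add: mult.assoc)
      also have "\<dots> = (q' * (X.downi 1 N * X.upi 1 N)) * X N * Yi N"
        unfolding YN_XN[symmetric] by (simp add: mult.assoc invl)
      finally have "Yi N * X N = (q' * (X.downi 1 N * X.upi 1 N)) * X N * Yi N" .
      moreover have "q' * (X.downi 1 N * X.upi 1 N) \<in> HH"
        by (intro subring_gen.times K_HH K up_HH) auto
      ultimately show ?thesis using span_HH_times[OF HX YiN] rN 3 a True by simp
    next
      case False
      let ?C = "X.downi (Suc i) N * (T i * T i) * X.up (Suc i) N"
      have i': "i \<in> {1..<N}" using False i by auto
      have "Yi N * X i = Yi N * (X i * Y N) * Yi N" by (simp add: mult.assoc inv)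
      also have "\<dots> = X i * (?C * Yi N)" unfolding X_YN[OF i'] by (simp add: mult.assoc invl)
      finally have "Yi N * X i = X i * (?C * Yi N)" .
      moreover have "?C * Yi N \<in> AA"
        by (intro subring_gen.times YiN HH_AA' T_HH up_HH) (use i' in auto)
      ultimately show ?thesis using lin_span_mult[of "X i" "X ` {1..N}"] i 3 a by auto
    qed
  qed
qed (use assms(2) in simp)

lemma AA_D:
  assumes "y \<in> AA" "j \<in> {1..N}" shows "y * Dg j \<in> lin_span (Dg ` {1..N}) AA"
proof (rule subring_gen_exchange[OF _ assms(1)])
  fix g a assume g: "g \<in> aff_gens" and "a \<in> Dg ` {1..N}"
  then obtain i where a: "a = Dg i" and i: "i \<in> {1..N}" by auto
  have HX: "h * Dg j \<in> lin_span (Dg ` {1..N}) HH" if "h \<in> HH" "j \<in> {1..N}" for h j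
    using HH_exchange[of Dg h j] D.hecke_family_axioms that by simp
  consider "g \<in> hecke_gens" | "g = Y 1" | "yinv" "g = Yi N"
    using g by (auto simp: aff_gens_def split: if_splits)
  then show "g * a \<in> lin_span (Dg ` {1..N}) (subring_gen aff_gens)"
  proof cases
    case 1
    then show ?thesis using HX[of g i] i a span_HH_AA by (auto intro: subring_gen.gen)
  next
    case 2
    show ?thesis
    proof (cases "i = 1")
      case True
      let ?L = "X.upi 1 N * X.downi 1 N"
      have "X.downi 1 N * X.up 1 N = 1" "X.upi 1 N * X.down 1 N = 1"
        using X.up_inverse[of 1 N] by auto
      then have "?L * (X.up 1 N * X.down 1 N) = 1"
        by (simp add: mult.assoc) (simp flip: mult.assoc)
      then have L: "?L * ((X.up 1 N * X.down 1 N) * x) = x" for x by (simp flip: mult.assoc)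
      have "(q' * ?L) * Dg 1 * Y 1 = q' * (?L * (q * (X.up 1 N * X.down 1 N) * Y 1 * Dg 1))"
        unfolding D1_Y1[symmetric] by (simp only: mult.assoc)
      also have "\<dots> = q' * (q * (?L * ((X.up 1 N * X.down 1 N) * (Y 1 * Dg 1))))"
        by (simp only: mult.assoc K_inv(1)[of ?L] K_inv(1)[of "X.upi 1 N"] K_inv(1)[of "X.downi 1 N"])
      also have "\<dots> = Y 1 * Dg 1" unfolding L q'q ..
      finally have "Y 1 * Dg 1 = (q' * ?L) * Dg 1 * Y 1" ..
      moreover have "q' * ?L \<in> HH"
        by (intro subring_gen.times K_HH K up_HH) auto
      ultimately show ?thesis using span_HH_times[OF HX Y1_AA] r1 2 a True by simp
    next
      case False
      then have "Y 1 * Dg i = Dg i * ((X.down 2 i * (T 1 * T 1) * X.upi 2 i) * Y 1)"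
        using Y1_D[of i] i by (simp add: mult.assoc)
      moreover have "(X.down 2 i * (T 1 * T 1) * X.upi 2 i) * Y 1 \<in> AA"
        by (intro subring_gen.times Y1_AA HH_AA' T_HH up_HH) (use i False in auto)
      ultimately show ?thesis using lin_span_mult[of "Dg i" "Dg ` {1..N}"] i 2 a by auto
    qed
  next
    case 3
    note inv = Y_Yi[OF 3(1) rN] Yi_Y[OF 3(1) rN]
    have invl: "Y N * (Yi N * x) = x" "Yi N * (Y N * x) = x" for x
      using inv by (simp_all flip: mult.assoc)
    have YiN: "Yi N \<in> AA" by (rule Yi_AA[OF 3(1) rN])
    show ?thesis
    proof (cases "i = N")
      case True
      let ?L = "X.downi 1 N * X.upi 1 N" and ?M = "X.down 1 N * X.up 1 N"
      have "X.downi 1 N * X.up 1 N = 1" "X.upi 1 N * X.down 1 N = 1"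
        using X.up_inverse[of 1 N] by auto
      then have LM: "?L * ?M = 1"
        by (simp add: mult.assoc) (simp flip: mult.assoc)
      have "Dg N * (q * ?M * Yi N) = Yi N * (q * Y N * Dg N) * ?M * Yi N"
        by (simp add: mult.assoc invl K_inv(1)[of "Yi N"] K_inv(1)[of "Dg N"])
      also have "\<dots> = Yi N * Dg N * Y N * (?L * ?M) * Yi N"
        unfolding DN_YN[symmetric] by (simp only: mult.assoc)
      also have "\<dots> = Yi N * Dg N" unfolding LM by (simp add: mult.assoc inv)
      finally have "Yi N * Dg N = Dg N * (q * ?M * Yi N)" ..
      moreover have "q * ?M * Yi N \<in> AA"
        by (intro subring_gen.times YiN HH_AA' K_HH K up_HH) auto
      ultimately show ?thesis using lin_span_mult[of "Dg N" "Dg ` {1..N}"] rN 3 a True by auto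
    next
      case False
      let ?C = "X.downi (Suc i) N * (X.Ti i * X.Ti i) * X.up (Suc i) N"
      have i': "i \<in> {1..<N}" using False i by auto
      have "Yi N * Dg i = Yi N * (Y N * ?C * Dg i) * Yi N \<Longrightarrow> Yi N * Dg i = ?C * Dg i * Yi N"
        by (simp add: mult.assoc invl)
      moreover have "Yi N * (Dg i * Y N) * Yi N = Yi N * Dg i" by (simp add: mult.assoc inv)
      ultimately have "Yi N * Dg i = ?C * Dg i * Yi N" unfolding D_YN[OF i'] by simp
      moreover have "?C \<in> HH"
        by (intro subring_gen.times Ti_HH up_HH) (use i' in auto)
      ultimately show ?thesis using span_HH_times[OF HX YiN] i 3 a by simp
    qed
  qed
qed (use assms(2) in simp)

lemma zprod_AA: "y \<in> AA \<Longrightarrow> 1 \<le> m \<Longrightarrow> n \<le> l \<Longrightarrow> zprod Z y m n \<in> AA"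
  unfolding zprod_def
  by (rule subring_gen_prod) (auto simp del: upt_Suc intro!: subring_gen_minus HH_AA'[OF K_HH[OF K(6)]])

lemma loop_Y_AA: "q * (X.up 1 N * X.down 1 N) * Y 1 \<in> AA"
  by (intro subring_gen.times Y1_AA HH_AA' K_HH K up_HH) auto

text \<open>For i = 1 these are the products of the Y_1 - Z_r and of the q J_N Y_1 - Z_r.
  Conjugation by T_i carries X_i D_i to X_{i+1} D_{i+1}, and conjugation by T_i^{-1} does the same
  for D_i X_i.\<close>

lemma X_D_AA:
  assumes "i \<in> {1..N}"
  shows "X i * Dg i \<in> AA" and "Dg i * X i \<in> AA"
proof -
  have "1 \<le> i" "i \<le> N" using assms by auto
  then have "X i * Dg i \<in> AA \<and> Dg i * X i \<in> AA"
  proof (induction i rule: dec_induct)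
    case base
    show ?case unfolding X1_D1 D1_X1 using zprod_AA Y1_AA loop_Y_AA by simp
  next
    case (step i)
    then have i: "i \<in> {1..<N}" by auto
    have "X (Suc i) * Dg (Suc i) = T i * (X i * Dg i) * X.Ti i"
      "Dg (Suc i) * X (Suc i) = X.Ti i * (Dg i * X i) * T i"
      unfolding X.TAT[OF i, symmetric] D.TAT[OF i, symmetric]
      by (simp_all add: mult.assoc X.T_Ti_l[OF i] X.Ti_T_l[OF i])
    then show ?case using step T_HH[OF i] Ti_HH[OF i] HH_AA' by (auto intro!: subring_gen.times)
  qed
  then show "X i * Dg i \<in> AA" "Dg i * X i \<in> AA" by auto
qed

lemma T_Dg: "i \<in> {1..<N} \<Longrightarrow> j \<in> {1..N} \<Longrightarrow> j \<noteq> i \<Longrightarrow> j \<noteq> Suc i \<Longrightarrow> T i * Dg j = Dg j * T i"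
  using X.commute_inverse D.TA by blast

lemma D_X_conj:
  assumes "k \<in> {1..<N}" "Dg k * X j - X j * Dg k \<in> AA" "j \<in> {1..N}" "j \<noteq> k" "j \<noteq> Suc k"
  shows "Dg (Suc k) * X j - X j * Dg (Suc k) \<in> AA"
proof -
  have c: "X.Ti k * X j = X j * X.Ti k" by (rule X.commute_Ti, rule X.TA) (use assms in auto)
  have "Dg (Suc k) * X j - X j * Dg (Suc k) = X.Ti k * (Dg k * X j - X j * Dg k) * X.Ti k"
    unfolding D.TAT[OF assms(1), symmetric]
    by (simp add: right_diff_distrib left_diff_distrib mult.assoc c) (simp add: c flip: mult.assoc)
  then show ?thesis using assms Ti_HH[OF assms(1)] HH_AA' by (auto intro!: subring_gen.times)
qed

text \<open>All terms of the relation for [D_1, X_2] lie in \<open>AA\<close>. The T_j with j >= 2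
  then raise the index of X while fixing D_1, and afterwards the T_i^{-1} raise the index of D while
  fixing X_j.\<close>

lemma D_X_less:
  assumes "1 \<le> i" "i < j" "j \<le> N"
  shows "Dg i * X j - X j * Dg i \<in> AA"
proof -
  have first: "Dg 1 * X j - X j * Dg 1 \<in> AA" if "2 \<le> j" "j \<le> N" for j
    using that
  proof (induction j rule: dec_induct)
    case base
    have i: "1 \<in> {1..<N}" using base by auto
    have YT: "Y 2 * (X.Ti 1 * X.Ti 1) \<in> AA"
      using Y_AA[of 2] HH_AA'[OF Ti_HH[OF i]] base by (auto intro: subring_gen.times)
    have c: "t' - t \<in> AA"
      using subring_gen_minus HH_AA'[OF K_HH[OF K(3)]] HH_AA'[OF K_HH[OF K(2)]] by blast
    have "zprod Z (q * (X.up 1 N * X.down 1 N) * Y 1) 1 (r - 1) * (Y 2 * (X.Ti 1 * X.Ti 1))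
        * zprod Z (Y 2 * (X.Ti 1 * X.Ti 1)) (Suc r) l * T 1 \<in> AA" if "r \<in> {1..l}" for r
    proof -
      have "zprod Z (q * (X.up 1 N * X.down 1 N) * Y 1) 1 (r - 1) \<in> AA"
        "zprod Z (Y 2 * (X.Ti 1 * X.Ti 1)) (Suc r) l \<in> AA"
        using that by (auto intro: zprod_AA loop_Y_AA YT)
      then show ?thesis using YT HH_AA'[OF T_HH[OF i]] by (auto intro: subring_gen.times)
    qed
    then show ?case unfolding D1_X2[OF base]
      by (intro subring_gen.times[OF c] subring_gen_sum) auto
  next
    case (step j)
    then have j: "j \<in> {1..<N}" by auto
    have c: "T j * Dg 1 = Dg 1 * T j" by (rule T_Dg) (use step in auto)
    have "Dg 1 * X (Suc j) - X (Suc j) * Dg 1 = T j * (Dg 1 * X j - X j * Dg 1) * T j"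
      unfolding X.TAT[OF j, symmetric]
      by (simp add: right_diff_distrib left_diff_distrib mult.assoc c) (simp add: c flip: mult.assoc)
    then show ?case using step T_HH[OF j] HH_AA' by (auto intro!: subring_gen.times)
  qed
  from assms show ?thesis
  proof (induction i rule: dec_induct)
    case base then show ?case using first[of j] by simp
  next
    case (step i)
    then show ?case by (intro D_X_conj) auto
  qed
qed

text \<open>Here T_i affects both letters. Both D_{i+1} X_i and X_i D_{i+1} are compared with the
  commutator of D_i and X_{i+1} multiplied by T_i^{-1} on both sides. The quadratic relation
  produces correction terms in D_{i+1} X_{i+1} and X_i D_i, which lie in \<open>AA\<close> by
  \<open>X_D_AA\<close>.\<close>

lemma D_X_greater_Suc:
  assumes i: "i \<in> {1..<N}"
  shows "Dg (Suc i) * X i - X i * Dg (Suc i) \<in> AA"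
proof -
  let ?T = "T i" and ?T' = "X.Ti i" and ?c = "t - t'"
  have 1: "Dg i * X (Suc i) - X (Suc i) * Dg i \<in> AA" by (rule D_X_less) (use i in auto)
  have tc: "x * ?c = ?c * x" for x
    using X.t_central[of x] X.t'_central[of x] by (simp add: algebra_simps)
  have tcl: "x * (?c * y) = ?c * (x * y)" for x y
    using tc[of x] by (simp flip: mult.assoc)
  have ex: "a * (1 - ?c * b) * w = a * w - ?c * (a * b * w)" "a * (1 + ?c * b) * w = a * w + ?c * (a * b * w)" for a b w
    by (simp_all only: right_diff_distrib[of a] left_diff_distrib[of a] distrib_left[of a] distrib_right[of a] mult_1_right mult.assoc tcl)
  have X: "X i = ?T' * X (Suc i) * ?T'"
    unfolding X.TAT[OF i, symmetric] by (simp add: mult.assoc X.T_Ti[OF i] X.Ti_T_l[OF i])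
  have e: "?T - ?c = ?T'" by (simp add: X.Ti_def)
  have "?T' * ?T' = (?T - ?c) * ?T'" by (simp only: e)
  then have T'T': "?T' * ?T' = 1 - ?c * ?T'"
    by (simp only: left_diff_distrib X.T_Ti[OF i])
  have T_eq: "?T' * X (Suc i) = X i * ?T" "Dg i * ?T' = ?T * Dg (Suc i)"
    using X.A_T[OF i] D.A_T[OF i] unfolding X.inverse_Ti by simp_all
  have "Dg (Suc i) * X i = (?T' * Dg i) * (?T' * ?T') * (X (Suc i) * ?T')"
    unfolding D.TAT[OF i, symmetric] X by (simp only: mult.assoc)
  also have "\<dots> = ?T' * (Dg i * X (Suc i)) * ?T' - ?c * (?T' * Dg i * ?T' * X (Suc i) * ?T')"
    unfolding T'T' ex by (simp only: mult.assoc)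
  finally have A: "Dg (Suc i) * X i = ?T' * (Dg i * X (Suc i)) * ?T' - ?c * (?T' * Dg i * ?T' * X (Suc i) * ?T')" .
  have B: "?T' * Dg i * ?T' * X (Suc i) * ?T' \<in> AA"
    unfolding D.TAT[OF i]
    using X_D_AA[of "Suc i"] Ti_HH[OF i] HH_AA' i by (auto intro!: subring_gen.times)
  have TT: "?T * ?T = 1 + ?c * ?T" by (rule X.T_square[OF i])
  have "?T' * (X (Suc i) * Dg i) * ?T' = X i * (?T * ?T) * Dg (Suc i)"
    unfolding T_eq mult.assoc[of _ "Dg i"] by (simp only: mult.assoc[symmetric] T_eq(1)) (simp only: mult.assoc T_eq(2))
  also have "\<dots> = X i * Dg (Suc i) + ?c * (X i * (?T * Dg (Suc i)))"
    unfolding TT ex by (simp only: mult.assoc)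
  also have "X i * (?T * Dg (Suc i)) = X i * Dg i * ?T'" unfolding T_eq(2)[symmetric] by (simp only: mult.assoc)
  finally have C: "X i * Dg (Suc i) = ?T' * (X (Suc i) * Dg i) * ?T' - ?c * (X i * Dg i * ?T')" by simp
  have "Dg (Suc i) * X i - X i * Dg (Suc i) = ?T' * (Dg i * X (Suc i) - X (Suc i) * Dg i) * ?T'
    - ?c * (?T' * Dg i * ?T' * X (Suc i) * ?T') + ?c * (X i * Dg i * ?T')"
    unfolding A C by (simp add: right_diff_distrib left_diff_distrib)
  moreover have "X i * Dg i \<in> AA" using X_D_AA i by simp
  moreover have "?T' \<in> AA" "?c \<in> AA"
    using HH_AA'[OF Ti_HH[OF i]] subring_gen_minus[OF HH_AA'[OF K_HH[OF K(2)]] HH_AA'[OF K_HH[OF K(3)]]]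
    by blast+
  ultimately show ?thesis using 1 B
    by (auto intro!: subring_gen.plus subring_gen_minus subring_gen.times)
qed

lemma D_X_commutator:
  assumes "i \<in> {1..N}" "j \<in> {1..N}" "i \<noteq> j"
  shows "Dg i * X j - X j * Dg i \<in> AA"
proof (cases "i < j")
  case True
  then show ?thesis using D_X_less assms by simp
next
  case False
  then have "Suc j \<le> i" "i \<le> N" "1 \<le> j" using assms by auto
  then show ?thesis
  proof (induction i rule: dec_induct)
    case base
    show ?case by (rule D_X_greater_Suc) (use base in auto)
  next
    case (step i)
    then show ?case by (intro D_X_conj) auto
  qed
qed

end

subsection \<open>Ordered monomials\<close>

lemma prod_list_cancel_inverse:
  fixes A B :: "'i \<Rightarrow> 'r::monoid_mult"
  assumes "\<And>i j. i \<in> I \<Longrightarrow> j \<in> I \<Longrightarrow> A i * A j = A j * A i"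
    and B: "\<And>i j. i \<in> I \<Longrightarrow> j \<in> I \<Longrightarrow> B i * B j = B j * B i"
    and AB: "\<And>i. i \<in> I \<Longrightarrow> A i * B i = 1"
    and comm: "\<And>i j. i \<in> I \<Longrightarrow> j \<in> I \<Longrightarrow> B i * A j = A j * B i"
    and i: "i \<in> I" and xs: "set xs \<subseteq> I" "set ys \<subseteq> I"
  shows "i \<notin> set xs \<Longrightarrow> B i * (prod_list (map A xs) * prod_list (map B ys))
        = prod_list (map A xs) * prod_list (map B (i # ys))"
    and "i \<in> set xs \<Longrightarrow> B i * (prod_list (map A xs) * prod_list (map B ys))
        = prod_list (map A (remove1 i xs)) * prod_list (map B ys)"
    and "i \<in> set ys \<Longrightarrow> A i * (prod_list (map A xs) * prod_list (map B ys))
        = prod_list (map A xs) * prod_list (map B (remove1 i ys))"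
proof -
  have BA: "B i * prod_list (map A xs) = prod_list (map A xs) * B i"
    by (rule prod_list_commute) (use comm i xs in auto)
  then show "B i * (prod_list (map A xs) * prod_list (map B ys))
        = prod_list (map A xs) * prod_list (map B (i # ys))"
    by (simp flip: mult.assoc)
  show "B i * (prod_list (map A xs) * prod_list (map B ys))
        = prod_list (map A (remove1 i xs)) * prod_list (map B ys)" if "i \<in> set xs"
  proof -
    have "prod_list (map A xs) = A i * prod_list (map A (remove1 i xs))"
      by (rule prod_list_remove1[where I = I]) (use assms that in auto)
    then have "B i * prod_list (map A xs) = (B i * A i) * prod_list (map A (remove1 i xs))"
      by (simp add: mult.assoc)
    then show ?thesis using comm[OF i i] AB[OF i] by (simp flip: mult.assoc)
  qed
  show "A i * (prod_list (map A xs) * prod_list (map B ys))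
        = prod_list (map A xs) * prod_list (map B (remove1 i ys))" if "i \<in> set ys"
  proof -
    have "prod_list (map B ys) = B i * prod_list (map B (remove1 i ys))"
      by (rule prod_list_remove1[where I = I]) (use assms that in auto)
    moreover have "A i * prod_list (map A xs) = prod_list (map A xs) * A i"
      by (rule prod_list_commute) (use assms(1) i xs in auto)
    ultimately have "A i * (prod_list (map A xs) * prod_list (map B ys))
      = prod_list (map A xs) * (A i * B i) * prod_list (map B (remove1 i ys))"
      by (simp add: mult.assoc) (simp flip: mult.assoc)
    then show ?thesis using AB[OF i] by simp
  qed
qed

text \<open>
  A pair of disjoint sorted lists stands for a monomial in two commuting families: \<open>(xs, ds)\<close> for a
  product of \<open>X\<close>'s and \<open>D\<close>'s, \<open>(ys, zs)\<close> for a Laurent monomial in the \<open>Y\<close>'s.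
\<close>

definition disjoint_pairs :: "nat \<Rightarrow> (nat list \<times> nat list) set" where
  "disjoint_pairs N = {(xs, ds). sorted xs \<and> sorted ds \<and> set xs \<subseteq> {1..N} \<and> set ds \<subseteq> {1..N} \<and> set xs \<inter> set ds = {}}"

definition pair_prod :: "(nat \<Rightarrow> 'r::monoid_mult) \<Rightarrow> (nat \<Rightarrow> 'r) \<Rightarrow> nat list \<times> nat list \<Rightarrow> 'r" where
  "pair_prod A B p = prod_list (map A (fst p)) * prod_list (map B (snd p))"

context cyc_alg
begin

definition "YP = disjoint_pairs N \<inter> (if yinv then UNIV else UNIV \<times> {[]})"

lemma YP_inv: "yinv \<Longrightarrow> YP = disjoint_pairs N"
  unfolding YP_def by simp

lemma pair_prod_sort:
  assumes "\<And>i j. i \<in> {1..N} \<Longrightarrow> j \<in> {1..N} \<Longrightarrow> A i * A j = A j * A i"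
    and "\<And>i j. i \<in> {1..N} \<Longrightarrow> j \<in> {1..N} \<Longrightarrow> B i * B j = B j * B i"
    and "set xs \<subseteq> {1..N}" "set ds \<subseteq> {1..N}"
  shows "prod_list (map A xs) * prod_list (map B ds) = pair_prod A B (sort xs, sort ds)"
proof -
  have "prod_list (map A xs) = prod_list (map A (sort xs))"
    by (rule prod_list_permute[of "{1..N}"]) (use assms in auto)
  moreover have "prod_list (map B ds) = prod_list (map B (sort ds))"
    by (rule prod_list_permute[of "{1..N}"]) (use assms in auto)
  ultimately show ?thesis by (simp add: pair_prod_def)
qed

lemma Yi_commute:
  assumes yinv "i \<in> {1..N}" "j \<in> {1..N}"
  shows "Yi i * Y j = Y j * Yi i" "Yi i * Yi j = Yi j * Yi i"
  using inverse_commute[OF YY[OF assms(2,3)] Y_Yi Yi_Y] inverse_commute2[OF YY[OF assms(2,3)] Y_Yi Yi_Y Y_Yi Yi_Y] assms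
  by auto

lemma scalar_HH': "k \<in> K \<Longrightarrow> - k \<in> K"
  by (rule add_closedD(3)[OF scalar_closed])

text \<open>The span contains 1, so it only has to be stable under the generators of
  \<open>AA\<close>. Y_i and Y_i^{-1} act on the monomials by cancelling or inserting a letter; a
  Hecke element is moved through a monomial one letter at a time.\<close>

lemma AA_span: "AA \<subseteq> lin_span (pair_prod Y Yi ` YP) HH"
proof
  let ?S = "lin_span (pair_prod Y Yi ` YP) HH"
  have cl: "add_closed ?S" by (rule lin_span_closed) (rule subring_gen.uminus)
  have mult_mono: "g * z \<in> ?S" if "\<And>p. p \<in> YP \<Longrightarrow> g * pair_prod Y Yi p \<in> pair_prod Y Yi ` YP" "z \<in> ?S" for g z
  proof (rule lin_span_least[OF cl _ that(2)])
    fix m w assume "m \<in> pair_prod Y Yi ` YP" "w \<in> HH"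
    then have "(g * m) * w \<in> ?S" using that(1) by (intro lin_span_mult) auto
    then show "g * (m * w) \<in> ?S" by (simp add: mult.assoc)
  qed
  have Y_stable: "Y i * z \<in> ?S" if i: "i \<in> {1..N}" and z: "z \<in> ?S" for i z
  proof (rule mult_mono[OF _ z])
    fix p assume p: "p \<in> YP"
    obtain ys zs where pe: "p = (ys, zs)" by (cases p)
    have r: "set ys \<subseteq> {1..N}" "set zs \<subseteq> {1..N}" "set ys \<inter> set zs = {}" "sorted zs"
      using p by (auto simp: YP_def disjoint_pairs_def pe)
    show "Y i * pair_prod Y Yi p \<in> pair_prod Y Yi ` YP"
    proof (cases "i \<in> set zs")
      case False
      show ?thesis
      proof -
        have "prod_list (map Y (i # ys)) = prod_list (map Y (sort (i # ys)))"
          by (rule prod_list_permute[of "{1..N}"]) (use YY r i in auto)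
        then have "Y i * pair_prod Y Yi p = pair_prod Y Yi (sort (i # ys), zs)"
          by (simp add: pe pair_prod_def mult.assoc del: sort_key_simps) (simp flip: mult.assoc)
        moreover have "(sort (i # ys), zs) \<in> YP"
          using p False i by (auto simp: YP_def disjoint_pairs_def pe split: if_splits simp del: sort_key_simps)
        ultimately show ?thesis by blast
      qed
    next
      case True
      then have yinv using p by (auto simp: YP_def pe split: if_splits)
      note c = Yi_commute[OF this] Y_Yi[OF this]
      have "Y i * pair_prod Y Yi p = pair_prod Y Yi (ys, remove1 i zs)"
        unfolding pair_prod_def pe fst_conv snd_conv
        by (rule prod_list_cancel_inverse(3)[of "{1..N}"]) (use c YY i r True in auto)
      moreover have "(ys, remove1 i zs) \<in> YP"
        using p unfolding YP_inv[OF \<open>yinv\<close>] by (auto simp: disjoint_pairs_def pe sorted_remove1 dest: notin_set_remove1 set_remove1_subset[THEN subsetD])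
      ultimately show ?thesis by blast
    qed
  qed
  have Yi_stable: "Yi i * z \<in> ?S" if yinv and i: "i \<in> {1..N}" and z: "z \<in> ?S" for i z
  proof (rule mult_mono[OF _ z])
    fix p assume p: "p \<in> YP"
    note c = Yi_commute[OF \<open>yinv\<close>] Y_Yi[OF \<open>yinv\<close>]
    obtain ys zs where pe: "p = (ys, zs)" by (cases p)
    have r: "set ys \<subseteq> {1..N}" "set zs \<subseteq> {1..N}" "set ys \<inter> set zs = {}" "sorted zs" "sorted ys"
      using p by (auto simp: YP_def disjoint_pairs_def pe)
    show "Yi i * pair_prod Y Yi p \<in> pair_prod Y Yi ` YP"
    proof (cases "i \<in> set ys")
      case True
      have "Yi i * pair_prod Y Yi p = pair_prod Y Yi (remove1 i ys, zs)"
        unfolding pair_prod_def pe fst_conv snd_conv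
        by (rule prod_list_cancel_inverse(2)[of "{1..N}"]) (use c YY i r True in auto)
      moreover have "(remove1 i ys, zs) \<in> YP"
        using p unfolding YP_inv[OF \<open>yinv\<close>] by (auto simp: disjoint_pairs_def pe sorted_remove1 dest: notin_set_remove1 set_remove1_subset[THEN subsetD])
      ultimately show ?thesis by blast
    next
      case False
      have "Yi i * pair_prod Y Yi p = prod_list (map Y ys) * prod_list (map Yi (i # zs))"
        unfolding pair_prod_def pe fst_conv snd_conv
        by (rule prod_list_cancel_inverse(1)[of "{1..N}"]) (use c YY i r False in auto)
      also have "\<dots> = pair_prod Y Yi (sort ys, sort (i # zs))"
        by (rule pair_prod_sort) (use c YY i r in auto)
      finally have "Yi i * pair_prod Y Yi p = pair_prod Y Yi (sort ys, sort (i # zs))" .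
      moreover have "(sort ys, sort (i # zs)) \<in> YP"
        using r i False unfolding YP_inv[OF \<open>yinv\<close>] by (auto simp: disjoint_pairs_def simp del: sort_key_simps)
      ultimately show ?thesis by blast
    qed
  qed
  have one: "([], []) \<in> YP" by (simp add: YP_def disjoint_pairs_def)
  \<comment> \<open>Induction step for moving \<open>h\<close> through a monomial: h A_j is a sum of
    products A_i h' with h' in \<open>HH\<close>; the rest \<open>m\<close> of the monomial absorbs
    h' by induction, and A_i preserves the span.\<close>
  have step: "h * (A j * m) \<in> ?S"
    if A: "hecke_family N T t t' A \<or> hecke_family N X.Ti t' t A" "\<And>i z. i \<in> {1..N} \<Longrightarrow> z \<in> ?S \<Longrightarrow> A i * z \<in> ?S"
      and m: "\<And>h. h \<in> HH \<Longrightarrow> h * m \<in> ?S" and "h \<in> HH" "j \<in> {1..N}" for A h j m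
  proof -
    have "h * A j \<in> lin_span (A ` {1..N}) HH" by (rule HH_exchange) (use that in auto)
    then have "(h * A j) * m \<in> ?S"
    proof (induction rule: lin_span_induct)
      case zero then show ?case using add_closedD(1)[OF cl] by simp
    next
      case (mult a w)
      then show ?case using A(2) m by (auto simp: mult.assoc)
    next
      case (plus x y)
      then show ?case using add_closedD(2)[OF cl] by (simp add: distrib_right)
    qed
    then show ?thesis by (simp add: mult.assoc)
  qed
  have HH_mono: "h * pair_prod Y Yi p \<in> ?S" if p: "p \<in> YP" and h: "h \<in> HH" for p h
  proof -
    obtain ys zs where pe: "p = (ys, zs)" by (cases p)
    have r: "set ys \<subseteq> {1..N}" "set zs \<subseteq> {1..N}"
      using p by (auto simp: YP_def disjoint_pairs_def pe)
    have 1: "h * prod_list (map Yi zs) \<in> ?S" if "h \<in> HH" for h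
    proof (cases "zs = []")
      case True
      have "pair_prod Y Yi ([], []) * h \<in> ?S" by (rule lin_span_mult) (use one that in auto)
      then show ?thesis by (simp add: True pair_prod_def)
    next
      case False
      then have yinv using p by (auto simp: YP_def pe split: if_splits)
      show ?thesis using r(2) that
      proof (induction zs arbitrary: h)
        case Nil
        have "pair_prod Y Yi ([], []) * h \<in> ?S" by (rule lin_span_mult) (use one Nil in auto)
        then show ?case by (simp add: pair_prod_def)
      next
        case (Cons j zs)
        show ?case unfolding list.map prod_list.Cons
          by (rule step[of Yi]) (use Cons Yi_family[OF \<open>yinv\<close>] Yi_stable[OF \<open>yinv\<close>] in auto)
      qed
    qed
    have "h * (prod_list (map Y ys) * prod_list (map Yi zs)) \<in> ?S"
      using r(1) h
    proof (induction ys arbitrary: h)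
      case Nil then show ?case using 1 by simp
    next
      case (Cons j ys)
      show ?case unfolding list.map prod_list.Cons mult.assoc
        by (rule step[of Y]) (use Cons Y.hecke_family_axioms Y_stable in \<open>auto simp: mult.assoc\<close>)
    qed
    then show ?thesis by (simp add: pair_prod_def pe)
  qed
  have HH_stable: "h * z \<in> ?S" if h: "h \<in> HH" and z: "z \<in> ?S" for h z
  proof (rule lin_span_least[OF cl _ z])
    fix m w assume m: "m \<in> pair_prod Y Yi ` YP" and w: "w \<in> HH"
    then have "h * m \<in> ?S" using HH_mono h by auto
    then have "(h * m) * w \<in> ?S" by (rule lin_span_right[rotated]) (rule subring_gen.times[OF _ w])
    then show "h * (m * w) \<in> ?S" by (simp add: mult.assoc)
  qed
  fix x assume x: "x \<in> AA"
  have "x * 1 \<in> ?S"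
  proof (rule subring_gen_act[OF cl _ x])
    show "g * z \<in> ?S" if "g \<in> aff_gens" "z \<in> ?S" for g z
      using that HH_stable[of g z] Y_stable[OF r1] Yi_stable[OF _ rN]
      by (auto simp: aff_gens_def split: if_splits intro: subring_gen.gen)
    have "pair_prod Y Yi ([], []) * 1 \<in> ?S"
      by (rule lin_span_mult[OF imageI[OF one] subring_gen.one])
    then show "1 \<in> ?S" by (simp add: pair_prod_def)
  qed
  then show "x \<in> ?S" by simp
qed

definition "XD = X ` {1..N} \<union> Dg ` {1..N}"

text \<open>Filtration by the number of letters X_i and D_i standing to the left of an element of
  \<open>AA\<close>. Allowing the letter 1 makes it increasing. Exchanging D_i and X_j for i
  \<noteq> j costs only terms of lower degree.\<close>

fun filt :: "nat \<Rightarrow> 'r set" where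
  "filt 0 = AA"
| "filt (Suc n) = lin_span (insert 1 XD) (filt n)"

lemma filt_closed: "add_closed (filt n)"
proof (induction n)
  case 0 then show ?case by (simp add: subring_gen_closed)
next
  case (Suc n)
  then show ?case using lin_span_closed[of "filt n"] add_closedD(3)[OF Suc] by simp
qed

lemma filt_Suc: "filt n \<subseteq> filt (Suc n)"
  using lin_span_mult[of 1 "insert 1 XD"] by auto

lemma filt_mono: "m \<le> n \<Longrightarrow> filt m \<subseteq> filt n"
  by (rule lift_Suc_mono_le[of filt, OF filt_Suc])

lemma filt_XD: "g \<in> XD \<Longrightarrow> z \<in> filt n \<Longrightarrow> g * z \<in> filt (Suc n)"
  using lin_span_mult[of g "insert 1 XD"] by auto

lemma AA_filt: "y \<in> AA \<Longrightarrow> z \<in> filt n \<Longrightarrow> y * z \<in> filt n"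
proof (induction n arbitrary: y z)
  case 0
  then show ?case by (simp add: subring_gen.times)
next
  case (Suc n)
  have "y * (m * w) \<in> filt (Suc n)" if m: "m \<in> insert 1 XD" and w: "w \<in> filt n" for m w
  proof (cases "m = 1")
    case True
    then show ?thesis using Suc.IH[OF Suc.prems(1) w] filt_Suc by auto
  next
    case False
    then have "m \<in> XD" using m by auto
    have "y * m \<in> lin_span XD AA"
    proof -
      have "lin_span (X ` {1..N}) AA \<subseteq> lin_span XD AA" "lin_span (Dg ` {1..N}) AA \<subseteq> lin_span XD AA"
        by (rule lin_span_mono; auto simp: XD_def)+
      then show ?thesis using AA_X[OF Suc.prems(1)] AA_D[OF Suc.prems(1)] \<open>m \<in> XD\<close> by (auto simp: XD_def)
    qed
    then have "(y * m) * w \<in> filt (Suc n)"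
    proof (induction rule: lin_span_induct)
      case zero then show ?case using add_closedD(1)[OF filt_closed] by (simp del: filt.simps)
    next
      case (mult g h)
      then show ?case using filt_XD[OF mult(1) Suc.IH[OF mult(2) w]] by (simp add: mult.assoc)
    next
      case (plus u v)
      then show ?case using add_closedD(2)[OF filt_closed] by (simp add: distrib_right del: filt.simps)
    qed
    then show ?thesis by (simp add: mult.assoc)
  qed
  then show ?case using lin_span_least[OF filt_closed[of "Suc n"] _ Suc.prems(2)[unfolded filt.simps]] by blast
qed

lemma filt_Xs: "set xs \<subseteq> {1..N} \<Longrightarrow> z \<in> filt n \<Longrightarrow> prod_list (map X xs) * z \<in> filt (length xs + n)"
  and filt_Ds: "set xs \<subseteq> {1..N} \<Longrightarrow> z \<in> filt n \<Longrightarrow> prod_list (map Dg xs) * z \<in> filt (length xs + n)"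
  by (induction xs) (auto simp: mult.assoc XD_def simp del: filt.simps intro!: filt_XD)

text \<open>Each letter X_j that D_i passes leaves the error [D_i, X_j], an element of
  \<open>AA\<close>, in place of two letters. The stated filtration degree is therefore one less
  than that of the two products compared.\<close>

lemma D_Xs:
  assumes "i \<in> {1..N}" "set xs \<subseteq> {1..N}" "i \<notin> set xs" "w \<in> filt k"
  shows "Dg i * (prod_list (map X xs) * w) - prod_list (map X xs) * (Dg i * w) \<in> filt (length xs + k)"
  using assms(2,3)
proof (induction xs)
  case Nil
  then show ?case using add_closedD(1)[OF filt_closed] by simp
next
  case (Cons j xs)
  let ?u = "prod_list (map X xs) * w"
  have u: "?u \<in> filt (length xs + k)" using filt_Xs Cons.prems assms(4) by simp
  have "Dg i * X j - X j * Dg i \<in> AA" using D_X_commutator Cons.prems assms(1) by auto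
  from AA_filt[OF this u] have 1: "(Dg i * X j - X j * Dg i) * ?u \<in> filt (Suc (length xs + k))"
    using filt_Suc by blast
  have 2: "X j * (Dg i * ?u - prod_list (map X xs) * (Dg i * w)) \<in> filt (Suc (length xs + k))"
    by (rule filt_XD) (use Cons in \<open>auto simp: XD_def\<close>)
  have "Dg i * (prod_list (map X (j # xs)) * w) - prod_list (map X (j # xs)) * (Dg i * w)
    = (Dg i * X j - X j * Dg i) * ?u + X j * (Dg i * ?u - prod_list (map X xs) * (Dg i * w))"
    by (simp add: left_diff_distrib right_diff_distrib mult.assoc)
  then show ?case using add_closedD(2)[OF filt_closed 1 2] by simp
qed

definition "bounded_pairs n = {p \<in> disjoint_pairs N. length (fst p) + length (snd p) \<le> n}"

text \<open>A new letter X_i or D_i is sorted into an ordered monomial. If the opposite letter of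
  the same index is present, the two are brought together and their product lies in
  \<open>AA\<close>; otherwise reordering costs only lower terms. This is what keeps the two lists
  of a pair disjoint.\<close>

lemma filt_span_bounded: "filt n \<subseteq> lin_span (pair_prod X Dg ` bounded_pairs n) AA"
proof (induction n)
  case 0
  have "([], []) \<in> bounded_pairs 0" by (simp add: bounded_pairs_def disjoint_pairs_def)
  then have "pair_prod X Dg ([], []) \<in> pair_prod X Dg ` bounded_pairs 0" by (rule imageI)
  from lin_span_mult[OF this] show ?case by (auto simp: pair_prod_def)
next
  case (Suc n)
  let ?S = "\<lambda>n. lin_span (pair_prod X Dg ` bounded_pairs n) AA"
  have cl: "add_closed (?S n)" for n by (rule lin_span_closed) (rule subring_gen.uminus)
  have mono: "?S n \<subseteq> ?S (Suc n)"
    by (rule lin_span_mono) (auto simp: bounded_pairs_def)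
  \<comment> \<open>Whatever has lost a letter on the way is covered by the induction
    hypothesis.\<close>
  have lower: "z \<in> ?S (Suc n)" if "z \<in> filt m" "m \<le> n" for z m
    using filt_mono[OF that(2)] that(1) Suc mono by blast
  have "g * z \<in> ?S (Suc n)" if g: "g \<in> insert 1 XD" and z: "z \<in> filt n" for g z
  proof (rule lin_span_least[OF cl _ subsetD[OF Suc z]])
    fix m y assume m: "m \<in> pair_prod X Dg ` bounded_pairs n" and y: "y \<in> AA"
    then obtain xs ds where m: "m = prod_list (map X xs) * prod_list (map Dg ds)"
      and p: "(xs, ds) \<in> bounded_pairs n" by (auto simp: pair_prod_def)
    have r: "set xs \<subseteq> {1..N}" "set ds \<subseteq> {1..N}" "set xs \<inter> set ds = {}" "sorted xs" "sorted ds"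
      "length xs + length ds \<le> n"
      using p by (auto simp: bounded_pairs_def disjoint_pairs_def)
    have y0: "y \<in> filt 0" using y by simp
    consider "g = 1" | i where "g = X i" "i \<in> {1..N}" "i \<notin> set ds" | i where "g = X i" "i \<in> {1..N}" "i \<in> set ds"
      | i where "g = Dg i" "i \<in> {1..N}" "i \<notin> set xs" | i where "g = Dg i" "i \<in> {1..N}" "i \<in> set xs"
      using g unfolding XD_def by blast
    then show "g * (m * y) \<in> ?S (Suc n)"
    proof cases
      case 1
      have "pair_prod X Dg (xs, ds) * y \<in> ?S n" using p y by (intro lin_span_mult) auto
      then show ?thesis using mono 1 by (auto simp: m pair_prod_def)
    next
      case 2
      have "g * (m * y) = (prod_list (map X (i # xs)) * prod_list (map Dg ds)) * y"
        by (simp add: m 2 mult.assoc)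
      also have "prod_list (map X (i # xs)) * prod_list (map Dg ds) = pair_prod X Dg (sort (i # xs), sort ds)"
        by (rule pair_prod_sort) (use XX DD r 2 in auto)
      finally have "g * (m * y) = pair_prod X Dg (sort (i # xs), sort ds) * y" .
      moreover have "(sort (i # xs), sort ds) \<in> bounded_pairs (Suc n)"
        using r 2 by (auto simp: bounded_pairs_def disjoint_pairs_def simp del: sort_key_simps)
      ultimately show ?thesis using y by (metis imageI lin_span_mult)
    next
      case 3
      have "prod_list (map Dg ds) = Dg i * prod_list (map Dg (remove1 i ds))"
        by (rule prod_list_remove1[where I = "{1..N}"]) (use DD r 3 in auto)
      moreover have "X i * prod_list (map X xs) = prod_list (map X xs) * X i"
        by (rule prod_list_commute) (use XX r 3 in auto)
      ultimately have e: "g * (m * y) = prod_list (map X xs) * ((X i * Dg i) * (prod_list (map Dg (remove1 i ds)) * y))"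
        by (simp add: m 3 mult.assoc) (simp flip: mult.assoc)
      have "g * (m * y) \<in> filt (length xs + (length (remove1 i ds) + 0))"
        unfolding e by (intro filt_Xs AA_filt filt_Ds X_D_AA y0) (use r 3 in \<open>auto dest: set_remove1_subset[THEN subsetD]\<close>)
      then show ?thesis by (rule lower) (use r 3 in \<open>auto simp: length_remove1\<close>)
    next
      case 4
      let ?w = "prod_list (map Dg ds) * y"
      have w: "?w \<in> filt (length ds + 0)" by (rule filt_Ds[OF r(2) y0])
      have 1: "Dg i * (prod_list (map X xs) * ?w) - prod_list (map X xs) * (Dg i * ?w) \<in> ?S (Suc n)"
        by (rule lower[OF D_Xs[OF 4(2) r(1) 4(3) w]]) (use r in simp)
      have "prod_list (map X xs) * (Dg i * ?w) = (prod_list (map X xs) * prod_list (map Dg (i # ds))) * y"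
        by (simp add: mult.assoc)
      also have "prod_list (map X xs) * prod_list (map Dg (i # ds)) = pair_prod X Dg (sort xs, sort (i # ds))"
        by (rule pair_prod_sort) (use XX DD r 4 in auto)
      finally have "prod_list (map X xs) * (Dg i * ?w) = pair_prod X Dg (sort xs, sort (i # ds)) * y" .
      moreover have "(sort xs, sort (i # ds)) \<in> bounded_pairs (Suc n)"
        using r 4 by (auto simp: bounded_pairs_def disjoint_pairs_def simp del: sort_key_simps)
      ultimately have 2: "prod_list (map X xs) * (Dg i * ?w) \<in> ?S (Suc n)"
        using y by (metis imageI lin_span_mult)
      show ?thesis using add_closedD(2)[OF cl 1 2] by (simp add: m 4 mult.assoc)
    next
      case 5
      have "prod_list (map X xs) = X i * prod_list (map X (remove1 i xs))"
        by (rule prod_list_remove1[where I = "{1..N}"]) (use XX r 5 in auto)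
      then have e: "g * (m * y) = (Dg i * X i) * (prod_list (map X (remove1 i xs)) * (prod_list (map Dg ds) * y))"
        by (simp add: m 5 mult.assoc)
      have "g * (m * y) \<in> filt (length (remove1 i xs) + (length ds + 0))"
        unfolding e by (intro filt_Xs AA_filt filt_Ds X_D_AA y0) (use r 5 in \<open>auto dest: set_remove1_subset[THEN subsetD]\<close>)
      then show ?thesis by (rule lower) (use r 5 in \<open>auto simp: length_remove1\<close>)
    qed
  qed
  then show ?case using lin_span_subset[OF cl[of "Suc n"], of "insert 1 XD" "filt n"] by simp
qed

definition "basis_elem b = pair_prod X Dg (fst b) * (pair_prod Y Yi (fst (snd b)) * prod_list (map T (snd (snd b))))"
definition "basis_index = disjoint_pairs N \<times> YP \<times> perm_words N"

text \<open>The union of the filtration contains 1 and is stable under every generator, hence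
  contains the whole subring. It remains to multiply three normal forms: X and D over
  \<open>AA\<close>, Y over \<open>HH\<close>, T over \<open>K\<close>.\<close>

theorem spanning:
  "subring_gen (K \<union> T ` {1..<N} \<union> X ` {1..N} \<union> Dg ` {1..N} \<union> Y ` {1..N} \<union> (if yinv then Yi ` {1..N} else {}))
    \<subseteq> lin_span (basis_elem ` basis_index) K"
proof
  let ?G = "K \<union> T ` {1..<N} \<union> X ` {1..N} \<union> Dg ` {1..N} \<union> Y ` {1..N} \<union> (if yinv then Yi ` {1..N} else {})"
  let ?F = "\<Union>n. filt n"
  fix x assume x: "x \<in> subring_gen ?G"
  have F: "add_closed ?F"
    unfolding add_closed_def
  proof (intro conjI ballI)
    show "0 \<in> ?F" using add_closedD(1)[OF filt_closed] by blast
    show "- u \<in> ?F" if "u \<in> ?F" for u using that add_closedD(3)[OF filt_closed] by blast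
    fix u v assume "u \<in> ?F" "v \<in> ?F"
    then obtain m n where "u \<in> filt m" "v \<in> filt n" by blast
    then have "u \<in> filt (max m n)" "v \<in> filt (max m n)"
      using filt_mono[of m "max m n"] filt_mono[of n "max m n"] by auto
    then show "u + v \<in> ?F" using add_closedD(2)[OF filt_closed] by blast
  qed
  have "x * 1 \<in> ?F"
  proof (rule subring_gen_act[OF F _ x])
    show "1 \<in> ?F" using subring_gen.one[of aff_gens] by (auto intro!: exI[of _ 0])
    fix g z assume g: "g \<in> ?G" and "z \<in> ?F"
    then obtain n where z: "z \<in> filt n" by blast
    have "g \<in> AA \<or> g \<in> XD"
      using g K_HH T_HH HH_AA' Y_AA Yi_AA by (auto simp: XD_def split: if_splits)
    then show "g * z \<in> ?F" using AA_filt[OF _ z] filt_XD[OF _ z] by blast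
  qed
  then obtain n where "x \<in> filt n" by auto
  then have 1: "x \<in> lin_span (pair_prod X Dg ` disjoint_pairs N) AA"
    using filt_span_bounded[of n] lin_span_mono[of "pair_prod X Dg ` bounded_pairs n" "pair_prod X Dg ` disjoint_pairs N" AA AA]
    by (auto simp: bounded_pairs_def)
  let ?W = "(\<lambda>w. prod_list (map T w)) ` perm_words N"
  have H: "HH \<subseteq> lin_span ?W K" unfolding hecke_gens_def by (rule X.hecke_span[OF K(1-3)])
  have "AA \<subseteq> lin_span (pair_prod Y Yi ` YP) (lin_span ?W K)"
    using AA_span lin_span_mono[OF order_refl H] by blast
  also have "\<dots> \<subseteq> lin_span {m * m' | m m'. m \<in> pair_prod Y Yi ` YP \<and> m' \<in> ?W} K" (is "_ \<subseteq> lin_span ?V K")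
    by (rule lin_span_assoc) (rule scalar_HH')
  finally have "x \<in> lin_span (pair_prod X Dg ` disjoint_pairs N) (lin_span ?V K)"
    using 1 lin_span_mono[OF order_refl, of AA] by blast
  also have "\<dots> \<subseteq> lin_span {m * m' | m m'. m \<in> pair_prod X Dg ` disjoint_pairs N \<and> m' \<in> ?V} K"
    by (rule lin_span_assoc) (rule scalar_HH')
  also have "\<dots> \<subseteq> lin_span (basis_elem ` basis_index) K"
  proof (rule lin_span_mono[OF _ order_refl], rule subsetI)
    fix u assume "u \<in> {m * m' | m m'. m \<in> pair_prod X Dg ` disjoint_pairs N \<and> m' \<in> ?V}"
    then obtain p p' w where "u = basis_elem (p, p', w)" "p \<in> disjoint_pairs N" "p' \<in> YP" "w \<in> perm_words N"
      by (auto simp: basis_elem_def)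
    then show "u \<in> basis_elem ` basis_index" by (auto simp: basis_index_def)
  qed
  finally show "x \<in> lin_span (basis_elem ` basis_index) K" .
qed

end

subsection \<open>Homomorphisms of unital rings\<close>

definition rhom :: "('a::ring_1 \<Rightarrow> 'b::ring_1) \<Rightarrow> bool" where
  "rhom f \<longleftrightarrow> f 1 = 1 \<and> (\<forall>a b. f (a + b) = f a + f b) \<and> (\<forall>a b. f (a * b) = f a * f b)"

lemma rhomD:
  assumes "rhom f"
  shows "f 1 = 1" "f (a + b) = f a + f b" "f (a * b) = f a * f b" "f 0 = 0" "f (- a) = - f a" "f (a - b) = f a - f b"
proof -
  show 1: "f 1 = 1" and 2: "\<And>a b. f (a + b) = f a + f b" and "f (a * b) = f a * f b"
    using assms unfolding rhom_def by auto
  show 3: "f 0 = 0" using 2[of 0 0] by simp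
  show 4: "f (- a) = - f a" for a using 2[of a "- a"] 3 by (simp add: minus_unique)
  show "f (a - b) = f a - f b" using 2[of a "- b"] 4 by simp
qed

lemma rhom_sum: "rhom f \<Longrightarrow> f (sum g A) = (\<Sum>x\<in>A. f (g x))"
  by (induction A rule: infinite_finite_induct) (simp_all add: rhomD)

lemma rhom_prod_list: "rhom f \<Longrightarrow> f (prod_list xs) = prod_list (map f xs)"
  by (induction xs) (simp_all add: rhomD)

lemma rhom_power: "rhom f \<Longrightarrow> f (a ^ n) = f a ^ n"
  by (induction n) (simp_all add: rhomD)

lemma rhom_compose: "rhom f \<Longrightarrow> rhom g \<Longrightarrow> rhom (\<lambda>x. f (g x))"
  unfolding rhom_def by simp

lemma rhom_id: "rhom (\<lambda>x. x)"
  unfolding rhom_def by simp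

subsection \<open>Evaluation of monoid algebras\<close>

abbreviation "keys \<equiv> Poly_Mapping.keys"
abbreviation "lookup \<equiv> Poly_Mapping.lookup"
abbreviation "single \<equiv> Poly_Mapping.single"

text \<open>Free algebras and Laurent polynomials are both monoid algebras, so one evaluation serves
  words and exponent vectors. The target may be noncommutative; \<open>rhom_pm_ev\<close> asks only
  that images of coefficients commute with images of monoid elements.\<close>

definition pm_ev :: "('k::ring_1 \<Rightarrow> 'b::ring_1) \<Rightarrow> ('m::monoid_add \<Rightarrow> 'b) \<Rightarrow> ('m \<Rightarrow>\<^sub>0 'k) \<Rightarrow> 'b" where
  "pm_ev \<rho> \<chi> p = (\<Sum>m\<in>keys p. \<rho> (lookup p m) * \<chi> m)"

lemma poly_mapping_sum_single: "p = (\<Sum>m\<in>keys p. single m (lookup p m))"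
proof (rule poly_mapping_eqI)
  fix k
  have "lookup (\<Sum>m\<in>keys p. single m (lookup p m)) k = (\<Sum>m\<in>keys p. if k = m then lookup p m else 0)"
    by (simp add: lookup_sum lookup_single when_def eq_commute cong: if_cong)
  also have "\<dots> = lookup p k" by (simp add: in_keys_iff)
  finally show "lookup p k = lookup (\<Sum>m\<in>keys p. single m (lookup p m)) k" ..
qed

lemma mult_sum_single:
  fixes p r :: "'m::monoid_add \<Rightarrow>\<^sub>0 'k::ring_1"
  shows "p * r = (\<Sum>m\<in>keys p. \<Sum>n\<in>keys r. single (m + n) (lookup p m * lookup r n))"
proof -
  have "p * r = (\<Sum>m\<in>keys p. single m (lookup p m)) * (\<Sum>n\<in>keys r. single n (lookup r n))"
    using poly_mapping_sum_single[of p] poly_mapping_sum_single[of r] by simp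
  then show ?thesis by (simp add: sum_product mult_single)
qed

context
  fixes \<rho> :: "'k::ring_1 \<Rightarrow> 'b::ring_1" and \<chi> :: "'m::monoid_add \<Rightarrow> 'b"
  assumes rho: "rhom \<rho>"
begin

lemma pm_ev_superset: "finite A \<Longrightarrow> keys p \<subseteq> A \<Longrightarrow> pm_ev \<rho> \<chi> p = (\<Sum>m\<in>A. \<rho> (lookup p m) * \<chi> m)"
  unfolding pm_ev_def by (rule sum.mono_neutral_left) (auto simp: in_keys_iff rhomD[OF rho])

lemma pm_ev_single: "pm_ev \<rho> \<chi> (single m k) = \<rho> k * \<chi> m"
  using pm_ev_superset[of "{m}" "single m k"] by simp

lemma pm_ev_add: "pm_ev \<rho> \<chi> (p + r) = pm_ev \<rho> \<chi> p + pm_ev \<rho> \<chi> r"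
proof -
  let ?A = "keys p \<union> keys r"
  have "keys (p + r) \<subseteq> ?A" by (rule keys_add)
  then show ?thesis
    using pm_ev_superset[of ?A "p + r"] pm_ev_superset[of ?A p] pm_ev_superset[of ?A r]
    by (simp add: lookup_add rhomD[OF rho] distrib_right sum.distrib)
qed

lemma pm_ev_zero: "pm_ev \<rho> \<chi> 0 = 0"
  by (simp add: pm_ev_def)

lemma pm_ev_sum: "pm_ev \<rho> \<chi> (sum f A) = (\<Sum>x\<in>A. pm_ev \<rho> \<chi> (f x))"
  by (induction A rule: infinite_finite_induct) (simp_all add: pm_ev_add pm_ev_zero)

lemma rhom_pm_ev:
  assumes "\<chi> 0 = 1" "\<And>m n. \<chi> (m + n) = \<chi> m * \<chi> n" "\<And>k m. \<rho> k * \<chi> m = \<chi> m * \<rho> k"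
  shows "rhom (pm_ev \<rho> \<chi>)"
  unfolding rhom_def
proof (intro conjI allI)
  show "pm_ev \<rho> \<chi> 1 = 1"
    using pm_ev_single[of 0 1] assms(1) rhomD(1)[OF rho] by simp
  show "pm_ev \<rho> \<chi> (p + r) = pm_ev \<rho> \<chi> p + pm_ev \<rho> \<chi> r" for p r by (rule pm_ev_add)
  fix p r
  have e: "\<rho> (a * b) * \<chi> (m + n) = (\<rho> a * \<chi> m) * (\<rho> b * \<chi> n)" for a b m n
  proof -
    have "\<rho> (a * b) * \<chi> (m + n) = \<rho> a * (\<rho> b * \<chi> m) * \<chi> n"
      by (simp add: rhomD[OF rho] assms(2) mult.assoc)
    then show ?thesis unfolding assms(3)[of b m] by (simp only: mult.assoc)
  qed
  have "pm_ev \<rho> \<chi> (p * r) = (\<Sum>m\<in>keys p. \<Sum>n\<in>keys r. (\<rho> (lookup p m) * \<chi> m) * (\<rho> (lookup r n) * \<chi> n))"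
    unfolding mult_sum_single by (simp add: pm_ev_sum pm_ev_single e)
  then show "pm_ev \<rho> \<chi> (p * r) = pm_ev \<rho> \<chi> p * pm_ev \<rho> \<chi> r"
    by (simp add: pm_ev_def sum_product)
qed

end

definition fev :: "('k::comm_ring_1 \<Rightarrow> 'b::ring_1) \<Rightarrow> ('g \<Rightarrow> 'b) \<Rightarrow> ('g, 'k) falg \<Rightarrow> 'b" where
  "fev \<rho> v = pm_ev \<rho> (\<lambda>w. prod_list (map v (letters w)))"

lemma rhom_fev:
  assumes "rhom \<rho>" "\<And>k g. \<rho> k * v g = v g * \<rho> k"
  shows "rhom (fev \<rho> v)"
  unfolding fev_def
proof (rule rhom_pm_ev[OF assms(1)])
  show "\<rho> k * prod_list (map v (letters m)) = prod_list (map v (letters m)) * \<rho> k" for k m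
    by (rule prod_list_commute) (use assms(2) in auto)
qed (simp_all add: zero_fword_def plus_fword_def)

lemma fev_gen: "rhom \<rho> \<Longrightarrow> fev \<rho> v (gen g) = v g"
  by (simp add: fev_def gen_def pm_ev_single rhomD)

lemma fev_scal: "rhom \<rho> \<Longrightarrow> fev \<rho> v (scal k) = \<rho> k"
  by (simp add: fev_def scal_def pm_ev_single zero_fword_def)

lemma rhom_scal: "rhom scal"
  by (simp add: rhom_def scal_add scal_mult scal_one)

lemma scal_commute: "scal c * x = x * (scal c :: ('g, 'k::comm_ring_1) falg)"
proof -
  have "scal c * single w k = single w k * scal c" for w :: "'g fword" and k
    by (simp add: scal_def mult_single mult.commute)
  then have "scal c * (\<Sum>w\<in>keys x. single w (lookup x w)) = (\<Sum>w\<in>keys x. single w (lookup x w)) * scal c"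
    by (simp add: sum_distrib_left sum_distrib_right)
  then show ?thesis using poly_mapping_sum_single[of x] by simp
qed

lemma prod_list_gen: "prod_list (map gen xs) = (single (Word xs) 1 :: ('g, 'k::comm_ring_1) falg)"
  by (induction xs) (simp_all add: gen_def mult_single plus_fword_def zero_fword_def flip: single_one)

lemma single_word: "single w k = scal k * prod_list (map gen (letters w))"
  by (cases w) (simp add: prod_list_gen scal_def mult_single)

subsection \<open>Two-sided ideals and a ring containing all quotients\<close>

definition two_ideal :: "'a::ring_1 set \<Rightarrow> bool" where
  "two_ideal I \<longleftrightarrow> 0 \<in> I \<and> (\<forall>x\<in>I. \<forall>y\<in>I. x + y \<in> I) \<and> (\<forall>x\<in>I. - x \<in> I) \<and> (\<forall>x\<in>I. \<forall>a. a * x \<in> I \<and> x * a \<in> I)"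

lemma two_idealD:
  assumes "two_ideal I"
  shows "0 \<in> I" "x \<in> I \<Longrightarrow> y \<in> I \<Longrightarrow> x + y \<in> I" "x \<in> I \<Longrightarrow> - x \<in> I" "x \<in> I \<Longrightarrow> a * x \<in> I" "x \<in> I \<Longrightarrow> x * a \<in> I"
    "x \<in> I \<Longrightarrow> y \<in> I \<Longrightarrow> x - y \<in> I"
  using assms unfolding two_ideal_def
  by (auto simp: diff_conv_add_uminus simp del: add_uminus_conv_diff)

text \<open>
  The product of the quotients of \<open>'a\<close> by all its two-sided ideals. It makes the type class machinery
  for rings available in a quotient by an ideal that depends on parameters.
\<close>

quotient_type (overloaded) 'a uquot = "'a set \<Rightarrow> 'a::ring_1" /
  "\<lambda>f g. \<forall>I. two_ideal I \<longrightarrow> f I - g I \<in> I"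
proof (rule equivpI)
  show "reflp (\<lambda>f g. \<forall>I::'a set. two_ideal I \<longrightarrow> f I - g I \<in> I)"
    by (auto intro!: reflpI simp: two_idealD(1))
  show "symp (\<lambda>f g. \<forall>I::'a set. two_ideal I \<longrightarrow> f I - g I \<in> I)"
    by (rule sympI) (metis minus_diff_eq two_idealD(3))
  show "transp (\<lambda>f g. \<forall>I::'a set. two_ideal I \<longrightarrow> f I - g I \<in> I)"
  proof (rule transpI, intro allI impI)
    fix f g h :: "'a set \<Rightarrow> 'a" and I :: "'a set"
    assume "\<forall>I. two_ideal I \<longrightarrow> f I - g I \<in> I" "\<forall>I. two_ideal I \<longrightarrow> g I - h I \<in> I" "two_ideal I"
    then show "f I - h I \<in> I" using two_idealD(2)[of I "f I - g I" "g I - h I"] by simp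
  qed
qed

instantiation uquot :: (ring_1) ring_1
begin

lift_definition zero_uquot :: "'a uquot" is "\<lambda>_. 0" .
lift_definition one_uquot :: "'a uquot" is "\<lambda>_. 1" .
lift_definition plus_uquot :: "'a uquot \<Rightarrow> 'a uquot \<Rightarrow> 'a uquot" is "\<lambda>f g I. f I + g I"
  by (metis add_diff_add two_idealD(2))
lift_definition uminus_uquot :: "'a uquot \<Rightarrow> 'a uquot" is "\<lambda>f I. - f I"
  by (metis minus_diff_minus two_idealD(3))
lift_definition minus_uquot :: "'a uquot \<Rightarrow> 'a uquot \<Rightarrow> 'a uquot" is "\<lambda>f g I. f I - g I"
  subgoal for f1 f2 g1 g2 I
    using two_idealD(6)[of I "f1 I - f2 I" "g1 I - g2 I"] by (simp add: algebra_simps)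
  done
lift_definition times_uquot :: "'a uquot \<Rightarrow> 'a uquot \<Rightarrow> 'a uquot" is "\<lambda>f g I. f I * g I"
  subgoal for f1 f2 g1 g2 I
    using two_idealD(2)[OF _ two_idealD(5)[of I "f1 I - f2 I" "g1 I"] two_idealD(4)[of I "g1 I - g2 I" "f2 I"]]
    by (simp add: algebra_simps)
  done

instance
proof
  fix a b c :: "'a uquot"
  show "a * b * c = a * (b * c)" "1 * a = a" "a * 1 = a"
    "a + b + c = a + (b + c)" "a + b = b + a" "0 + a = a" "- a + a = 0" "a - b = a + - b"
    "(a + b) * c = a * c + b * c" "a * (b + c) = a * b + a * c"
    by (transfer, simp add: algebra_simps two_idealD(1))+
  \<comment> \<open>The component at the zero ideal keeps 0 and 1 apart, even though the component
    at the whole ring does not.\<close>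
  have "two_ideal {0::'a}" by (auto simp: two_ideal_def)
  moreover have "(0::'a) - 1 \<notin> {0}" by simp
  ultimately show "(0::'a uquot) \<noteq> 1" by transfer blast
qed

end

text \<open>At the component \<open>I\<close> this is the quotient map. The other components are
  filled by \<open>f\<close> so that 1 is sent to 1; when \<open>f\<close> vanishes on the ideal
  \<open>I\<close>, being zero means exactly membership in \<open>I\<close>.\<close>

lift_definition embq :: "'a::ring_1 set \<Rightarrow> ('a \<Rightarrow> 'a) \<Rightarrow> 'a \<Rightarrow> 'a uquot" is
  "\<lambda>I f p J. if J = I then p else f p" .

lemma rhom_embq:
  assumes f: "rhom f" shows "rhom (embq I f)"
proof -
  have "embq I f 1 = 1" by (transfer fixing: f) (simp add: rhomD[OF f] two_idealD(1))
  moreover have "embq I f (a + b) = embq I f a + embq I f b" for a b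
    by (transfer fixing: f) (simp add: rhomD[OF f] two_idealD(1))
  moreover have "embq I f (a * b) = embq I f a * embq I f b" for a b
    by (transfer fixing: f) (simp add: rhomD[OF f] two_idealD(1))
  ultimately show ?thesis unfolding rhom_def by blast
qed

lemma embq_eq_0: "two_ideal I \<Longrightarrow> embq I f p = 0 \<Longrightarrow> p \<in> I"
  by transfer force

lemma embq_zero: "two_ideal I \<Longrightarrow> p \<in> I \<Longrightarrow> f p = 0 \<Longrightarrow> embq I f p = 0"
  by transfer (auto intro: two_idealD)

text \<open>The ideal in the whole type, with all coefficients and all generator names as
  multipliers. Sums of terms x (a - b) y allow a homomorphism that respects the relations, or a
  retraction, to be applied term by term.\<close>

inductive_set tideal :: "('a::ring_1 \<times> 'a) set \<Rightarrow> 'a set" for R where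
  zero: "0 \<in> tideal R"
| add: "(a, b) \<in> R \<Longrightarrow> z \<in> tideal R \<Longrightarrow> x * (a - b) * y + z \<in> tideal R"

lemma two_ideal_tideal: "two_ideal (tideal R)"
  unfolding two_ideal_def
proof (intro conjI ballI allI)
  show "0 \<in> tideal R" by (rule tideal.zero)
  show "x + y \<in> tideal R" if "x \<in> tideal R" "y \<in> tideal R" for x y
    using that by (induction x rule: tideal.induct) (auto simp: add.assoc intro: tideal.add)
  show "- x \<in> tideal R" if "x \<in> tideal R" for x
    using that
  proof (induction x rule: tideal.induct)
    case (add a b z x y)
    have "- (x * (a - b) * y + z) = (- x) * (a - b) * y + - z" by simp
    then show ?case using tideal.add[OF add(1,3)] by metis
  qed (simp add: tideal.zero)
  show "c * x \<in> tideal R" if "x \<in> tideal R" for x c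
    using that
  proof (induction x rule: tideal.induct)
    case (add a b z x y)
    have "c * (x * (a - b) * y + z) = (c * x) * (a - b) * y + c * z" by (simp only: distrib_left mult.assoc)
    then show ?case using tideal.add[OF add(1,3)] by metis
  qed (simp add: tideal.zero)
  show "x * c \<in> tideal R" if "x \<in> tideal R" for x c
    using that
  proof (induction x rule: tideal.induct)
    case (add a b z x y)
    have "(x * (a - b) * y + z) * c = x * (a - b) * (y * c) + z * c" by (simp only: distrib_right mult.assoc)
    then show ?case using tideal.add[OF add(1,3)] by metis
  qed (simp add: tideal.zero)
qed

lemma tideal_gen: "(a, b) \<in> R \<Longrightarrow> a - b \<in> tideal R"
  using tideal.add[OF _ tideal.zero, of a b R 1 1] by simp

lemma rhom_tideal:
  assumes "rhom f" "\<And>a b. (a, b) \<in> R \<Longrightarrow> f a = f b" "z \<in> tideal R"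
  shows "f z = 0"
  using assms(3) by (induction rule: tideal.induct) (auto simp: rhomD[OF assms(1)] assms(2))

lemma embq_tideal:
  assumes "rhom f" "\<And>a b. (a, b) \<in> R \<Longrightarrow> f a = f b"
  shows "rhom (embq (tideal R) f)"
    and "(a, b) \<in> R \<Longrightarrow> embq (tideal R) f a = embq (tideal R) f b"
    and "embq (tideal R) f p = 0 \<longleftrightarrow> p \<in> tideal R"
proof -
  show h: "rhom (embq (tideal R) f)" by (rule rhom_embq[OF assms(1)])
  show z: "embq (tideal R) f p = 0 \<longleftrightarrow> p \<in> tideal R" for p
    using embq_eq_0[OF two_ideal_tideal] embq_zero[OF two_ideal_tideal] rhom_tideal[OF assms] by metis
  show "embq (tideal R) f a = embq (tideal R) f b" if "(a, b) \<in> R"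
    using z[of "a - b"] tideal_gen[OF that] by (simp add: rhomD[OF h])
qed

subsection \<open>The ring of a free algebra\<close>

locale coeff_ring =
  fixes K :: "'k::comm_ring_1 set" and G :: "'g set"
  assumes K1: "1 \<in> K" and Kminus: "a \<in> K \<Longrightarrow> b \<in> K \<Longrightarrow> a - b \<in> K" and Kmult: "a \<in> K \<Longrightarrow> b \<in> K \<Longrightarrow> a * b \<in> K"
begin

lemma K0: "0 \<in> K" using Kminus[OF K1 K1] by simp
lemma Kplus: "a \<in> K \<Longrightarrow> b \<in> K \<Longrightarrow> a + b \<in> K" using Kminus[OF _ Kminus[OF K0]] by fastforce

abbreviation "F \<equiv> free_algebra K G"

lemma F_simps: "monoid.mult F = (*)" "monoid.one F = 1" "ring.zero F = 0" "ring.add F = (+)"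
  by (simp_all add: free_algebra_def)

lemma F_iff: "p \<in> carrier F \<longleftrightarrow> (\<forall>w\<in>keys p. lookup p w \<in> K \<and> set (letters w) \<subseteq> G)"
  by (simp add: free_algebra_def)

lemma F_single: "k \<in> K \<Longrightarrow> set (letters w) \<subseteq> G \<Longrightarrow> single w k \<in> carrier F"
  by (auto simp: F_iff)

lemma F_0: "0 \<in> carrier F" by (simp add: F_iff)

lemma F_lookup: "p \<in> carrier F \<Longrightarrow> lookup p w \<in> K"
  using K0 by (cases "w \<in> keys p") (auto simp: F_iff in_keys_iff)

lemma F_add: "p \<in> carrier F \<Longrightarrow> r \<in> carrier F \<Longrightarrow> p + r \<in> carrier F"
  using keys_add[of p r] F_lookup[of p] F_lookup[of r] by (auto simp: F_iff lookup_add intro!: Kplus)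

lemma F_uminus: "p \<in> carrier F \<Longrightarrow> - p \<in> carrier F"
  using Kminus[OF K0] by (auto simp: F_iff)

lemma F_minus: "p \<in> carrier F \<Longrightarrow> r \<in> carrier F \<Longrightarrow> p - r \<in> carrier F"
  using F_add[OF _ F_uminus] by fastforce

lemma F_sum: "(\<And>x. x \<in> A \<Longrightarrow> f x \<in> carrier F) \<Longrightarrow> sum f A \<in> carrier F"
  by (induction A rule: infinite_finite_induct) (auto intro: F_add F_0)

lemma F_mult: "p \<in> carrier F \<Longrightarrow> r \<in> carrier F \<Longrightarrow> p * r \<in> carrier F"
  unfolding mult_sum_single
  by (intro F_sum F_single Kmult F_lookup) (auto simp: F_iff plus_fword_def)

lemma F_scal: "k \<in> K \<Longrightarrow> scal k \<in> carrier F"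
  unfolding scal_def by (rule F_single) (auto simp: zero_fword_def)

lemma F_1: "1 \<in> carrier F" using F_scal[OF K1] by (simp add: scal_one)

lemma F_gen: "g \<in> G \<Longrightarrow> gen g \<in> carrier F"
  unfolding gen_def by (rule F_single) (auto simp: K1)

lemma F_prod_list: "(\<And>x. x \<in> set xs \<Longrightarrow> x \<in> carrier F) \<Longrightarrow> prod_list xs \<in> carrier F"
  by (induction xs) (auto intro: F_mult F_1)

lemma F_power: "x \<in> carrier F \<Longrightarrow> x ^ n \<in> carrier F"
  by (induction n) (auto intro: F_mult F_1)

lemma F_induct [consumes 1, case_names zero mult add]:
  assumes "p \<in> carrier F" "Q 0"
    "\<And>k xs. k \<in> K \<Longrightarrow> set xs \<subseteq> G \<Longrightarrow> Q (scal k * prod_list (map gen xs))"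
    "\<And>p r. p \<in> carrier F \<Longrightarrow> r \<in> carrier F \<Longrightarrow> Q p \<Longrightarrow> Q r \<Longrightarrow> Q (p + r)"
  shows "Q p"
proof -
  have t: "single w (lookup p w) \<in> carrier F \<and> Q (single w (lookup p w))" if "w \<in> keys p" for w
  proof
    have "lookup p w \<in> K" "set (letters w) \<subseteq> G" using that assms(1) by (auto simp: F_iff)
    then show "single w (lookup p w) \<in> carrier F" "Q (single w (lookup p w))"
      using assms(3) F_single unfolding single_word by auto
  qed
  have "sum (\<lambda>w. single w (lookup p w)) A \<in> carrier F \<and> Q (sum (\<lambda>w. single w (lookup p w)) A)" if "A \<subseteq> keys p" for A
    using finite_subset[OF that finite_keys] that
    by (induction A rule: finite_induct) (use t assms(2,4) F_add F_0 in auto)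
  then have "Q (sum (\<lambda>w. single w (lookup p w)) (keys p))" by blast
  then show ?thesis unfolding poly_mapping_sum_single[of p, symmetric] .
qed

lemma F_ring: "ring F"
proof (rule ringI)
  show "abelian_group F"
  proof (rule abelian_groupI)
    fix x assume "x \<in> carrier F"
    then show "\<exists>y\<in>carrier F. y \<oplus>\<^bsub>F\<^esub> x = \<zero>\<^bsub>F\<^esub>"
      by (intro bexI[of _ "- x"]) (auto simp: F_simps intro: F_uminus)
  qed (auto simp: F_simps F_0 F_add ac_simps)
  show "Group.monoid F" by (rule monoidI) (auto simp: F_simps F_1 F_mult ac_simps)
qed (auto simp: F_simps algebra_simps)

lemma F_a_inv: "p \<in> carrier F \<Longrightarrow> \<ominus>\<^bsub>F\<^esub> p = - p"
  using abelian_group.minus_equality[OF ring.is_abelian_group[OF F_ring], of "- p" p] by (simp add: F_simps F_uminus)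

text \<open>
  A type-level two-sided ideal meets the free algebra over \<open>K\<close> on \<open>G\<close> in the ideal generated there,
  because the latter is a retract.
\<close>

lemma tideal_retract:
  assumes R: "\<And>a b. (a, b) \<in> R \<Longrightarrow> a \<in> carrier F \<and> b \<in> carrier F"
    and r: "rhom r" "\<And>p. r p \<in> carrier F" "\<And>p. p \<in> carrier F \<Longrightarrow> r p = p"
    and p: "p \<in> tideal R" "p \<in> carrier F"
  shows "p \<in> rel_ideal K G R"
proof -
  interpret R: ring F by (rule F_ring)
  have RF: "{a - b | a b. (a, b) \<in> R} \<subseteq> carrier F" using R F_minus by auto
  interpret I: ideal "rel_ideal K G R" F
    unfolding rel_ideal_def by (rule R.genideal_ideal[OF RF])
  \<comment> \<open>The retraction fixes every difference a - b and sends the multipliers x and y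
    into the free algebra, so each term lands in the ideal generated there.\<close>
  have "r p \<in> rel_ideal K G R"
    using p(1)
  proof (induction rule: tideal.induct)
    case zero
    then show ?case using I.zero_closed by (simp add: rhomD[OF r(1)] F_simps)
  next
    case (add a b z x y)
    have "a - b \<in> rel_ideal K G R"
      using R.genideal_self[OF RF] add(1) unfolding rel_ideal_def by blast
    then have "r x * (a - b) * r y \<in> rel_ideal K G R"
      using I.I_l_closed I.I_r_closed r(2) by (simp add: F_simps)
    then show ?case using I.a_closed[OF _ add.IH] R[OF add(1)] r(3) F_minus
      by (simp add: rhomD[OF r(1)] F_simps)
  qed
  then show ?thesis using r(3)[OF p(2)] by simp
qed

end

subsection \<open>Hecke algebras with a rotation\<close>

lemma (in hecke) Ti_downi_shift:
  assumes "1 \<le> a" "a \<le> k" "Suc k < b" "b \<le> N"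
  shows "T k * downi a b = downi a b * T (Suc k)"
proof -
  interpret H: hecke N Ti t' t by (rule hecke_inverse)
  have "H.down a b = downi a b" by (simp add: H.down_def downi_def)
  then have s: "Ti k * downi a b = downi a b * Ti (Suc k)"
    using H.down_T_shift[OF assms] by simp
  have r: "k \<in> {1..<N}" "Suc k \<in> {1..<N}" using assms by auto
  have "T k * downi a b = T k * (downi a b * Ti (Suc k)) * T (Suc k)"
    by (simp add: mult.assoc Ti_T[OF r(2)])
  then show ?thesis unfolding s[symmetric] by (simp add: mult.assoc T_Ti_l[OF r(1)])
qed

lemma (in hecke_family) T_commute_prod:
  assumes "\<And>i j. i \<in> {1..N} \<Longrightarrow> j \<in> {1..N} \<Longrightarrow> A i * A j = A j * A i" "k \<in> {1..<N}"
  shows "T k * prod_list (map A [1..<Suc N]) = prod_list (map A [1..<Suc N]) * T k"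
proof -
  have k: "1 \<le> k" "k \<le> Suc N" "Suc (Suc k) \<le> Suc N" using assms(2) by auto
  have "[1..<Suc N] = [1..<k] @ [k..<Suc N]"
    using upt_add_eq_append[OF k(1), of "Suc N - k"] k(2) by (simp del: upt_Suc)
  also have "[k..<Suc N] = k # Suc k # [Suc (Suc k)..<Suc N]"
    using k assms(2) by (simp add: upt_conv_Cons del: upt_Suc)
  finally have e: "prod_list (map A [1..<Suc N]) = prod_list (map A [1..<k]) * (A (Suc k) * A k) * prod_list (map A [Suc (Suc k)..<Suc N])"
    using assms(1)[of "Suc k" k] assms(2)
    by (simp only: map_append prod_list.append list.map prod_list.Cons mult.assoc[symmetric]) (simp add: mult.assoc)
  have 1: "T k * prod_list (map A [1..<k]) = prod_list (map A [1..<k]) * T k"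
    by (rule prod_list_commute) (use assms(2) in \<open>auto intro!: TA\<close>)
  have 2: "T k * prod_list (map A [Suc (Suc k)..<Suc N]) = prod_list (map A [Suc (Suc k)..<Suc N]) * T k"
    by (rule prod_list_commute) (use assms(2) in \<open>auto intro!: TA simp del: upt_Suc\<close>)
  have 3: "T k * (A (Suc k) * A k) = A (Suc k) * A k * T k"
    by (rule T_commute_pair[OF assms(2)]) (use assms in auto)
  have "T k * prod_list (map A [1..<Suc N]) = prod_list (map A [1..<k]) * (T k * (A (Suc k) * A k)) * prod_list (map A [Suc (Suc k)..<Suc N])"
    unfolding e mult.assoc[symmetric] 1 by (simp only: mult.assoc)
  also have "\<dots> = prod_list (map A [1..<k]) * (A (Suc k) * A k) * (T k * prod_list (map A [Suc (Suc k)..<Suc N]))"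
    unfolding 3 by (simp only: mult.assoc)
  finally show ?thesis unfolding e 2 by (simp only: mult.assoc)
qed

text \<open>The DAHA described by the T_i, the Y_i and the rotation \<open>rot\<close>, in the role
  of X_1 T_1 ... T_{N-1}. On functions of points \<open>rot\<close> is a mere change of variables,
  so its relations are easy to verify; X_1 is recovered as rot T_{N-1}^{-1} ... T_1^{-1}, and the
  DAHA relations are derived from here.\<close>

locale hecke_rotation = Y: hecke_family N T t t' Y
  for N and T :: "nat \<Rightarrow> 'r::ring_1" and t t' and Y :: "nat \<Rightarrow> 'r" +
  fixes rot rot' q q' :: 'r
  assumes N: "1 \<le> N" and YY: "i \<in> {1..N} \<Longrightarrow> j \<in> {1..N} \<Longrightarrow> Y i * Y j = Y j * Y i"
    and rot_inv: "rot * rot' = 1" "rot' * rot = 1"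
    and rot_T: "1 \<le> i \<Longrightarrow> Suc i < N \<Longrightarrow> rot * T i = T (Suc i) * rot"
    and rot2_T: "2 \<le> N \<Longrightarrow> rot * rot * T (N - 1) = T 1 * (rot * rot)"
    and rot_Y: "i \<in> {1..<N} \<Longrightarrow> rot * Y i = Y (Suc i) * rot"
    and rot_YN: "rot * Y N = q' * Y 1 * rot"
    and q_central: "q * x = x * q" and q'_central: "q' * x = x * q'" and qq': "q * q' = 1"
begin

definition "Xr i = Y.down 1 i * (rot * Y.downi 1 N) * Y.up 1 i"
definition "Xr' i = Y.downi 1 i * (Y.up 1 N * rot') * Y.upi 1 i"

lemma Xr1: "Xr 1 = rot * Y.downi 1 N"
  by (simp add: Xr_def)

lemma rot_Ti: "1 \<le> i \<Longrightarrow> Suc i < N \<Longrightarrow> rot * Y.Ti i = Y.Ti (Suc i) * rot"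
  using rot_T[of i] Y.t_central[of rot] Y.t'_central[of rot] by (simp add: Y.Ti_def algebra_simps)

sublocale X: hecke_family N T t t' Xr
proof (rule Y.hecke_familyI)
  show "Xr i = Y.down 1 i * Xr 1 * Y.up 1 i" for i by (simp add: Xr_def)
  fix i assume i: "2 \<le> i" "i < N"
  define k where "k = i - 1"
  have k: "i = Suc k" "1 \<le> k" "Suc k < N" using i by (auto simp: k_def)
  have "T i * Xr 1 = rot * (T k * Y.downi 1 N)"
    unfolding Xr1 k(1) mult.assoc[symmetric] rot_T[OF k(2,3), symmetric] ..
  also have "\<dots> = Xr 1 * T i"
    using Y.Ti_downi_shift[of 1 k N] k by (simp add: Xr1 mult.assoc)
  finally show "T i * Xr 1 = Xr 1 * T i" .
qed

lemma Xr_inv: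
  assumes "i \<in> {1..N}" shows "Xr i * Xr' i = 1" "Xr' i * Xr i = 1"
proof -
  note u = Y.up_inverse[of 1 i] Y.up_inverse[of 1 N]
  have r: "1 \<le> i" "i \<le> N" using assms by auto
  have "Xr i * Xr' i = Y.down 1 i * rot * (Y.downi 1 N * ((Y.up 1 i * Y.downi 1 i) * Y.up 1 N)) * rot' * Y.upi 1 i"
    by (simp only: Xr_def Xr'_def mult.assoc)
  also have "\<dots> = Y.down 1 i * (rot * rot') * Y.upi 1 i"
    using u r by (simp add: mult.assoc)
  finally show "Xr i * Xr' i = 1" using u r rot_inv by simp
  have "Xr' i * Xr i = Y.downi 1 i * Y.up 1 N * (rot' * ((Y.upi 1 i * Y.down 1 i) * rot)) * Y.downi 1 N * Y.up 1 i"
    by (simp only: Xr_def Xr'_def mult.assoc)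
  also have "\<dots> = Y.downi 1 i * (Y.up 1 N * Y.downi 1 N) * Y.up 1 i"
    using u r rot_inv by (simp add: mult.assoc)
  finally show "Xr' i * Xr i = 1" using u r by simp
qed

text \<open>For n = N - 1 the product in parentheses is the Hecke part of (X_1 T_1)^2 once both
  rotations have been moved to the left.\<close>

lemma two_downi:
  assumes "1 \<le> n" "n < N"
  shows "T n * (Y.downi 1 n * Y.downi 2 (Suc n)) = Y.downi 1 n * Y.downi 2 (Suc n) * T 1"
  using assms
proof (induction n rule: dec_induct)
  case base
  have "Y.downi 2 (Suc 1) = 1" by simp
  then show ?case by (simp del: Suc_1)
next
  case (step n)
  have c: "Y.Ti (Suc n) * Y.downi 1 n = Y.downi 1 n * Y.Ti (Suc n)"
    by (rule Y.commute_Ti, rule Y.commute_up(4)[symmetric]) (use step in \<open>auto intro!: Y.far'\<close>)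
  have b: "Y.Ti n * Y.Ti (Suc n) * T n = T (Suc n) * Y.Ti n * Y.Ti (Suc n)"
    using Y.braid_conj(3)[of n] step by simp
  let ?V = "Y.downi 1 n * Y.downi 2 (Suc n)"
  have e: "Y.downi 1 (Suc n) * Y.downi 2 (Suc (Suc n)) = Y.Ti n * Y.Ti (Suc n) * ?V"
    using step.hyps by (simp add: Y.up_Suc mult.assoc) (simp add: c flip: mult.assoc)
  have "T (Suc n) * (Y.downi 1 (Suc n) * Y.downi 2 (Suc (Suc n))) = (T (Suc n) * Y.Ti n * Y.Ti (Suc n)) * ?V"
    unfolding e by (simp only: mult.assoc)
  also have "\<dots> = Y.Ti n * Y.Ti (Suc n) * (T n * ?V)"
    unfolding b[symmetric] by (simp only: mult.assoc)
  also have "T n * ?V = ?V * T 1" using step by simp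
  finally show ?case unfolding e by (simp only: mult.assoc)
qed

lemma rot_downi:
  assumes "2 \<le> N" shows "Y.downi 2 N * rot = rot * Y.downi 1 (N - 1)"
proof -
  have "Y.downi 2 (Suc n) * rot = rot * Y.downi 1 n" if "1 \<le> n" "n < N" for n
    using that
  proof (induction n rule: dec_induct)
    case base
    have "Y.downi 2 (Suc 1) = 1" by simp
    then show ?case by (simp del: Suc_1)
  next
    case (step n)
    have IH: "Y.downi 2 (Suc n) * rot = rot * Y.downi 1 n" using step by simp
    have "Y.downi 2 (Suc (Suc n)) * rot = Y.Ti (Suc n) * (Y.downi 2 (Suc n) * rot)"
      using step.hyps by (simp add: Y.up_Suc mult.assoc)
    also have "\<dots> = (Y.Ti (Suc n) * rot) * Y.downi 1 n" unfolding IH by (simp only: mult.assoc)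
    also have "\<dots> = (rot * Y.Ti n) * Y.downi 1 n"
      using rot_Ti[of n] step.hyps step.prems by simp
    also have "\<dots> = rot * Y.downi 1 (Suc n)"
      using step.hyps by (simp add: Y.up_Suc mult.assoc)
    finally show ?case .
  qed
  from this[of "N - 1"] show ?thesis using assms by simp
qed

text \<open>X_1 X_2 = (X_1 T_1)^2 and X_2 X_1 = T_1 (X_1 T_1)^2 T_1^{-1}, so X_1 and X_2 commute
  exactly if T_1 commutes with (X_1 T_1)^2. Since X_1 T_1 = rot T_{N-1}^{-1} ... T_2^{-1}, this
  follows from rot^2 T_{N-1} = T_1 rot^2 and \<open>two_downi\<close>.\<close>

lemma XX:
  assumes "i \<in> {1..N}" "j \<in> {1..N}" shows "Xr i * Xr j = Xr j * Xr i"
proof (rule X.commute_from_first_two[OF _ assms])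
  assume N2: "2 \<le> N"
  have i: "1 \<in> {1..<N}" using N2 by auto
  let ?U = "Y.downi 2 N" and ?V = "Y.downi 1 (N - 1)"
  have XT: "Xr 1 * T 1 = rot * ?U"
    using Y.up_rec(4)[of 1 N] N2 Y.Ti_T[OF i] by (simp add: Xr1 mult.assoc)
  have "T 1 * ((rot * ?U) * (rot * ?U)) = (T 1 * (rot * rot)) * (?V * ?U)"
    by (simp add: mult.assoc) (simp add: mult.assoc[of ?U, symmetric] rot_downi[OF N2] mult.assoc)
  also have "\<dots> = rot * rot * (T (N - 1) * (?V * ?U))"
    unfolding rot2_T[OF N2, symmetric] by (simp only: mult.assoc)
  also have "T (N - 1) * (?V * ?U) = ?V * ?U * T 1"
    using two_downi[of "N - 1"] N2 by simp
  also have "rot * rot * (?V * ?U * T 1) = rot * (rot * ?V) * ?U * T 1" by (simp only: mult.assoc)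
  also have "\<dots> = ((rot * ?U) * (rot * ?U)) * T 1"
    unfolding rot_downi[OF N2, symmetric] by (simp only: mult.assoc)
  finally have c: "T 1 * ((Xr 1 * T 1) * (Xr 1 * T 1)) = ((Xr 1 * T 1) * (Xr 1 * T 1)) * T 1"
    unfolding XT .
  have X2: "Xr 2 = T 1 * Xr 1 * T 1" using X.TAT[OF i] by simp
  have "Xr 2 * Xr 1 = (T 1 * ((Xr 1 * T 1) * (Xr 1 * T 1))) * Y.Ti 1"
    unfolding X2 by (simp add: mult.assoc Y.T_Ti[OF i])
  also have "\<dots> = Xr 1 * Xr 2"
    unfolding c X2 by (simp add: mult.assoc Y.T_Ti[OF i])
  finally show "Xr 1 * Xr 2 = Xr 2 * Xr 1" ..
qed

sublocale cross: hecke_cross N T t t' Xr Y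
proof
  assume N2: "2 \<le> N"
  have i: "1 \<in> {1..<N}" using N2 by auto
  have Y2: "Y 2 = T 1 * Y 1 * T 1" using Y.TAT[OF i] by simp
  have X1: "Xr 1 = rot * Y.downi 2 N * Y.Ti 1"
    using Y.up_rec(4)[of 1 N] N2 by (simp add: Xr1 mult.assoc)
  have c: "Y.downi 2 N * Y 1 = Y 1 * Y.downi 2 N"
    using Y.commute_above(4)[of 1 2 N] N2 by simp
  have "Xr 1 * Y 2 = rot * (Y.downi 2 N * Y 1) * T 1"
    unfolding X1 Y2 by (simp add: mult.assoc Y.Ti_T_l[OF i])
  also have "\<dots> = (rot * Y 1) * Y.downi 2 N * T 1" unfolding c by (simp only: mult.assoc)
  also have "\<dots> = Y 2 * Xr 1 * (T 1 * T 1)"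
    using rot_Y[OF i] by (simp add: X1 mult.assoc Y.Ti_T_l[OF i])
  finally show "Xr 1 * Y 2 = Y 2 * Xr 1 * (T 1 * T 1)" .
qed

text \<open>The derivation of Y_1 X_1 = q X_1 J_N Y_1 run backwards: this identity comes from rot
  Y_N = q^{-1} Y_1 rot, and multiplication by X_2 ... X_N cancels J_N. The T_i commute with the full
  product, which gives the other Y_i.\<close>

lemma Y_Xprod:
  assumes "i \<in> {1..N}"
  shows "Y i * prod_list (map Xr [1..<Suc N]) = q * prod_list (map Xr [1..<Suc N]) * Y i"
proof -
  let ?X = "prod_list (map Xr [1..<Suc N])" and ?L = "Y.up 1 N * Y.down 1 N"
  note u = Y.up_inverse[of 1 N]
  have "q * (rot * Y N) = (q * q') * Y 1 * rot" unfolding rot_YN by (simp only: mult.assoc)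
  then have Yrot: "Y 1 * rot = q * (rot * Y N)" using qq' by simp
  have YN: "Y N * Y.downi 1 N = Y.down 1 N * Y 1"
    using Y.A_down_up[of 1 N] N u by (simp add: mult.assoc)
  have "Y 1 * Xr 1 = (Y 1 * rot) * Y.downi 1 N" by (simp add: Xr1 mult.assoc)
  also have "\<dots> = q * rot * (Y N * Y.downi 1 N)" unfolding Yrot by (simp only: mult.assoc)
  also have "\<dots> = q * rot * (Y.downi 1 N * Y.up 1 N) * Y.down 1 N * Y 1"
    unfolding YN using u by (simp add: mult.assoc)
  also have "\<dots> = q * Xr 1 * ?L * Y 1" by (simp only: Xr1 mult.assoc)
  finally have Y1X1: "Y 1 * Xr 1 = q * Xr 1 * ?L * Y 1" .
  have split: "?X = Xr 1 * cross.Xs 2 (Suc N)"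
    using N upt_conv_Cons[of 1 "Suc N"] by (simp add: cross.Xs_def del: upt_Suc)
  have LL: "?L * (Y.upi 1 N * Y.downi 1 N) = 1"
    using u by (simp add: mult.assoc) (simp flip: mult.assoc)
  have s: "?L * (Y 1 * cross.Xs 2 (Suc N)) = cross.Xs 2 (Suc N) * Y 1"
    using cross.Y1_Xs[OF XX N order_refl] LL by (simp flip: mult.assoc)
  have "Y 1 * ?X = (Y 1 * Xr 1) * cross.Xs 2 (Suc N)" unfolding split by (simp only: mult.assoc)
  also have "\<dots> = q * Xr 1 * (?L * (Y 1 * cross.Xs 2 (Suc N)))" unfolding Y1X1 by (simp only: mult.assoc)
  also have "\<dots> = q * ?X * Y 1" unfolding s split by (simp only: mult.assoc)
  finally have base: "Y 1 * ?X = q * ?X * Y 1" .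
  have "1 \<le> i" "i \<le> N" using assms by auto
  then show ?thesis
  proof (induction i rule: dec_induct)
    case (step i)
    then have i: "i \<in> {1..<N}" by auto
    have c: "T i * ?X = ?X * T i" by (rule X.T_commute_prod[OF XX i])
    have IH: "Y i * ?X = q * ?X * Y i" using step by simp
    have "Y (Suc i) * ?X = T i * (Y i * ?X) * T i"
      unfolding Y.TAT[OF i, symmetric] by (simp only: mult.assoc c)
    also have "\<dots> = (T i * q) * ?X * Y i * T i" unfolding IH by (simp only: mult.assoc)
    also have "\<dots> = q * (T i * ?X) * Y i * T i" unfolding q_central[symmetric] by (simp only: mult.assoc)
    also have "\<dots> = q * ?X * Y (Suc i)" unfolding c Y.TAT[OF i, symmetric] by (simp only: mult.assoc)
    finally show ?case .
  qed (rule base)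
qed

text \<open>\<open>rot\<close> carries Y_1, ..., Y_{N-1} to Y_2, ..., Y_N and Y_N to q^{-1} Y_1,
  hence commutes with the full product up to q^{-1}; the T_i commute with it outright.\<close>

lemma X_Yprod:
  assumes "i \<in> {1..N}"
  shows "Xr i * prod_list (map Y [1..<Suc N]) = q' * prod_list (map Y [1..<Suc N]) * Xr i"
proof -
  let ?Y = "prod_list (map Y [1..<Suc N])"
  have c: "T k * ?Y = ?Y * T k" if "k \<in> {1..<N}" for k by (rule Y.T_commute_prod[OF YY that])
  have rY: "rot * prod_list (map Y [1..<Suc n]) = prod_list (map Y [2..<Suc (Suc n)]) * rot" if "n < N" for n
    using that
  proof (induction n)
    case (Suc n)
    have "rot * prod_list (map Y [1..<Suc (Suc n)]) = (rot * prod_list (map Y [1..<Suc n])) * Y (Suc n)"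
      by (simp add: mult.assoc)
    also have "\<dots> = prod_list (map Y [2..<Suc (Suc n)]) * (rot * Y (Suc n))"
      using Suc by (simp only: mult.assoc Suc_lessD)
    also have "\<dots> = prod_list (map Y [2..<Suc (Suc (Suc n))]) * rot"
      using rot_Y[of "Suc n"] Suc.prems by (simp add: mult.assoc)
    finally show ?case .
  qed simp
  have "rot * ?Y = (rot * prod_list (map Y [1..<N])) * Y N" using N by (simp add: mult.assoc)
  also have "rot * prod_list (map Y [1..<N]) = prod_list (map Y [2..<Suc N]) * rot"
    using rY[of "N - 1"] N by simp
  also have "prod_list (map Y [2..<Suc N]) * rot * Y N = prod_list (map Y [2..<Suc N]) * (q' * Y 1) * rot"
    by (simp only: mult.assoc rot_YN)
  also have "prod_list (map Y [2..<Suc N]) * (q' * Y 1) = q' * (Y 1 * prod_list (map Y [2..<Suc N]))"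
  proof -
    have "Y 1 * prod_list (map Y [2..<Suc N]) = prod_list (map Y [2..<Suc N]) * Y 1"
      by (rule prod_list_commute) (use N YY in \<open>auto simp del: upt_Suc\<close>)
    then show ?thesis unfolding q'_central by (simp only: mult.assoc)
  qed
  also have "Y 1 * prod_list (map Y [2..<Suc N]) = ?Y"
    using N upt_conv_Cons[of 1 "Suc N"] by (simp del: upt_Suc)
  finally have rot: "rot * ?Y = q' * ?Y * rot" .
  have d: "Y.downi 1 N * ?Y = ?Y * Y.downi 1 N"
    by (rule Y.commute_up(4)) (use c in auto)
  have base: "Xr 1 * ?Y = q' * ?Y * Xr 1"
    unfolding Xr1 mult.assoc d unfolding mult.assoc[symmetric] rot ..
  have "1 \<le> i" "i \<le> N" using assms by auto
  then show ?thesis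
  proof (induction i rule: dec_induct)
    case (step i)
    then have i: "i \<in> {1..<N}" by auto
    have IH: "Xr i * ?Y = q' * ?Y * Xr i" using step by simp
    have "Xr (Suc i) * ?Y = T i * (Xr i * ?Y) * T i"
      unfolding X.TAT[OF i, symmetric] by (simp only: mult.assoc c[OF i])
    also have "\<dots> = (T i * q') * ?Y * Xr i * T i" unfolding IH by (simp only: mult.assoc)
    also have "\<dots> = q' * (T i * ?Y) * Xr i * T i" unfolding q'_central[symmetric] by (simp only: mult.assoc)
    also have "\<dots> = q' * ?Y * Xr (Suc i)" unfolding c[OF i] X.TAT[OF i, symmetric] by (simp only: mult.assoc)
    finally show ?case .
  qed (rule base)
qed

end

subsection \<open>Operators on functions\<close>

definition linear_map :: "(('p \<Rightarrow> 'r) \<Rightarrow> 'p \<Rightarrow> 'r::comm_ring_1) \<Rightarrow> bool" where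
  "linear_map F \<longleftrightarrow> (\<forall>k u v p. F (\<lambda>p. k * u p + v p) p = k * F u p + F v p)"

lemma linear_mapD: "linear_map F \<Longrightarrow> F (\<lambda>p. k * u p + v p) p = k * F u p + F v p"
  unfolding linear_map_def by blast

lemma linear_mapI: "(\<And>k u v p. F (\<lambda>p. k * u p + v p) p = k * F u p + F v p) \<Longrightarrow> linear_map F"
  unfolding linear_map_def by blast

lemma linear_mapD': "linear_map F \<Longrightarrow> F (\<lambda>p. k * u p + v p) = (\<lambda>p. k * F u p + F v p)"
  by (rule ext) (rule linear_mapD)

lemma linear_map_add: "linear_map F \<Longrightarrow> F (\<lambda>p. u p + v p) = (\<lambda>p. F u p + F v p)"
  using linear_mapD'[of F 1 u v] by simp

context
  fixes F G :: "('p \<Rightarrow> 'r) \<Rightarrow> 'p \<Rightarrow> 'r::comm_ring_1"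
  assumes F: "linear_map F" and G: "linear_map G"
begin

lemma linear_map_plus: "linear_map (\<lambda>u p. F u p + G u p)"
proof (rule linear_mapI)
  fix k u v p
  show "F (\<lambda>p. k * u p + v p) p + G (\<lambda>p. k * u p + v p) p = k * (F u p + G u p) + (F v p + G v p)"
    unfolding linear_mapD[OF F] linear_mapD[OF G] by (simp add: algebra_simps)
qed

lemma linear_map_minus: "linear_map (\<lambda>u p. F u p - G u p)"
proof (rule linear_mapI)
  fix k u v p
  show "F (\<lambda>p. k * u p + v p) p - G (\<lambda>p. k * u p + v p) p = k * (F u p - G u p) + (F v p - G v p)"
    unfolding linear_mapD[OF F] linear_mapD[OF G] by (simp add: algebra_simps)
qed

lemma linear_map_uminus: "linear_map (\<lambda>u p. - F u p)"
proof (rule linear_mapI)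
  fix k u v p
  show "- F (\<lambda>p. k * u p + v p) p = k * - F u p + - F v p"
    unfolding linear_mapD[OF F] by (simp add: algebra_simps)
qed

lemma linear_map_times: "linear_map (\<lambda>u. F (G u))"
  by (rule linear_mapI) (unfold linear_mapD'[OF G], rule linear_mapD[OF F])

end

text \<open>Additivity of the maps gives left distributivity, and homogeneity makes multiplication
  by a constant central in the operator ring.\<close>

typedef (overloaded) ('p, 'r) oper = "{F :: ('p \<Rightarrow> 'r::comm_ring_1) \<Rightarrow> 'p \<Rightarrow> 'r. linear_map F}"
  morphisms app Oper
  by (rule exI[of _ "\<lambda>u. u"]) (simp add: linear_map_def)

setup_lifting type_definition_oper

instantiation oper :: (type, comm_ring_1) ring_1
begin

lift_definition zero_oper :: "('a, 'b) oper" is "\<lambda>_ _. 0" by (rule linear_mapI) simp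
lift_definition one_oper :: "('a, 'b) oper" is "\<lambda>u. u" by (rule linear_mapI) simp
lift_definition plus_oper :: "('a, 'b) oper \<Rightarrow> ('a, 'b) oper \<Rightarrow> ('a, 'b) oper"
  is "\<lambda>F G u p. F u p + G u p" by (rule linear_map_plus)
lift_definition minus_oper :: "('a, 'b) oper \<Rightarrow> ('a, 'b) oper \<Rightarrow> ('a, 'b) oper"
  is "\<lambda>F G u p. F u p - G u p" by (rule linear_map_minus)
lift_definition uminus_oper :: "('a, 'b) oper \<Rightarrow> ('a, 'b) oper"
  is "\<lambda>F u p. - F u p" by (rule linear_map_uminus)
lift_definition times_oper :: "('a, 'b) oper \<Rightarrow> ('a, 'b) oper \<Rightarrow> ('a, 'b) oper"
  is "\<lambda>F G u. F (G u)" by (rule linear_map_times)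

instance
proof
  fix a b c :: "('a, 'b) oper"
  show "a * b * c = a * (b * c)" "1 * a = a" "a * 1 = a" "a + b + c = a + (b + c)" "a + b = b + a"
    "0 + a = a" "- a + a = 0" "a - b = a + - b" "(a + b) * c = a * c + b * c"
    by (transfer, simp add: add_ac)+
  show "a * (b + c) = a * b + a * c"
    by transfer (simp add: linear_map_add)
  show "(0::('a, 'b) oper) \<noteq> 1"
  proof transfer
    have "(\<lambda>_. 0::'b) \<noteq> (\<lambda>_::'a. 1)" by (simp add: fun_eq_iff)
    then show "(\<lambda>_ _. 0) \<noteq> (\<lambda>u::'a \<Rightarrow> 'b. u)" by metis
  qed
qed

end

lemma app_simps [simp]:
  "app 0 u = (\<lambda>p. 0)" "app 1 u = u" "app (F + G) u = (\<lambda>p. app F u p + app G u p)"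
  "app (F - G) u = (\<lambda>p. app F u p - app G u p)" "app (F * G) u = app F (app G u)"
  by (simp_all add: zero_oper.rep_eq one_oper.rep_eq plus_oper.rep_eq minus_oper.rep_eq times_oper.rep_eq)

lemma oper_eqI: "(\<And>u p. app F u p = app G u p) \<Longrightarrow> F = G"
  by (metis app_inject ext)

lift_definition mulop :: "('p \<Rightarrow> 'r::comm_ring_1) \<Rightarrow> ('p, 'r) oper" is "\<lambda>g u p. g p * u p"
  by (simp add: linear_map_def algebra_simps)

lift_definition moveop :: "('p \<Rightarrow> 'p) \<Rightarrow> ('p, 'r::comm_ring_1) oper" is "\<lambda>\<phi> u p. u (\<phi> p)"
  by (simp add: linear_map_def)

lemma app_mulop [simp]: "app (mulop g) u p = g p * u p" by transfer simp
lemma app_moveop [simp]: "app (moveop \<phi>) u p = u (\<phi> p)" by transfer simp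

lemma app_scale: "app F (\<lambda>p. k * u p) = (\<lambda>p. k * app F u p)"
proof -
  have lin: "app F (\<lambda>p. k * u p + v p) = (\<lambda>p. k * app F u p + app F v p)" for k u v
    using linear_mapD'[of "app F"] app[of F] by blast
  have "app F (\<lambda>p. 0) = (\<lambda>p. 0)"
    using lin[of "- 1" u u] by simp
  then show ?thesis using lin[of k u "\<lambda>p. 0"] by simp
qed

lemma mulop_central: "mulop (\<lambda>_. k) * F = F * mulop (\<lambda>_. k)"
proof (rule oper_eqI)
  fix u p
  have "app (mulop (\<lambda>_. k)) u = (\<lambda>p. k * u p)" for u :: "'a \<Rightarrow> 'b" by (rule ext) simp
  then show "app (mulop (\<lambda>_. k) * F) u p = app (F * mulop (\<lambda>_. k)) u p"
    by (simp add: app_scale)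
qed

lemma rhom_mulop: "rhom f \<Longrightarrow> rhom (\<lambda>k. mulop (\<lambda>_::'p. f k))"
  unfolding rhom_def by (auto intro!: oper_eqI simp: algebra_simps)

subsection \<open>Points\<close>

text \<open>
  The \<open>i\<close>-th coordinate \<open>(j, k)\<close> of a point stands for the value \<open>q\<^sup>k \<xi>\<^sub>j\<close> of \<open>Y\<^sub>i\<close>, where the
  \<open>\<xi>\<^sub>j\<close> are independent.
\<close>

typedef point = "{p :: nat \<Rightarrow> nat \<times> int. inj (\<lambda>i. fst (p i))}"
  morphisms coord Point
  by (rule exI[of _ "\<lambda>i. (i, 0)"]) (simp add: inj_def)

setup_lifting type_definition_point

lemma fst_coord_eq [simp]: "fst (coord p i) = fst (coord p j) \<longleftrightarrow> i = j"
  using coord[of p] by (auto simp: inj_def)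

lemma point_eqI: "(\<And>i. coord p i = coord p' i) \<Longrightarrow> p = p'"
  by (metis coord_inject ext)

definition tr :: "nat \<Rightarrow> nat \<Rightarrow> nat" where
  "tr i j = (if j = i then Suc i else if j = Suc i then i else j)"

lemma tr_tr [simp]: "tr i (tr i j) = j" by (simp add: tr_def)

definition cyc :: "nat \<Rightarrow> nat \<Rightarrow> nat" where
  "cyc N j = (if 1 \<le> j \<and> j < N then Suc j else if 1 \<le> N \<and> j = N then 1 else j)"
definition cyci :: "nat \<Rightarrow> nat \<Rightarrow> nat" where
  "cyci N j = (if 1 < j \<and> j \<le> N then j - 1 else if 1 \<le> N \<and> j = 1 then N else j)"

lemma cyc_cyci: "cyci N (cyc N j) = j" "cyc N (cyci N j) = j"
  by (auto simp: cyc_def cyci_def)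

lemma inj_reindex:
  fixes p :: "nat \<Rightarrow> nat \<times> int"
  assumes "inj (\<lambda>i. fst (p i))" "\<And>j. g (f j) = j" "\<And>j. fst (p' j) = fst (p (f j))"
  shows "inj (\<lambda>j. fst (p' j))"
  unfolding assms(3) by (rule injI) (metis assms(1,2) injD)

lift_definition swap :: "nat \<Rightarrow> point \<Rightarrow> point" is "\<lambda>i p. p \<circ> tr i"
  subgoal for i p
    by (rule inj_reindex[where p = p and f = "tr i" and g = "tr i"]) (simp_all add: o_def)
  done

text \<open>The first coordinate moves to place N with its exponent lowered by 1, which is what
  makes Y_N pick up q^{-1} when the rotation passes it.\<close>

lift_definition rotate :: "nat \<Rightarrow> point \<Rightarrow> point" is
  "\<lambda>N p j. if 1 \<le> j \<and> j < N then p (Suc j) else if 1 \<le> N \<and> j = N then (fst (p 1), snd (p 1) - 1) else p j"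
  subgoal for N p
    by (rule inj_reindex[where p = p and f = "cyc N" and g = "cyci N"], assumption, rule cyc_cyci) (simp add: cyc_def)
  done

lift_definition rotate_back :: "nat \<Rightarrow> point \<Rightarrow> point" is
  "\<lambda>N p j. if 1 < j \<and> j \<le> N then p (j - 1) else if 1 \<le> N \<and> j = 1 then (fst (p N), snd (p N) + 1) else p j"
  subgoal for N p
    by (rule inj_reindex[where p = p and f = "cyci N" and g = "cyc N"], assumption, rule cyc_cyci) (simp add: cyci_def)
  done

lift_definition shift :: "nat \<Rightarrow> int \<Rightarrow> point \<Rightarrow> point" is
  "\<lambda>i k p. p(i := (fst (p i), snd (p i) + k))"
  subgoal for i k p
    by (rule inj_reindex[where p = p and f = "\<lambda>j. j" and g = "\<lambda>j. j"]) simp_all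
  done

lemma coord_simps:
  "coord (swap i p) j = coord p (tr i j)"
  "coord (rotate N p) j = (if 1 \<le> j \<and> j < N then coord p (Suc j)
     else if 1 \<le> N \<and> j = N then (fst (coord p 1), snd (coord p 1) - 1) else coord p j)"
  "coord (rotate_back N p) j = (if 1 < j \<and> j \<le> N then coord p (j - 1)
     else if 1 \<le> N \<and> j = 1 then (fst (coord p N), snd (coord p N) + 1) else coord p j)"
  "coord (shift i k p) j = (if j = i then (fst (coord p i), snd (coord p i) + k) else coord p j)"
  by (simp_all add: swap.rep_eq rotate.rep_eq rotate_back.rep_eq shift.rep_eq)

lemma swap_swap: "swap i (swap i p) = p"
  by (rule point_eqI) (simp add: coord_simps)

lemma rotate_inverse: "rotate N (rotate_back N p) = p" "rotate_back N (rotate N p) = p"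
  by (rule point_eqI, auto simp: coord_simps)+

subsection \<open>Demazure--Lusztig operators\<close>

text \<open>\<open>\<alpha> a b\<close> plays the role of \<open>y\<^sub>b / (y\<^sub>b - y\<^sub>a)\<close>.\<close>

locale polynomial_rep =
  fixes y yi :: "nat \<times> int \<Rightarrow> 'r::comm_ring_1" and \<alpha> :: "nat \<times> int \<Rightarrow> nat \<times> int \<Rightarrow> 'r" and t t' q q' :: 'r and N :: nat
  assumes N: "1 \<le> N" and tt': "t * t' = 1" and qq': "q * q' = 1"
    and y_inverse: "y a * yi a = 1"
    and y_shift: "y (j, k - 1) = q' * y (j, k)"
    and \<alpha>_y: "fst a \<noteq> fst b \<Longrightarrow> (y b - y a) * \<alpha> a b = y b"
    and \<alpha>_sym: "fst a \<noteq> fst b \<Longrightarrow> \<alpha> b a = 1 - \<alpha> a b"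
    and \<alpha>_shift: "\<alpha> (i, m - 1) (j, n - 1) = \<alpha> (i, m) (j, n)"
    and \<alpha>_three: "fst a \<noteq> fst b \<Longrightarrow> fst b \<noteq> fst d \<Longrightarrow> fst a \<noteq> fst d \<Longrightarrow>
      \<alpha> a b * \<alpha> b d = \<alpha> a d * (\<alpha> a b + \<alpha> b d - 1)"
begin

text \<open>With T_i = a + b s_i, the coefficient a is forced by T_i Y_i = Y_{i+1} T_i^{-1}, which
  requires (y_{i+1} - y_i) a = (t - t^{-1}) y_{i+1}. The choice b = t - a makes T_i act by t on
  functions invariant under s_i.\<close>

definition "acf i p = (t - t') * \<alpha> (coord p i) (coord p (Suc i))"
definition "bcf i p = t - acf i p"
definition Top :: "nat \<Rightarrow> (point, 'r) oper" where
  "Top i = mulop (acf i) + mulop (bcf i) * moveop (swap i)"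
definition Yop :: "nat \<Rightarrow> (point, 'r) oper" where "Yop i = mulop (\<lambda>p. y (coord p i))"
definition Yiop :: "nat \<Rightarrow> (point, 'r) oper" where "Yiop i = mulop (\<lambda>p. yi (coord p i))"
definition sc :: "'r \<Rightarrow> (point, 'r) oper" where "sc k = mulop (\<lambda>_. k)"

lemma app_Top: "app (Top i) u p = acf i p * u p + bcf i p * u (swap i p)"
  by (simp add: Top_def)

lemma acf_swap: "acf i (swap i p) = (t - t') - acf i p"
proof -
  have "\<alpha> (coord p (Suc i)) (coord p i) = 1 - \<alpha> (coord p i) (coord p (Suc i))" by (rule \<alpha>_sym) simp
  then have "acf i (swap i p) = (t - t') * (1 - \<alpha> (coord p i) (coord p (Suc i)))"
    by (simp add: acf_def coord_simps tr_def)
  then show ?thesis by (simp add: acf_def algebra_simps)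
qed

lemma bcf_swap: "bcf i (swap i p) = t' + acf i p"
  by (simp add: bcf_def acf_swap)

lemma Top_quad: "(Top i - sc t) * (Top i + sc t') = 0"
proof (rule oper_eqI)
  fix u p
  have "app ((Top i - sc t) * (Top i + sc t')) u p
    = (acf i p - t) * ((acf i p + t') * u p + bcf i p * u (swap i p))
      + bcf i p * ((acf i (swap i p) + t') * u (swap i p) + bcf i (swap i p) * u p)"
    by (simp add: app_Top sc_def swap_swap algebra_simps)
  also have "\<dots> = 0" unfolding acf_swap bcf_swap unfolding bcf_def by (simp add: algebra_simps)
  finally show "app ((Top i - sc t) * (Top i + sc t')) u p = app 0 u p" by simp
qed

lemma Top_far:
  assumes "i + 2 \<le> j" shows "Top i * Top j = Top j * Top i"
proof (rule oper_eqI)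
  fix u p
  have s: "swap i (swap j p) = swap j (swap i p)"
    by (rule point_eqI) (use assms in \<open>auto simp: coord_simps tr_def\<close>)
  have a: "acf i (swap j p) = acf i p" "acf j (swap i p) = acf j p" "bcf i (swap j p) = bcf i p" "bcf j (swap i p) = bcf j p"
    using assms by (simp_all add: acf_def bcf_def coord_simps tr_def)
  show "app (Top i * Top j) u p = app (Top j * Top i) u p"
    by (simp add: app_Top a s algebra_simps)
qed

text \<open>Both sides combine the six values of \<open>u\<close> at permutations of three
  coordinates. The coefficients at the two 3-cycles and at the longest permutation agree by
  commutativity; the other three differ by multiples of A B - C (A + B - (t - t')), which vanishes
  by \<open>\<alpha>_three\<close>.\<close>

lemma Top_braid: "Top i * Top (Suc i) * Top i = Top (Suc i) * Top i * Top (Suc i)"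
proof (rule oper_eqI)
  fix u p
  let ?x = "coord p i" and ?y = "coord p (Suc i)" and ?z = "coord p (Suc (Suc i))"
  let ?s = "swap i" and ?r = "swap (Suc i)" and ?c = "t - t'"
  define A B C where "A = ?c * \<alpha> ?x ?y" and "B = ?c * \<alpha> ?y ?z" and "C = ?c * \<alpha> ?x ?z"
  have ne: "fst ?x \<noteq> fst ?y" "fst ?y \<noteq> fst ?z" "fst ?x \<noteq> fst ?z" by simp_all
  have sym: "?c * \<alpha> ?y ?x = ?c - A" "?c * \<alpha> ?z ?y = ?c - B" "?c * \<alpha> ?z ?x = ?c - C"
    unfolding A_def B_def C_def \<alpha>_sym[OF ne(1)] \<alpha>_sym[OF ne(2)] \<alpha>_sym[OF ne(3)]
    by (simp_all only: right_diff_distrib mult_1_right)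
  have three: "A * B = C * (A + B - ?c)"
  proof -
    have "A * B = ?c * ?c * (\<alpha> ?x ?y * \<alpha> ?y ?z)" by (simp only: A_def B_def mult_ac)
    also have "\<dots> = C * (A + B - ?c)"
      unfolding \<alpha>_three[OF ne] A_def B_def C_def by (simp add: algebra_simps)
    finally show ?thesis .
  qed
  have st: "?s (?r (?s p)) = ?r (?s (?r p))"
    by (rule point_eqI) (auto simp: coord_simps tr_def)
  have co: "acf i p = A" "acf (Suc i) p = B"
    "acf i (?r p) = C" "acf (Suc i) (?s p) = C" "acf i (?s p) = ?c - A" "acf (Suc i) (?r p) = ?c - B"
    "acf i (?r (?s p)) = B" "acf (Suc i) (?s (?r p)) = A"
    "acf i (?s (?r p)) = ?c - C" "acf (Suc i) (?r (?s p)) = ?c - C"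
    using sym by (simp_all add: acf_def coord_simps tr_def A_def B_def C_def)
  have L: "app (Top i * Top (Suc i) * Top i) u p =
      A * (B * (A * u p + bcf i p * u (?s p)) + bcf (Suc i) p * (C * u (?r p) + bcf i (?r p) * u (?s (?r p))))
    + bcf i p * (C * ((?c - A) * u (?s p) + bcf i (?s p) * u p)
        + bcf (Suc i) (?s p) * (B * u (?r (?s p)) + bcf i (?r (?s p)) * u (?s (?r (?s p)))))"
    by (simp only: app_simps app_Top co swap_swap)
  have R: "app (Top (Suc i) * Top i * Top (Suc i)) u p =
      B * (A * (B * u p + bcf (Suc i) p * u (?r p)) + bcf i p * (C * u (?s p) + bcf (Suc i) (?s p) * u (?r (?s p))))
    + bcf (Suc i) p * (C * ((?c - B) * u (?r p) + bcf (Suc i) (?r p) * u p)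
        + bcf i (?r p) * (A * u (?s (?r p)) + bcf (Suc i) (?s (?r p)) * u (?r (?s (?r p)))))"
    by (simp only: app_simps app_Top co swap_swap)
  have id: "A * B * A + bcf i p * C * bcf i (?s p) = B * A * B + bcf (Suc i) p * C * bcf (Suc i) (?r p)"
  proof -
    have "(A * B * A + bcf i p * C * bcf i (?s p)) - (B * A * B + bcf (Suc i) p * C * bcf (Suc i) (?r p))
      = (A - B) * (A * B - C * (A + B - ?c))"
      unfolding bcf_def co by (simp add: algebra_simps)
    then show ?thesis unfolding three by simp
  qed
  have s1: "A * B * bcf i p + bcf i p * C * (?c - A) = B * bcf i p * C"
  proof -
    have "A * B * bcf i p + bcf i p * C * (?c - A) - B * bcf i p * C = bcf i p * (A * B - C * (A + B - ?c))"
      by (simp add: algebra_simps)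
    then show ?thesis unfolding three by simp
  qed
  have s2: "A * bcf (Suc i) p * C = B * A * bcf (Suc i) p + bcf (Suc i) p * C * (?c - B)"
  proof -
    have "B * A * bcf (Suc i) p + bcf (Suc i) p * C * (?c - B) - A * bcf (Suc i) p * C = bcf (Suc i) p * (A * B - C * (A + B - ?c))"
      by (simp add: algebra_simps)
    then show ?thesis unfolding three by simp
  qed
  have l: "bcf i p * bcf (Suc i) (?s p) * bcf i (?r (?s p)) = bcf (Suc i) p * bcf i (?r p) * bcf (Suc i) (?s (?r p))"
    unfolding bcf_def co by (simp add: algebra_simps)
  have "app (Top i * Top (Suc i) * Top i) u p =
     (A * B * A + bcf i p * C * bcf i (?s p)) * u p + (A * B * bcf i p + bcf i p * C * (?c - A)) * u (?s p)
     + (A * bcf (Suc i) p * C) * u (?r p) + A * bcf (Suc i) p * bcf i (?r p) * u (?s (?r p))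
     + bcf i p * bcf (Suc i) (?s p) * B * u (?r (?s p))
     + (bcf i p * bcf (Suc i) (?s p) * bcf i (?r (?s p))) * u (?s (?r (?s p)))"
    unfolding L by (simp only: distrib_left distrib_right mult.assoc add_ac)
  also have "\<dots> = app (Top (Suc i) * Top i * Top (Suc i)) u p"
    unfolding id s1 s2 l st R by (simp only: distrib_left distrib_right mult_ac add_ac)
  finally show "app (Top i * Top (Suc i) * Top i) u p = app (Top (Suc i) * Top i * Top (Suc i)) u p" .
qed

lemma Top_Yop: "Top i * Yop i = Yop (Suc i) * (Top i - sc t + sc t')"
proof (rule oper_eqI)
  fix u p
  let ?a = "coord p i" and ?b = "coord p (Suc i)"
  have "(y ?b - y ?a) * acf i p = (t - t') * y ?b"
    using \<alpha>_y[of ?a ?b] by (simp add: acf_def mult.left_commute)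
  then have e: "acf i p * y ?a = y ?b * (acf i p - t + t')" by (simp add: algebra_simps)
  have "app (Top i * Yop i) u p = (acf i p * y ?a) * u p + bcf i p * (y ?b * u (swap i p))"
    by (simp add: app_Top Yop_def coord_simps tr_def)
  also have "\<dots> = app (Yop (Suc i) * (Top i - sc t + sc t')) u p"
    unfolding e by (simp add: app_Top Yop_def sc_def algebra_simps)
  finally show "app (Top i * Yop i) u p = app (Yop (Suc i) * (Top i - sc t + sc t')) u p" .
qed

lemma sc_simps: "sc a * sc b = sc (a * b)" "sc 1 = 1" "sc a + sc b = sc (a + b)"
  by (auto intro!: oper_eqI simp: sc_def algebra_simps)

definition "rotop = (moveop (rotate N) :: (point, 'r) oper)"
definition "rotiop = (moveop (rotate_back N) :: (point, 'r) oper)"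

lemma rot_rels:
  "rotop * rotiop = 1" "rotiop * rotop = 1"
  "1 \<le> i \<Longrightarrow> Suc i < N \<Longrightarrow> rotop * Top i = Top (Suc i) * rotop"
  "2 \<le> N \<Longrightarrow> rotop * rotop * Top (N - 1) = Top 1 * (rotop * rotop)"
  "i \<in> {1..<N} \<Longrightarrow> rotop * Yop i = Yop (Suc i) * rotop"
  "rotop * Yop N = sc q' * Yop 1 * rotop"
proof -
  show "rotop * rotiop = 1" "rotiop * rotop = 1"
    by (auto intro!: oper_eqI simp: rotop_def rotiop_def rotate_inverse)
  show "rotop * Top i = Top (Suc i) * rotop" if i: "1 \<le> i" "Suc i < N"
  proof (rule oper_eqI)
    fix u p
    have "acf i (rotate N p) = acf (Suc i) p" using i by (simp add: acf_def coord_simps)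
    moreover have "swap i (rotate N p) = rotate N (swap (Suc i) p)"
      by (rule point_eqI) (use i in \<open>auto simp: coord_simps tr_def\<close>)
    ultimately show "app (rotop * Top i) u p = app (Top (Suc i) * rotop) u p"
      by (simp add: app_Top rotop_def bcf_def)
  qed
  show "rotop * rotop * Top (N - 1) = Top 1 * (rotop * rotop)" if N2: "2 \<le> N"
  proof (rule oper_eqI)
    fix u p
    \<comment> \<open>Two rotations bring the first two coordinates to the places N - 1 and N with
      both exponents lowered by one, and \<open>\<alpha>\<close> is invariant under such a
      simultaneous shift. For N = 2 these are all the rotated coordinates.\<close>
    have "acf (N - 1) (rotate N (rotate N p)) = acf 1 p"
      using N2 \<alpha>_shift[of "fst (coord p 1)" "snd (coord p 1)" "fst (coord p 2)" "snd (coord p 2)"]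
      by (cases "N = 2") (auto simp: acf_def coord_simps)
    moreover have "swap (N - 1) (rotate N (rotate N p)) = rotate N (rotate N (swap 1 p))"
      by (rule point_eqI) (use N2 in \<open>auto simp: coord_simps tr_def\<close>)
    ultimately show "app (rotop * rotop * Top (N - 1)) u p = app (Top 1 * (rotop * rotop)) u p"
      by (simp add: app_Top rotop_def bcf_def)
  qed
  show "rotop * Yop i = Yop (Suc i) * rotop" if "i \<in> {1..<N}"
    using that by (intro oper_eqI) (simp add: rotop_def Yop_def coord_simps)
  show "rotop * Yop N = sc q' * Yop 1 * rotop"
    using N y_shift by (intro oper_eqI) (simp add: rotop_def Yop_def sc_def coord_simps mult.assoc)
qed

lemma Yop_Yiop: "Yop i * Yiop i = 1" "Yiop i * Yop i = 1"
proof -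
  have "yi a * (y a * x) = x" "y a * (yi a * x) = x" for a x
  proof -
    have "yi a * (y a * x) = (y a * yi a) * x" "y a * (yi a * x) = (y a * yi a) * x" by (simp_all only: mult_ac)
    then show "yi a * (y a * x) = x" "y a * (yi a * x) = x" by (simp_all add: y_inverse)
  qed
  then show "Yop i * Yiop i = 1" "Yiop i * Yop i = 1"
    by (intro oper_eqI; simp only: Yop_def Yiop_def app_simps app_mulop)+
qed

sublocale Tt: hecke N Top "sc t" "sc t'"
proof
  show "sc t * x = x * sc t" "sc t' * x = x * sc t'" for x unfolding sc_def by (rule mulop_central)+
  show "sc t * sc t' = 1" by (simp add: sc_simps tt')
  show "Top i * Top j = Top j * Top i" if "i + 2 \<le> j" for i j by (rule Top_far[OF that])
qed (simp_all add: Top_quad Top_braid)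

lemma Top_Ti: "Tt.Ti i = Top i - sc t + sc t'"
  by (rule Tt.Ti_def)

sublocale R: hecke_rotation N Top "sc t" "sc t'" Yop rotop rotiop "sc q" "sc q'"
proof
  fix i assume i: "i \<in> {1..<N}"
  show "Top i * Yop i * Top i = Yop (Suc i)"
    using Top_Yop[of i] Tt.Ti_T[OF i] by (simp add: Top_Ti mult.assoc)
next
  fix i j assume "i \<in> {1..<N}" "j \<in> {1..N}" "j \<noteq> i" "j \<noteq> Suc i"
  then show "Top i * Yop j = Yop j * Top i"
    by (intro oper_eqI) (simp add: app_Top Yop_def coord_simps tr_def algebra_simps)
next
  show "Yop i * Yop j = Yop j * Yop i" for i j
    by (rule oper_eqI) (simp add: Yop_def mult.left_commute)
  show "sc q * x = x * sc q" "sc q' * x = x * sc q'" for x unfolding sc_def by (rule mulop_central)+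
  show "sc q * sc q' = 1" by (simp add: sc_simps qq')
qed (use N rot_rels in \<open>auto\<close>)

text \<open>The letters D do not occur in the DAHA, so their value 1 is a dummy; D_i acts through
  its expression in the other letters.\<close>

fun rep_value :: "generator \<Rightarrow> (point, 'r) oper" where
  "rep_value (Gen_T i) = Top i"
| "rep_value (Gen_X i) = R.Xr i"
| "rep_value (Gen_Xinv i) = R.Xr' i"
| "rep_value (Gen_Y i) = Yop i"
| "rep_value (Gen_Yinv i) = Yiop i"
| "rep_value (Gen_D i) = 1"

lemma rep_rels:
  assumes \<rho>: "rhom (\<rho> :: qt_laurent \<Rightarrow> 'r)"
    and \<rho>t: "\<rho> (lvar Var_t 1) = t" "\<rho> (lvar Var_t (-1)) = t'" "\<rho> (lvar Var_q 1) = q" "\<rho> (lvar Var_q (-1)) = q'"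
    and ab: "(a, b) \<in> daha_rels N"
  shows "fev (\<lambda>k. sc (\<rho> k)) rep_value a = fev (\<lambda>k. sc (\<rho> k)) rep_value b"
proof -
  have s: "rhom (\<lambda>k. sc (\<rho> k))" unfolding sc_def by (rule rhom_mulop[OF \<rho>])
  have h: "rhom (fev (\<lambda>k. sc (\<rho> k)) rep_value)"
    by (rule rhom_fev[OF s]) (simp add: sc_def mulop_central)
  note S = rhomD[OF h] fev_gen[OF s] fev_scal[OF s] rhom_prod_list[OF h] rhom_power[OF h] \<rho>t
  have X12: "R.Xr' 1 * Yiop 2 * R.Xr 1 * Yop 2 = Top 1 * Top 1" if N2: "2 \<le> N"
  proof -
    have "Yiop 2 * (R.Xr 1 * Yop 2) = (Yiop 2 * Yop 2) * R.Xr 1 * (Top 1 * Top 1)"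
      unfolding R.cross.cross[OF N2] by (simp only: mult.assoc)
    then have "R.Xr' 1 * (Yiop 2 * (R.Xr 1 * Yop 2)) = (R.Xr' 1 * R.Xr 1) * (Top 1 * Top 1)"
      by (simp add: Yop_Yiop mult.assoc)
    then show ?thesis using R.Xr_inv[of 1] N by (simp add: mult.assoc)
  qed
  from ab show ?thesis
    unfolding daha_rels_def affine_rels_def X_inverse_rels_def Y_inverse_rels_def
    by (auto simp: S X_tilde_def Y_tilde_def Top_quad Top_braid Tt.far' R.X.TAT R.Y.TAT R.X.TA R.Y.TA R.XX R.YY
        R.Xr_inv Yop_Yiop X12 power2_eq_square Suc_eq_plus1[symmetric] R.Y_Xprod R.X_Yprod o_def split: if_splits simp del: upt_Suc)
qed

end

section \<open>Permutations represented by the standard words\<close>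

fun word_perm :: "nat list \<Rightarrow> nat \<Rightarrow> nat" where
  "word_perm [] j = j"
| "word_perm (i # w) j = tr i (word_perm w j)"

lemma word_perm_append: "word_perm (v @ w) j = word_perm v (word_perm w j)"
  by (induction v) simp_all

lemma inj_word_perm: "word_perm w j = word_perm w k \<longleftrightarrow> j = k"
proof (induction w)
  case (Cons i w)
  then show ?case by (metis tr_tr word_perm.simps(2))
qed simp

lemma word_perm_rev: "word_perm w (word_perm (rev w) j) = j"
  by (induction w arbitrary: j) (simp_all add: word_perm_append)

lemma word_perm_above: "(\<And>i. i \<in> set w \<Longrightarrow> Suc i < j) \<Longrightarrow> word_perm w j = j"
  by (induction w) (fastforce simp: tr_def)+

lemma word_perm_run: "j \<le> n \<Longrightarrow> word_perm [j..<n] n = j"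
proof (induction j rule: inc_induct)
  case (step j)
  then show ?case by (simp add: upt_conv_Cons tr_def)
qed simp

lemma set_perm_words: "w \<in> perm_words n \<Longrightarrow> i \<in> set w \<Longrightarrow> 1 \<le> i \<and> i < n"
  by (induction n arbitrary: w) (fastforce simp del: upt_Suc)+

text \<open>The permutation sends the last letter to j, since the word for fewer letters fixes it.
  So the leading run can be read off and cancelled.\<close>

lemma inj_perm_words:
  assumes "w \<in> perm_words n" "w' \<in> perm_words n" "word_perm w = word_perm w'"
  shows "w = w'"
  using assms
proof (induction n arbitrary: w w')
  case (Suc n)
  obtain j u where w: "w = [j..<Suc n] @ u" "j \<in> {1..Suc n}" "u \<in> perm_words n"
    using Suc.prems(1) by (auto simp del: upt_Suc)
  obtain j' u' where w': "w' = [j'..<Suc n] @ u'" "j' \<in> {1..Suc n}" "u' \<in> perm_words n"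
    using Suc.prems(2) by (auto simp del: upt_Suc)
  have fx: "word_perm v (Suc n) = Suc n" if "v \<in> perm_words n" for v
    using set_perm_words[OF that] by (intro word_perm_above) auto
  have "word_perm w (Suc n) = j" "word_perm w' (Suc n) = j'"
    unfolding w(1) w'(1) word_perm_append fx[OF w(3)] fx[OF w'(3)]
    by (rule word_perm_run; use w(2) w'(2) in simp)+
  then have jj: "j = j'" using Suc.prems(3) by simp
  have "word_perm u i = word_perm u' i" for i
    using fun_cong[OF Suc.prems(3), of i] unfolding w(1) w'(1) word_perm_append jj inj_word_perm .
  then have "u = u'" using Suc.IH[OF w(3) w'(3)] by auto
  then show ?case using w w' jj by simp
qed simp

section \<open>The representation over power series in t - 1 and its reduction\<close>

locale generic_field =
  fixes q0 :: "'f::field" and \<xi> :: "nat \<Rightarrow> 'f" and N :: nat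
  assumes N1: "1 \<le> N" and q0: "q0 \<noteq> 0" and \<xi>0: "\<xi> j \<noteq> 0"
    and generic: "i \<noteq> j \<Longrightarrow> q0 powi k * \<xi> i \<noteq> q0 powi m * \<xi> j"
begin

definition val :: "nat \<times> int \<Rightarrow> 'f" where "val a = q0 powi (snd a) * \<xi> (fst a)"

lemma val_nz: "val a \<noteq> 0" by (simp add: val_def q0 \<xi>0)

lemma val_neq: "fst a \<noteq> fst b \<Longrightarrow> val b - val a \<noteq> 0"
  using generic[of "fst b" "fst a"] by (simp add: val_def)

lemma val_shift: "val (j, k - 1) = inverse q0 * val (j, k)"
  using q0 by (simp add: val_def power_int_diff divide_inverse)

abbreviation "tt \<equiv> (1 + fps_X :: 'f fps)"
abbreviation "al a b \<equiv> val b / (val b - val a)"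

sublocale polynomial_rep "\<lambda>a. fps_const (val a)" "\<lambda>a. fps_const (inverse (val a))"
  "\<lambda>a b. fps_const (al a b)" tt "inverse tt" "fps_const q0" "fps_const (inverse q0)" N
proof
  show "1 \<le> N" by (rule N1)
  show "tt * inverse tt = 1" by (rule inverse_mult_eq_1') simp
  show "fps_const q0 * fps_const (inverse q0) = 1" using q0 by simp
  show "fps_const (val a) * fps_const (inverse (val a)) = 1" for a using val_nz by simp
  show "fps_const (val (j, k - 1)) = fps_const (inverse q0) * fps_const (val (j, k))" for j k
    by (simp add: val_shift)
  show "(fps_const (val b) - fps_const (val a)) * fps_const (al a b) = fps_const (val b)" if "fst a \<noteq> fst b" for a b
    using val_neq[OF that] by simp
  show "fps_const (al b a) = 1 - fps_const (al a b)" if "fst a \<noteq> fst b" for a b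
  proof -
    have "val a - val b \<noteq> 0" using val_neq[of b a] that by simp
    then have "al b a = 1 - al a b" using val_neq[OF that] by (simp add: field_simps)
    then show ?thesis by (simp flip: fps_const_sub)
  qed
  show "fps_const (al (i, m - 1) (j, n - 1)) = fps_const (al (i, m) (j, n))" for i m j n
    unfolding val_shift using q0 by (simp flip: right_diff_distrib)
  show "fps_const (al a b) * fps_const (al b d)
      = fps_const (al a d) * (fps_const (al a b) + fps_const (al b d) - 1)"
    if "fst a \<noteq> fst b" "fst b \<noteq> fst d" "fst a \<noteq> fst d" for a b d
  proof -
    have "al a b * al b d = al a d * (al a b + al b d - 1)"
    proof -
      define u v w where "u = val b - val a" and "v = val d - val b" and "w = val d - val a"
      have nz: "u \<noteq> 0" "v \<noteq> 0" "w \<noteq> 0"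
        unfolding u_def v_def w_def using val_neq that by blast+
      have num: "val b * v + val d * u - u * v = val b * w" unfolding u_def v_def w_def by (simp add: algebra_simps)
      have "val b / u + val d / v - 1 = val b * w / (u * v)"
        unfolding num[symmetric] using nz(1,2) by (simp add: field_simps)
      then have "val d / w * (val b / u + val d / v - 1) = val b / u * (val d / v)"
        using nz by simp
      then show ?thesis unfolding u_def v_def w_def by simp
    qed
    then have "fps_const (al a b * al b d) = fps_const (al a d * (al a b + al b d - 1))" by simp
    then show ?thesis by (simp only: fps_const_1_eq_1[symmetric] fps_const_add fps_const_sub fps_const_mult)
  qed
qed

text \<open>The operator \<open>F\<close> reduces modulo \<open>t - 1\<close> to multiplication by \<open>g\<close> after moving points by \<open>\<phi>\<close>.\<close>

definition reduces :: "(point, 'f fps) oper \<Rightarrow> (point \<Rightarrow> 'f) \<Rightarrow> (point \<Rightarrow> point) \<Rightarrow> bool" where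
  "reduces F g \<phi> \<longleftrightarrow> (\<forall>u p. fps_nth (app F u p) 0 = g p * fps_nth (u (\<phi> p)) 0)"

lemma reduces_times:
  "reduces F g \<phi> \<Longrightarrow> reduces G h \<psi> \<Longrightarrow> reduces (F * G) (\<lambda>p. g p * h (\<phi> p)) (\<lambda>p. \<psi> (\<phi> p))"
  by (simp add: reduces_def mult.assoc)

lemma reduces_1: "reduces 1 (\<lambda>_. 1) (\<lambda>p. p)"
  by (simp add: reduces_def)

lemma reduces_T: "reduces (Top i) (\<lambda>_. 1) (swap i)" and reduces_Ti: "reduces (Tt.Ti i) (\<lambda>_. 1) (swap i)"
proof -
  have "fps_nth (acf i p) 0 = 0" "fps_nth (bcf i p) 0 = 1" for p
    by (simp_all add: acf_def bcf_def)
  then show 1: "reduces (Top i) (\<lambda>_. 1) (swap i)" by (simp add: reduces_def app_Top)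
  then show "reduces (Tt.Ti i) (\<lambda>_. 1) (swap i)" unfolding Top_Ti by (simp add: reduces_def sc_def)
qed

lemma reduces_rotop: "reduces rotop (\<lambda>_. 1) (rotate N)"
  by (simp add: reduces_def rotop_def)

lemma reduces_inverse:
  assumes "reduces F (\<lambda>_. 1) \<phi>" "F * G = 1" "\<And>p. \<phi> (\<psi> p) = p"
  shows "reduces G (\<lambda>_. 1) \<psi>"
  unfolding reduces_def
proof (intro allI)
  fix u p
  have "fps_nth (app (F * G) u (\<psi> p)) 0 = fps_nth (app G u (\<phi> (\<psi> p))) 0"
    using assms(1) by (simp add: reduces_def)
  then show "fps_nth (app G u p) 0 = 1 * fps_nth (u (\<psi> p)) 0" using assms(2,3) by simp
qed

lemma reduces_X:
  assumes "i \<in> {1..N}" shows "reduces (R.Xr i) (\<lambda>_. 1) (shift i (-1))"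
proof -
  \<comment> \<open>At t = 1 each further T_k^{-1} undoes one transposition of the rotation: the
    operator ending in T_k^{-1} rotates only the first k coordinates. At k = 1 just the lowering of
    the first exponent remains.\<close>
  have chain: "\<exists>\<phi>. reduces (rotop * Tt.downi k N) (\<lambda>_. 1) \<phi> \<and>
      (\<forall>p j. coord (\<phi> p) j = (if 1 \<le> j \<and> j < k then coord p (Suc j)
        else if j = k then (fst (coord p 1), snd (coord p 1) - 1) else coord p j))"
    if "1 \<le> k" "k \<le> N" for k
    using that(2,1)
  proof (induction k rule: inc_induct)
    case base
    then show ?case using reduces_rotop by (intro exI[of _ "rotate N"]) (auto simp: coord_simps)
  next
    case (step k)
    then obtain \<phi> where r: "reduces (rotop * Tt.downi (Suc k) N) (\<lambda>_. 1) \<phi>"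
      and c: "\<And>p j. coord (\<phi> p) j = (if 1 \<le> j \<and> j < Suc k then coord p (Suc j)
        else if j = Suc k then (fst (coord p 1), snd (coord p 1) - 1) else coord p j)" by auto
    have "rotop * Tt.downi k N = (rotop * Tt.downi (Suc k) N) * Tt.Ti k"
      using Tt.up_rec(4)[of k N] step by (simp add: mult.assoc)
    then have "reduces (rotop * Tt.downi k N) (\<lambda>_. 1) (\<lambda>p. swap k (\<phi> p))"
      using reduces_times[OF r reduces_Ti[of k]] by simp
    moreover have "coord (swap k (\<phi> p)) j = (if 1 \<le> j \<and> j < k then coord p (Suc j)
        else if j = k then (fst (coord p 1), snd (coord p 1) - 1) else coord p j)" for p j
      using step.prems by (auto simp: coord_simps c tr_def)
    ultimately show ?case by blast
  qed
  have base: "reduces (R.Xr 1) (\<lambda>_. 1) (shift 1 (-1))"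
  proof -
    obtain \<phi> where r: "reduces (rotop * Tt.downi 1 N) (\<lambda>_. 1) \<phi>"
      and c: "\<And>p j. coord (\<phi> p) j = (if 1 \<le> j \<and> j < 1 then coord p (Suc j)
        else if j = 1 then (fst (coord p 1), snd (coord p 1) - 1) else coord p j)"
      using chain[of 1] N1 by auto
    have "\<phi> = shift 1 (-1)"
      by (rule ext, rule point_eqI) (auto simp: c coord_simps)
    then show ?thesis using r by (simp add: R.Xr1)
  qed
  have "1 \<le> i" "i \<le> N" using assms by auto
  then show ?thesis
  proof (induction i rule: dec_induct)
    case (step i)
    then have i: "i \<in> {1..<N}" by auto
    have "(\<lambda>p. swap i (shift i (-1) (swap i p))) = shift (Suc i) (-1)"
      by (rule ext, rule point_eqI) (auto simp: coord_simps tr_def)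
    moreover have "reduces (Top i * R.Xr i * Top i) (\<lambda>_. 1) (\<lambda>p. swap i (shift i (-1) (swap i p)))"
      using reduces_times[OF reduces_times[OF reduces_T[of i] step.IH] reduces_T[of i]] step by simp
    ultimately show ?case unfolding R.X.TAT[OF i] by (simp only:)
  qed (rule base)
qed

lemma reduces_Xi: "i \<in> {1..N} \<Longrightarrow> reduces (R.Xr' i) (\<lambda>_. 1) (shift i 1)"
  by (rule reduces_inverse[OF reduces_X R.Xr_inv(1)]) (auto intro!: point_eqI simp: coord_simps)

lemma reduces_Y: "reduces (Yop i) (\<lambda>p. val (coord p i)) (\<lambda>p. p)"
  and reduces_Yi: "reduces (Yiop i) (\<lambda>p. inverse (val (coord p i))) (\<lambda>p. p)"
  by (simp_all add: reduces_def Yop_def Yiop_def)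

definition Dop :: "(nat \<Rightarrow> 'f) \<Rightarrow> nat \<Rightarrow> nat \<Rightarrow> (point, 'f fps) oper" where
  "Dop z l i = Tt.downi 1 i * (R.Xr' 1 * zprod (\<lambda>r. sc (fps_const (z r))) (Yop 1) 1 l) * Tt.upi 1 i"

text \<open>X_1^{-1} raises the first exponent, and P(Y_1) contributes a product of differences
  \<open>val a - z r\<close>, none of which is zero. Multiplication by T_i^{-1} on both sides then
  only renames the coordinate that is shifted.\<close>

lemma reduces_D:
  assumes z: "\<And>r a. r \<in> {1..l} \<Longrightarrow> val a \<noteq> z r" and i: "i \<in> {1..N}"
  shows "\<exists>g. (\<forall>p. g p \<noteq> 0) \<and> reduces (Dop z l i) g (shift i 1)"
proof -
  have P: "\<exists>g. (\<forall>p. g p \<noteq> 0) \<and> reduces (zprod (\<lambda>r. sc (fps_const (z r))) (Yop 1) 1 n) g (\<lambda>p. p)" if "n \<le> l" for n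
    using that
  proof (induction n)
    case 0
    show ?case using reduces_1 by (intro exI[of _ "\<lambda>_. 1"]) simp
  next
    case (Suc n)
    then obtain g where g: "\<forall>p. g p \<noteq> 0" "reduces (zprod (\<lambda>r. sc (fps_const (z r))) (Yop 1) 1 n) g (\<lambda>p. p)" by auto
    have "reduces (Yop 1 - sc (fps_const (z (Suc n)))) (\<lambda>p. val (coord p 1) - z (Suc n)) (\<lambda>p. p)"
      by (simp add: reduces_def Yop_def sc_def algebra_simps)
    from reduces_times[OF g(2) this] show ?case using g(1) z[of "Suc n"] Suc.prems
      by (intro exI[of _ "\<lambda>p. g p * (val (coord p 1) - z (Suc n))"]) (simp add: zprod_Suc)
  qed
  have "1 \<le> i" "i \<le> N" using i by auto
  then show ?thesis
  proof (induction i rule: dec_induct)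
    case base
    obtain g where g: "\<forall>p. g p \<noteq> 0" "reduces (zprod (\<lambda>r. sc (fps_const (z r))) (Yop 1) 1 l) g (\<lambda>p. p)"
      using P by auto
    show ?case using reduces_times[OF reduces_Xi[of 1] g(2)] g(1) N1
      by (intro exI[of _ "\<lambda>p. g (shift 1 1 p)"]) (simp add: Dop_def)
  next
    case (step i)
    then obtain g where g: "\<forall>p. g p \<noteq> 0" "reduces (Dop z l i) g (shift i 1)" by auto
    have e: "Dop z l (Suc i) = Tt.Ti i * Dop z l i * Tt.Ti i"
      using step by (simp add: Dop_def Tt.up_Suc mult.assoc)
    have "(\<lambda>p. swap i (shift i 1 (swap i p))) = shift (Suc i) 1"
      by (rule ext, rule point_eqI) (auto simp: coord_simps tr_def)
    then show ?case
      using reduces_times[OF reduces_times[OF reduces_Ti[of i] g(2)] reduces_Ti[of i]] g(1)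
      by (intro exI[of _ "\<lambda>p. g (swap i p)"]) (simp add: e)
  qed
qed

lemma reduces_Xs:
  "set xs \<subseteq> {1..N} \<Longrightarrow> \<exists>\<phi>. reduces (prod_list (map R.Xr xs)) (\<lambda>_. 1) \<phi> \<and>
    (\<forall>p j. coord (\<phi> p) j = (fst (coord p j), snd (coord p j) - int (count_list xs j)))"
proof (induction xs)
  case Nil
  show ?case using reduces_1 by (intro exI[of _ "\<lambda>p. p"]) simp
next
  case (Cons i xs)
  then obtain \<phi> where r: "reduces (prod_list (map R.Xr xs)) (\<lambda>_. 1) \<phi>"
    and c: "\<And>p j. coord (\<phi> p) j = (fst (coord p j), snd (coord p j) - int (count_list xs j))" by auto
  show ?case using reduces_times[OF reduces_X[of i] r] Cons.prems
    by (intro exI[of _ "\<lambda>p. \<phi> (shift i (-1) p)"]) (auto simp: c coord_simps)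
qed

lemma reduces_Ds:
  assumes z: "\<And>r a. r \<in> {1..l} \<Longrightarrow> val a \<noteq> z r"
  shows "set xs \<subseteq> {1..N} \<Longrightarrow> \<exists>g \<phi>. (\<forall>p. g p \<noteq> 0) \<and> reduces (prod_list (map (Dop z l) xs)) g \<phi> \<and>
    (\<forall>p j. coord (\<phi> p) j = (fst (coord p j), snd (coord p j) + int (count_list xs j)))"
proof (induction xs)
  case Nil
  show ?case using reduces_1 by (intro exI[of _ "\<lambda>_. 1"] exI[of _ "\<lambda>p. p"]) simp
next
  case (Cons i xs)
  then obtain g \<phi> where g: "\<forall>p. g p \<noteq> 0" and r: "reduces (prod_list (map (Dop z l) xs)) g \<phi>"
    and c: "\<And>p j. coord (\<phi> p) j = (fst (coord p j), snd (coord p j) + int (count_list xs j))" by auto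
  obtain h where h: "\<forall>p. h p \<noteq> 0" "reduces (Dop z l i) h (shift i 1)"
    using reduces_D[where l = l and z = z and i = i, OF z] Cons.prems by auto
  show ?case using reduces_times[OF h(2) r] h(1) g Cons.prems
    by (intro exI[of _ "\<lambda>p. h p * g (shift i 1 p)"] exI[of _ "\<lambda>p. \<phi> (shift i 1 p)"]) (auto simp: c coord_simps)
qed

lemma reduces_Ys: "reduces (prod_list (map Yop ys)) (\<lambda>p. prod_list (map (\<lambda>i. val (coord p i)) ys)) (\<lambda>p. p)"
  and reduces_Yis: "reduces (prod_list (map Yiop ys)) (\<lambda>p. prod_list (map (\<lambda>i. inverse (val (coord p i))) ys)) (\<lambda>p. p)"
proof (induction ys)
  case (Cons i ys)
  case 1 show ?case using reduces_times[OF reduces_Y Cons(1)] by simp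
  case 2 show ?case using reduces_times[OF reduces_Yi Cons(2)] by simp
qed (simp_all add: reduces_1)

lemma reduces_word:
  "\<exists>\<phi>. reduces (prod_list (map Top w)) (\<lambda>_. 1) \<phi> \<and> (\<forall>p j. coord (\<phi> p) j = coord p (word_perm w j))"
proof (induction w)
  case Nil
  show ?case using reduces_1 by (intro exI[of _ "\<lambda>p. p"]) simp
next
  case (Cons i w)
  then obtain \<phi> where r: "reduces (prod_list (map Top w)) (\<lambda>_. 1) \<phi>"
    and c: "\<And>p j. coord (\<phi> p) j = coord p (word_perm w j)" by auto
  show ?case using reduces_times[OF reduces_T r]
    by (intro exI[of _ "\<lambda>p. \<phi> (swap i p)"]) (simp add: c coord_simps)
qed

definition "rep_basis z l b = pair_prod R.Xr (Dop z l) (fst b)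
    * (pair_prod Yop Yiop (fst (snd b)) * prod_list (map Top (snd (snd b))))"

lift_definition origin :: point is "\<lambda>i. (i, 0)" by (simp add: inj_def)

text \<open>The value of the Y-monomial at the point to which the X and D part has moved the origin:
  there the exponent of coordinate i is the number of D_i minus the number of X_i.\<close>

definition "shifted_monomial b = prod_list (map (\<lambda>i. val (i, int (count_list (snd (fst b)) i) - int (count_list (fst (fst b)) i))) (fst (fst (snd b))))
    * prod_list (map (\<lambda>i. inverse (val (i, int (count_list (snd (fst b)) i) - int (count_list (fst (fst b)) i)))) (snd (fst (snd b))))"

text \<open>The constant \<open>c\<close> and the end point \<open>P\<close> depend on the X, D part
  \<open>p\<close> and the word \<open>w\<close> but not on the Y part \<open>y\<close>. One delta
  function therefore tests all Y parts occurring with given \<open>p\<close> and \<open>w\<close> at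
  once.\<close>

definition "basis_data z l p w c P \<longleftrightarrow> c \<noteq> 0 \<and>
  (\<forall>j. coord P j = (word_perm w j, int (count_list (snd p) (word_perm w j)) - int (count_list (fst p) (word_perm w j)))) \<and>
  (\<forall>y u. fps_nth (app (rep_basis z l (p, y, w)) u origin) 0 = c * shifted_monomial (p, y, w) * fps_nth (u P) 0)"

lemma reduces_basis:
  assumes z: "\<And>r a. r \<in> {1..l} \<Longrightarrow> val a \<noteq> z r" and p: "p \<in> disjoint_pairs N"
  shows "\<exists>c P. basis_data z l p w c P"
proof -
  obtain xs ds where b: "p = (xs, ds)" by (cases p)
  have r: "set xs \<subseteq> {1..N}" "set ds \<subseteq> {1..N}" using p by (auto simp: b disjoint_pairs_def)
  obtain \<phi> where 1: "reduces (prod_list (map R.Xr xs)) (\<lambda>_. 1) \<phi>"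
    and c1: "\<And>p j. coord (\<phi> p) j = (fst (coord p j), snd (coord p j) - int (count_list xs j))"
    using reduces_Xs[OF r(1)] by auto
  obtain g \<psi> where g: "\<forall>p. g p \<noteq> 0" and 2: "reduces (prod_list (map (Dop z l) ds)) g \<psi>"
    and c2: "\<And>p j. coord (\<psi> p) j = (fst (coord p j), snd (coord p j) + int (count_list ds j))"
    using reduces_Ds[where l = l and z = z, OF z r(2)] by auto
  obtain \<chi> where 3: "reduces (prod_list (map Top w)) (\<lambda>_. 1) \<chi>"
    and c3: "\<And>p j. coord (\<chi> p) j = coord p (word_perm w j)"
    using reduces_word[of w] by blast
  note red = reduces_times[OF reduces_times[OF 1 2] reduces_times[OF reduces_times[OF reduces_Ys reduces_Yis] 3]]
  let ?p = "\<psi> (\<phi> origin)"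
  have cp: "coord ?p i = (i, int (count_list ds i) - int (count_list xs i))" for i
    by (simp add: c1 c2 origin.rep_eq)
  have "basis_data z l p w (g (\<phi> origin)) (\<chi> ?p)"
    unfolding basis_data_def
    using red g by (auto simp: reduces_def rep_basis_def pair_prod_def b shifted_monomial_def cp c3 mult.assoc)
  then show ?thesis by blast
qed

text \<open>Moving the origin affects only exponents of q, not the labels, so the \<xi>-part of the
  monomial survives and the power of q can be absorbed into the coefficients.\<close>

lemma shifted_monomial_eq: "\<exists>m. shifted_monomial (p, y, w) = q0 powi m * pair_prod \<xi> (\<lambda>j. inverse (\<xi> j)) y"
proof -
  let ?f = "\<lambda>i. int (count_list (snd p) i) - int (count_list (fst p) i)"
  have 1: "\<exists>m. prod_list (map (\<lambda>i. val (i, ?f i)) ys) = q0 powi m * prod_list (map \<xi> ys)" for ys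
  proof (induction ys)
    case Nil show ?case by (intro exI[of _ 0]) simp
  next
    case (Cons i ys)
    then obtain m where "prod_list (map (\<lambda>i. val (i, ?f i)) ys) = q0 powi m * prod_list (map \<xi> ys)" by blast
    then show ?case by (intro exI[of _ "?f i + m"]) (simp add: val_def power_int_add q0)
  qed
  have 2: "\<exists>m. prod_list (map (\<lambda>i. inverse (val (i, ?f i))) ys) = q0 powi m * prod_list (map (\<lambda>j. inverse (\<xi> j)) ys)" for ys
  proof (induction ys)
    case Nil show ?case by (intro exI[of _ 0]) simp
  next
    case (Cons i ys)
    then obtain m where "prod_list (map (\<lambda>i. inverse (val (i, ?f i))) ys) = q0 powi m * prod_list (map (\<lambda>j. inverse (\<xi> j)) ys)" by blast
    moreover have "inverse (val (i, ?f i)) = q0 powi (- ?f i) * inverse (\<xi> i)"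
      by (simp only: val_def power_int_minus inverse_mult_distrib fst_conv snd_conv)
    ultimately show ?case by (intro exI[of _ "- ?f i + m"]) (simp only: list.map prod_list.Cons power_int_add q0 simp_thms disj_not1 mult_ac)
  qed
  obtain m n where "prod_list (map (\<lambda>i. val (i, ?f i)) (fst y)) = q0 powi m * prod_list (map \<xi> (fst y))"
    "prod_list (map (\<lambda>i. inverse (val (i, ?f i))) (snd y)) = q0 powi n * prod_list (map (\<lambda>j. inverse (\<xi> j)) (snd y))"
    using 1 2 by meson
  then show ?thesis
    by (intro exI[of _ "m + n"]) (simp add: shifted_monomial_def pair_prod_def power_int_add q0 mult_ac)
qed

text \<open>For each i one of the two multiplicities is zero, so their difference determines both;
  sortedness then determines the lists.\<close>

lemma disjoint_pairs_determined:
  assumes "(xs, ds) \<in> disjoint_pairs N" "(xs', ds') \<in> disjoint_pairs N"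
    and "\<And>i. int (count_list ds i) - int (count_list xs i) = int (count_list ds' i) - int (count_list xs' i)"
  shows "xs = xs'" "ds = ds'"
proof -
  have z: "count_list xs i = 0 \<or> count_list ds i = 0" if "(xs, ds) \<in> disjoint_pairs N" for xs ds i
    using that by (auto simp: disjoint_pairs_def count_list_0_iff)
  have "count_list xs i = count_list xs' i" "count_list ds i = count_list ds' i" for i
    using assms(3)[of i] z[OF assms(1), of i] z[OF assms(2), of i] by auto
  then have "mset xs = mset xs'" "mset ds = mset ds'"
    by (auto intro!: multiset_eqI simp: count_mset)
  moreover have "sorted xs" "sorted xs'" "sorted ds" "sorted ds'"
    using assms(1,2) by (auto simp: disjoint_pairs_def)
  ultimately show "xs = xs'" "ds = ds'"
    using properties_for_sort[of xs xs'] properties_for_sort[of ds ds'] by (auto simp: sorted_sort_id)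
qed

text \<open>
  Independence over a set \<open>S\<close> of scalars over which the monomials in the \<open>\<xi>\<^sub>j\<close> are independent: divide a
  relation by the highest common power of \<open>t - 1\<close>, reduce and test on a delta function.
\<close>

theorem rep_basis_independent:
  assumes z: "\<And>r a. r \<in> {1..l} \<Longrightarrow> val a \<noteq> z r"
    and S: "\<And>a k. a \<in> S \<Longrightarrow> a * q0 powi k \<in> S"
    and indep: "\<And>P \<kappa>. finite P \<Longrightarrow> P \<subseteq> disjoint_pairs N \<Longrightarrow> (\<And>y. y \<in> P \<Longrightarrow> \<kappa> y \<in> S) \<Longrightarrow>
      (\<Sum>y\<in>P. \<kappa> y * pair_prod \<xi> (\<lambda>j. inverse (\<xi> j)) y) = 0 \<Longrightarrow> \<forall>y\<in>P. \<kappa> y = 0"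
    and B: "finite B" "B \<subseteq> disjoint_pairs N \<times> disjoint_pairs N \<times> perm_words N"
    and k: "\<And>b n. b \<in> B \<Longrightarrow> fps_nth (k b) n \<in> S"
    and sum0: "(\<Sum>b\<in>B. sc (k b) * rep_basis z l b) = 0"
  shows "\<forall>b\<in>B. k b = 0"
proof (rule ccontr)
  assume "\<not> ?thesis"
  then have ne: "{n. \<exists>b\<in>B. fps_nth (k b) n \<noteq> 0} \<noteq> {}" by (auto simp: fps_eq_iff)
  define n where "n = (LEAST n. \<exists>b\<in>B. fps_nth (k b) n \<noteq> 0)"
  have n: "\<exists>b\<in>B. fps_nth (k b) n \<noteq> 0" unfolding n_def by (rule LeastI_ex) (use ne in blast)
  have low: "fps_nth (k b) m = 0" if "b \<in> B" "m < n" for b m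
    using not_less_Least[of m "\<lambda>n. \<exists>b\<in>B. fps_nth (k b) n \<noteq> 0"] that unfolding n_def by blast
  define k' where "k' b = fps_shift n (k b)" for b
  have kk': "k b = fps_X ^ n * k' b" if "b \<in> B" for b
    by (rule fps_ext) (use low[OF that] in \<open>simp add: k'_def fps_X_power_mult_nth\<close>)
  have app_sum: "app (\<Sum>b\<in>A. sc (k b) * rep_basis z l b) u p = (\<Sum>b\<in>A. k b * app (rep_basis z l b) u p)" for A u p k
    by (induction A rule: infinite_finite_induct) (simp_all add: sc_def)
  have van: "(\<Sum>b\<in>B. k' b * app (rep_basis z l b) u p) = 0" for u p
  proof -
    have "fps_X ^ n * (\<Sum>b\<in>B. k' b * app (rep_basis z l b) u p) = (\<Sum>b\<in>B. k b * app (rep_basis z l b) u p)"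
      by (simp add: sum_distrib_left kk' mult.assoc)
    also have "\<dots> = 0" using app_sum[of k B u p] sum0 by simp
    finally show ?thesis by simp
  qed
  have "\<exists>c P. \<forall>p\<in>disjoint_pairs N. \<forall>w. basis_data z l p w (c p w) (P p w)"
  proof -
    have "\<exists>cP. p \<in> disjoint_pairs N \<longrightarrow> basis_data z l p w (fst cP) (snd cP)" for p w
      using reduces_basis[where l = l and z = z and p = p and w = w, OF z] by fastforce
    then have "\<exists>cP. \<forall>p w. p \<in> disjoint_pairs N \<longrightarrow> basis_data z l p w (fst (cP p w)) (snd (cP p w))"
      by (intro choice allI)
    then obtain cP where "\<forall>p w. p \<in> disjoint_pairs N \<longrightarrow> basis_data z l p w (fst (cP p w)) (snd (cP p w))" by blast
    then show ?thesis
      by (intro exI[of _ "\<lambda>p w. fst (cP p w)"] exI[of _ "\<lambda>p w. snd (cP p w)"]) blast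
  qed
  then obtain c P where cP: "\<And>p w. p \<in> disjoint_pairs N \<Longrightarrow> basis_data z l p w (c p w) (P p w)" by blast
  \<comment> \<open>The labels of the end point reveal the permutation, hence the word
    \<open>w\<close>; its exponents, read in the unpermuted order, are the differences that
    determine \<open>p\<close>.\<close>
  have same: "p = p' \<and> w = w'"
    if in': "p \<in> disjoint_pairs N" "p' \<in> disjoint_pairs N" "w \<in> perm_words N" "w' \<in> perm_words N"
      and eq: "P p w = P p' w'" for p p' w w'
  proof -
    note co = cP[OF in'(1), unfolded basis_data_def, THEN conjunct2, THEN conjunct1, rule_format]
      cP[OF in'(2), unfolded basis_data_def, THEN conjunct2, THEN conjunct1, rule_format]
    have "word_perm w j = word_perm w' j" for j
      using co(1)[of w j] co(2)[of w' j] unfolding eq by simp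
    then have w: "w = w'" using inj_perm_words[OF in'(3,4)] by blast
    obtain xs ds xs' ds' where e: "p = (xs, ds)" "p' = (xs', ds')" by (metis prod.collapse)
    have "int (count_list ds i) - int (count_list xs i) = int (count_list ds' i) - int (count_list xs' i)" for i
      using co(1)[of w "word_perm (rev w) i"] co(2)[of w' "word_perm (rev w) i"] unfolding eq
      by (simp add: e w word_perm_rev)
    from disjoint_pairs_determined[OF in'(1,2)[unfolded e] this] show ?thesis by (simp add: e w)
  qed
  obtain b0 where b0: "b0 \<in> B" "fps_nth (k b0) n \<noteq> 0" using n by blast
  obtain p0 y0 w0 where b0e: "b0 = (p0, y0, w0)" by (metis prod.collapse)
  have in0: "p0 \<in> disjoint_pairs N" "w0 \<in> perm_words N" using b0 B(2) by (auto simp: b0e)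
  define u0 :: "point \<Rightarrow> 'f fps" where "u0 p = (if p = P p0 w0 then 1 else 0)" for p
  \<comment> \<open>The delta function cannot distinguish the Y parts collected here; what survives
    is a linear relation among their \<xi>-monomials, with a common factor \<open>c p0 w0\<close>
    that is nonzero.\<close>
  define Q where "Q = {y. (p0, y, w0) \<in> B}"
  have finQ: "finite Q"
    unfolding Q_def by (rule finite_subset[OF _ finite_imageI[OF B(1), of "\<lambda>b. fst (snd b)"]]) force
  have summand: "fps_nth (k' (p, y, w) * app (rep_basis z l (p, y, w)) u0 origin) 0
      = (if p = p0 \<and> w = w0 then fps_nth (k (p, y, w)) n * (c p0 w0 * shifted_monomial (p0, y, w0)) else 0)"
    if "(p, y, w) \<in> B" for p y w
  proof -
    have in': "p \<in> disjoint_pairs N" "w \<in> perm_words N" using that B(2) by auto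
    have "fps_nth (app (rep_basis z l (p, y, w)) u0 origin) 0 = c p w * shifted_monomial (p, y, w) * fps_nth (u0 (P p w)) 0"
      using cP[OF in'(1), of w] unfolding basis_data_def by blast
    moreover have "P p w = P p0 w0 \<longleftrightarrow> p = p0 \<and> w = w0"
      using same[OF in'(1) in0(1) in'(2) in0(2)] by blast
    ultimately show ?thesis by (auto simp: u0_def k'_def)
  qed
  have "0 = fps_nth (\<Sum>b\<in>B. k' b * app (rep_basis z l b) u0 origin) 0"
    unfolding van by simp
  also have "\<dots> = (\<Sum>b\<in>B. fps_nth (k' b * app (rep_basis z l b) u0 origin) 0)"
    by (rule fps_sum_nth)
  also have "\<dots> = (\<Sum>b\<in>(\<lambda>y. (p0, y, w0)) ` Q. fps_nth (k b) n * (c p0 w0 * shifted_monomial b))"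
  proof (rule sum.mono_neutral_cong_right[OF B(1)])
    show "(\<lambda>y. (p0, y, w0)) ` Q \<subseteq> B" by (auto simp: Q_def)
    show "\<forall>b\<in>B - (\<lambda>y. (p0, y, w0)) ` Q. fps_nth (k' b * app (rep_basis z l b) u0 origin) 0 = 0"
    proof
      fix b assume b: "b \<in> B - (\<lambda>y. (p0, y, w0)) ` Q"
      obtain p y w where be: "b = (p, y, w)" by (metis prod.collapse)
      have "\<not> (p = p0 \<and> w = w0)" using b by (auto simp: be Q_def)
      then show "fps_nth (k' b * app (rep_basis z l b) u0 origin) 0 = 0"
        using summand[of p y w] b unfolding be by (simp only: if_False DiffD1)
    qed
    show "fps_nth (k' b * app (rep_basis z l b) u0 origin) 0 = fps_nth (k b) n * (c p0 w0 * shifted_monomial b)"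
      if b: "b \<in> (\<lambda>y. (p0, y, w0)) ` Q" for b
    proof -
      obtain y where y: "b = (p0, y, w0)" "(p0, y, w0) \<in> B" using b by (auto simp: Q_def)
      show ?thesis unfolding y(1) summand[OF y(2)] by simp
    qed
  qed
  also have "\<dots> = (\<Sum>y\<in>Q. fps_nth (k (p0, y, w0)) n * (c p0 w0 * shifted_monomial (p0, y, w0)))"
    by (subst sum.reindex) (auto simp: inj_on_def)
  finally have s1: "(\<Sum>y\<in>Q. fps_nth (k (p0, y, w0)) n * (c p0 w0 * shifted_monomial (p0, y, w0))) = 0" by simp
  obtain m where m: "\<And>y. shifted_monomial (p0, y, w0) = q0 powi (m y) * pair_prod \<xi> (\<lambda>j. inverse (\<xi> j)) y"
    using shifted_monomial_eq[of p0 _ w0] by metis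
  have "c p0 w0 * (\<Sum>y\<in>Q. (fps_nth (k (p0, y, w0)) n * q0 powi (m y)) * pair_prod \<xi> (\<lambda>j. inverse (\<xi> j)) y)
      = (\<Sum>y\<in>Q. fps_nth (k (p0, y, w0)) n * (c p0 w0 * shifted_monomial (p0, y, w0)))"
    unfolding sum_distrib_left by (rule sum.cong) (simp_all add: m mult_ac)
  moreover have "c p0 w0 \<noteq> 0" using cP[OF in0(1), of w0] unfolding basis_data_def by blast
  ultimately have "(\<Sum>y\<in>Q. (fps_nth (k (p0, y, w0)) n * q0 powi (m y)) * pair_prod \<xi> (\<lambda>j. inverse (\<xi> j)) y) = 0"
    using s1 by simp
  then have "\<forall>y\<in>Q. fps_nth (k (p0, y, w0)) n * q0 powi (m y) = 0"
    by (intro indep[OF finQ]) (use B(2) in \<open>auto simp: Q_def intro!: S k\<close>)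
  moreover have "y0 \<in> Q" using b0 by (simp add: Q_def b0e)
  ultimately have "fps_nth (k b0) n * q0 powi (m y0) = 0" by (simp add: b0e)
  then show False using b0(2) q0 by simp
qed

end

section \<open>Rational functions in q, Z_r and \<xi>_j\<close>

type_synonym lpoly = "(nat \<Rightarrow>\<^sub>0 int) \<Rightarrow>\<^sub>0 complex"

definition emb :: "lpoly \<Rightarrow> lpoly fract" where "emb p = Fract p 1"

lemma rhom_emb: "rhom emb"
  by (simp add: rhom_def emb_def One_fract_def)

lemma emb_1 [simp]: "emb 1 = 1"
  by (rule rhomD(1)[OF rhom_emb])

lemma emb_inj: "emb p = emb r \<longleftrightarrow> p = r"
  by (simp add: emb_def eq_fract)

lemma emb_0: "emb p = 0 \<longleftrightarrow> p = 0"
  using emb_inj[of p 0] by (simp add: rhomD(4)[OF rhom_emb])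

abbreviation mon :: "(nat \<Rightarrow>\<^sub>0 int) \<Rightarrow> lpoly fract" where "mon e \<equiv> emb (single e 1)"

lemma mon_add: "mon (e + f) = mon e * mon f"
  by (simp add: mult_single flip: rhomD(3)[OF rhom_emb])

lemma mon_minus: "mon (- e) = inverse (mon e)"
proof -
  have "mon e * mon (- e) = 1" using mon_add[of e "- e"] by simp
  then show ?thesis by (rule inverse_unique[symmetric])
qed

lemma mon_inj: "mon e = mon f \<longleftrightarrow> e = f"
  by (simp add: emb_inj) (metis keys_single singleton_iff zero_neq_one singletonI)

text \<open>The variable \<open>q\<close> has index \<open>0\<close>, \<open>Z\<^sub>r\<close> has index \<open>2 r + 1\<close> and \<open>\<xi>\<^sub>j\<close> has index \<open>2 j + 2\<close>.\<close>

abbreviation "qf \<equiv> mon (single 0 1)"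
abbreviation "zf r \<equiv> mon (single (2 * r + 1) 1)"
abbreviation "xf j \<equiv> mon (single (2 * j + 2) 1)"

lemma mon_nz: "mon e \<noteq> 0"
  unfolding emb_0 by (metis lookup_single_eq lookup_zero zero_neq_one)

lemma qf_powi: "qf powi k = mon (single 0 k)"
proof -
  have nat: "qf ^ n = mon (single 0 (int n))" for n
    by (induction n) (simp_all add: single_add add.commute flip: mon_add)
  show ?thesis
  proof (cases "k \<ge> 0")
    case True
    then show ?thesis using nat[of "nat k"] by (simp add: power_int_def)
  next
    case False
    then show ?thesis using nat[of "nat (- k)"] mon_minus[of "single 0 (- k)"]
      by (simp add: power_int_def power_inverse single_uminus)
  qed
qed

lemma generic_fract: "1 \<le> N \<Longrightarrow> generic_field qf xf N"
proof
  show "xf j \<noteq> 0" "qf \<noteq> 0" for j by (rule mon_nz)+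
  fix i j :: nat and k m :: int assume ij: "i \<noteq> j"
  show "qf powi k * xf i \<noteq> qf powi m * xf j"
  proof
    assume "qf powi k * xf i = qf powi m * xf j"
    then have "single 0 k + single (2 * i + 2) 1 = single 0 m + single (2 * j + 2) 1"
      unfolding qf_powi mon_add[symmetric] mon_inj .
    from arg_cong[OF this, of "\<lambda>e. lookup e (2 * i + 2)"] show False
      using ij by (simp add: lookup_add lookup_single when_def)
  qed
qed simp

text \<open>Laurent polynomials without any \<xi>_j, these being the variables with even index at
  least 2. No denominators are allowed, so that exponents of the \<xi>_j can be compared.\<close>

definition scalars :: "lpoly fract set" where
  "scalars = emb ` {p. \<forall>e\<in>keys p. \<forall>j. lookup e (2 * j + 2) = 0}"

lemma scalars_emb: "(\<And>e j. e \<in> keys p \<Longrightarrow> lookup e (2 * j + 2) = 0) \<Longrightarrow> emb p \<in> scalars"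
  unfolding scalars_def by blast

lemma scalars_closed: "a \<in> scalars \<Longrightarrow> b \<in> scalars \<Longrightarrow> a + b \<in> scalars" "a \<in> scalars \<Longrightarrow> b \<in> scalars \<Longrightarrow> a * b \<in> scalars"
  "0 \<in> scalars" "1 \<in> scalars" "a \<in> scalars \<Longrightarrow> - a \<in> scalars"
proof -
  show "0 \<in> scalars" "1 \<in> scalars"
    using scalars_emb[of 0] scalars_emb[of 1] by (simp_all add: rhomD[OF rhom_emb])
  show "- a \<in> scalars" if "a \<in> scalars"
  proof -
    from that obtain p where p: "a = emb p" "\<forall>e\<in>keys p. \<forall>j. lookup e (2 * j + 2) = 0" unfolding scalars_def by blast
    then show ?thesis using scalars_emb[of "- p"] by (simp add: rhomD[OF rhom_emb])
  qed
  assume "a \<in> scalars" "b \<in> scalars"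
  then obtain p r where p: "a = emb p" "\<forall>e\<in>keys p. \<forall>j. lookup e (2 * j + 2) = 0"
    and r: "b = emb r" "\<forall>e\<in>keys r. \<forall>j. lookup e (2 * j + 2) = 0" unfolding scalars_def by blast
  have "emb (p + r) \<in> scalars" by (rule scalars_emb) (use keys_add[of p r] p r in blast)
  then show "a + b \<in> scalars" by (simp add: rhomD[OF rhom_emb] p r)
  have "emb (p * r) \<in> scalars"
    by (rule scalars_emb) (use keys_mult[of p r] p r in \<open>auto simp: lookup_add\<close>)
  then show "a * b \<in> scalars" by (simp add: rhomD[OF rhom_emb] p r)
qed

lemma scalars_q: "qf powi k \<in> scalars" and scalars_Z: "zf r \<in> scalars"
  unfolding qf_powi by (rule scalars_emb; auto simp: lookup_single when_def; presburger)+

definition xi_exp :: "nat list \<times> nat list \<Rightarrow> nat \<Rightarrow>\<^sub>0 int" where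
  "xi_exp y = sum_list (map (\<lambda>j. single (2 * j + 2) 1) (fst y)) - sum_list (map (\<lambda>j. single (2 * j + 2) 1) (snd y))"

lemma pair_prod_xi: "pair_prod xf (\<lambda>j. inverse (xf j)) y = mon (xi_exp y)"
proof -
  have 1: "prod_list (map xf ys) = mon (sum_list (map (\<lambda>j. single (2 * j + 2) 1) ys))" for ys
    by (induction ys) (simp_all add: mon_add)
  have 2: "prod_list (map (\<lambda>j. inverse (xf j)) ys) = mon (- sum_list (map (\<lambda>j. single (2 * j + 2) 1) ys))" for ys
  proof (induction ys)
    case (Cons j ys)
    show ?case unfolding list.map prod_list.Cons sum_list.Cons Cons
      by (simp only: mon_minus mon_add inverse_mult_distrib)
  qed simp
  show ?thesis unfolding pair_prod_def 1 2 xi_exp_def mon_add[symmetric] by simp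
qed

lemma lookup_xi_exp: "lookup (xi_exp y) (2 * j + 2) = int (count_list (fst y) j) - int (count_list (snd y) j)"
proof -
  have "lookup (sum_list (map (\<lambda>j. single (2 * j + 2) 1) ys)) (2 * j + 2) = int (count_list ys j)" for ys
    by (induction ys) (auto simp: lookup_add lookup_single when_def)
  then show ?thesis by (simp add: xi_exp_def lookup_minus)
qed

lemma lookup_mult_single: "lookup (p * single x 1) f = lookup (p :: lpoly) (f - x)"
proof -
  have "p * single x 1 = (\<Sum>m\<in>keys p. single m (lookup p m)) * single x 1"
    by (rule arg_cong[where f = "\<lambda>p. p * single x 1", OF poly_mapping_sum_single])
  also have "\<dots> = (\<Sum>m\<in>keys p. single (m + x) (lookup p m))"
    by (simp add: sum_distrib_right mult_single)
  finally have "lookup (p * single x 1) f = (\<Sum>m\<in>keys p. lookup (single (m + x) (lookup p m)) f)"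
    by (simp add: lookup_sum)
  also have "\<dots> = (\<Sum>m\<in>keys p. if m = f - x then lookup p m else 0)"
    by (rule sum.cong) (auto simp: lookup_single when_def eq_diff_eq)
  finally show ?thesis by (simp add: in_keys_iff)
qed

text \<open>The coefficients contain no \<xi>_j, so two terms can share an exponent vector only if
  their \<xi>-exponents coincide. Those are differences of multiplicities, which determine a
  disjoint pair.\<close>

lemma xi_independent:
  assumes "1 \<le> N" "finite P" "P \<subseteq> disjoint_pairs N" "\<And>y. y \<in> P \<Longrightarrow> \<kappa> y \<in> scalars"
    and sum0: "(\<Sum>y\<in>P. \<kappa> y * pair_prod xf (\<lambda>j. inverse (xf j)) y) = 0"
  shows "\<forall>y\<in>P. \<kappa> y = 0"
proof
  interpret generic_field qf xf N by (rule generic_fract[OF assms(1)])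
  have "\<exists>p. \<forall>y\<in>P. \<kappa> y = emb (p y) \<and> (\<forall>e\<in>keys (p y). \<forall>j. lookup e (2 * j + 2) = 0)"
    using assms(4) unfolding scalars_def by (intro bchoice) blast
  then obtain p where p: "\<And>y. y \<in> P \<Longrightarrow> \<kappa> y = emb (p y)"
    "\<And>y e j. y \<in> P \<Longrightarrow> e \<in> keys (p y) \<Longrightarrow> lookup e (2 * j + 2) = 0" by blast
  have "emb (\<Sum>y\<in>P. p y * single (xi_exp y) 1) = (\<Sum>y\<in>P. \<kappa> y * pair_prod xf (\<lambda>j. inverse (xf j)) y)"
    unfolding pair_prod_xi by (simp add: rhom_sum[OF rhom_emb] rhomD[OF rhom_emb] p(1))
  then have s: "(\<Sum>y\<in>P. p y * single (xi_exp y) 1) = 0" using sum0 emb_0 by simp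
  fix y0 assume y0: "y0 \<in> P"
  have "lookup (p y0) e = 0" if e: "e \<in> keys (p y0)" for e
  proof -
    have z: "lookup (p y) (e + xi_exp y0 - xi_exp y) = 0" if y: "y \<in> P" "y \<noteq> y0" for y
    proof (rule ccontr)
      assume "lookup (p y) (e + xi_exp y0 - xi_exp y) \<noteq> 0"
      then have "e + xi_exp y0 - xi_exp y \<in> keys (p y)" by (simp add: in_keys_iff)
      from p(2)[OF y(1) this] have eq: "lookup (xi_exp y0) (2 * j + 2) = lookup (xi_exp y) (2 * j + 2)" for j
        using p(2)[OF y0 e] by (simp add: lookup_add lookup_minus)
      have d: "(fst y, snd y) \<in> disjoint_pairs N" "(fst y0, snd y0) \<in> disjoint_pairs N" using y y0 assms(3) by auto
      have "int (count_list (snd y) j) - int (count_list (fst y) j) = int (count_list (snd y0) j) - int (count_list (fst y0) j)" for j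
        using eq[of j] unfolding lookup_xi_exp by simp
      from disjoint_pairs_determined[OF d this] show False using y(2) by (simp add: prod_eq_iff)
    qed
    have "0 = lookup (\<Sum>y\<in>P. p y * single (xi_exp y) 1) (e + xi_exp y0)" unfolding s by simp
    also have "\<dots> = (\<Sum>y\<in>P. lookup (p y) (e + xi_exp y0 - xi_exp y))" by (simp add: lookup_sum lookup_mult_single)
    also have "\<dots> = (\<Sum>y\<in>{y0}. lookup (p y) (e + xi_exp y0 - xi_exp y))"
      by (rule sum.mono_neutral_right) (use assms(2) y0 z in auto)
    finally show ?thesis by simp
  qed
  then have "p y0 = 0" by (intro poly_mapping_eqI) (metis in_keys_iff lookup_zero)
  then show "\<kappa> y0 = 0" using p(1)[OF y0] by (simp add: rhomD[OF rhom_emb])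
qed

lemma val_neq_Z:
  fixes N :: nat
  assumes "1 \<le> N" shows "generic_field.val qf xf a \<noteq> zf r"
proof
  interpret generic_field qf xf N by (rule generic_fract[OF assms])
  assume "val a = zf r"
  then have "single 0 (snd a) + single (2 * fst a + 2) 1 = single (2 * r + 1) 1"
    unfolding val_def qf_powi mon_add[symmetric] mon_inj .
  from arg_cong[OF this, of "\<lambda>e. lookup e (2 * fst a + 2)"] show False
    by (auto simp: lookup_add lookup_single when_def split: if_splits) presburger
qed

subsection \<open>Embedding the coefficient ring\<close>

abbreviation "s1 \<equiv> (1 + fps_X :: lpoly fract fps)"

text \<open>Integer powers of a unit with its inverse supplied as a second argument: power series do
  not form a field, but t = 1 + \<open>fps_X\<close> has negative powers.\<close>

definition upow :: "'r::comm_ring_1 \<Rightarrow> 'r \<Rightarrow> int \<Rightarrow> 'r" where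
  "upow u v k = (if k \<ge> 0 then u ^ nat k else v ^ nat (- k))"

lemma upow_simps: "upow u v 0 = 1" "upow u v 1 = u" "upow u v (-1) = v"
  by (simp_all add: upow_def)

lemma upow_nat:
  assumes "u * v = 1" shows "u ^ n * upow u v k = upow u v (k + int n)"
proof (induction n)
  case (Suc n)
  have "u * upow u v k = upow u v (k + 1)" for k
  proof (cases "k \<ge> 0")
    case True
    then have "nat (k + 1) = Suc (nat k)" by simp
    then show ?thesis using True by (simp add: upow_def)
  next
    case False
    then have "nat (- k) = Suc (nat (- (k + 1)))" by simp
    then have "upow u v k = v * v ^ nat (- (k + 1))" using False by (simp add: upow_def)
    then have "u * upow u v k = v ^ nat (- (k + 1))" using assms by (simp flip: mult.assoc)
    then show ?thesis using False by (cases "k = -1") (simp_all add: upow_def)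
  qed
  then show ?case using Suc by (simp add: mult.assoc add_ac)
qed simp

lemma upow_add:
  assumes "u * v = 1" shows "upow u v (j + k) = upow u v j * upow u v k"
proof -
  have c: "u ^ n * x = u ^ n * y \<Longrightarrow> x = y" for n x y
  proof -
    assume "u ^ n * x = u ^ n * y"
    then have "(v * u) ^ n * x = (v * u) ^ n * y" by (simp add: power_mult_distrib mult.assoc)
    then show "x = y" using assms by (simp add: mult.commute)
  qed
  let ?m = "nat (- j)" and ?n = "nat (- k)"
  have "u ^ (?m + ?n) * (upow u v j * upow u v k) = (u ^ ?m * upow u v j) * (u ^ ?n * upow u v k)"
    by (simp add: power_add mult_ac)
  also have "\<dots> = u ^ (nat (j + int ?m) + nat (k + int ?n))"
    unfolding upow_nat[OF assms] by (simp add: upow_def power_add)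
  also have "nat (j + int ?m) + nat (k + int ?n) = nat (j + k + int (?m + ?n))"
    by (cases "0 \<le> j"; cases "0 \<le> k"; simp add: nat_add_distrib)
  also have "u ^ nat (j + k + int (?m + ?n)) = u ^ (?m + ?n) * upow u v (j + k)"
    unfolding upow_nat[OF assms] by (simp add: upow_def)
  finally have e: "u ^ (?m + ?n) * (upow u v j * upow u v k) = u ^ (?m + ?n) * upow u v (j + k)" .
  show ?thesis by (rule c[OF e, symmetric])
qed

definition chi_qt :: "(qt_var \<Rightarrow>\<^sub>0 int) \<Rightarrow> lpoly fract fps" where
  "chi_qt m = fps_const (mon (single 0 (lookup m Var_q))) * upow s1 (inverse s1) (lookup m Var_t)"

text \<open>Renames Z_r to the variable with index 2 r + 1: for odd j = 2 r + 1 the quotient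
  \<open>j div 2\<close> is r.\<close>

lift_definition zexp :: "(nat \<Rightarrow>\<^sub>0 int) \<Rightarrow> nat \<Rightarrow>\<^sub>0 int" is
  "\<lambda>m j. if odd j then m (j div 2) else 0"
proof -
  fix m :: "nat \<Rightarrow> int" assume "finite {k. m k \<noteq> 0}"
  then have "finite ((\<lambda>k. 2 * k + 1) ` {k. m k \<noteq> 0})" by simp
  moreover have "{j. (if odd j then m (j div 2) else 0) \<noteq> 0} \<subseteq> (\<lambda>k. 2 * k + 1) ` {k. m k \<noteq> 0}"
    by (auto elim!: oddE split: if_splits)
  ultimately show "finite {j. (if odd j then m (j div 2) else 0) \<noteq> 0}" by (rule finite_subset[rotated])
qed

lemma lookup_zexp: "lookup (zexp m) j = (if odd j then lookup m (j div 2) else 0)"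
  by (simp add: zexp.rep_eq)

definition chi_Z :: "(nat \<Rightarrow>\<^sub>0 int) \<Rightarrow> lpoly fract fps" where "chi_Z m = fps_const (mon (zexp m))"

definition ev_qt :: "qt_laurent \<Rightarrow> lpoly fract fps" where
  "ev_qt = pm_ev (\<lambda>c. fps_const (emb (single 0 c))) chi_qt"
definition ev_K :: "Zqt_laurent \<Rightarrow> lpoly fract fps" where "ev_K = pm_ev ev_qt chi_Z"

lemma s1_inv: "s1 * inverse s1 = 1"
  by (rule inverse_mult_eq_1') simp

lemma rhom_const: "rhom (\<lambda>c::complex. fps_const (emb (single 0 c)))"
  by (simp add: rhom_def rhomD[OF rhom_emb] single_add flip: fps_const_add)
    (simp add: mult_single flip: rhomD(3)[OF rhom_emb])

lemma rhom_ev_qt: "rhom ev_qt"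
  unfolding ev_qt_def
  by (rule rhom_pm_ev[OF rhom_const])
    (simp_all add: chi_qt_def upow_simps lookup_add single_add mon_add upow_add[OF s1_inv] mult_ac flip: fps_const_mult)

lemma rhom_ev_K: "rhom ev_K"
  unfolding ev_K_def
proof (rule rhom_pm_ev[OF rhom_ev_qt])
  have z: "zexp 0 = 0" "zexp (m + n) = zexp m + zexp n" for m n
    by (auto intro!: poly_mapping_eqI simp: lookup_zexp lookup_add)
  show "chi_Z 0 = 1" "chi_Z (m + n) = chi_Z m * chi_Z n" for m n
    by (simp_all add: chi_Z_def z mon_add)
qed (rule mult.commute)

lemma ev_qt_lvar: "ev_qt (lvar Var_q k) = fps_const (qf powi k)" "ev_qt (lvar Var_t 1) = s1" "ev_qt (lvar Var_t (-1)) = inverse s1"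
  unfolding qf_powi
  by (simp_all add: lvar_def ev_qt_def pm_ev_single[OF rhom_const] chi_qt_def lookup_single upow_simps)

lemma ev_K_single: "ev_K (single m u) = ev_qt u * chi_Z m"
  by (simp add: ev_K_def pm_ev_single[OF rhom_ev_qt])

lemma ev_K_Z: "ev_K (lvar r 1) = fps_const (zf r)"
proof -
  have "zexp (single r 1) = single (2 * r + 1) 1"
    by (rule poly_mapping_eqI) (auto simp: lookup_zexp lookup_single when_def elim!: oddE)
  then show ?thesis by (simp add: lvar_def ev_K_single rhomD[OF rhom_ev_qt] chi_Z_def)
qed

lemma scalars_sum: "(\<And>x. x \<in> A \<Longrightarrow> f x \<in> scalars) \<Longrightarrow> sum f A \<in> scalars"
  by (induction A rule: infinite_finite_induct) (auto intro: scalars_closed)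

text \<open>The series with all coefficients in \<open>scalars\<close> form a ring that contains 1 +
  \<open>fps_X\<close>, and also its inverse, whose coefficients are powers of -1. Hence expanding
  in t - 1 introduces neither \<xi>_j nor denominators.\<close>

lemma ev_K_scalars: "fps_nth (ev_K k) n \<in> scalars"
proof -
  let ?G = "{f :: lpoly fract fps. \<forall>n. fps_nth f n \<in> scalars}"
  have mult: "f * g \<in> ?G" if "f \<in> ?G" "g \<in> ?G" for f g
    using that by (auto simp: fps_mult_nth intro!: scalars_sum scalars_closed(2))
  have sum: "sum f A \<in> ?G" if "\<And>x. x \<in> A \<Longrightarrow> f x \<in> ?G" for f :: "'x \<Rightarrow> _" and A
    using that by (auto simp: fps_sum_nth intro!: scalars_sum)
  have const: "fps_const c \<in> ?G" if "c \<in> scalars" for c using that by (auto intro: scalars_closed)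
  have one: "1 \<in> ?G" using const[OF scalars_closed(4)] by simp
  have pow: "f ^ n \<in> ?G" if "f \<in> ?G" for f n by (induction n) (use that one mult in auto)
  have s: "s1 \<in> ?G" by (auto simp: fps_X_def intro: scalars_closed)
  have minus: "(- 1) ^ n \<in> scalars" for n :: nat
    by (induction n) (auto intro: scalars_closed)
  have si: "inverse s1 \<in> ?G"
    using minus by (simp add: fps_inverse_fps_X_plus1)
  have m0: "emb (single 0 c) \<in> scalars" for c by (rule scalars_emb) (auto split: if_splits)
  have mz: "mon (zexp m) \<in> scalars" for m by (rule scalars_emb) (simp add: lookup_zexp)
  have mq: "mon (single 0 a) \<in> scalars" for a using scalars_q[of a] unfolding qf_powi .
  have "chi_qt m \<in> ?G" for m
  proof -
    have "upow s1 (inverse s1) k \<in> ?G" for k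
      unfolding upow_def using pow[OF s] pow[OF si] by (cases "k \<ge> 0") (simp_all only: if_True if_False)
    then show ?thesis unfolding chi_qt_def by (rule mult[OF const[OF mq]])
  qed
  then have "ev_qt u \<in> ?G" for u
    unfolding ev_qt_def pm_ev_def by (intro sum mult const m0)
  then have "ev_K k \<in> ?G"
    unfolding ev_K_def pm_ev_def chi_Z_def by (intro sum mult const mz)
  then show ?thesis by simp
qed

text \<open>Multiplication by a high power of 1 + \<open>fps_X\<close> removes negative exponents
  and leaves a polynomial evaluated at 1 + X. Composition with 1 + X is injective on polynomials, so
  all coefficients vanish.\<close>

lemma fps_power_independent:
  fixes a :: "int \<Rightarrow> lpoly fract"
  assumes "finite A" "(\<Sum>k\<in>A. fps_const (a k) * upow s1 (inverse s1) k) = 0"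
  shows "\<forall>k\<in>A. a k = 0"
proof -
  obtain m where m: "\<And>k. k \<in> A \<Longrightarrow> - int m \<le> k"
  proof -
    have "- int (nat (\<Sum>j\<in>A. \<bar>j\<bar>)) \<le> k" if "k \<in> A" for k
      using member_le_sum[of k A "\<lambda>j. \<bar>j\<bar>"] assms(1) that by auto
    then show ?thesis using that by blast
  qed
  define p where "p = (\<Sum>k\<in>A. Polynomial.monom (a k) (nat (k + int m)))"
  have "fps_of_poly (pcompose p [:1, 1:]) = (\<Sum>k\<in>A. fps_const (a k) * s1 ^ nat (k + int m))"
  proof -
    have lin: "fps_of_poly [:1, 1:] = s1" by (simp add: fps_of_poly_pCons)
    have hom: "fps_of_poly (pcompose (Polynomial.monom c n) [:1, 1:]) = fps_const c * s1 ^ n" for c and n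
    proof -
      have "pcompose ([:0, 1:] ^ n) [:1, 1:] = ([:1, 1:] ^ n :: lpoly fract poly)"
        by (induction n) (simp_all add: pcompose_1 pcompose_mult pcompose_pCons)
      then show ?thesis
        by (simp add: monom_altdef pcompose_smult fps_of_poly_smult fps_of_poly_power lin)
    qed
    show ?thesis unfolding p_def by (simp add: pcompose_sum fps_of_poly_sum hom)
  qed
  also have "\<dots> = s1 ^ m * (\<Sum>k\<in>A. fps_const (a k) * upow s1 (inverse s1) k)"
    unfolding sum_distrib_left
  proof (rule sum.cong[OF refl])
    fix k assume k: "k \<in> A"
    have "s1 ^ m * upow s1 (inverse s1) k = s1 ^ nat (k + int m)"
      unfolding upow_nat[OF s1_inv] using m[OF k] by (simp add: upow_def)
    then show "fps_const (a k) * s1 ^ nat (k + int m) = s1 ^ m * (fps_const (a k) * upow s1 (inverse s1) k)"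
      by (simp add: mult.left_commute)
  qed
  finally have "pcompose p [:1, 1:] = 0" using assms(2) by simp
  then have p0: "p = 0" by (simp add: pcompose_eq_0_iff)
  show ?thesis
  proof
    fix k assume k: "k \<in> A"
    have "Polynomial.coeff p (nat (k + int m)) = (\<Sum>k'\<in>A. if k' = k then a k' else 0)"
      unfolding p_def Polynomial.coeff_sum
    proof (rule sum.cong[OF refl])
      fix k' assume k': "k' \<in> A"
      have "nat (k' + int m) = nat (k + int m) \<longleftrightarrow> k' = k" using m[OF k] m[OF k'] by auto
      then show "Polynomial.coeff (Polynomial.monom (a k') (nat (k' + int m))) (nat (k + int m)) = (if k' = k then a k' else 0)"
        by (simp add: Polynomial.coeff_monom)
    qed
    then show "a k = 0" using p0 k assms(1) by simp
  qed
qed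

text \<open>Terms are grouped by their exponent of t, and each group vanishes by
  \<open>fps_power_independent\<close>. Within a group the exponents of q and of the Z_r, recorded
  together in \<open>E\<close>, identify a single term.\<close>

lemma ev_K_inj:
  assumes "ev_K k = 0" shows "k = 0"
proof -
  define I where "I = Sigma (keys k) (\<lambda>m. keys (lookup k m))"
  define E where "E i = zexp (fst i) + single 0 (lookup (snd i) Var_q)" for i :: "(nat \<Rightarrow>\<^sub>0 int) \<times> (qt_var \<Rightarrow>\<^sub>0 int)"
  define d where "d i = lookup (snd i) Var_t" for i :: "(nat \<Rightarrow>\<^sub>0 int) \<times> (qt_var \<Rightarrow>\<^sub>0 int)"
  define cf where "cf i = lookup (lookup k (fst i)) (snd i)" for i
  have finI: "finite I" unfolding I_def by (rule finite_SigmaI) auto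
  have e1: "emb (single e c) = emb (single 0 c) * mon e" for e c
    by (simp add: mult_single flip: rhomD(3)[OF rhom_emb])
  have smd: "fps_const (emb (single 0 c)) * chi_qt n * chi_Z m = fps_const (emb (single (E (m, n)) c)) * upow s1 (inverse s1) (d (m, n))" for m n c
    unfolding e1[of "E (m, n)" c] unfolding chi_qt_def chi_Z_def E_def d_def mon_add fst_conv snd_conv fps_const_mult[symmetric]
    by (simp only: mult_ac)
  have "ev_K k = (\<Sum>m\<in>keys k. \<Sum>n\<in>keys (lookup k m). fps_const (emb (single (E (m, n)) (cf (m, n)))) * upow s1 (inverse s1) (d (m, n)))"
    unfolding ev_K_def ev_qt_def pm_ev_def sum_distrib_right
    unfolding smd cf_def fst_conv snd_conv ..
  also have "\<dots> = (\<Sum>i\<in>I. fps_const (emb (single (E i) (cf i))) * upow s1 (inverse s1) (d i))"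
    unfolding I_def by (subst sum.Sigma) (auto simp: case_prod_unfold)
  also have "\<dots> = (\<Sum>a\<in>d ` I. \<Sum>i\<in>{i\<in>I. d i = a}. fps_const (emb (single (E i) (cf i))) * upow s1 (inverse s1) (d i))"
    by (rule sum.image_gen[OF finI])
  also have "\<dots> = (\<Sum>a\<in>d ` I. fps_const (emb (\<Sum>i\<in>{i\<in>I. d i = a}. single (E i) (cf i))) * upow s1 (inverse s1) a)"
  proof (rule sum.cong[OF refl])
    fix a
    have fc: "fps_const (sum f B) = (\<Sum>i\<in>B. fps_const (f i))" for f :: "_ \<Rightarrow> lpoly fract" and B
      by (induction B rule: infinite_finite_induct) (simp_all flip: fps_const_add)
    show "(\<Sum>i\<in>{i\<in>I. d i = a}. fps_const (emb (single (E i) (cf i))) * upow s1 (inverse s1) (d i))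
      = fps_const (emb (\<Sum>i\<in>{i\<in>I. d i = a}. single (E i) (cf i))) * upow s1 (inverse s1) a"
      unfolding rhom_sum[OF rhom_emb] fc sum_distrib_right by (rule sum.cong) auto
  qed
  finally have "(\<Sum>a\<in>d ` I. fps_const (emb (\<Sum>i\<in>{i\<in>I. d i = a}. single (E i) (cf i))) * upow s1 (inverse s1) a) = 0"
    using assms by simp
  from fps_power_independent[OF finite_imageI[OF finI] this]
  have z: "(\<Sum>i\<in>{i\<in>I. d i = a}. single (E i) (cf i)) = 0" if "a \<in> d ` I" for a
    using that emb_0 by blast
  have inj: "i = i'" if "E i = E i'" "d i = d i'" for i i'
  proof -
    obtain m n m' n' where i: "i = (m, n)" "i' = (m', n')" by (metis prod.collapse)
    have "lookup m r = lookup m' r" for r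
      using arg_cong[OF that(1), of "\<lambda>e. lookup e (2 * r + 1)"]
      by (simp add: E_def i lookup_add lookup_zexp lookup_single)
    then have m: "m = m'" by (rule poly_mapping_eqI)
    have "lookup n Var_q = lookup n' Var_q"
      using arg_cong[OF that(1), of "\<lambda>e. lookup e 0"] by (simp add: E_def i lookup_add lookup_zexp)
    moreover have "lookup n Var_t = lookup n' Var_t" using that(2) by (simp add: d_def i)
    ultimately have "lookup n v = lookup n' v" for v by (cases v) simp_all
    then have "n = n'" by (rule poly_mapping_eqI)
    then show ?thesis by (simp add: i m)
  qed
  have cf0: "cf i = 0" if i: "i \<in> I" for i
  proof -
    have "0 = lookup (\<Sum>j\<in>{j\<in>I. d j = d i}. single (E j) (cf j)) (E i)"
      using z[of "d i"] i by simp
    also have "\<dots> = (\<Sum>j\<in>{j\<in>I. d j = d i}. if j = i then cf j else 0)"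
      unfolding lookup_sum by (rule sum.cong) (auto simp: lookup_single when_def dest: inj)
    also have "\<dots> = cf i" using finI i by simp
    finally show ?thesis by simp
  qed
  have "lookup (lookup k m) n = 0" for m n
  proof (rule ccontr)
    assume nz: "lookup (lookup k m) n \<noteq> 0"
    then have "lookup k m \<noteq> 0" by auto
    then have "(m, n) \<in> I" using nz unfolding I_def by (simp add: in_keys_iff)
    from cf0[OF this] nz show False by (simp add: cf_def)
  qed
  then show "k = 0" by (intro poly_mapping_eqI) simp
qed

subsection \<open>Coefficients with respect to the \<open>Z\<close> variables\<close>

text \<open>The coefficient of Z^m. It reads a noncommutative polynomial over the Laurent ring in
  the Z_r as a Laurent polynomial in the Z_r over the free algebra, which is how
  \<open>daha_Z\<close> is built.\<close>

definition coef :: "('g, (nat \<Rightarrow>\<^sub>0 int) \<Rightarrow>\<^sub>0 'k::comm_ring_1) falg \<Rightarrow> (nat \<Rightarrow>\<^sub>0 int) \<Rightarrow> ('g, 'k) falg" where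
  "coef p m = (\<Sum>w\<in>keys p. single w (lookup (lookup p w) m))"

lemma lookup_coef: "lookup (coef p m) w = lookup (lookup p w) m"
proof -
  have "lookup (coef p m) w = (\<Sum>v\<in>keys p. if w = v then lookup (lookup p v) m else 0)"
    unfolding coef_def lookup_sum by (rule sum.cong) (auto simp: lookup_single when_def)
  then show ?thesis by (simp add: in_keys_iff)
qed

lemma coef_add: "coef (p + r) m = coef p m + coef r m"
  by (rule poly_mapping_eqI) (simp add: lookup_coef lookup_add)

lemma coef_zero: "coef 0 m = 0"
  by (simp add: coef_def)

lemma coef_sum: "coef (sum f A) m = (\<Sum>x\<in>A. coef (f x) m)"
  by (induction A rule: infinite_finite_induct) (simp_all add: coef_add coef_zero)

lemma coef_single: "coef (single w c) m = single w (lookup c m)"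
  by (rule poly_mapping_eqI) (simp add: lookup_coef lookup_single when_def)

lemma lookup_single_mult: "lookup (single a x * d) m = x * lookup d (m - a)"
  for d :: "'m::ab_group_add \<Rightarrow>\<^sub>0 'k::comm_ring_1"
proof -
  have "single a x * d = single a x * (\<Sum>b\<in>keys d. single b (lookup d b))"
    by (rule arg_cong[OF poly_mapping_sum_single])
  also have "\<dots> = (\<Sum>b\<in>keys d. single (a + b) (x * lookup d b))"
    by (simp add: sum_distrib_left mult_single)
  finally have "lookup (single a x * d) m = (\<Sum>b\<in>keys d. if b = m - a then x * lookup d b else 0)"
    by (simp only: lookup_sum) (rule sum.cong, auto simp: lookup_single when_def algebra_simps)
  then show ?thesis by (simp add: in_keys_iff)
qed

lemma lookup_mult_superset:
  fixes c d :: "'m::ab_group_add \<Rightarrow>\<^sub>0 'k::comm_ring_1"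
  assumes "finite A" "keys c \<subseteq> A"
  shows "lookup (c * d) m = (\<Sum>a\<in>A. lookup c a * lookup d (m - a))"
proof -
  have "c * d = (\<Sum>a\<in>keys c. single a (lookup c a)) * d"
    by (rule arg_cong[where f = "\<lambda>c. c * d", OF poly_mapping_sum_single])
  then have "lookup (c * d) m = (\<Sum>a\<in>keys c. lookup c a * lookup d (m - a))"
    by (simp add: sum_distrib_right lookup_sum lookup_single_mult)
  also have "\<dots> = (\<Sum>a\<in>A. lookup c a * lookup d (m - a))"
    by (rule sum.mono_neutral_left) (use assms in \<open>auto simp: in_keys_iff\<close>)
  finally show ?thesis .
qed

lemma coef_mult:
  fixes p r :: "('g, (nat \<Rightarrow>\<^sub>0 int) \<Rightarrow>\<^sub>0 'k::comm_ring_1) falg"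
  assumes A: "finite A" "\<And>w. keys (lookup p w) \<subseteq> A"
  shows "coef (p * r) m = (\<Sum>a\<in>A. coef p a * coef r (m - a))"
proof -
  have s: "single w (sum f A) = (\<Sum>a\<in>A. single w (f a))" for w :: "'g fword" and f :: "(nat \<Rightarrow>\<^sub>0 int) \<Rightarrow> 'k"
    by (induction A rule: infinite_finite_induct) (simp_all add: single_add)
  have "coef (p * r) m = (\<Sum>w\<in>keys p. \<Sum>v\<in>keys r. \<Sum>a\<in>A. single w (lookup (lookup p w) a) * single v (lookup (lookup r v) (m - a)))"
    unfolding mult_sum_single[of p r] coef_sum coef_single lookup_mult_superset[OF A] s mult_single ..
  also have "\<dots> = (\<Sum>w\<in>keys p. \<Sum>a\<in>A. \<Sum>v\<in>keys r. single w (lookup (lookup p w) a) * single v (lookup (lookup r v) (m - a)))"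
    by (intro sum.cong refl sum.swap)
  also have "\<dots> = (\<Sum>a\<in>A. \<Sum>w\<in>keys p. \<Sum>v\<in>keys r. single w (lookup (lookup p w) a) * single v (lookup (lookup r v) (m - a)))"
    by (rule sum.swap)
  finally show ?thesis by (simp add: coef_def sum_product)
qed

lemma finite_coef_support:
  fixes p :: "('g, (nat \<Rightarrow>\<^sub>0 int) \<Rightarrow>\<^sub>0 'k::comm_ring_1) falg"
  shows "finite (\<Union>w. keys (lookup p w))"
proof -
  have "(\<Union>w. keys (lookup p w)) \<subseteq> (\<Union>w\<in>keys p. keys (lookup p w))"
  proof
    fix a assume "a \<in> (\<Union>w. keys (lookup p w))"
    then obtain w where w: "a \<in> keys (lookup p w)" by blast
    then have "w \<in> keys p" by (cases "lookup p w = 0") (auto simp: in_keys_iff)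
    with w show "a \<in> (\<Union>w\<in>keys p. keys (lookup p w))" by blast
  qed
  then show ?thesis by (rule finite_subset) auto
qed

lemma coef_one: "coef 1 m = (if m = 0 then 1 else 0)"
proof -
  have "coef (single 0 1) m = single 0 (lookup 1 m)"
    by (rule coef_single)
  also have "lookup 1 m = (if m = 0 then 1 else 0)" by (simp add: lookup_one when_def)
  finally show ?thesis by (simp split: if_splits)
qed

subsection \<open>Presented rings\<close>

definition type_ring :: "'a::ring_1 ring" where
  "type_ring = \<lparr>carrier = UNIV, monoid.mult = (*), one = 1, zero = 0, add = (+)\<rparr>"

lemma ring_type_ring: "ring type_ring"
proof (rule ringI)
  show "abelian_group (type_ring :: 'a ring)"
    by (rule abelian_groupI) (auto simp: type_ring_def ac_simps intro: exI[of _ "- x" for x])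
  show "Group.monoid (type_ring :: 'a ring)" by (rule monoidI) (auto simp: type_ring_def ac_simps)
qed (auto simp: type_ring_def algebra_simps)

context coeff_ring
begin

lemma rel_ideal_ideal:
  assumes "\<And>a b. (a, b) \<in> R \<Longrightarrow> a \<in> carrier F \<and> b \<in> carrier F"
  shows "ideal (rel_ideal K G R) F"
  unfolding rel_ideal_def by (rule ring.genideal_ideal[OF F_ring]) (use assms F_minus in auto)

lemma rel_ideal_kernel:
  assumes S: "ring S" and h: "h \<in> ring_hom F S"
    and R: "\<And>a b. (a, b) \<in> R \<Longrightarrow> a \<in> carrier F \<and> b \<in> carrier F"
    and eq: "\<And>a b. (a, b) \<in> R \<Longrightarrow> h a = h b"
  shows "rel_ideal K G R \<subseteq> a_kernel F S h"
proof -
  interpret h: ring_hom_ring F S h by (rule ring_hom_ringI2[OF F_ring S h])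
  have "h (a - b) = \<zero>\<^bsub>S\<^esub>" if "(a, b) \<in> R" for a b
  proof -
    have "h (a - b) \<oplus>\<^bsub>S\<^esub> h b = h b"
      using ring_hom_add[OF h, of "a - b" b] R[OF that] F_minus eq[OF that] by (simp add: F_simps)
    then show ?thesis
      using h.S.add.r_cancel_one[of "h b" "h (a - b)"] R[OF that] F_minus[of a b] h.hom_closed by simp
  qed
  then have "{a - b | a b. (a, b) \<in> R} \<subseteq> a_kernel F S h"
    unfolding a_kernel_def' using R F_minus by blast
  then show ?thesis
    unfolding rel_ideal_def by (rule ring.genideal_minimal[OF F_ring h.kernel_is_ideal])
qed

lemma rel_ideal_rhom:
  assumes f: "rhom f"
    and R: "\<And>a b. (a, b) \<in> R \<Longrightarrow> a \<in> carrier F \<and> b \<in> carrier F"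
    and eq: "\<And>a b. (a, b) \<in> R \<Longrightarrow> f a = f b"
    and p: "p \<in> rel_ideal K G R"
  shows "f p = 0"
proof -
  have "f \<in> ring_hom F type_ring"
    by (rule ring_hom_memI) (auto simp: type_ring_def F_simps rhomD[OF f])
  from rel_ideal_kernel[OF ring_type_ring this R eq] p show ?thesis
    by (auto simp: a_kernel_def' type_ring_def)
qed

lemma pclass_ring_hom:
  assumes "\<And>a b. (a, b) \<in> R \<Longrightarrow> a \<in> carrier F \<and> b \<in> carrier F"
  shows "pclass K G R \<in> ring_hom F (presented K G R)"
proof -
  have "pclass K G R = (+>\<^bsub>F\<^esub>) (rel_ideal K G R)" by (rule ext) (simp add: pclass_def)
  then show ?thesis
    unfolding presented_def using ideal.rcos_ring_hom[OF rel_ideal_ideal[OF assms]] by simp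
qed

lemma presented_ring:
  assumes "\<And>a b. (a, b) \<in> R \<Longrightarrow> a \<in> carrier F \<and> b \<in> carrier F"
  shows "ring (presented K G R)"
  unfolding presented_def by (rule ideal.quotient_is_ring[OF rel_ideal_ideal[OF assms]])

lemma pclass_surj:
  assumes "x \<in> carrier (presented K G R)"
  shows "\<exists>p\<in>carrier F. x = pclass K G R p"
  using assms by (auto simp: presented_def FactRing_def A_RCOSETS_def' pclass_def)

lemma pclass_eq_0:
  assumes R: "\<And>a b. (a, b) \<in> R \<Longrightarrow> a \<in> carrier F \<and> b \<in> carrier F" and p: "p \<in> carrier F"
    and eq: "pclass K G R p = \<zero>\<^bsub>presented K G R\<^esub>"
  shows "p \<in> rel_ideal K G R"
proof -
  interpret I: ideal "rel_ideal K G R" F by (rule rel_ideal_ideal[OF R])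
  show ?thesis using eq I.rcos_const_imp_mem[OF p] by (simp add: pclass_def presented_def FactRing_def)
qed

text \<open>First isomorphism theorem. The ring \<open>B\<close> differs from \<open>S\<close> only
  in its carrier, so the homomorphism and its kernel may be studied in \<open>S\<close>, and
  \<open>B\<close> is recognized as the image.\<close>

lemma has_presentationI:
  assumes S: "ring S" and h: "h \<in> ring_hom F S"
    and R: "\<And>a b. (a, b) \<in> R \<Longrightarrow> a \<in> carrier F \<and> b \<in> carrier F"
    and eq: "\<And>a b. (a, b) \<in> R \<Longrightarrow> h a = h b"
    and ker: "\<And>p. p \<in> carrier F \<Longrightarrow> h p = \<zero>\<^bsub>S\<^esub> \<Longrightarrow> p \<in> rel_ideal K G R"
    and onto: "h ` carrier F = carrier B" and B: "B = S\<lparr>carrier := H\<rparr>"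
    and \<sigma>: "\<And>c. c \<in> K \<Longrightarrow> h (scal c) = \<sigma> c" and v: "\<And>g. g \<in> G \<Longrightarrow> h (gen g) = v g"
  shows "has_presentation B K \<sigma> G v R"
proof -
  have hB: "h \<in> ring_hom F B"
    using h onto by (auto simp: ring_hom_def B)
  interpret h: ring_hom_ring F S h by (rule ring_hom_ringI2[OF F_ring S h])
  have "ring (S\<lparr>carrier := h ` carrier F, zero := h \<zero>\<^bsub>F\<^esub>\<rparr>)"
    by (rule ring.ring_hom_imp_img_ring[OF F_ring h])
  moreover have "S\<lparr>carrier := h ` carrier F, zero := h \<zero>\<^bsub>F\<^esub>\<rparr> = B"
    using onto h.hom_zero by (simp add: B)
  ultimately have rB: "ring B" by simp
  interpret hB: ring_hom_ring F B h by (rule ring_hom_ringI2[OF F_ring rB hB])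
  have kB: "a_kernel F B h = rel_ideal K G R"
  proof
    show "a_kernel F B h \<subseteq> rel_ideal K G R"
    proof
      fix p assume "p \<in> a_kernel F B h"
      then have "p \<in> carrier F" "h p = \<zero>\<^bsub>B\<^esub>" unfolding a_kernel_def' by blast+
      then show "p \<in> rel_ideal K G R" using ker by (simp add: B)
    qed
    show "rel_ideal K G R \<subseteq> a_kernel F B h" by (rule rel_ideal_kernel[OF rB hB R eq])
  qed
  have iso: "(\<lambda>X. the_elem (h ` X)) \<in> ring_iso (presented K G R) B"
    using hB.FactRing_iso_set[OF onto] unfolding presented_def kB by simp
  have val: "the_elem (h ` pclass K G R p) = h p" if "p \<in> carrier F" for p
  proof -
    interpret I: ideal "rel_ideal K G R" F by (rule rel_ideal_ideal[OF R])
    note p = that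
    have "h x = h p" if x: "x \<in> pclass K G R p" for x
    proof -
      obtain i where i: "i \<in> a_kernel F B h" "x = i \<oplus>\<^bsub>F\<^esub> p"
        using x unfolding kB by (auto simp: pclass_def a_r_coset_def')
      then have "i \<in> carrier F" and hi: "h i = \<zero>\<^bsub>B\<^esub>" unfolding a_kernel_def' by blast+
      then have "h x = h i \<oplus>\<^bsub>B\<^esub> h p" unfolding i(2) using ring_hom_add[OF hB] p by blast
      then show ?thesis unfolding hi using hB.S.l_zero hB.hom_closed[OF p] by simp
    qed
    moreover have "p \<in> pclass K G R p"
      unfolding pclass_def using I.a_rcos_self[OF that] .
    ultimately have "h ` pclass K G R p = {h p}" by blast
    then show ?thesis by simp
  qed
  show ?thesis
    unfolding has_presentation_def
    by (rule bexI[OF _ iso]) (simp add: val F_scal F_gen \<sigma> v)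
qed

end

section \<open>Coefficients in Z_1, ..., Z_l: inclusion, retraction and augmentation\<close>

lemma Zqt_coeffsD: "k \<in> Zqt_coeffs l \<Longrightarrow> lookup k m \<noteq> 0 \<Longrightarrow> keys m \<subseteq> {1..l}"
  unfolding Zqt_coeffs_def by (auto simp: in_keys_iff)

lemma Zqt_coeffsI: "(\<And>m. lookup k m \<noteq> 0 \<Longrightarrow> keys m \<subseteq> {1..l}) \<Longrightarrow> k \<in> Zqt_coeffs l"
  unfolding Zqt_coeffs_def by (auto simp: in_keys_iff)

lemma Zqt_single: "keys m \<subseteq> {1..l} \<Longrightarrow> single m u \<in> Zqt_coeffs l"
  by (rule Zqt_coeffsI) (auto simp: lookup_single when_def split: if_splits)

lemma coeff_ring_Zqt: "coeff_ring (Zqt_coeffs l)"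
proof
  show "1 \<in> Zqt_coeffs l" using Zqt_single[of 0 l 1] by simp
  fix a b assume ab: "a \<in> Zqt_coeffs l" "b \<in> Zqt_coeffs l"
  show "a - b \<in> Zqt_coeffs l"
  proof (rule Zqt_coeffsI)
    fix m assume "lookup (a - b) m \<noteq> 0"
    then have "lookup a m \<noteq> 0 \<or> lookup b m \<noteq> 0" by (auto simp: lookup_minus)
    then show "keys m \<subseteq> {1..l}" using Zqt_coeffsD ab by blast
  qed
  show "a * b \<in> Zqt_coeffs l"
    unfolding Zqt_coeffs_def
  proof (intro CollectI ballI)
    fix m assume "m \<in> keys (a * b)"
    then obtain m1 m2 where "m1 \<in> keys a" "m2 \<in> keys b" "m = m1 + m2"
      using keys_mult[of a b] by blast
    moreover have "keys m1 \<subseteq> {1..l}" "keys m2 \<subseteq> {1..l}"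
      using calculation ab unfolding Zqt_coeffs_def by auto
    ultimately show "keys m \<subseteq> {1..l}" using keys_add[of m1 m2] by blast
  qed
qed

lemma coeff_ring_UNIV: "coeff_ring UNIV"
  by standard auto

lemma Zqt_consts: "ct \<in> Zqt_coeffs l" "ct' \<in> Zqt_coeffs l" "cq \<in> Zqt_coeffs l" "r \<in> {1..l} \<Longrightarrow> lvar r 1 \<in> Zqt_coeffs l"
  unfolding ct_def ct'_def cq_def lvar_def by (rule Zqt_single; simp)+

definition inZ :: "(nat \<Rightarrow>\<^sub>0 int) \<Rightarrow> ('g, qt_laurent) falg \<Rightarrow> ('g, Zqt_laurent) falg" where
  "inZ m g = (\<Sum>w\<in>keys g. single w (single m (lookup g w)))"

lemma coef_inZ: "coef (inZ m g) n = (if n = m then g else 0)"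
proof -
  have "coef (inZ m g) n = (\<Sum>w\<in>keys g. single w (if n = m then lookup g w else 0))"
    by (simp add: inZ_def coef_sum coef_single lookup_single when_def eq_commute)
  then show ?thesis using poly_mapping_sum_single[of g] by (simp split: if_splits)
qed

lemma inZ_fev: "inZ 0 = fev (\<lambda>u. scal (single 0 u)) gen"
proof (rule ext)
  fix g :: "('g, qt_laurent) falg"
  show "inZ 0 g = fev (\<lambda>u. scal (single 0 u)) gen g"
    unfolding inZ_def fev_def pm_ev_def by (rule sum.cong) (simp_all flip: single_word)
qed

lemma rhom_single: "rhom (single 0)"
  by (simp add: rhom_def single_add mult_single)

lemma rhom_scal_single: "rhom (\<lambda>u. scal (single 0 u))"
  by (rule rhom_compose[OF rhom_scal rhom_single])

lemma rhom_inZ: "rhom (inZ 0)"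
  unfolding inZ_fev by (rule rhom_fev[OF rhom_scal_single scal_commute])

lemma inZ_gen: "inZ 0 (gen g) = gen g"
  unfolding inZ_fev by (rule fev_gen[OF rhom_scal_single])

lemma inZ_scal: "inZ 0 (scal u) = scal (single 0 u)"
  unfolding inZ_fev by (rule fev_scal[OF rhom_scal_single])

lemma inZ_closed:
  assumes "g \<in> carrier (free_algebra UNIV G)" "keys m \<subseteq> {1..l}"
  shows "inZ m g \<in> carrier (free_algebra (Zqt_coeffs l) G)"
proof -
  interpret coeff_ring "Zqt_coeffs l" G by (rule coeff_ring_Zqt)
  show ?thesis unfolding inZ_def
    by (intro F_sum F_single Zqt_single assms(2)) (use assms(1) in \<open>auto simp: free_algebra_def\<close>)
qed

lemma coef_closed:
  "p \<in> carrier (free_algebra (Zqt_coeffs l) G) \<Longrightarrow> coef p m \<in> carrier (free_algebra UNIV G)"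
proof -
  interpret coeff_ring "UNIV :: qt_laurent set" G by (rule coeff_ring_UNIV)
  assume "p \<in> carrier (free_algebra (Zqt_coeffs l) G)"
  then show ?thesis unfolding coef_def
    by (intro F_sum F_single) (auto simp: free_algebra_def)
qed

definition restr :: "nat \<Rightarrow> (nat \<Rightarrow>\<^sub>0 int) \<Rightarrow> nat \<Rightarrow>\<^sub>0 int" where
  "restr l m = (\<Sum>k\<in>keys m \<inter> {1..l}. single k (lookup m k))"

lemma lookup_restr: "lookup (restr l m) k = (if k \<in> {1..l} then lookup m k else 0)"
proof -
  have "lookup (restr l m) k = (\<Sum>j\<in>keys m \<inter> {1..l}. if j = k then lookup m k else 0)"
    by (simp add: restr_def lookup_sum lookup_single when_def cong: if_cong)
  then show ?thesis by (auto simp: in_keys_iff)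
qed

lemma restr_add: "restr l (m + n) = restr l m + restr l n"
  by (rule poly_mapping_eqI) (simp add: lookup_restr lookup_add)

lemma restr_zero: "restr l 0 = 0"
  by (simp add: restr_def)

lemma restr_id: "keys m \<subseteq> {1..l} \<Longrightarrow> restr l m = m"
  by (rule poly_mapping_eqI) (auto simp: lookup_restr in_keys_iff)

lemma keys_restr: "keys (restr l m) \<subseteq> {1..l}"
  by (auto simp: in_keys_iff lookup_restr split: if_splits)

text \<open>Sets Z_r = 1 for all r outside 1, ..., l: a ring retraction of the coefficient type onto
  \<open>Zqt_coeffs l\<close>.\<close>

definition Zrestr :: "nat \<Rightarrow> Zqt_laurent \<Rightarrow> Zqt_laurent" where
  "Zrestr l = pm_ev (single 0) (\<lambda>m. single (restr l m) 1)"

lemma rhom_Zrestr: "rhom (Zrestr l)"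
  unfolding Zrestr_def
  by (rule rhom_pm_ev[OF rhom_single]) (simp_all add: restr_zero restr_add mult_single)

lemma Zrestr_closed: "Zrestr l k \<in> Zqt_coeffs l"
proof -
  interpret coeff_ring "Zqt_coeffs l" by (rule coeff_ring_Zqt)
  have sum: "(\<And>x. x \<in> A \<Longrightarrow> f x \<in> Zqt_coeffs l) \<Longrightarrow> sum f A \<in> Zqt_coeffs l" for f :: "(nat \<Rightarrow>\<^sub>0 int) \<Rightarrow> Zqt_laurent" and A
    by (induction A rule: infinite_finite_induct) (auto intro: Kplus K0)
  show ?thesis unfolding Zrestr_def pm_ev_def
    by (rule sum) (simp add: mult_single Zqt_single keys_restr)
qed

lemma Zrestr_id:
  assumes "k \<in> Zqt_coeffs l" shows "Zrestr l k = k"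
proof -
  have "Zrestr l k = (\<Sum>m\<in>keys k. single m (lookup k m))"
    unfolding Zrestr_def pm_ev_def
    by (rule sum.cong) (use assms in \<open>auto simp: mult_single restr_id Zqt_coeffs_def\<close>)
  then show ?thesis using poly_mapping_sum_single[of k] by simp
qed

lemma tideal_rel_ideal:
  fixes G :: "'g set" and l :: nat
  assumes R: "\<And>a b. (a, b) \<in> R \<Longrightarrow> a \<in> carrier (free_algebra (Zqt_coeffs l) G) \<and> b \<in> carrier (free_algebra (Zqt_coeffs l) G)"
    and p: "p \<in> tideal R" "p \<in> carrier (free_algebra (Zqt_coeffs l) G)"
  shows "p \<in> rel_ideal (Zqt_coeffs l) G R"
proof -
  interpret coeff_ring "Zqt_coeffs l" G by (rule coeff_ring_Zqt)
  \<comment> \<open>The retraction needed by \<open>tideal_retract\<close> restricts the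
    coefficients by \<open>Zrestr\<close> and sends the letters outside G to 0.\<close>
  define r where "r = fev (\<lambda>k. scal (Zrestr l k)) (\<lambda>g::'g. if g \<in> G then gen g else 0)"
  have s: "rhom (\<lambda>k. scal (Zrestr l k) :: ('g, Zqt_laurent) falg)"
    by (rule rhom_compose[OF rhom_scal rhom_Zrestr])
  have r: "rhom r" unfolding r_def by (rule rhom_fev[OF s scal_commute])
  show ?thesis
  proof (rule tideal_retract[OF R r _ _ p])
    show "r x \<in> carrier F" for x
      unfolding r_def fev_def pm_ev_def
      by (intro F_sum F_mult F_scal Zrestr_closed F_prod_list) (auto intro: F_gen F_0)
    show "r x = x" if "x \<in> carrier F" for x
      using that
    proof (induction x rule: F_induct)
      case (mult k xs)
      have "map (\<lambda>g. r (gen g)) xs = map gen xs"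
        by (rule map_cong) (use mult in \<open>auto simp: r_def fev_gen[OF s]\<close>)
      then have "r (prod_list (map gen xs)) = prod_list (map gen xs)"
        by (simp only: rhom_prod_list[OF r] map_map o_def)
      moreover have "r (scal k) = scal k" using mult by (simp add: r_def fev_scal[OF s] Zrestr_id)
      ultimately show ?case by (simp only: rhomD(3)[OF r])
    qed (simp_all add: rhomD[OF r])
  qed
qed

definition aug_coeff :: "Zqt_laurent \<Rightarrow> Zqt_laurent" where
  "aug_coeff = pm_ev (pm_ev (\<lambda>c. single 0 (single 0 c)) (\<lambda>_. 1)) (\<lambda>_. 1)"

lemma rhom_aug_coeff: "rhom aug_coeff"
  unfolding aug_coeff_def
  by (intro rhom_pm_ev rhom_compose[OF rhom_single rhom_single]) simp_all

lemma aug_coeff_var: "aug_coeff (single m (single n 1)) = 1"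
proof -
  have c: "rhom (\<lambda>c::complex. single 0 (single 0 c) :: Zqt_laurent)" by (rule rhom_compose[OF rhom_single rhom_single])
  have i: "rhom (pm_ev (\<lambda>c::complex. single 0 (single 0 c) :: Zqt_laurent) (\<lambda>_::qt_var \<Rightarrow>\<^sub>0 int. 1))"
    by (rule rhom_pm_ev[OF c]) simp_all
  show ?thesis unfolding aug_coeff_def by (simp add: pm_ev_single[OF i] pm_ev_single[OF c])
qed

text \<open>
  The homomorphism \<open>embq I f\<close> uses \<open>f\<close> at all ideals other than \<open>I\<close>, so that a unital \<open>f\<close> respecting the
  relations is needed; the augmentation at \<open>q = \<^bold>t = Z\<^sub>r = 1\<close> is one.
\<close>

definition aug :: "nat \<Rightarrow> (generator, Zqt_laurent) falg \<Rightarrow> (generator, Zqt_laurent) falg" where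
  "aug l = fev (\<lambda>k. scal (aug_coeff k)) (\<lambda>g. case g of Gen_D _ \<Rightarrow> if l = 0 then 1 else 0 | _ \<Rightarrow> 1)"

lemma rhom_scal_aug: "rhom (\<lambda>k. scal (aug_coeff k) :: (generator, Zqt_laurent) falg)"
  by (rule rhom_compose[OF rhom_scal rhom_aug_coeff])

lemma rhom_aug: "rhom (aug l)"
  unfolding aug_def by (rule rhom_fev[OF rhom_scal_aug scal_commute])

lemma aug_scal: "aug l (scal k) = scal (aug_coeff k)"
  unfolding aug_def by (rule fev_scal[OF rhom_scal_aug])

lemma aug_gens: "aug l (T i) = 1" "aug l (X i) = 1" "aug l (Xinv i) = 1" "aug l (Y i) = 1" "aug l (Yinv i) = 1"
  "aug l (D i) = (if l = 0 then 1 else 0)"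
  by (simp_all add: aug_def fev_gen[OF rhom_scal_aug])

lemma aug_consts: "aug l (scal ct) = 1" "aug l (scal ct') = 1" "aug l (scal cq) = 1" "aug l (scal (lvar r 1)) = 1"
  "aug l (scal (single 0 (lvar v k))) = 1"
  using aug_coeff_var[of "single r 1" 0]
  by (simp_all add: aug_scal ct_def ct'_def cq_def lvar_def aug_coeff_var scal_one)

lemma prod_list_map_one: "prod_list (map (\<lambda>_. 1 :: 'a::monoid_mult) xs) = 1"
  by (induction xs) simp_all

lemma embq_central:
  assumes "\<And>x. c * x = x * c" "\<And>x. f c * x = x * f c"
  shows "embq I f c * z = z * embq I f c"
  by (transfer fixing: f c) (simp add: assms two_idealD(1))

subsection \<open>The DAHA with central variables\<close>

lemma daha_gens_iff:
  "Gen_T i \<in> daha_gens N \<longleftrightarrow> i \<in> {1..<N}" "Gen_X i \<in> daha_gens N \<longleftrightarrow> i \<in> {1..N}"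
  "Gen_Xinv i \<in> daha_gens N \<longleftrightarrow> i \<in> {1..N}" "Gen_Y i \<in> daha_gens N \<longleftrightarrow> i \<in> {1..N}"
  "Gen_Yinv i \<in> daha_gens N \<longleftrightarrow> i \<in> {1..N}"
  by (auto simp: daha_gens_def)

context coeff_ring
begin

lemma affine_rels_closed:
  assumes "t \<in> K" "t' \<in> K" "Gen_T ` {1..<N} \<union> Gen_X ` {1..N} \<union> Gen_Y ` {1..N} \<subseteq> G'"
    and "(a, b) \<in> affine_rels t t' N"
  shows "a \<in> carrier (free_algebra K G') \<and> b \<in> carrier (free_algebra K G')"
proof -
  interpret G: coeff_ring K G' by unfold_locales
  have g: "i \<in> {1..<N} \<Longrightarrow> T i \<in> carrier G.F" "i \<in> {1..N} \<Longrightarrow> X i \<in> carrier G.F" "i \<in> {1..N} \<Longrightarrow> Y i \<in> carrier G.F" for i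
    using assms(3) by (auto intro!: G.F_gen)
  from assms(4) show ?thesis
    unfolding affine_rels_def
    by (elim UnE; clarsimp; intro conjI G.F_mult G.F_minus G.F_add G.F_scal g G.F_0; (simp add: assms)?)
qed

end

locale cyclotomic =
  fixes N l :: nat
  assumes N1: "1 \<le> N"
begin

sublocale F0: coeff_ring "UNIV :: qt_laurent set" "daha_gens N" by (rule coeff_ring_UNIV)
sublocale FZ: coeff_ring "Zqt_coeffs l" "daha_gens N" by (rule coeff_ring_Zqt)

lemma F0_gen:
  "i \<in> {1..<N} \<Longrightarrow> T i \<in> carrier F0.F" "i \<in> {1..N} \<Longrightarrow> X i \<in> carrier F0.F" "i \<in> {1..N} \<Longrightarrow> Y i \<in> carrier F0.F"
  "i \<in> {1..N} \<Longrightarrow> Xinv i \<in> carrier F0.F" "i \<in> {1..N} \<Longrightarrow> Yinv i \<in> carrier F0.F"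
  by (rule F0.F_gen, simp add: daha_gens_iff)+

lemma daha_rels_closed:
  assumes "(a, b) \<in> daha_rels N"
  shows "a \<in> carrier F0.F \<and> b \<in> carrier F0.F"
proof -
  have aff: "a \<in> carrier F0.F \<and> b \<in> carrier F0.F" if "(a, b) \<in> affine_rels (lvar Var_t 1) (lvar Var_t (-1)) N" for a b
    by (rule F0.affine_rels_closed[OF _ _ _ that]) (auto simp: daha_gens_def)
  have t: "X_tilde N \<in> carrier F0.F" "Y_tilde N \<in> carrier F0.F"
    unfolding X_tilde_def Y_tilde_def by (rule F0.F_prod_list; auto intro!: F0_gen)+
  have "(a, b) \<in> daha_rels N \<Longrightarrow> ?thesis"
    unfolding daha_rels_def X_inverse_rels_def Y_inverse_rels_def
    by (elim UnE; (erule aff | (clarsimp split: if_splits;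
        intro conjI F0.F_mult F0.F_power F0.F_scal F0.F_1 F0_gen t; (simp add: N1)?)))
  then show ?thesis using assms by blast
qed

abbreviation "\<pi> \<equiv> daha_class N"

lemma pi_hom: "\<pi> \<in> ring_hom F0.F (daha N)"
proof -
  have "\<pi> = pclass UNIV (daha_gens N) (daha_rels N)" by (rule ext) (simp add: daha_class_def)
  then show ?thesis using F0.pclass_ring_hom[OF daha_rels_closed] by (simp add: daha_def)
qed

lemma daha_ring: "ring (daha N)"
  unfolding daha_def by (rule F0.presented_ring[OF daha_rels_closed])

sublocale R0: ring "daha N" by (rule daha_ring)

lemma pi_closed: "p \<in> carrier F0.F \<Longrightarrow> \<pi> p \<in> carrier (daha N)"
  and pi_add: "p \<in> carrier F0.F \<Longrightarrow> r \<in> carrier F0.F \<Longrightarrow> \<pi> (p + r) = \<pi> p \<oplus>\<^bsub>daha N\<^esub> \<pi> r"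
  and pi_mult: "p \<in> carrier F0.F \<Longrightarrow> r \<in> carrier F0.F \<Longrightarrow> \<pi> (p * r) = \<pi> p \<otimes>\<^bsub>daha N\<^esub> \<pi> r"
  and pi_one: "\<pi> 1 = \<one>\<^bsub>daha N\<^esub>"
  using ring_hom_closed[OF pi_hom] ring_hom_add[OF pi_hom] ring_hom_mult[OF pi_hom] ring_hom_one[OF pi_hom]
  by (simp_all add: F0.F_simps)

lemma pi_zero: "\<pi> 0 = \<zero>\<^bsub>daha N\<^esub>"
  using ring_hom_zero[OF pi_hom F0.F_ring daha_ring] by (simp add: F0.F_simps)

lemma pi_sum:
  assumes "finite A" "\<And>x. x \<in> A \<Longrightarrow> f x \<in> carrier F0.F"
  shows "\<pi> (sum f A) = (\<Oplus>\<^bsub>daha N\<^esub>x\<in>A. \<pi> (f x))"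
  using assms
proof (induction A rule: finite_induct)
  case (insert x A)
  then have "sum f A \<in> carrier F0.F" by (intro F0.F_sum) auto
  moreover have "(\<Oplus>\<^bsub>daha N\<^esub>y\<in>insert x A. \<pi> (f y)) = \<pi> (f x) \<oplus>\<^bsub>daha N\<^esub> (\<Oplus>\<^bsub>daha N\<^esub>y\<in>A. \<pi> (f y))"
    by (rule R0.finsum_insert) (use insert in \<open>auto intro: pi_closed\<close>)
  ultimately show ?case using insert by (simp add: pi_add)
qed (simp add: pi_zero)

lemma pi_eq:
  assumes "(a, b) \<in> daha_rels N" shows "\<pi> a = \<pi> b"
proof -
  note c = daha_rels_closed[OF assms]
  have I: "ideal (rel_ideal UNIV (daha_gens N) (daha_rels N)) F0.F" by (rule F0.rel_ideal_ideal[OF daha_rels_closed])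
  have "{a - b | a b. (a, b) \<in> daha_rels N} \<subseteq> carrier F0.F" using daha_rels_closed F0.F_minus by blast
  from ring.genideal_self[OF F0.F_ring this]
  have "a - b \<in> rel_ideal UNIV (daha_gens N) (daha_rels N)" unfolding rel_ideal_def using assms by blast
  moreover have "a \<ominus>\<^bsub>F0.F\<^esub> b = a - b"
    using c by (simp add: a_minus_def F0.F_a_inv) (simp add: F0.F_simps)
  ultimately show ?thesis
    using ring.quotient_eq_iff_same_a_r_cos[OF F0.F_ring I, of a b] c by (simp add: daha_class_def pclass_def)
qed

text \<open>Presents \<open>daha_Z N l\<close> as the image of a free algebra over
  \<open>Zqt_coeffs l\<close> whose letters are those of the DAHA, by taking classes coefficient by
  coefficient in the Z_r.\<close>

definition \<Phi> :: "(generator, Zqt_laurent) falg \<Rightarrow> daha_Z_elem" where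
  "\<Phi> p = (\<lambda>m. \<pi> (coef p m))"

lemma coef_F0: "p \<in> carrier FZ.F \<Longrightarrow> coef p m \<in> carrier F0.F"
  by (rule coef_closed)

lemma coef_support:
  assumes "p \<in> carrier FZ.F" "coef p m \<noteq> 0"
  shows "keys m \<subseteq> {1..l}" "m \<in> (\<Union>w. keys (lookup p w))"
proof -
  obtain w where w: "lookup (lookup p w) m \<noteq> 0"
    using assms(2) by (metis lookup_coef lookup_zero poly_mapping_eqI)
  then show "m \<in> (\<Union>w. keys (lookup p w))" by (auto simp: in_keys_iff)
  have "lookup p w \<in> Zqt_coeffs l" by (rule FZ.F_lookup[OF assms(1)])
  with w show "keys m \<subseteq> {1..l}" by (rule Zqt_coeffsD[rotated])
qed

lemma daha_Z_simps: "\<zero>\<^bsub>daha_Z N l\<^esub> = (\<lambda>_. \<zero>\<^bsub>daha N\<^esub>)" "\<one>\<^bsub>daha_Z N l\<^esub> = (\<lambda>m. if m = 0 then \<one>\<^bsub>daha N\<^esub> else \<zero>\<^bsub>daha N\<^esub>)"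
  "f \<oplus>\<^bsub>daha_Z N l\<^esub> g = (\<lambda>m. f m \<oplus>\<^bsub>daha N\<^esub> g m)"
  "f \<otimes>\<^bsub>daha_Z N l\<^esub> g = (\<lambda>m. \<Oplus>\<^bsub>daha N\<^esub>a\<in>{a. f a \<noteq> \<zero>\<^bsub>daha N\<^esub>}. f a \<otimes>\<^bsub>daha N\<^esub> g (m - a))"
  by (simp_all add: daha_Z_def laurent_ring_def)

lemma Phi_support:
  assumes "p \<in> carrier FZ.F"
  shows "{a. \<Phi> p a \<noteq> \<zero>\<^bsub>daha N\<^esub>} \<subseteq> (\<Union>w. keys (lookup p w))"
proof
  fix a assume "a \<in> {a. \<Phi> p a \<noteq> \<zero>\<^bsub>daha N\<^esub>}"
  then have "coef p a \<noteq> 0" by (auto simp: \<Phi>_def pi_zero)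
  then show "a \<in> (\<Union>w. keys (lookup p w))" by (rule coef_support[OF assms])
qed

lemma Phi_closed: "p \<in> carrier FZ.F \<Longrightarrow> \<Phi> p \<in> carrier (daha_Z N l)"
proof -
  assume p: "p \<in> carrier FZ.F"
  have "finite {a. \<Phi> p a \<noteq> \<zero>\<^bsub>daha N\<^esub>}"
    by (rule finite_subset[OF Phi_support[OF p] finite_coef_support])
  moreover have "keys m \<subseteq> {1..l}" if "\<Phi> p m \<noteq> \<zero>\<^bsub>daha N\<^esub>" for m
  proof -
    have "coef p m \<noteq> 0" using that by (auto simp: \<Phi>_def pi_zero)
    then show ?thesis by (rule coef_support[OF p])
  qed
  moreover have "\<Phi> p m \<in> carrier (daha N)" for m unfolding \<Phi>_def by (rule pi_closed[OF coef_F0[OF p]])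
  ultimately show ?thesis by (simp add: daha_Z_def laurent_ring_def)
qed

lemma Phi_hom: "\<Phi> \<in> ring_hom FZ.F (daha_Z N l)"
proof (rule ring_hom_memI)
  fix p r assume p: "p \<in> carrier FZ.F" and r: "r \<in> carrier FZ.F"
  show "\<Phi> (p \<oplus>\<^bsub>FZ.F\<^esub> r) = \<Phi> p \<oplus>\<^bsub>daha_Z N l\<^esub> \<Phi> r"
    unfolding daha_Z_simps \<Phi>_def FZ.F_simps coef_add by (rule ext) (rule pi_add[OF coef_F0[OF p] coef_F0[OF r]])
  let ?A = "\<Union>w. keys (lookup p w)"
  have A: "finite ?A" by (rule finite_coef_support)
  have c: "\<Phi> p a \<otimes>\<^bsub>daha N\<^esub> \<Phi> r b = \<pi> (coef p a * coef r b)" for a b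
    unfolding \<Phi>_def by (rule pi_mult[symmetric, OF coef_F0[OF p] coef_F0[OF r]])
  show "\<Phi> (p \<otimes>\<^bsub>FZ.F\<^esub> r) = \<Phi> p \<otimes>\<^bsub>daha_Z N l\<^esub> \<Phi> r"
  proof (rule ext)
    fix m
    have "\<Phi> (p * r) m = \<pi> (\<Sum>a\<in>?A. coef p a * coef r (m - a))"
      unfolding \<Phi>_def by (rule arg_cong[OF coef_mult[OF A]]) blast
    also have "\<dots> = (\<Oplus>\<^bsub>daha N\<^esub>a\<in>?A. \<pi> (coef p a * coef r (m - a)))"
      by (rule pi_sum[OF A]) (rule F0.F_mult[OF coef_F0[OF p] coef_F0[OF r]])
    also have "\<dots> = (\<Oplus>\<^bsub>daha N\<^esub>a\<in>?A. \<Phi> p a \<otimes>\<^bsub>daha N\<^esub> \<Phi> r (m - a))"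
      unfolding c ..
    also have "\<dots> = (\<Oplus>\<^bsub>daha N\<^esub>a\<in>{a. \<Phi> p a \<noteq> \<zero>\<^bsub>daha N\<^esub>}. \<Phi> p a \<otimes>\<^bsub>daha N\<^esub> \<Phi> r (m - a))"
    proof (rule R0.add.finprod_mono_neutral_cong_left[symmetric])
      show "finite ?A" "{a. \<Phi> p a \<noteq> \<zero>\<^bsub>daha N\<^esub>} \<subseteq> ?A" by (rule A, rule Phi_support[OF p])
      show "(\<lambda>a. \<Phi> p a \<otimes>\<^bsub>daha N\<^esub> \<Phi> r (m - a)) \<in> ?A \<rightarrow> carrier (daha N)"
        unfolding c by (intro Pi_I pi_closed F0.F_mult coef_F0 p r)
      show "\<Phi> p a \<otimes>\<^bsub>daha N\<^esub> \<Phi> r (m - a) = \<zero>\<^bsub>daha N\<^esub>" if "a \<in> ?A - {a. \<Phi> p a \<noteq> \<zero>\<^bsub>daha N\<^esub>}" for a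
      proof -
        have "\<Phi> p a = \<zero>\<^bsub>daha N\<^esub>" using that by blast
        then show ?thesis using pi_closed[OF coef_F0[OF r]] by (simp add: \<Phi>_def)
      qed
    qed simp
    finally show "\<Phi> (p \<otimes>\<^bsub>FZ.F\<^esub> r) m = (\<Phi> p \<otimes>\<^bsub>daha_Z N l\<^esub> \<Phi> r) m"
      by (simp add: FZ.F_simps daha_Z_simps)
  qed
next
  show "\<Phi> \<one>\<^bsub>FZ.F\<^esub> = \<one>\<^bsub>daha_Z N l\<^esub>"
    by (rule ext) (simp add: \<Phi>_def daha_Z_simps FZ.F_simps coef_one pi_one pi_zero)
qed (rule Phi_closed)

lemma Phi_onto: "\<Phi> ` carrier FZ.F = carrier (daha_Z N l)"
proof
  show "\<Phi> ` carrier FZ.F \<subseteq> carrier (daha_Z N l)" using Phi_closed by blast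
  show "carrier (daha_Z N l) \<subseteq> \<Phi> ` carrier FZ.F"
  proof
    fix f assume f: "f \<in> carrier (daha_Z N l)"
    let ?A = "{m. f m \<noteq> \<zero>\<^bsub>daha N\<^esub>}"
    have A: "finite ?A" "\<And>m. m \<in> ?A \<Longrightarrow> keys m \<subseteq> {1..l}" and "\<And>m. f m \<in> carrier (daha N)"
      using f by (simp_all add: daha_Z_def laurent_ring_def)
    then have "\<forall>m. \<exists>g. g \<in> carrier F0.F \<and> f m = \<pi> g"
      using F0.pclass_surj unfolding daha_def daha_class_def by blast
    then obtain g where g: "\<And>m. g m \<in> carrier F0.F" "\<And>m. f m = \<pi> (g m)" by metis
    let ?p = "\<Sum>m\<in>?A. inZ m (g m)"
    have p: "?p \<in> carrier FZ.F" by (intro FZ.F_sum inZ_closed g A)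
    have "f m = \<Phi> ?p m" for m
    proof -
      have "coef ?p m = (if m \<in> ?A then g m else 0)"
        using A(1) by (simp add: coef_sum coef_inZ eq_commute)
      then show ?thesis by (auto simp: \<Phi>_def pi_zero g(2)[symmetric])
    qed
    then have "f = \<Phi> ?p" by (rule ext)
    then show "f \<in> \<Phi> ` carrier FZ.F" using p by (rule image_eqI)
  qed
qed

text \<open>The image of a ring under a map compatible with the operations is a ring, and
  \<open>\<Phi>\<close> is onto; so the axioms for the convolution product need no separate
  verification.\<close>

lemma daha_Z_ring: "ring (daha_Z N l)"
proof -
  have "ring (daha_Z N l\<lparr>carrier := \<Phi> ` carrier FZ.F, zero := \<Phi> \<zero>\<^bsub>FZ.F\<^esub>\<rparr>)"
    by (rule ring.ring_hom_imp_img_ring[OF FZ.F_ring Phi_hom])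
  moreover have "\<Phi> \<zero>\<^bsub>FZ.F\<^esub> = \<zero>\<^bsub>daha_Z N l\<^esub>"
    by (rule ext) (simp add: \<Phi>_def FZ.F_simps coef_zero pi_zero daha_Z_simps)
  ultimately show ?thesis unfolding Phi_onto by simp
qed

end

text \<open>Serves both quotient types, that of the DAHA and that of the presented algebra:
  relations given as pairs of free algebra elements become the locale assumptions for their
  images.\<close>

lemma affine_rels_hecke:
  assumes g: "rhom g" and rel: "\<And>a b. (a, b) \<in> affine_rels t t' N \<Longrightarrow> g a = g b"
    and central: "\<And>c x. g (scal c) * x = x * g (scal c)" and tt': "t * t' = 1"
  shows "hecke_family N (\<lambda>i. g (T i)) (g (scal t)) (g (scal t')) (\<lambda>i. g (X i))"
    and "hecke_family N (\<lambda>i. g (T i)) (g (scal t)) (g (scal t')) (\<lambda>i. g (Y i))"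
    and "i \<in> {1..N} \<Longrightarrow> j \<in> {1..N} \<Longrightarrow> g (X i) * g (X j) = g (X j) * g (X i)"
    and "i \<in> {1..N} \<Longrightarrow> j \<in> {1..N} \<Longrightarrow> g (Y i) * g (Y j) = g (Y j) * g (Y i)"
proof -
  note S = rhomD[OF g]
  have e: "g a = g b" if "(a, b) \<in> affine_rels t t' N" for a b by (rule rel[OF that])
  have h: "hecke N (\<lambda>i. g (T i)) (g (scal t)) (g (scal t'))"
  proof
    show "g (scal t) * x = x * g (scal t)" "g (scal t') * x = x * g (scal t')" for x by (rule central)+
    show "g (scal t) * g (scal t') = 1" using tt' by (simp add: scal_mult scal_one S flip: S(3))
    show "(g (T i) - g (scal t)) * (g (T i) + g (scal t')) = 0" if "i \<in> {1..<N}" for i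
    proof -
      have "((T i - scal t) * (T i + scal t'), 0) \<in> affine_rels t t' N" unfolding affine_rels_def using that by blast
      from e[OF this] show ?thesis by (simp only: S)
    qed
    show "g (T i) * g (T (Suc i)) * g (T i) = g (T (Suc i)) * g (T i) * g (T (Suc i))" if "1 \<le> i" "Suc i < N" for i
    proof -
      have "(T i * T (i+1) * T i, T (i+1) * T i * T (i+1)) \<in> affine_rels t t' N"
        unfolding affine_rels_def using that unfolding Suc_eq_plus1 by blast
      from e[OF this] show ?thesis by (simp only: S Suc_eq_plus1)
    qed
    show "g (T i) * g (T j) = g (T j) * g (T i)" if "i \<in> {1..<N}" "j \<in> {1..<N}" "i + 2 \<le> j" for i j
    proof -
      have "(T i * T j, T j * T i) \<in> affine_rels t t' N" unfolding affine_rels_def using that by blast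
      from e[OF this] show ?thesis by (simp only: S)
    qed
  qed
  have TXT: "g (T i) * g (X i) * g (T i) = g (X (Suc i))" "g (T i) * g (Y i) * g (T i) = g (Y (Suc i))" if "i \<in> {1..<N}" for i
  proof -
    have "(T i * X i * T i, X (i+1)) \<in> affine_rels t t' N" "(T i * Y i * T i, Y (i+1)) \<in> affine_rels t t' N"
      unfolding affine_rels_def using that by blast+
    from this[THEN e] show "g (T i) * g (X i) * g (T i) = g (X (Suc i))" "g (T i) * g (Y i) * g (T i) = g (Y (Suc i))"
      by (simp_all only: S Suc_eq_plus1)
  qed
  have TX: "g (T i) * g (X j) = g (X j) * g (T i)" "g (T i) * g (Y j) = g (Y j) * g (T i)"
    if "i \<in> {1..<N}" "j \<in> {1..N}" "j \<noteq> i" "j \<noteq> Suc i" for i j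
  proof -
    have "(T i * X j, X j * T i) \<in> affine_rels t t' N" "(T i * Y j, Y j * T i) \<in> affine_rels t t' N"
      unfolding affine_rels_def using that unfolding Suc_eq_plus1 by blast+
    from this[THEN e] show "g (T i) * g (X j) = g (X j) * g (T i)" "g (T i) * g (Y j) = g (Y j) * g (T i)"
      by (simp_all only: S)
  qed
  show "hecke_family N (\<lambda>i. g (T i)) (g (scal t)) (g (scal t')) (\<lambda>i. g (X i))"
    "hecke_family N (\<lambda>i. g (T i)) (g (scal t)) (g (scal t')) (\<lambda>i. g (Y i))"
    by (intro hecke_family.intro h hecke_family_axioms.intro TXT TX; assumption)+
  show "g (X i) * g (X j) = g (X j) * g (X i)" "g (Y i) * g (Y j) = g (Y j) * g (Y i)" if "i \<in> {1..N}" "j \<in> {1..N}"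
  proof -
    have "(X i * X j, X j * X i) \<in> affine_rels t t' N" "(Y i * Y j, Y j * Y i) \<in> affine_rels t t' N"
      unfolding affine_rels_def using that by blast+
    from this[THEN e] show "g (X i) * g (X j) = g (X j) * g (X i)" "g (Y i) * g (Y j) = g (Y j) * g (Y i)"
      by (simp_all only: S)
  qed
qed

lemma rhom_words:
  assumes "rhom h"
  shows "h (prod_list (T_up a b)) = prod_list (map (\<lambda>i. h (T i)) [a..<b])"
    "h (prod_list (T_down a b)) = prod_list (map (\<lambda>i. h (T i)) (rev [a..<b]))"
    "h (prod_list (Tinv_up a b)) = prod_list (map (\<lambda>i. h (Tinv i)) [a..<b])"
    "h (prod_list (Tinv_down a b)) = prod_list (map (\<lambda>i. h (Tinv i)) (rev [a..<b]))"
    "h (T_loop N i) = prod_list (map (\<lambda>i. h (T i)) [i..<N]) * prod_list (map (\<lambda>i. h (T i)) (rev [i..<N]))"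
    "h (Tinv_loop i) = prod_list (map (\<lambda>i. h (Tinv i)) (rev [1..<i])) * prod_list (map (\<lambda>i. h (Tinv i)) [1..<i])"
    "h (minus_Z_prod x m n) = zprod (\<lambda>r. h (scal (lvar r 1))) (h x) m n"
    "h (Tinv i) = h (T i) - h (scal ct) + h (scal ct')"
    "h (u ^ 2) = h u * h u"
  by (simp_all add: T_up_def T_down_def Tinv_up_def Tinv_down_def T_loop_def Tinv_loop_def minus_Z_prod_def zprod_def
      Tinv_def rhomD[OF assms] rhom_prod_list[OF assms] o_def power2_eq_square Suc_eq_plus1[symmetric] del: upt_Suc)

context cyclotomic
begin

definition RZ :: "Zqt_laurent relations" where
  "RZ = (\<lambda>(a, b). (inZ 0 a, inZ 0 b)) ` daha_rels N"

lemma RZ_closed: "(a, b) \<in> RZ \<Longrightarrow> a \<in> carrier FZ.F \<and> b \<in> carrier FZ.F"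
  unfolding RZ_def using daha_rels_closed by (auto intro!: inZ_closed)

lemma Phi_RZ: "(a, b) \<in> RZ \<Longrightarrow> \<Phi> a = \<Phi> b"
  unfolding RZ_def by (rule ext) (auto simp: \<Phi>_def coef_inZ pi_eq)

lemma Phi_tideal: "p \<in> tideal RZ \<Longrightarrow> p \<in> carrier FZ.F \<Longrightarrow> \<Phi> p = \<zero>\<^bsub>daha_Z N l\<^esub>"
  using FZ.rel_ideal_kernel[OF daha_Z_ring Phi_hom RZ_closed Phi_RZ] tideal_rel_ideal[OF RZ_closed]
  unfolding a_kernel_def' by blast

lemma aug_RZ: "(a, b) \<in> RZ \<Longrightarrow> aug l a = aug l b"
proof -
  define f where "f a = aug l (inZ 0 a)" for a
  have f: "rhom f" unfolding f_def by (rule rhom_compose[OF rhom_aug rhom_inZ])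
  have v: "f (T i) = 1" "f (X i) = 1" "f (Xinv i) = 1" "f (Y i) = 1" "f (Yinv i) = 1" "f (scal (lvar v k)) = 1" for i v k
    by (simp_all add: f_def inZ_gen inZ_scal aug_gens aug_consts)
  have "f a = f b" if "(a, b) \<in> daha_rels N" for a b
    using that unfolding daha_rels_def affine_rels_def X_inverse_rels_def Y_inverse_rels_def X_tilde_def Y_tilde_def
    by (elim UnE; clarsimp split: if_splits)
       (simp_all add: rhomD[OF f] rhom_prod_list[OF f] rhom_power[OF f] v o_def prod_list_map_one)
  then show "(a, b) \<in> RZ \<Longrightarrow> aug l a = aug l b" unfolding RZ_def f_def by auto
qed

definition Q :: "(generator, Zqt_laurent) falg \<Rightarrow> (generator, Zqt_laurent) falg uquot" where
  "Q = embq (tideal RZ) (aug l)"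

lemma rhom_Q: "rhom Q" and Q_eq_0: "Q p = 0 \<longleftrightarrow> p \<in> tideal RZ" and Q_RZ: "(a, b) \<in> RZ \<Longrightarrow> Q a = Q b"
  unfolding Q_def using embq_tideal[OF rhom_aug aug_RZ] by blast+

lemma Q_central: "Q (scal c) * z = z * Q (scal c)"
  unfolding Q_def by (rule embq_central) (simp_all only: aug_scal scal_commute)

text \<open>The bridge back from the quotient type: an identity computed with class-based ring
  arithmetic modulo the DAHA relations holds in \<open>daha_Z\<close>, provided both sides lie in
  the free algebra over the given coefficients and letters.\<close>

lemma Phi_eqI:
  assumes "Q p = Q r" "p \<in> carrier FZ.F" "r \<in> carrier FZ.F" shows "\<Phi> p = \<Phi> r"
proof -
  have "p - r \<in> tideal RZ" using assms(1) by (simp add: rhomD[OF rhom_Q] flip: Q_eq_0)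
  then have "\<Phi> (p - r) = \<zero>\<^bsub>daha_Z N l\<^esub>" by (rule Phi_tideal) (rule FZ.F_minus[OF assms(2,3)])
  then have "\<Phi> p = \<zero>\<^bsub>daha_Z N l\<^esub> \<oplus>\<^bsub>daha_Z N l\<^esub> \<Phi> r"
    using ring_hom_add[OF Phi_hom FZ.F_minus[OF assms(2,3)] assms(3)] by (simp add: FZ.F_simps)
  then show ?thesis
    using ring.ring_simprules(8)[OF daha_Z_ring Phi_closed[OF assms(3)]] by simp
qed

definition q0 :: "(generator, qt_laurent) falg \<Rightarrow> (generator, Zqt_laurent) falg uquot" where
  "q0 a = Q (inZ 0 a)"

lemma rhom_q0: "rhom q0"
  unfolding q0_def by (rule rhom_compose[OF rhom_Q rhom_inZ])

lemma q0_rels: "(a, b) \<in> daha_rels N \<Longrightarrow> q0 a = q0 b"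
  unfolding q0_def by (rule Q_RZ) (auto simp: RZ_def)

lemma q0_gen: "q0 (gen g) = Q (gen g)"
  by (simp add: q0_def inZ_gen)

lemma q0_scal: "q0 (scal u) = Q (scal (single 0 u))"
  by (simp add: q0_def inZ_scal)

lemma q0_consts: "q0 (scal (lvar Var_t 1)) = Q (scal ct)" "q0 (scal (lvar Var_t (-1))) = Q (scal ct')"
  "q0 (scal (lvar Var_q 1)) = Q (scal cq)"
  by (simp_all add: q0_scal ct_def ct'_def cq_def)

lemma Q_XX': "i \<in> {1..N} \<Longrightarrow> Q (X i) * Q (Xinv i) = 1" "i \<in> {1..N} \<Longrightarrow> Q (Xinv i) * Q (X i) = 1"
  and Q_YY': "i \<in> {1..N} \<Longrightarrow> Q (Y i) * Q (Yinv i) = 1" "i \<in> {1..N} \<Longrightarrow> Q (Yinv i) * Q (Y i) = 1"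
proof -
  assume i: "i \<in> {1..N}"
  have "(X i * Xinv i, 1) \<in> daha_rels N" "(Xinv i * X i, 1) \<in> daha_rels N" "(Y i * Yinv i, 1) \<in> daha_rels N" "(Yinv i * Y i, 1) \<in> daha_rels N"
    unfolding daha_rels_def X_inverse_rels_def Y_inverse_rels_def using i by blast+
  from this[THEN q0_rels] show "Q (X i) * Q (Xinv i) = 1" "Q (Xinv i) * Q (X i) = 1" "Q (Y i) * Q (Yinv i) = 1" "Q (Yinv i) * Q (Y i) = 1"
    by (simp_all add: rhomD[OF rhom_q0] q0_gen)
qed

sublocale DA: daha_alg N "\<lambda>i. Q (T i)" "Q (scal ct)" "Q (scal ct')" "\<lambda>i. Q (X i)" "\<lambda>i. Q (Y i)" "\<lambda>i. Q (Xinv i)" "Q (scal cq)" "\<lambda>r. Q (scal (lvar r 1))" l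
proof -
  have t1: "lvar Var_t 1 * lvar Var_t (-1) = (1 :: qt_laurent)" by (simp add: lvar_def mult_single flip: single_add)
  have aff: "(a, b) \<in> affine_rels (lvar Var_t 1) (lvar Var_t (-1)) N \<Longrightarrow> q0 a = q0 b" for a b
    by (rule q0_rels) (simp add: daha_rels_def)
  have c: "q0 (scal c) * x = x * q0 (scal c)" for c x by (simp only: q0_scal Q_central)
  note H = affine_rels_hecke[where N = N, OF rhom_q0 aff c t1, unfolded q0_gen q0_consts]
  have "Q (X 1) * Q (Y 2) = Q (Y 2) * Q (X 1) * (Q (T 1) * Q (T 1))" if N2: "2 \<le> N"
  proof -
    have "(Xinv 1 * Yinv 2 * X 1 * Y 2, T 1 ^ 2) \<in> daha_rels N" unfolding daha_rels_def using N2 by simp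
    from q0_rels[OF this]
    have r: "Q (Xinv 1) * (Q (Yinv 2) * (Q (X 1) * Q (Y 2))) = Q (T 1) * Q (T 1)"
      by (simp only: rhomD[OF rhom_q0] rhom_power[OF rhom_q0] q0_gen mult.assoc power2_eq_square)
    have i: "1 \<in> {1..N}" "2 \<in> {1..N}" using N2 by auto
    have "Q (X 1) * Q (Y 2) = Q (Y 2) * (Q (Yinv 2) * (Q (X 1) * Q (Y 2)))"
      using Q_YY'(1)[OF i(2)] by (simp flip: mult.assoc)
    also have "Q (Yinv 2) * (Q (X 1) * Q (Y 2)) = Q (X 1) * (Q (Xinv 1) * (Q (Yinv 2) * (Q (X 1) * Q (Y 2))))"
      using Q_XX'(1)[OF i(1)] by (simp flip: mult.assoc)
    finally show ?thesis unfolding r by (simp only: mult.assoc)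
  qed
  then have hc: "hecke_cross N (\<lambda>i. Q (T i)) (Q (scal ct)) (Q (scal ct')) (\<lambda>i. Q (X i)) (\<lambda>i. Q (Y i))"
    by (intro hecke_cross.intro hecke_cross_axioms.intro H(1,2))
  have "(Y 1 * X_tilde N, scal (lvar Var_q 1) * X_tilde N * Y 1) \<in> daha_rels N"
    unfolding daha_rels_def using N1 by fastforce
  from q0_rels[OF this]
  have "Q (Y 1) * prod_list (map (\<lambda>i. Q (X i)) [1..<N+1]) = Q (scal cq) * prod_list (map (\<lambda>i. Q (X i)) [1..<N+1]) * Q (Y 1)"
    by (simp only: rhomD[OF rhom_q0] q0_gen q0_consts X_tilde_def rhom_prod_list[OF rhom_q0] map_map o_def)
  then have YXs: "Q (Y 1) * hecke_cross.Xs (\<lambda>i. Q (X i)) 1 (Suc N) = Q (scal cq) * hecke_cross.Xs (\<lambda>i. Q (X i)) 1 (Suc N) * Q (Y 1)"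
    unfolding hecke_cross.Xs_def[OF hc] Suc_eq_plus1 .
  show "daha_alg N (\<lambda>i. Q (T i)) (Q (scal ct)) (Q (scal ct')) (\<lambda>i. Q (X i)) (\<lambda>i. Q (Y i)) (\<lambda>i. Q (Xinv i)) (Q (scal cq)) (\<lambda>r. Q (scal (lvar r 1)))"
    by (intro daha_alg.intro daha_alg_axioms.intro hc N1 Q_central Q_XX' H(3,4) YXs; assumption)
qed

definition Dl :: "nat \<Rightarrow> (generator, Zqt_laurent) falg" where
  "Dl i = prod_list (map Tinv (rev [1..<i])) * (Xinv 1 * minus_Z_prod (Y 1) 1 l) * prod_list (map Tinv [1..<i])"

text \<open>Substitutes for the letter D_i its expression in the DAHA and keeps all other letters.
  Followed by \<open>\<Phi>\<close> it is the map from the presented algebra whose kernel and image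
  are to be found.\<close>

definition \<theta> :: "(generator, Zqt_laurent) falg \<Rightarrow> (generator, Zqt_laurent) falg" where
  "\<theta> = fev scal (\<lambda>g. case g of Gen_D i \<Rightarrow> Dl i | _ \<Rightarrow> gen g)"

lemma rhom_theta: "rhom \<theta>"
  unfolding \<theta>_def by (rule rhom_fev[OF rhom_scal scal_commute])

lemma theta_simps: "\<theta> (scal c) = scal c" "\<theta> (T i) = T i" "\<theta> (X i) = X i" "\<theta> (Xinv i) = Xinv i" "\<theta> (Y i) = Y i" "\<theta> (Yinv i) = Yinv i" "\<theta> (D i) = Dl i"
  by (simp_all add: \<theta>_def fev_gen[OF rhom_scal] fev_scal[OF rhom_scal])

lemma Q_Tinv: "Q (Tinv i) = DA.X.Ti i"
  by (simp add: rhom_words(8)[OF rhom_Q] DA.X.Ti_def)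

lemma Q_Dl: "Q (Dl i) = DA.Dg i"
  by (simp add: Dl_def DA.Dg_def DA.P_def DA.X.upi_def DA.X.downi_def Q_Tinv rhomD[OF rhom_Q] rhom_prod_list[OF rhom_Q]
      rhom_words(7)[OF rhom_Q] o_def)

lemma cyc_rels_Q:
  assumes "(a, b) \<in> cyc_rels N l" shows "Q (\<theta> a) = Q (\<theta> b)"
proof -
  define h where "h p = Q (\<theta> p)" for p
  have h: "rhom h" unfolding h_def by (rule rhom_compose[OF rhom_Q rhom_theta])
  have g: "h (T i) = Q (T i)" "h (X i) = Q (X i)" "h (Y i) = Q (Y i)" "h (D i) = DA.Dg i" "h (scal c) = Q (scal c)" for i c
    by (simp_all add: h_def theta_simps Q_Dl)
  have Ti: "h (Tinv i) = DA.X.Ti i" for i unfolding rhom_words(8)[OF h] g by (simp only: DA.X.Ti_def)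
  have w: "h (prod_list (T_up a b)) = DA.X.up a b" "h (prod_list (T_down a b)) = DA.X.down a b"
    "h (prod_list (Tinv_up a b)) = DA.X.upi a b" "h (prod_list (Tinv_down a b)) = DA.X.downi a b"
    "h (T_loop N i) = DA.Loop i" "h (Tinv_loop i) = DA.Linv i" "h (minus_Z_prod u m n) = DA.P (h u) m n" for a b i u m n
    by (simp_all add: rhom_words(1-7)[OF h] g Ti DA.X.up_def DA.X.down_def DA.X.upi_def DA.X.downi_def DA.Loop_def DA.Linv_def DA.P_def)
  note S = rhomD[OF h] g Ti w rhom_words(9)[OF h] prod_list.append prod_list.Cons prod_list.Nil mult_1_right
  have DT: "Q (T j) * DA.Dg i = DA.Dg i * Q (T j)" if "i \<in> {1..N}" "j \<in> {1..<N}" "j + 1 \<noteq> i" "j \<noteq> i" for i j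
  proof -
    have "DA.X.Ti j * DA.Dg i = DA.Dg i * DA.X.Ti j"
      by (rule DA.D.TA) (use that in auto)
    then show ?thesis using Q_central[of ct "DA.Dg i"] Q_central[of ct' "DA.Dg i"]
      by (simp add: DA.X.Ti_def algebra_simps)
  qed
  have DX: "DA.Dg 1 * Q (X 2) - Q (X 2) * DA.Dg 1
    = h (scal (ct' - ct) * (\<Sum>r = 1..l. minus_Z_prod (scal cq * J N * Y 1) 1 (r - 1) * (Y 2 * Tinv 1 ^ 2)
        * minus_Z_prod (Y 2 * Tinv 1 ^ 2) (r + 1) l * T 1))" if "2 \<le> N"
  proof -
    have "scal (ct' - ct) = (scal ct' - scal ct :: (generator, Zqt_laurent) falg)"
      by (simp add: rhomD[OF rhom_scal])
    then show ?thesis using DA.D1_X2[OF that] by (simp only: S rhom_sum[OF h] Suc_eq_plus1)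
  qed
  have aff: "h a = h b" if "(a, b) \<in> affine_rels ct ct' N" for a b
    using that unfolding affine_rels_def
    apply (elim UnE)
    subgoal using DA.X.quad by (clarsimp simp only: mem_Collect_eq Pair_inject S)
    subgoal using DA.X.braid by (clarsimp simp only: mem_Collect_eq Pair_inject S Suc_eq_plus1)
    subgoal using DA.X.far by (clarsimp simp only: mem_Collect_eq Pair_inject S) (elim disjE, simp_all)
    subgoal using DA.X.TAT by (clarsimp simp only: mem_Collect_eq Pair_inject S Suc_eq_plus1)
    subgoal using DA.X.TA by (clarsimp simp only: mem_Collect_eq Pair_inject S Suc_eq_plus1)
    subgoal using DA.Y.TAT by (clarsimp simp only: mem_Collect_eq Pair_inject S Suc_eq_plus1)
    subgoal using DA.Y.TA by (clarsimp simp only: mem_Collect_eq Pair_inject S Suc_eq_plus1)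
    subgoal using DA.XX by (clarsimp simp only: mem_Collect_eq Pair_inject S)
    subgoal using DA.YY by (clarsimp simp only: mem_Collect_eq Pair_inject S)
    done
  have "h a = h b"
    using assms unfolding cyc_rels_def
    apply (elim UnE)
    subgoal by (rule aff)
    subgoal using DA.X_Y by (clarsimp simp only: mem_Collect_eq Pair_inject S mult.assoc Suc_eq_plus1)
    subgoal using DA.Y_X by (clarsimp simp only: mem_Collect_eq Pair_inject S mult.assoc Suc_eq_plus1)
    subgoal using DA.Y_X_diag by (clarsimp simp only: mem_Collect_eq Pair_inject S)
    subgoal using DA.D_D by (clarsimp simp only: mem_Collect_eq Pair_inject S)
    subgoal using DA.D.TAT by (clarsimp simp only: mem_Collect_eq Pair_inject S Suc_eq_plus1)
    subgoal using DT by (clarsimp simp only: mem_Collect_eq Pair_inject S)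
    subgoal using DA.D_Y by (clarsimp simp only: mem_Collect_eq Pair_inject S mult.assoc Suc_eq_plus1)
    subgoal using DA.Y_D by (clarsimp simp only: mem_Collect_eq Pair_inject S mult.assoc Suc_eq_plus1)
    subgoal using DA.D_Y_diag by (clarsimp simp only: mem_Collect_eq Pair_inject S)
    subgoal using DA.X1_D1 by (clarsimp simp only: singleton_iff Pair_inject S)
    subgoal using DA.D1_X1 by (clarsimp simp only: singleton_iff Pair_inject S)
    subgoal using DX by (auto simp only: S singleton_iff Pair_inject empty_iff split: if_splits)
    done
  then show ?thesis by (simp only: h_def)
qed

end

subsection \<open>The presented algebra\<close>

lemma perm_words_subset: "w \<in> perm_words n \<Longrightarrow> set w \<subseteq> {1..<n}"
proof (induction n arbitrary: w)
  case (Suc n)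
  then obtain j u where u: "w = [j..<Suc n] @ u" "j \<in> {1..Suc n}" "u \<in> perm_words n" by auto
  with Suc.IH[of u] show ?case by (auto simp del: upt_Suc)
qed simp

text \<open>Repeated spanning elements are collected, so that the index set is a genuine finite set
  and linear independence applies to the coefficients.\<close>

lemma lin_span_finite_sum:
  fixes g :: "'k::comm_ring_1 \<Rightarrow> 'r::ring_1"
  assumes "x \<in> lin_span (f ` B) (g ` K)" and g: "\<And>a b. g (a + b) = g a + g b" and K: "0 \<in> K" "\<And>a b. a \<in> K \<Longrightarrow> b \<in> K \<Longrightarrow> a + b \<in> K"
  shows "\<exists>A k. finite A \<and> A \<subseteq> B \<and> (\<forall>b. k b \<in> K) \<and> x = (\<Sum>b\<in>A. f b * g (k b))"
  using assms(1)
proof (induction rule: lin_span.induct)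
  case zero
  then show ?case using K(1) by (intro exI[of _ "{}"] exI[of _ "\<lambda>_. 0"]) simp
next
  case (add m w z)
  then obtain b c A k where b: "b \<in> B" "m = f b" "c \<in> K" "w = g c" and A: "finite A" "A \<subseteq> B" "\<forall>b. k b \<in> K" "z = (\<Sum>b\<in>A. f b * g (k b))"
    by auto
  have g0: "g 0 = 0" using g[of 0 0] by simp
  define k' where "k' a = (if a \<in> A then k a else 0)" for a
  have z: "z = (\<Sum>a\<in>insert b A. f a * g (k' a))"
    unfolding A(4) by (rule sum.mono_neutral_cong_left) (auto simp: k'_def g0 A(1))
  have "(\<Sum>a\<in>insert b A. f a * g ((k'(b := k' b + c)) a)) = f b * g (k' b + c) + (\<Sum>a\<in>A - {b}. f a * g (k' a))"
    using A(1) by (simp add: sum.insert_remove)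
  also have "\<dots> = f b * g c + (\<Sum>a\<in>insert b A. f a * g (k' a))"
    using A(1) by (simp add: sum.insert_remove g distrib_left)
  finally have "m * w + z = (\<Sum>a\<in>insert b A. f a * g ((k'(b := k' b + c)) a))"
    unfolding b z by simp
  moreover have "\<forall>a. (k'(b := k' b + c)) a \<in> K" using A(3) b(3) K by (simp add: k'_def)
  moreover have "finite (insert b A)" "insert b A \<subseteq> B" using A b by auto
  ultimately show ?case by blast
qed

text \<open>The flag \<open>yinv\<close> selects the algebra: with it the Y_i^{-1} are generators
  and their inverse relations are imposed, without it the unlocalized algebra is described.\<close>

locale cyclotomic_presentation = cyclotomic +
  fixes yinv :: bool
begin

definition "RA = cyc_rels N l \<union> (if yinv then Y_inverse_rels N else {})"
definition "GA = (if yinv then cyc_gens N else cyc_plus_gens N)"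

sublocale FA: coeff_ring "Zqt_coeffs l" GA by (rule coeff_ring_Zqt)

lemma GA_iff:
  "Gen_T i \<in> GA \<longleftrightarrow> i \<in> {1..<N}" "Gen_X i \<in> GA \<longleftrightarrow> i \<in> {1..N}" "Gen_D i \<in> GA \<longleftrightarrow> i \<in> {1..N}"
  "Gen_Y i \<in> GA \<longleftrightarrow> i \<in> {1..N}" "Gen_Yinv i \<in> GA \<longleftrightarrow> yinv \<and> i \<in> {1..N}" "Gen_Xinv i \<notin> GA"
  by (auto simp: GA_def cyc_gens_def cyc_plus_gens_def)

lemma FA_gen:
  "i \<in> {1..<N} \<Longrightarrow> T i \<in> carrier FA.F" "i \<in> {1..N} \<Longrightarrow> X i \<in> carrier FA.F" "i \<in> {1..N} \<Longrightarrow> D i \<in> carrier FA.F"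
  "i \<in> {1..N} \<Longrightarrow> Y i \<in> carrier FA.F" "yinv \<Longrightarrow> i \<in> {1..N} \<Longrightarrow> Yinv i \<in> carrier FA.F"
  by (rule FA.F_gen, subst GA_iff, simp)+

lemma FA_Tinv: "i \<in> {1..<N} \<Longrightarrow> Tinv i \<in> carrier FA.F"
  unfolding Tinv_def by (intro FA.F_add FA.F_minus FA.F_scal FA_gen Zqt_consts)

lemma FA_words:
  assumes "1 \<le> a" "b \<le> N"
  shows "prod_list (T_up a b) \<in> carrier FA.F" "prod_list (T_down a b) \<in> carrier FA.F"
    "prod_list (Tinv_up a b) \<in> carrier FA.F" "prod_list (Tinv_down a b) \<in> carrier FA.F"
  unfolding T_up_def T_down_def Tinv_up_def Tinv_down_def
  by (rule FA.F_prod_list; use assms in \<open>auto intro!: FA_gen(1) FA_Tinv\<close>)+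

lemma FA_minus_Z: "x \<in> carrier FA.F \<Longrightarrow> 1 \<le> m \<Longrightarrow> n \<le> l \<Longrightarrow> minus_Z_prod x m n \<in> carrier FA.F"
  unfolding minus_Z_prod_def
  by (rule FA.F_prod_list) (auto intro!: FA.F_minus FA.F_scal Zqt_consts)

lemma FA_loop: "i \<in> {1..N} \<Longrightarrow> T_loop N i \<in> carrier FA.F" "i \<in> {1..N} \<Longrightarrow> Tinv_loop i \<in> carrier FA.F"
  unfolding T_loop_def Tinv_loop_def prod_list.append by (intro FA.F_mult FA_words; simp)+

lemma RA_closed:
  assumes "(a, b) \<in> RA" shows "a \<in> carrier FA.F \<and> b \<in> carrier FA.F"
proof -
  have aff: "a \<in> carrier FA.F \<and> b \<in> carrier FA.F" if "(a, b) \<in> affine_rels ct ct' N" for a b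
    by (rule FA.affine_rels_closed[OF _ _ _ that]) (auto simp: Zqt_consts GA_iff)
  have d: "ct' - ct \<in> Zqt_coeffs l" by (intro FA.Kminus Zqt_consts)
  note I = FA.F_mult FA.F_minus FA.F_power FA.F_scal FA.F_1 FA.F_sum FA_gen FA_Tinv FA_words FA_minus_Z FA_loop Zqt_consts d
  have "(a, b) \<in> cyc_rels N l \<Longrightarrow> ?thesis"
    unfolding cyc_rels_def
    by (elim UnE; (erule aff | (clarsimp split: if_splits; intro conjI I; (simp add: N1 le_diff_conv)?)))
  moreover have ?thesis if R: "(a, b) \<in> Y_inverse_rels N" and y: yinv
  proof -
    obtain i where i: "i \<in> {1..N}" and "(a, b) = (Y i * Yinv i, 1) \<or> (a, b) = (Yinv i * Y i, 1)"
      using R unfolding Y_inverse_rels_def by blast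
    then show ?thesis using FA.F_mult FA_gen(4)[OF i] FA_gen(5)[OF y i] FA.F_1 by auto
  qed
  ultimately show ?thesis using assms unfolding RA_def by (auto split: if_splits)
qed

lemma aug_RA: "(a, b) \<in> RA \<Longrightarrow> aug l a = aug l b"
proof -
  note h = rhom_aug[of l]
  \<comment> \<open>At Y_1 = Z_r = 1 the product over r is empty for l = 0 and zero otherwise. This
    value of X_1 D_1 dictates the value that the augmentation gives to D.\<close>
  have z: "zprod (\<lambda>r. 1) (1 :: (generator, Zqt_laurent) falg) 1 l = (if l = 0 then 1 else 0)"
    by (cases l) (simp_all add: zprod_def upt_conv_Cons[of 1] del: upt_Suc)
  note S = rhomD[OF h] aug_gens aug_consts rhom_words[OF h] prod_list_map_one
  have d: "aug l (scal (ct' - ct)) = 0"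
    by (simp only: rhomD[OF rhom_scal] S diff_self)
  have aff: "(a, b) \<in> affine_rels ct ct' N \<Longrightarrow> aug l a = aug l b"
    unfolding affine_rels_def by (elim UnE; clarsimp; simp add: S)
  have Y: "(a, b) \<in> Y_inverse_rels N \<Longrightarrow> aug l a = aug l b"
    unfolding Y_inverse_rels_def by (elim UnE; clarsimp; simp add: S)
  have "(a, b) \<in> cyc_rels N l \<Longrightarrow> aug l a = aug l b"
    unfolding cyc_rels_def
    by (elim UnE; (erule aff | (clarsimp split: if_splits; simp add: S z d)))
  with Y show "(a, b) \<in> RA \<Longrightarrow> aug l a = aug l b" unfolding RA_def by (auto split: if_splits)
qed

definition QA :: "(generator, Zqt_laurent) falg \<Rightarrow> (generator, Zqt_laurent) falg uquot" where
  "QA = embq (tideal RA) (aug l)"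

lemma rhom_QA: "rhom QA" and QA_eq_0: "QA p = 0 \<longleftrightarrow> p \<in> tideal RA" and QA_RA: "(a, b) \<in> RA \<Longrightarrow> QA a = QA b"
  unfolding QA_def using embq_tideal[OF rhom_aug aug_RA] by blast+

lemma QA_central: "QA (scal c) * z = z * QA (scal c)"
  unfolding QA_def by (rule embq_central) (simp_all only: aug_scal scal_commute)

definition "cq' = (single 0 (lvar Var_q (-1)) :: Zqt_laurent)"
definition "KQ = (\<lambda>k. QA (scal k)) ` Zqt_coeffs l"

lemma cyc_alg_QA:
  "cyc_alg N (\<lambda>i. QA (T i)) (QA (scal ct)) (QA (scal ct')) (\<lambda>i. QA (X i)) (\<lambda>i. QA (Y i)) (\<lambda>i. QA (D i)) (\<lambda>i. QA (Yinv i))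
    (QA (scal cq)) (QA (scal cq')) (\<lambda>r. QA (scal (lvar r 1))) l KQ yinv"
proof -
  note QH = rhomD[OF rhom_QA]
  have rel: "QA a = QA b" if "(a, b) \<in> cyc_rels N l" for a b
    by (rule QA_RA) (simp add: RA_def that)
  have aff: "QA a = QA b" if "(a, b) \<in> affine_rels ct ct' N" for a b
    by (rule rel) (simp add: cyc_rels_def that)
  note H = affine_rels_hecke[where N = N, OF rhom_QA aff QA_central ct_inverse(1)]
  note H0 = H
  interpret X: hecke_family N "\<lambda>i. QA (T i)" "QA (scal ct)" "QA (scal ct')" "\<lambda>i. QA (X i)" by (rule H)
  have Ti: "QA (Tinv i) = X.Ti i" for i unfolding rhom_words(8)[OF rhom_QA] by (simp only: X.Ti_def)
  have w: "QA (prod_list (T_up a b)) = X.up a b" "QA (prod_list (T_down a b)) = X.down a b"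
    "QA (prod_list (Tinv_up a b)) = X.upi a b" "QA (prod_list (Tinv_down a b)) = X.downi a b"
    "QA (T_loop N i) = X.up i N * X.down i N" "QA (Tinv_loop i) = X.downi 1 i * X.upi 1 i"
    "QA (minus_Z_prod u m n) = zprod (\<lambda>r. QA (scal (lvar r 1))) (QA u) m n" for a b i u m n
    by (simp_all add: rhom_words(1-7)[OF rhom_QA] Ti X.up_def X.down_def X.upi_def X.downi_def)
  note S = QH Ti w rhom_words(9)[OF rhom_QA] prod_list.append prod_list.Cons prod_list.Nil mult_1_right
  have c12: "(1::nat) + 1 = 2" by simp
  have "hecke_family N X.Ti (QA (scal ct')) (QA (scal ct)) (\<lambda>i. QA (D i))"
  proof (intro hecke_family.intro X.hecke_inverse hecke_family_axioms.intro)
    show "X.Ti i * QA (D i) * X.Ti i = QA (D (Suc i))" if "i \<in> {1..<N}" for i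
    proof -
      have "(Tinv i * D i * Tinv i, D (i+1)) \<in> cyc_rels N l" unfolding cyc_rels_def using that by blast
      from rel[OF this] show ?thesis by (simp only: S Suc_eq_plus1)
    qed
    show "X.Ti j * QA (D i) = QA (D i) * X.Ti j" if "j \<in> {1..<N}" "i \<in> {1..N}" "i \<noteq> j" "i \<noteq> Suc j" for i j
    proof -
      have "(T j * D i, D i * T j) \<in> cyc_rels N l" unfolding cyc_rels_def using that unfolding Suc_eq_plus1 by blast
      from rel[OF this] show ?thesis using QA_central[of ct "QA (D i)"] QA_central[of ct' "QA (D i)"]
        by (simp add: X.Ti_def QH algebra_simps)
    qed
  qed
  moreover have "cyc_alg_axioms N (\<lambda>i. QA (T i)) (QA (scal ct)) (QA (scal ct')) (\<lambda>i. QA (X i)) (\<lambda>i. QA (Y i)) (\<lambda>i. QA (D i)) (\<lambda>i. QA (Yinv i))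
    (QA (scal cq)) (QA (scal cq')) (\<lambda>r. QA (scal (lvar r 1))) l KQ yinv"
  proof
    show "1 \<le> N" by (rule N1)
    show "scalar_set KQ"
      unfolding scalar_set_def add_closed_def KQ_def
    proof (intro conjI ballI allI)
      show "0 \<in> (\<lambda>k. QA (scal k)) ` Zqt_coeffs l" by (rule image_eqI[of _ _ 0]) (simp_all add: QH rhomD[OF rhom_scal] FA.K0)
      show "1 \<in> (\<lambda>k. QA (scal k)) ` Zqt_coeffs l" by (rule image_eqI[of _ _ 1]) (simp_all add: QH rhomD[OF rhom_scal] FA.K1)
      fix x assume "x \<in> (\<lambda>k. QA (scal k)) ` Zqt_coeffs l"
      then obtain a where a: "a \<in> Zqt_coeffs l" "x = QA (scal a)" by blast
      show "x * z = z * x" for z unfolding a by (rule QA_central)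
      show "- x \<in> (\<lambda>k. QA (scal k)) ` Zqt_coeffs l"
      proof (rule image_eqI)
        show "- x = QA (scal (0 - a))" by (simp only: a QH rhomD[OF rhom_scal] diff_0)
        show "0 - a \<in> Zqt_coeffs l" by (rule FA.Kminus[OF FA.K0 a(1)])
      qed
      fix y assume "y \<in> (\<lambda>k. QA (scal k)) ` Zqt_coeffs l"
      then obtain b where b: "b \<in> Zqt_coeffs l" "y = QA (scal b)" by blast
      show "x + y \<in> (\<lambda>k. QA (scal k)) ` Zqt_coeffs l"
        by (rule image_eqI[of _ _ "a + b"]) (use a b in \<open>simp_all add: QH rhomD[OF rhom_scal] FA.Kplus\<close>)
      show "x * y \<in> (\<lambda>k. QA (scal k)) ` Zqt_coeffs l"
        by (rule image_eqI[of _ _ "a * b"]) (use a b in \<open>simp_all add: QH rhomD[OF rhom_scal] FA.Kmult\<close>)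
    qed
    have "cq' \<in> Zqt_coeffs l" unfolding cq'_def by (rule Zqt_single) simp
    then show "QA (scal ct) \<in> KQ" "QA (scal ct') \<in> KQ" "QA (scal cq) \<in> KQ" "QA (scal cq') \<in> KQ"
      unfolding KQ_def by (intro imageI Zqt_consts; assumption)+
    show "QA (scal (lvar r 1)) \<in> KQ" if "r \<in> {1..l}" for r
      unfolding KQ_def by (rule imageI[OF Zqt_consts(4)[OF that]])
    have "cq' * cq = 1" by (simp add: cq'_def cq_def lvar_def mult_single flip: single_add)
    then show "QA (scal cq') * QA (scal cq) = 1" by (simp add: scal_mult scal_one QH flip: QH(3))
    show "QA (X i) * QA (X j) = QA (X j) * QA (X i)" "QA (Y i) * QA (Y j) = QA (Y j) * QA (Y i)"
      if "i \<in> {1..N}" "j \<in> {1..N}" for i j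
      by (rule H0(3)[OF _ that], assumption, rule H0(4)[OF _ that], assumption)
    show "QA (D i) * QA (D j) = QA (D j) * QA (D i)" if "i \<in> {1..N}" "j \<in> {1..N}" for i j
    proof -
      have "(D i * D j, D j * D i) \<in> cyc_rels N l" unfolding cyc_rels_def using that by blast
      from rel[OF this] show ?thesis by (simp only: S)
    qed
    have up: "X.up N N = 1" "X.down N N = 1" "X.upi 1 1 = 1" "X.downi 1 1 = 1" by simp_all
    have "(Y i * Tinv_loop i * X i, scal cq * X i * T_loop N i * Y i) \<in> cyc_rels N l"
      "(D i * Y i * Tinv_loop i, scal cq * T_loop N i * Y i * D i) \<in> cyc_rels N l" if "i \<in> {1..N}" for i
      unfolding cyc_rels_def using that by blast+
    note diag = this[THEN rel, unfolded S]
    have "1 \<in> {1..N}" "N \<in> {1..N}" using N1 by auto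
    from diag[OF this(1)] diag[OF this(2)]
    show "QA (Y 1) * QA (X 1) = QA (scal cq) * QA (X 1) * (X.up 1 N * X.down 1 N) * QA (Y 1)"
      "QA (D 1) * QA (Y 1) = QA (scal cq) * (X.up 1 N * X.down 1 N) * QA (Y 1) * QA (D 1)"
      "QA (Y N) * (X.downi 1 N * X.upi 1 N) * QA (X N) = QA (scal cq) * QA (X N) * QA (Y N)"
      "QA (D N) * QA (Y N) * (X.downi 1 N * X.upi 1 N) = QA (scal cq) * QA (Y N) * QA (D N)"
      unfolding up by (simp_all only: mult_1_left mult_1_right)
    show "QA (Y 1) * QA (X j) = X.down 2 j * (X.Ti 1 * X.Ti 1) * X.upi 2 j * QA (X j) * QA (Y 1)"
      "QA (D j) * (X.down 2 j * (QA (T 1) * QA (T 1)) * X.upi 2 j) * QA (Y 1) = QA (Y 1) * QA (D j)" if "2 \<le> j" "j \<le> N" for j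
    proof -
      have j: "1 \<le> (1::nat) \<and> 1 < j \<and> j \<le> N" using that by simp
      have "(Y 1 * X j, prod_list (T_down (1+1) j @ [Tinv 1 ^ 2] @ Tinv_up (1+1) j) * X j * Y 1) \<in> cyc_rels N l"
        "(D j * prod_list (T_down (1+1) j @ [T 1 ^ 2] @ Tinv_up (1+1) j) * Y 1, Y 1 * D j) \<in> cyc_rels N l"
        unfolding cyc_rels_def using j by blast+
      from this[THEN rel] show "QA (Y 1) * QA (X j) = X.down 2 j * (X.Ti 1 * X.Ti 1) * X.upi 2 j * QA (X j) * QA (Y 1)"
        "QA (D j) * (X.down 2 j * (QA (T 1) * QA (T 1)) * X.upi 2 j) * QA (Y 1) = QA (Y 1) * QA (D j)"
        unfolding S c12 by (simp_all only: mult.assoc)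
    qed
    have XD: "(X i * Y j, Y j * X i * prod_list (Tinv_down (i+1) j @ [T i ^ 2] @ T_up (i+1) j)) \<in> cyc_rels N l"
      "(D i * Y j, Y j * prod_list (Tinv_down (i+1) j @ [Tinv i ^ 2] @ T_up (i+1) j) * D i) \<in> cyc_rels N l"
      if ij: "1 \<le> i \<and> i < j \<and> j \<le> N" for i j
      unfolding cyc_rels_def
      by ((rule UnI2, rule CollectI, intro exI, rule conjI[OF refl ij]) | rule UnI1)+
    show "QA (X i) * QA (Y N) = QA (Y N) * QA (X i) * (X.downi (Suc i) N * (QA (T i) * QA (T i)) * X.up (Suc i) N)"
      "QA (D i) * QA (Y N) = QA (Y N) * (X.downi (Suc i) N * (X.Ti i * X.Ti i) * X.up (Suc i) N) * QA (D i)" if "i \<in> {1..<N}" for i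
    proof -
      have "1 \<le> i \<and> i < N \<and> N \<le> N" using that by simp
      note XD[OF this]
      from this[THEN rel] show "QA (X i) * QA (Y N) = QA (Y N) * QA (X i) * (X.downi (Suc i) N * (QA (T i) * QA (T i)) * X.up (Suc i) N)"
        "QA (D i) * QA (Y N) = QA (Y N) * (X.downi (Suc i) N * (X.Ti i * X.Ti i) * X.up (Suc i) N) * QA (D i)"
        unfolding S Suc_eq_plus1 by (simp_all only: mult.assoc)
    qed
    have "(X 1 * D 1, minus_Z_prod (Y 1) 1 l) \<in> cyc_rels N l"
      "(D 1 * X 1, minus_Z_prod (scal cq * J N * Y 1) 1 l) \<in> cyc_rels N l" unfolding cyc_rels_def by blast+
    from this[THEN rel] show "QA (X 1) * QA (D 1) = zprod (\<lambda>r. QA (scal (lvar r 1))) (QA (Y 1)) 1 l"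
      "QA (D 1) * QA (X 1) = zprod (\<lambda>r. QA (scal (lvar r 1))) (QA (scal cq) * (X.up 1 N * X.down 1 N) * QA (Y 1)) 1 l"
      unfolding S by simp_all
    show "QA (D 1) * QA (X 2) - QA (X 2) * QA (D 1)
      = (QA (scal ct') - QA (scal ct)) * (\<Sum>r = 1..l. zprod (\<lambda>r. QA (scal (lvar r 1))) (QA (scal cq) * (X.up 1 N * X.down 1 N) * QA (Y 1)) 1 (r - 1)
         * (QA (Y 2) * (X.Ti 1 * X.Ti 1)) * zprod (\<lambda>r. QA (scal (lvar r 1))) (QA (Y 2) * (X.Ti 1 * X.Ti 1)) (Suc r) l * QA (T 1))" if "2 \<le> N"
    proof -
      have "(D 1 * X 2 - X 2 * D 1, scal (ct' - ct) * (\<Sum>r = 1..l. minus_Z_prod (scal cq * J N * Y 1) 1 (r - 1)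
          * (Y 2 * Tinv 1 ^ 2) * minus_Z_prod (Y 2 * Tinv 1 ^ 2) (r + 1) l * T 1)) \<in> cyc_rels N l"
        unfolding cyc_rels_def using that by simp
      from rel[OF this] show ?thesis
        by (simp only: rhomD(6)[OF rhom_scal] S rhom_sum[OF rhom_QA] Suc_eq_plus1)
    qed
    show "QA (Y i) * QA (Yinv i) = 1" "QA (Yinv i) * QA (Y i) = 1" if yinv "i \<in> {1..N}" for i
    proof -
      have "(Y i * Yinv i, 1) \<in> RA" "(Yinv i * Y i, 1) \<in> RA" unfolding RA_def Y_inverse_rels_def using that by auto
      from this[THEN QA_RA] show "QA (Y i) * QA (Yinv i) = 1" "QA (Yinv i) * QA (Y i) = 1" by (simp_all only: S)
    qed
  qed
  ultimately show ?thesis by (intro cyc_alg.intro H)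
qed

end

section \<open>Evaluation of the free algebra in the representation\<close>

context cyclotomic
begin

sublocale GF: generic_field qf xf N by (rule generic_fract[OF N1])

definition E :: "(generator, Zqt_laurent) falg \<Rightarrow> (point, lpoly fract fps) oper" where
  "E = fev (\<lambda>k. GF.sc (ev_K k)) GF.rep_value"

lemma rhom_sc_ev: "rhom (\<lambda>k. GF.sc (ev_K k))" "rhom (\<lambda>k. GF.sc (ev_qt k))"
  unfolding GF.sc_def by (rule rhom_mulop[OF rhom_ev_K], rule rhom_mulop[OF rhom_ev_qt])

lemma sc_central: "GF.sc k * x = x * GF.sc k"
  unfolding GF.sc_def by (rule mulop_central)

lemma rhom_E: "rhom E"
  unfolding E_def by (rule rhom_fev[OF rhom_sc_ev(1) sc_central])

lemma E_simps: "E (scal k) = GF.sc (ev_K k)" "E (gen g) = GF.rep_value g"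
  unfolding E_def by (rule fev_scal[OF rhom_sc_ev(1)], rule fev_gen[OF rhom_sc_ev(1)])

text \<open>Although \<open>E\<close> is defined on the free algebra, it factors through
  \<open>\<Phi>\<close>: \<open>E x\<close> is the sum over m of Z^m times the action of
  \<open>coef x m\<close>. Each such coefficient is zero in the DAHA, whose relations hold for the
  operators.\<close>

lemma E_Phi_eq_0:
  assumes x: "x \<in> carrier FZ.F" and "\<Phi> x = \<zero>\<^bsub>daha_Z N l\<^esub>"
  shows "E x = 0"
proof -
  define e where "e = fev (\<lambda>k. GF.sc (ev_qt k)) GF.rep_value"
  have e: "rhom e" unfolding e_def by (rule rhom_fev[OF rhom_sc_ev(2) sc_central])
  have er: "e a = e b" if "(a, b) \<in> daha_rels N" for a b
    unfolding e_def
    by (rule GF.rep_rels[OF rhom_ev_qt _ _ _ _ that]) (simp_all add: ev_qt_lvar power_int_minus)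
  have c0: "e (coef x m) = 0" for m
  proof -
    have "daha_class N (coef x m) = \<zero>\<^bsub>daha N\<^esub>"
      using fun_cong[OF assms(2), of m] by (simp add: \<Phi>_def daha_Z_simps)
    then have r: "coef x m \<in> rel_ideal UNIV (daha_gens N) (daha_rels N)"
      using F0.pclass_eq_0[OF daha_rels_closed coef_F0[OF x]] by (simp add: daha_class_def daha_def)
    show ?thesis by (rule F0.rel_ideal_rhom[OF e _ _ r]) (erule daha_rels_closed, erule er)
  qed
  let ?M = "\<Union>w. keys (lookup x w)"
  let ?v = "\<lambda>w. prod_list (map GF.rep_value (letters w))"
  have M: "finite ?M" by (rule finite_coef_support)
  have se: "GF.sc (sum f A) = (\<Sum>a\<in>A. GF.sc (f a))" for f :: "(nat \<Rightarrow>\<^sub>0 int) \<Rightarrow> _" and A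
    unfolding GF.sc_def by (rule rhom_sum[OF rhom_mulop[OF rhom_id]])
  have k: "GF.sc (ev_K (lookup x w)) = (\<Sum>m\<in>?M. GF.sc (ev_qt (lookup (lookup x w) m)) * GF.sc (chi_Z m))" for w
  proof -
    have "ev_K (lookup x w) = (\<Sum>m\<in>?M. ev_qt (lookup (lookup x w) m) * chi_Z m)"
      unfolding ev_K_def by (rule pm_ev_superset[OF rhom_ev_qt M]) blast
    then show ?thesis by (simp add: se GF.sc_simps)
  qed
  have ec: "e (coef x m) = (\<Sum>w\<in>keys x. GF.sc (ev_qt (lookup (lookup x w) m)) * ?v w)" for m
    unfolding coef_def rhom_sum[OF e] unfolding e_def fev_def
    by (simp add: pm_ev_single[OF rhom_sc_ev(2)])
  have t: "GF.sc a * GF.sc c * y = GF.sc c * (GF.sc a * y)" for a c and y :: "(point, lpoly fract fps) oper"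
    using sc_central[of c "GF.sc a"] by (simp flip: mult.assoc)
  have "E x = (\<Sum>w\<in>keys x. \<Sum>m\<in>?M. GF.sc (chi_Z m) * (GF.sc (ev_qt (lookup (lookup x w) m)) * ?v w))"
    unfolding E_def fev_def pm_ev_def k sum_distrib_right t ..
  also have "\<dots> = (\<Sum>m\<in>?M. GF.sc (chi_Z m) * e (coef x m))"
    unfolding ec sum_distrib_left by (rule sum.swap)
  finally show ?thesis by (simp add: c0)
qed

lemma FZ_gen:
  "i \<in> {1..<N} \<Longrightarrow> T i \<in> carrier FZ.F" "i \<in> {1..N} \<Longrightarrow> X i \<in> carrier FZ.F" "i \<in> {1..N} \<Longrightarrow> Y i \<in> carrier FZ.F"
  "i \<in> {1..N} \<Longrightarrow> Xinv i \<in> carrier FZ.F" "i \<in> {1..N} \<Longrightarrow> Yinv i \<in> carrier FZ.F"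
  by (rule FZ.F_gen, simp add: daha_gens_iff)+

lemma FZ_Tinv: "i \<in> {1..<N} \<Longrightarrow> Tinv i \<in> carrier FZ.F"
  unfolding Tinv_def by (intro FZ.F_add FZ.F_minus FZ.F_scal FZ_gen Zqt_consts)

definition "YZ = minus_Z_prod (Y 1) 1 l"

lemma FZ_YZ: "YZ \<in> carrier FZ.F"
  unfolding YZ_def minus_Z_prod_def
  by (rule FZ.F_prod_list) (use N1 in \<open>auto intro!: FZ.F_minus FZ.F_scal Zqt_consts FZ_gen\<close>)

lemma FZ_Tinvs: "1 \<le> a \<Longrightarrow> b \<le> N \<Longrightarrow> prod_list (map Tinv [a..<b]) \<in> carrier FZ.F"
  "1 \<le> a \<Longrightarrow> b \<le> N \<Longrightarrow> prod_list (map Tinv (rev [a..<b])) \<in> carrier FZ.F"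
  "1 \<le> a \<Longrightarrow> b \<le> N \<Longrightarrow> prod_list (map T [a..<b]) \<in> carrier FZ.F"
  by (rule FZ.F_prod_list; auto intro!: FZ_Tinv FZ_gen(1))+

lemma FZ_Dl: "i \<in> {1..N} \<Longrightarrow> Dl i \<in> carrier FZ.F"
  unfolding Dl_def YZ_def[symmetric] by (intro FZ.F_mult FZ_Tinvs FZ_YZ FZ_gen) (use N1 in auto)

end

context cyclotomic_presentation
begin

lemma theta_closed:
  assumes "p \<in> carrier FA.F" shows "\<theta> p \<in> carrier FZ.F"
  using assms
proof (induction p rule: FA.F_induct)
  case (mult k xs)
  have "\<theta> (gen g) \<in> carrier FZ.F" if "g \<in> GA" for g
    using that by (cases g) (auto simp: GA_iff theta_simps FZ_Dl intro!: FZ_gen)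
  then have "prod_list (map (\<lambda>g. \<theta> (gen g)) xs) \<in> carrier FZ.F"
    using mult(2) by (intro FZ.F_prod_list) auto
  then show ?case using FZ.F_mult[OF FZ.F_scal[OF mult(1)]]
    by (simp add: rhomD[OF rhom_theta] rhom_prod_list[OF rhom_theta] theta_simps o_def)
qed (simp_all add: rhomD[OF rhom_theta] FZ.F_0 FZ.F_add)

lemma rhom_Q_theta: "rhom (\<lambda>p. Q (\<theta> p))"
  by (rule rhom_compose[OF rhom_Q rhom_theta])

lemma RA_Q:
  assumes "(a, b) \<in> RA" shows "Q (\<theta> a) = Q (\<theta> b)"
proof -
  have "(a, b) \<in> Y_inverse_rels N \<Longrightarrow> Q (\<theta> a) = Q (\<theta> b)"
    unfolding Y_inverse_rels_def
    by (elim UnE; clarsimp simp: rhomD[OF rhom_theta] rhomD[OF rhom_Q] theta_simps Q_YY')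
  then show ?thesis using assms cyc_rels_Q unfolding RA_def by (auto split: if_splits)
qed

definition "h0 p = \<Phi> (\<theta> p)"

lemma h0_hom: "h0 \<in> ring_hom FA.F (daha_Z N l)"
proof (rule ring_hom_memI)
  show "h0 x \<in> carrier (daha_Z N l)" if "x \<in> carrier FA.F" for x
    unfolding h0_def by (rule Phi_closed[OF theta_closed[OF that]])
  show "h0 \<one>\<^bsub>FA.F\<^esub> = \<one>\<^bsub>daha_Z N l\<^esub>"
    using ring_hom_one[OF Phi_hom] by (simp add: h0_def FA.F_simps FZ.F_simps rhomD[OF rhom_theta])
  fix x y assume "x \<in> carrier FA.F" "y \<in> carrier FA.F"
  note xy = this[THEN theta_closed]
  show "h0 (x \<otimes>\<^bsub>FA.F\<^esub> y) = h0 x \<otimes>\<^bsub>daha_Z N l\<^esub> h0 y" "h0 (x \<oplus>\<^bsub>FA.F\<^esub> y) = h0 x \<oplus>\<^bsub>daha_Z N l\<^esub> h0 y"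
    using ring_hom_mult[OF Phi_hom xy] ring_hom_add[OF Phi_hom xy]
    by (simp_all add: h0_def FA.F_simps FZ.F_simps rhomD[OF rhom_theta])
qed

lemma h0_RA: "(a, b) \<in> RA \<Longrightarrow> h0 a = h0 b"
  unfolding h0_def using Phi_eqI[OF RA_Q] theta_closed RA_closed by blast

definition mon_elem :: "(nat list \<times> nat list) \<times> (nat list \<times> nat list) \<times> nat list \<Rightarrow> (generator, Zqt_laurent) falg" where
  "mon_elem b = pair_prod X D (fst b) * (pair_prod Y Yinv (fst (snd b)) * prod_list (map T (snd (snd b))))"

lemma E_theta_mon: "E (\<theta> (mon_elem b)) = GF.rep_basis zf l b"
proof -
  define g where "g p = E (\<theta> p)" for p
  have g: "rhom g" unfolding g_def by (rule rhom_compose[OF rhom_E rhom_theta])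
  have z0: "zexp 0 = 0" by (rule poly_mapping_eqI) (simp add: lookup_zexp)
  have K: "ev_K ct = s1" "ev_K ct' = inverse s1"
    by (simp_all add: ct_def ct'_def ev_K_single ev_qt_lvar chi_Z_def z0)
  have Ti: "E (Tinv i) = GF.Tt.Ti i" for i
    unfolding rhom_words(8)[OF rhom_E] by (simp only: E_simps K GF.rep_value.simps GF.Tt.Ti_def)
  have Dl: "E (Dl i) = GF.Dop zf l i" for i
    by (simp only: Dl_def GF.Dop_def GF.Tt.downi_def GF.Tt.upi_def rhomD[OF rhom_E] rhom_prod_list[OF rhom_E] map_map o_def
        Ti rhom_words(7)[OF rhom_E] E_simps ev_K_Z GF.rep_value.simps)
  have v: "g (T i) = GF.Top i" "g (X i) = GF.R.Xr i" "g (Y i) = GF.Yop i" "g (Yinv i) = GF.Yiop i" "g (D i) = GF.Dop zf l i" for i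
    by (simp_all only: g_def theta_simps E_simps Dl GF.rep_value.simps)
  have "g (mon_elem b) = GF.rep_basis zf l b"
    by (simp only: mon_elem_def GF.rep_basis_def pair_prod_def rhomD[OF g] rhom_prod_list[OF g] map_map o_def v)
  then show ?thesis by (simp only: g_def)
qed

text \<open>Modulo the relations \<open>p\<close> equals a combination \<open>z\<close> of ordered
  products. The relations hold in the DAHA, so \<open>z\<close> has image zero as well and acts by
  zero in the representation. Independence there, with injectivity of \<open>ev_K\<close>, makes
  every coefficient of \<open>z\<close> vanish, and \<open>p\<close> itself lies in the
  ideal.\<close>

lemma h0_kernel:
  assumes p: "p \<in> carrier FA.F" and "h0 p = \<zero>\<^bsub>daha_Z N l\<^esub>"
  shows "p \<in> rel_ideal (Zqt_coeffs l) GA RA"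
proof -
  interpret C: cyc_alg N "\<lambda>i. QA (T i)" "QA (scal ct)" "QA (scal ct')" "\<lambda>i. QA (X i)" "\<lambda>i. QA (Y i)" "\<lambda>i. QA (D i)" "\<lambda>i. QA (Yinv i)"
    "QA (scal cq)" "QA (scal cq')" "\<lambda>r. QA (scal (lvar r 1))" l KQ yinv by (rule cyc_alg_QA)
  note QH = rhomD[OF rhom_QA]
  let ?G = "KQ \<union> (\<lambda>i. QA (T i)) ` {1..<N} \<union> (\<lambda>i. QA (X i)) ` {1..N} \<union> (\<lambda>i. QA (D i)) ` {1..N} \<union> (\<lambda>i. QA (Y i)) ` {1..N}
    \<union> (if yinv then (\<lambda>i. QA (Yinv i)) ` {1..N} else {})"
  have "QA p \<in> subring_gen ?G"
    using p
  proof (induction p rule: FA.F_induct)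
    case zero
    then show ?case by (simp add: QH subring_gen_zero)
  next
    case (add p r)
    then show ?case by (simp add: QH subring_gen.plus)
  next
    case (mult k xs)
    have gG: "QA (gen g) \<in> ?G" if g: "g \<in> GA" for g
      using g by (cases g) (simp_all add: GA_iff)
    have "QA (prod_list (map gen xs)) \<in> subring_gen ?G"
      using mult(2)
    proof (induction xs)
      case Nil
      show ?case unfolding list.map prod_list.Nil QH by (rule subring_gen.one)
    next
      case (Cons g xs)
      then have g: "g \<in> GA" and xs: "QA (prod_list (map gen xs)) \<in> subring_gen ?G" by auto
      show ?case unfolding list.map prod_list.Cons QH by (rule subring_gen.times[OF subring_gen.gen[OF gG[OF g]] xs])
    qed
    moreover have "QA (scal k) \<in> subring_gen ?G" using mult(1) by (intro subring_gen.gen) (simp add: KQ_def)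
    ultimately show ?case unfolding QH by (intro subring_gen.times)
  qed
  then have "QA p \<in> lin_span (C.basis_elem ` C.basis_index) KQ" using C.spanning by blast
  from lin_span_finite_sum[OF this[unfolded KQ_def] _ FA.K0 FA.Kplus]
  obtain B k where B: "finite B" "B \<subseteq> C.basis_index" and k: "\<And>b. k b \<in> Zqt_coeffs l"
    and s: "QA p = (\<Sum>b\<in>B. C.basis_elem b * QA (scal (k b)))"
    by (auto simp: QH rhomD[OF rhom_scal])
  define z where "z = (\<Sum>b\<in>B. mon_elem b * scal (k b))"
  have "QA (mon_elem b) = C.basis_elem b" for b
    by (simp add: mon_elem_def C.basis_elem_def pair_prod_def QH rhom_prod_list[OF rhom_QA] o_def)
  then have "QA p = QA z" by (simp add: s z_def rhom_sum[OF rhom_QA] QH)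
  then have pz: "p - z \<in> tideal RA" by (simp add: QH flip: QA_eq_0)
  have mon: "mon_elem b \<in> carrier FA.F" if "b \<in> C.basis_index" for b
  proof -
    obtain xs ds ys zs w where b: "b = ((xs, ds), (ys, zs), w)" by (metis prod.collapse)
    have sets: "set xs \<subseteq> {1..N}" "set ds \<subseteq> {1..N}" "set ys \<subseteq> {1..N}" "set zs \<subseteq> {1..N}" "\<not> yinv \<Longrightarrow> zs = []" "set w \<subseteq> {1..<N}"
      using that perm_words_subset[of w N] unfolding b C.basis_index_def C.YP_def disjoint_pairs_def by (auto split: if_splits)
    have "prod_list (map Yinv zs) \<in> carrier FA.F"
    proof (cases yinv)
      case True
      show ?thesis by (rule FA.F_prod_list) (use sets(4) FA_gen(5)[OF True] in auto)
    next
      case False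
      show ?thesis unfolding sets(5)[OF False] list.map prod_list.Nil by (rule FA.F_1)
    qed
    moreover have "prod_list (map X xs) \<in> carrier FA.F" "prod_list (map D ds) \<in> carrier FA.F"
      "prod_list (map Y ys) \<in> carrier FA.F" "prod_list (map T w) \<in> carrier FA.F"
      by (rule FA.F_prod_list; use sets in \<open>auto intro!: FA_gen(1-4)\<close>)+
    ultimately show ?thesis unfolding mon_elem_def pair_prod_def b fst_conv snd_conv by (intro FA.F_mult)
  qed
  have zF: "z \<in> carrier FA.F" unfolding z_def by (intro FA.F_sum FA.F_mult FA.F_scal k mon) (use B in blast)
  have "Q (\<theta> (p - z)) = 0" by (rule rhom_tideal[OF rhom_Q_theta RA_Q pz])
  then have "Q (\<theta> z) = Q (\<theta> p)" by (simp add: rhomD[OF rhom_theta] rhomD[OF rhom_Q])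
  then have "\<Phi> (\<theta> z) = \<Phi> (\<theta> p)" by (rule Phi_eqI[OF _ theta_closed[OF zF] theta_closed[OF p]])
  then have "E (\<theta> z) = 0" using assms(2) by (intro E_Phi_eq_0 theta_closed zF) (simp add: h0_def)
  then have sum0: "(\<Sum>b\<in>B. GF.sc (ev_K (k b)) * GF.rep_basis zf l b) = 0"
    by (simp add: z_def rhom_sum[OF rhom_theta] rhom_sum[OF rhom_E] rhomD[OF rhom_theta] rhomD[OF rhom_E] theta_simps E_theta_mon E_simps sc_central)
  have "\<forall>b\<in>B. ev_K (k b) = 0"
  proof (rule GF.rep_basis_independent[where S = scalars, OF _ _ _ B(1) _ _ sum0])
    show "GF.val a \<noteq> zf r" for r a by (rule val_neq_Z[OF N1])
    show "a * qf powi n \<in> scalars" if "a \<in> scalars" for a n by (rule scalars_closed(2)[OF that scalars_q])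
    show "B \<subseteq> disjoint_pairs N \<times> disjoint_pairs N \<times> perm_words N"
      using B(2) unfolding C.basis_index_def C.YP_def by auto
    show "fps_nth (ev_K (k b)) n \<in> scalars" for b n by (rule ev_K_scalars)
    show "\<forall>y\<in>P. \<kappa> y = 0" if "finite P" "P \<subseteq> disjoint_pairs N" "\<And>y. y \<in> P \<Longrightarrow> \<kappa> y \<in> scalars"
      "(\<Sum>y\<in>P. \<kappa> y * pair_prod xf (\<lambda>j. inverse (xf j)) y) = 0" for P \<kappa>
      by (rule xi_independent[OF N1 that])
  qed
  then have "k b = 0" if "b \<in> B" for b using that ev_K_inj by blast
  then have "z = 0" unfolding z_def by (simp add: rhomD[OF rhom_scal])
  then have "p \<in> tideal RA" using pz by simp
  from this p show ?thesis by (intro tideal_rel_ideal RA_closed)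
qed

end

section \<open>The generators of the cyclotomic algebras as images of free algebra elements\<close>

context cyclotomic
begin

sublocale PH: ring_hom_ring FZ.F "daha_Z N l" \<Phi>
  by (rule ring_hom_ringI2[OF FZ.F_ring daha_Z_ring Phi_hom])

lemma Phi_scal: "\<Phi> (scal c) = hscal N c"
  by (rule ext) (simp add: \<Phi>_def hscal_def scal_def coef_single)

lemma Phi_gen: "\<Phi> (gen g) = (\<lambda>m. daha_class N (if m = 0 then gen g else 0))"
  by (rule ext) (simp add: \<Phi>_def gen_def coef_single lookup_one when_def)

lemma Phi_T: "\<Phi> (T i) = hT N i" and Phi_X: "\<Phi> (X i) = hX N i" and Phi_Y: "\<Phi> (Y i) = hY N i"
  by (simp_all add: Phi_gen hT_def hX_def hY_def)

lemma Phi_mult: "p \<in> carrier FZ.F \<Longrightarrow> r \<in> carrier FZ.F \<Longrightarrow> \<Phi> (p * r) = \<Phi> p \<otimes>\<^bsub>daha_Z N l\<^esub> \<Phi> r"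
  and Phi_add: "p \<in> carrier FZ.F \<Longrightarrow> r \<in> carrier FZ.F \<Longrightarrow> \<Phi> (p + r) = \<Phi> p \<oplus>\<^bsub>daha_Z N l\<^esub> \<Phi> r"
  and Phi_one: "\<Phi> 1 = \<one>\<^bsub>daha_Z N l\<^esub>"
  using ring_hom_mult[OF Phi_hom] ring_hom_add[OF Phi_hom] ring_hom_one[OF Phi_hom] by (simp_all add: FZ.F_simps)

lemma Phi_uminus: "p \<in> carrier FZ.F \<Longrightarrow> \<Phi> (- p) = \<ominus>\<^bsub>daha_Z N l\<^esub> \<Phi> p"
  using PH.hom_a_inv[of p] by (simp add: FZ.F_a_inv)

lemma Phi_minus: "p \<in> carrier FZ.F \<Longrightarrow> r \<in> carrier FZ.F \<Longrightarrow> \<Phi> (p - r) = \<Phi> p \<ominus>\<^bsub>daha_Z N l\<^esub> \<Phi> r"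
  using Phi_add[of p "- r"] Phi_uminus[of r] FZ.F_uminus[of r] by (simp add: a_minus_def)

lemma Phi_prod_list:
  "(\<And>x. x \<in> set xs \<Longrightarrow> x \<in> carrier FZ.F) \<Longrightarrow> ring_prod_list (daha_Z N l) (map \<Phi> xs) = \<Phi> (prod_list xs)"
proof (induction xs)
  case (Cons x xs)
  moreover have "prod_list xs \<in> carrier FZ.F" by (rule FZ.F_prod_list) (use Cons.prems in auto)
  ultimately show ?case by (simp add: ring_prod_list_def Phi_mult)
qed (simp add: ring_prod_list_def Phi_one)

text \<open>An inverse in the ring with explicit carrier is identified by exhibiting a two-sided
  inverse, and the two products need only be computed in the quotient type.\<close>

lemma Phi_inverse:
  assumes "p \<in> carrier FZ.F" "r \<in> carrier FZ.F" "Q (p * r) = 1" "Q (r * p) = 1"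
  shows "inv\<^bsub>daha_Z N l\<^esub> \<Phi> p = \<Phi> r"
proof -
  have Q1: "Q 1 = 1" by (rule rhomD(1)[OF rhom_Q])
  have "\<Phi> p \<otimes>\<^bsub>daha_Z N l\<^esub> \<Phi> r = \<one>\<^bsub>daha_Z N l\<^esub>" "\<Phi> r \<otimes>\<^bsub>daha_Z N l\<^esub> \<Phi> p = \<one>\<^bsub>daha_Z N l\<^esub>"
    using Phi_eqI[of "p * r" 1] Phi_eqI[of "r * p" 1] assms FZ.F_mult FZ.F_1 by (simp_all add: Q1 Phi_mult Phi_one)
  then show ?thesis
    using monoid.inv_unique'[OF ring.is_monoid[OF daha_Z_ring] Phi_closed[OF assms(1)] Phi_closed[OF assms(2)]] by simp
qed

lemma inv_hT: "i \<in> {1..<N} \<Longrightarrow> inv\<^bsub>daha_Z N l\<^esub> hT N i = \<Phi> (Tinv i)"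
  unfolding Phi_T[symmetric]
  by (rule Phi_inverse) (simp_all add: FZ_gen FZ_Tinv rhomD[OF rhom_Q] Q_Tinv DA.X.T_Ti DA.X.Ti_T)

lemma inv_hX: "i \<in> {1..N} \<Longrightarrow> inv\<^bsub>daha_Z N l\<^esub> hX N i = \<Phi> (Xinv i)"
  unfolding Phi_X[symmetric]
  by (rule Phi_inverse) (simp_all add: FZ_gen rhomD[OF rhom_Q] Q_XX')

lemma inv_hY: "i \<in> {1..N} \<Longrightarrow> inv\<^bsub>daha_Z N l\<^esub> hY N i = \<Phi> (Yinv i)"
  unfolding Phi_Y[symmetric]
  by (rule Phi_inverse) (simp_all add: FZ_gen rhomD[OF rhom_Q] Q_YY')

lemma one_mem: "1 \<in> {1..N}"
  using N1 by simp

lemma hYZ_Phi: "hYZ N l = \<Phi> YZ"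
proof -
  have c: "Y 1 - scal (lvar r 1) \<in> carrier FZ.F" if "r \<in> {1..l}" for r
    by (intro FZ.F_minus FZ.F_scal Zqt_consts FZ_gen one_mem that)
  have e: "hY N 1 \<ominus>\<^bsub>daha_Z N l\<^esub> hscal N (lvar r 1) = \<Phi> (Y 1 - scal (lvar r 1))" if "r \<in> {1..l}" for r
    by (simp only: Phi_minus[OF FZ_gen(3)[OF one_mem] FZ.F_scal[OF Zqt_consts(4)[OF that]]] Phi_Y Phi_scal)
  have "map (\<lambda>r. hY N 1 \<ominus>\<^bsub>daha_Z N l\<^esub> hscal N (lvar r 1)) [1..<l+1] = map \<Phi> (map (\<lambda>r. Y 1 - scal (lvar r 1)) [1..<l+1])"
    using e by auto
  then show ?thesis
    unfolding hYZ_def YZ_def minus_Z_prod_def by (simp only:) (rule Phi_prod_list, use c in auto)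
qed

lemma hD_Phi:
  assumes i: "i \<in> {1..N}" shows "hD N l i = \<Phi> (Dl i)"
proof -
  have "map (\<lambda>k. inv\<^bsub>daha_Z N l\<^esub> hT N k) xs = map \<Phi> (map Tinv xs)" if "set xs \<subseteq> {1..<N}" for xs
    using that by (auto simp: inv_hT)
  moreover have "set [1..<i] \<subseteq> {1..<N}" "set (rev [1..<i]) \<subseteq> {1..<N}" using i by auto
  moreover have "inv\<^bsub>daha_Z N l\<^esub> hX N 1 \<otimes>\<^bsub>daha_Z N l\<^esub> hYZ N l = \<Phi> (Xinv 1 * YZ)"
    by (simp only: inv_hX[OF one_mem] hYZ_Phi Phi_mult[OF FZ_gen(4)[OF one_mem] FZ_YZ])
  ultimately have "hD N l i = ring_prod_list (daha_Z N l) (map \<Phi> (map Tinv (rev [1..<i]) @ [Xinv 1 * YZ] @ map Tinv [1..<i]))"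
    unfolding hD_def by (simp only: map_append list.map)
  also have "\<dots> = \<Phi> (prod_list (map Tinv (rev [1..<i]) @ [Xinv 1 * YZ] @ map Tinv [1..<i]))"
    by (rule Phi_prod_list) (use i in \<open>auto intro!: FZ_Tinv FZ.F_mult FZ_gen(4) one_mem FZ_YZ\<close>)
  finally show ?thesis by (simp add: Dl_def YZ_def mult.assoc)
qed

definition "Tw = prod_list (map T [1..<N])"
definition "Tw' = prod_list (map Tinv (rev [1..<N]))"

lemma FZ_Tw: "Tw \<in> carrier FZ.F" "Tw' \<in> carrier FZ.F"
  unfolding Tw_def Tw'_def by (rule FZ_Tinvs; simp)+

lemma Q_Tw: "Q Tw * Q Tw' = 1" "Q Tw' * Q Tw = 1"
proof -
  have "Q Tw = DA.X.up 1 N" "Q Tw' = DA.X.downi 1 N"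
    by (simp_all add: Tw_def Tw'_def DA.X.up_def DA.X.downi_def rhom_prod_list[OF rhom_Q] o_def Q_Tinv)
  then show "Q Tw * Q Tw' = 1" "Q Tw' * Q Tw = 1"
    using DA.X.up_inverse[of 1 N] by simp_all
qed

lemma hpi_Phi: "hpi N l = \<Phi> (X 1 * Tw)"
proof -
  have "map (hT N) [1..<N] = map \<Phi> (map T [1..<N])" by (simp add: Phi_T o_def)
  then have "hpi N l = ring_prod_list (daha_Z N l) (map \<Phi> (X 1 # map T [1..<N]))"
    unfolding hpi_def by (simp only: list.map Phi_X)
  also have "\<dots> = \<Phi> (prod_list (X 1 # map T [1..<N]))"
    by (rule Phi_prod_list) (auto intro!: FZ_gen(1) FZ_gen(2)[OF one_mem])
  finally show ?thesis by (simp add: Tw_def)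
qed

lemma inv_hpi: "inv\<^bsub>daha_Z N l\<^esub> hpi N l \<otimes>\<^bsub>daha_Z N l\<^esub> hYZ N l = \<Phi> (Tw' * (Xinv 1 * YZ))"
proof -
  have "Q (X 1 * Tw * (Tw' * Xinv 1)) = Q (X 1) * (Q Tw * Q Tw') * Q (Xinv 1)"
    "Q (Tw' * Xinv 1 * (X 1 * Tw)) = Q Tw' * (Q (Xinv 1) * Q (X 1)) * Q Tw"
    by (simp_all add: rhomD[OF rhom_Q] mult.assoc)
  then have "inv\<^bsub>daha_Z N l\<^esub> hpi N l = \<Phi> (Tw' * Xinv 1)"
    unfolding hpi_Phi
    by (intro Phi_inverse FZ.F_mult FZ_Tw FZ_gen one_mem) (simp_all add: Q_Tw Q_XX'[OF one_mem])
  then show ?thesis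
    using Phi_mult[OF FZ.F_mult[OF FZ_Tw(2) FZ_gen(4)[OF one_mem]] FZ_YZ] by (simp add: hYZ_Phi mult.assoc)
qed

text \<open>
  \<open>X\<^sub>i\<close> and \<open>D\<^sub>i\<close> lie in the subring generated by \<open>\<pi>\<close> and \<open>\<pi>\<^sup>-\<^sup>1 \<Prod>(Y\<^sub>1 - Z\<^sub>r)\<close>, because \<open>X\<^sub>1 = \<pi> (T\<^sub>1 \<cdots> T\<^sub>N\<^sub>-\<^sub>1)\<^sup>-\<^sup>1\<close>
  and \<open>D\<^sub>1 = T\<^sub>1 \<cdots> T\<^sub>N\<^sub>-\<^sub>1 \<pi>\<^sup>-\<^sup>1 \<Prod>(Y\<^sub>1 - Z\<^sub>r)\<close>.
\<close>

lemma X_D_generated: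
  fixes H
  defines "W \<equiv> generate_ring (daha_Z N l) H"
  assumes K: "\<And>c. c \<in> Zqt_coeffs l \<Longrightarrow> \<Phi> (scal c) \<in> W" and T: "\<And>i. i \<in> {1..<N} \<Longrightarrow> \<Phi> (T i) \<in> W"
    and pi: "\<Phi> (X 1 * Tw) \<in> W" "\<Phi> (Tw' * (Xinv 1 * YZ)) \<in> W" and i: "i \<in> {1..N}"
  shows "\<Phi> (X i) \<in> W" "\<Phi> (Dl i) \<in> W"
proof -
  define S where "S = {p \<in> carrier FZ.F. \<Phi> p \<in> W}"
  have mult: "p * r \<in> S" if "p \<in> S" "r \<in> S" for p r
    using that FZ.F_mult generate_ring.eng_mult by (auto simp: S_def Phi_mult W_def)
  have add: "p + r \<in> S" if "p \<in> S" "r \<in> S" for p r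
    using that FZ.F_add generate_ring.eng_add by (auto simp: S_def Phi_add W_def)
  have minus: "- p \<in> S" if "p \<in> S" for p
    using that FZ.F_uminus generate_ring.a_inv by (auto simp: S_def Phi_uminus W_def)
  have one: "1 \<in> S"
    using FZ.F_1 generate_ring.one by (auto simp: S_def Phi_one W_def)
  have prod: "prod_list xs \<in> S" if "set xs \<subseteq> S" for xs
    using that by (induction xs) (auto intro: one mult)
  have eqv: "\<Phi> r \<in> W" if "p \<in> S" "Q r = Q p" "r \<in> carrier FZ.F" for p r
    using that Phi_eqI[of r p] by (auto simp: S_def)
  have TS: "T i \<in> S" if "i \<in> {1..<N}" for i using that T FZ_gen by (simp add: S_def)
  have "scal ct \<in> S" "scal ct' \<in> S" using K FZ.F_scal Zqt_consts by (simp_all add: S_def)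
  then have TiS: "Tinv i \<in> S" if "i \<in> {1..<N}" for i
    using add[OF add[OF TS[OF that] minus]] by (simp add: Tinv_def)
  have Tw: "Tw \<in> S" "Tw' \<in> S" unfolding Tw_def Tw'_def by (rule prod; auto intro!: TS TiS)+
  have P: "X 1 * Tw \<in> S" "Tw' * (Xinv 1 * YZ) \<in> S"
    using pi by (auto simp: S_def intro!: FZ.F_mult FZ_Tw FZ_YZ FZ_gen one_mem)
  have "i \<le> N \<longrightarrow> X i \<in> S \<and> Dl i \<in> S" if "1 \<le> i" for i
    using that
  proof (induction i rule: dec_induct)
    case base
    have "Q (X 1) = Q (X 1 * Tw * Tw')" using Q_Tw by (simp add: rhomD[OF rhom_Q] mult.assoc)
    moreover have "Q (Dl 1) = Q (Tw * (Tw' * (Xinv 1 * YZ)))"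
    proof -
      have "Q (Tw * (Tw' * (Xinv 1 * YZ))) = (Q Tw * Q Tw') * Q (Xinv 1 * YZ)" by (simp add: rhomD[OF rhom_Q] mult.assoc)
      then show ?thesis by (simp add: Q_Tw Dl_def YZ_def)
    qed
    ultimately show ?case
      using eqv[OF mult[OF P(1) Tw(2)]] eqv[OF mult[OF Tw(1) P(2)]] FZ_gen(2)[OF one_mem] FZ_Dl[OF one_mem] by (simp add: S_def)
  next
    case (step i)
    show ?case
    proof
      assume "Suc i \<le> N"
      then have i: "i \<in> {1..<N}" and r: "Suc i \<in> {1..N}" using step.hyps by auto
      then have IH: "X i \<in> S" "Dl i \<in> S" using step.IH by auto
      have "Q (X (Suc i)) = Q (T i * X i * T i)" "Q (Dl (Suc i)) = Q (Tinv i * Dl i * Tinv i)"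
        using DA.X.TAT[OF i] DA.D.TAT[OF i] by (simp_all add: rhomD[OF rhom_Q] Q_Dl Q_Tinv)
      then show "X (Suc i) \<in> S \<and> Dl (Suc i) \<in> S"
        using eqv[OF mult[OF mult[OF TS[OF i] IH(1)] TS[OF i]]] eqv[OF mult[OF mult[OF TiS[OF i] IH(2)] TiS[OF i]]]
          FZ_gen(2)[OF r] FZ_Dl[OF r] by (simp add: S_def)
    qed
  qed
  then show "\<Phi> (X i) \<in> W" "\<Phi> (Dl i) \<in> W" using i by (auto simp: S_def)
qed

end

context cyclotomic_presentation
begin

lemma h0_simps: "h0 (scal c) = hscal N c" "g \<in> GA \<Longrightarrow> h0 (gen g) = cyc_value N l g"
proof -
  show "h0 (scal c) = hscal N c" by (simp add: h0_def theta_simps Phi_scal)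
  show "h0 (gen g) = cyc_value N l g" if "g \<in> GA"
    using that by (cases g) (simp_all add: GA_iff h0_def theta_simps Phi_T Phi_X Phi_Y inv_hY hD_Phi)
qed

text \<open>The set \<open>H\<close> need not consist of images of generators: for the localized
  algebra it contains \<pi> in place of the X_i and D_i. Hence each generating set has to be found
  in the ring generated by the other.\<close>

lemma h0_image:
  assumes K: "\<And>c. c \<in> Zqt_coeffs l \<Longrightarrow> h0 (scal c) \<in> generate_ring (daha_Z N l) H"
    and G: "\<And>g. g \<in> GA \<Longrightarrow> h0 (gen g) \<in> generate_ring (daha_Z N l) H"
    and H: "H \<subseteq> h0 ` carrier FA.F"
  shows "h0 ` carrier FA.F = generate_ring (daha_Z N l) H"
proof -
  interpret h: ring_hom_ring FA.F "daha_Z N l" h0 by (rule ring_hom_ringI2[OF FA.F_ring daha_Z_ring h0_hom])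
  let ?W = "generate_ring (daha_Z N l) H"
  have hm: "h0 (x * y) = h0 x \<otimes>\<^bsub>daha_Z N l\<^esub> h0 y" "h0 (x + y) = h0 x \<oplus>\<^bsub>daha_Z N l\<^esub> h0 y" if "x \<in> carrier FA.F" "y \<in> carrier FA.F" for x y
    using h.hom_mult[OF that] h.hom_add[OF that] by (simp_all add: FA.F_simps)
  have h1: "h0 1 = \<one>\<^bsub>daha_Z N l\<^esub>" using h.hom_one by (simp add: FA.F_simps)
  have "h0 p \<in> ?W" if "p \<in> carrier FA.F" for p
    using that
  proof (induction p rule: FA.F_induct)
    case zero
    have "h0 0 = h0 1 \<oplus>\<^bsub>daha_Z N l\<^esub> (\<ominus>\<^bsub>daha_Z N l\<^esub> h0 1)"
      using h.hom_zero abelian_group.r_neg[OF ring.is_abelian_group[OF daha_Z_ring] ring.ring_simprules(6)[OF daha_Z_ring]] by (simp add: FA.F_simps h1)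
    then show ?case unfolding h1 by (auto intro: generate_ring.intros)
  next
    case (mult k xs)
    have "prod_list (map gen xs) \<in> carrier FA.F \<and> h0 (prod_list (map gen xs)) \<in> ?W"
      using mult(2)
    proof (induction xs)
      case Nil
      show ?case using FA.F_1 by (simp add: h1 generate_ring.one)
    next
      case (Cons g xs)
      then show ?case using FA.F_gen[of g] G[of g] FA.F_mult by (auto simp: hm intro: generate_ring.eng_mult)
    qed
    then show ?case using K[OF mult(1)] FA.F_scal[OF mult(1)] by (auto simp: hm intro: generate_ring.eng_mult)
  next
    case (add p r)
    then show ?case by (auto simp: hm intro: generate_ring.eng_add)
  qed
  moreover have "x \<in> h0 ` carrier FA.F" if "x \<in> ?W" for x
    using that
  proof (induction x rule: generate_ring.induct)
    case one
    show ?case using FA.F_1 h1 by (metis image_eqI)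
  next
    case (incl x)
    then show ?case using H by blast
  next
    case (a_inv x)
    then obtain p where p: "p \<in> carrier FA.F" "x = h0 p" by blast
    then have "\<ominus>\<^bsub>daha_Z N l\<^esub> x = h0 (- p)" using h.hom_a_inv[OF p(1)] by (simp add: FA.F_a_inv)
    then show ?case using FA.F_uminus[OF p(1)] by blast
  next
    case (eng_add x y)
    then obtain p r where "p \<in> carrier FA.F" "x = h0 p" "r \<in> carrier FA.F" "y = h0 r" by blast
    then show ?case using FA.F_add[of p r] hm(2)[of p r] by (metis image_eqI)
  next
    case (eng_mult x y)
    then obtain p r where "p \<in> carrier FA.F" "x = h0 p" "r \<in> carrier FA.F" "y = h0 r" by blast
    then show ?case using FA.F_mult[of p r] hm(1)[of p r] by (metis image_eqI)
  qed
  ultimately show ?thesis by blast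
qed

lemma presentation:
  assumes "h0 ` carrier FA.F = carrier B" "B = daha_Z N l\<lparr>carrier := W\<rparr>"
  shows "has_presentation B (Zqt_coeffs l) (hscal N) GA (cyc_value N l) RA"
  by (rule FA.has_presentationI[OF daha_Z_ring h0_hom RA_closed h0_RA h0_kernel assms h0_simps(1,2)])

end

theorem theorem3p28:
  fixes N l :: nat
  assumes "1 \<le> N"
  shows "has_presentation (cyc_daha_plus N l) (Zqt_coeffs l) (hscal N)
           (cyc_plus_gens N) (cyc_value N l) (cyc_rels N l)
       \<and> has_presentation (cyc_daha N l) (Zqt_coeffs l) (hscal N)
           (cyc_gens N) (cyc_value N l) (cyc_rels N l \<union> Y_inverse_rels N)"
proof
  interpret P: cyclotomic_presentation N l False by unfold_locales (rule assms)
  have RG: "P.RA = cyc_rels N l" "P.GA = cyc_plus_gens N" by (simp_all add: P.RA_def P.GA_def)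
  let ?H = "hscal N ` Zqt_coeffs l \<union> hT N ` {1..<N} \<union> hX N ` {1..N} \<union> hD N l ` {1..N} \<union> hY N ` {1..N}"
  have val: "P.h0 (scal c) = hscal N c" "i \<in> {1..<N} \<Longrightarrow> P.h0 (T i) = hT N i" "j \<in> {1..N} \<Longrightarrow> P.h0 (X j) = hX N j"
    "j \<in> {1..N} \<Longrightarrow> P.h0 (D j) = hD N l j" "j \<in> {1..N} \<Longrightarrow> P.h0 (Y j) = hY N j" for c i j
    by (simp_all add: P.h0_simps P.GA_iff)
  have "P.h0 ` carrier P.FA.F = generate_ring (daha_Z N l) ?H"
  proof (rule P.h0_image)
    show "P.h0 (scal c) \<in> generate_ring (daha_Z N l) ?H" if "c \<in> Zqt_coeffs l" for c
      using that by (auto simp: val intro!: generate_ring.incl)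
    show "P.h0 (gen g) \<in> generate_ring (daha_Z N l) ?H" if "g \<in> P.GA" for g
      using that by (cases g) (auto simp: val P.GA_iff intro!: generate_ring.incl)
    show "?H \<subseteq> P.h0 ` carrier P.FA.F"
    proof (intro Un_least image_subsetI)
      show "hscal N c \<in> P.h0 ` carrier P.FA.F" if "c \<in> Zqt_coeffs l" for c
        using imageI[OF P.FA.F_scal[OF that], of P.h0] by (simp add: val)
      show "hT N i \<in> P.h0 ` carrier P.FA.F" if "i \<in> {1..<N}" for i
        using imageI[OF P.FA_gen(1)[OF that], of P.h0] that by (simp add: val)
      show "hX N i \<in> P.h0 ` carrier P.FA.F" "hD N l i \<in> P.h0 ` carrier P.FA.F" "hY N i \<in> P.h0 ` carrier P.FA.F" if "i \<in> {1..N}" for i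
        using imageI[OF P.FA_gen(2)[OF that], of P.h0] imageI[OF P.FA_gen(3)[OF that], of P.h0] imageI[OF P.FA_gen(4)[OF that], of P.h0] that
        by (simp_all add: val)
    qed
  qed
  then show "has_presentation (cyc_daha_plus N l) (Zqt_coeffs l) (hscal N) (cyc_plus_gens N) (cyc_value N l) (cyc_rels N l)"
    using P.presentation[of "cyc_daha_plus N l"] unfolding RG by (simp add: cyc_daha_plus_def)
next
  interpret P: cyclotomic_presentation N l True by unfold_locales (rule assms)
  have RG: "P.RA = cyc_rels N l \<union> Y_inverse_rels N" "P.GA = cyc_gens N" by (simp_all add: P.RA_def P.GA_def)
  let ?H = "hscal N ` Zqt_coeffs l \<union> hT N ` {1..<N} \<union> hY N ` {1..N} \<union> (\<lambda>i. inv\<^bsub>daha_Z N l\<^esub> hY N i) ` {1..N}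
    \<union> {hpi N l, inv\<^bsub>daha_Z N l\<^esub> hpi N l \<otimes>\<^bsub>daha_Z N l\<^esub> hYZ N l}"
  let ?W = "generate_ring (daha_Z N l) ?H"
  have val: "P.h0 (scal c) = hscal N c" "i \<in> {1..<N} \<Longrightarrow> P.h0 (T i) = hT N i" "j \<in> {1..N} \<Longrightarrow> P.h0 (X j) = hX N j"
    "j \<in> {1..N} \<Longrightarrow> P.h0 (D j) = hD N l j" "j \<in> {1..N} \<Longrightarrow> P.h0 (Y j) = hY N j" "j \<in> {1..N} \<Longrightarrow> P.h0 (Yinv j) = inv\<^bsub>daha_Z N l\<^esub> hY N j" for c i j
    by (simp_all add: P.h0_simps P.GA_iff)
  have "P.h0 ` carrier P.FA.F = ?W"
  proof (rule P.h0_image)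
    show K: "P.h0 (scal c) \<in> ?W" if "c \<in> Zqt_coeffs l" for c
      using that by (auto simp: val intro!: generate_ring.incl)
    \<comment> \<open>The X_i and D_i are absent from this generating set and have to be recovered
      from \<pi> and \<pi>^{-1} times the product of the Y_1 - Z_r.\<close>
    have XD: "hX N i \<in> ?W" "hD N l i \<in> ?W" if i: "i \<in> {1..N}" for i
    proof -
      have c: "P.\<Phi> (scal c) \<in> ?W" if "c \<in> Zqt_coeffs l" for c
        unfolding P.Phi_scal using that by (auto intro!: generate_ring.incl)
      have T: "P.\<Phi> (T i) \<in> ?W" if "i \<in> {1..<N}" for i
        unfolding P.Phi_T using that by (auto intro!: generate_ring.incl)
      have pi: "P.\<Phi> (X 1 * P.Tw) \<in> ?W" "P.\<Phi> (P.Tw' * (Xinv 1 * P.YZ)) \<in> ?W"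
        by (subst P.hpi_Phi[symmetric], rule generate_ring.incl, blast, subst P.inv_hpi[symmetric], rule generate_ring.incl, blast)
      from P.X_D_generated[OF c T pi i]
      show "hX N i \<in> ?W" "hD N l i \<in> ?W" by (simp_all only: P.Phi_X P.hD_Phi[OF i])
    qed
    show "P.h0 (gen g) \<in> ?W" if "g \<in> P.GA" for g
      using that XD by (cases g) (auto simp: val P.GA_iff intro!: generate_ring.incl)
    show "?H \<subseteq> P.h0 ` carrier P.FA.F"
    proof (intro Un_least image_subsetI insert_subsetI empty_subsetI)
      show "hscal N c \<in> P.h0 ` carrier P.FA.F" if "c \<in> Zqt_coeffs l" for c
        using imageI[OF P.FA.F_scal[OF that], of P.h0] by (simp add: val)
      show "hT N i \<in> P.h0 ` carrier P.FA.F" if "i \<in> {1..<N}" for i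
        using imageI[OF P.FA_gen(1)[OF that], of P.h0] that by (simp add: val)
      show "hY N i \<in> P.h0 ` carrier P.FA.F" "inv\<^bsub>daha_Z N l\<^esub> hY N i \<in> P.h0 ` carrier P.FA.F" if "i \<in> {1..N}" for i
        using imageI[OF P.FA_gen(4)[OF that], of P.h0] imageI[OF P.FA_gen(5)[OF TrueI that], of P.h0] that
        by (simp_all add: val)
      have "prod_list (T_up 1 N) = P.Tw" "prod_list (Tinv_down 1 N) = P.Tw'"
        by (simp_all add: T_up_def Tinv_down_def P.Tw_def P.Tw'_def)
      then have FT: "P.Tw \<in> carrier P.FA.F" "P.Tw' \<in> carrier P.FA.F" using P.FA_words[of 1 N] by simp_all
      have "P.\<theta> (Tinv i) = Tinv i" for i
        by (simp add: Tinv_def P.theta_simps rhomD[OF P.rhom_theta])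
      then have \<theta>: "P.\<theta> P.Tw = P.Tw" "P.\<theta> P.Tw' = P.Tw'"
        by (simp_all add: P.Tw_def P.Tw'_def rhom_prod_list[OF P.rhom_theta] o_def P.theta_simps)
      have "P.h0 (X 1 * P.Tw) = hpi N l"
        by (simp add: P.h0_def rhomD[OF P.rhom_theta] P.theta_simps \<theta> P.hpi_Phi)
      then show "hpi N l \<in> P.h0 ` carrier P.FA.F"
        using imageI[OF P.FA.F_mult[OF P.FA_gen(2)[OF P.one_mem] FT(1)], of P.h0] by simp
      \<comment> \<open>Since \<pi> = X_1 T_1 ... T_{N-1}, the last generator is (T_1 ...
        T_{N-1})^{-1} D_1, an expression in letters of the presentation.\<close>
      have "P.h0 (P.Tw' * D 1) = inv\<^bsub>daha_Z N l\<^esub> hpi N l \<otimes>\<^bsub>daha_Z N l\<^esub> hYZ N l"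
        unfolding P.inv_hpi by (simp add: P.h0_def rhomD[OF P.rhom_theta] P.theta_simps \<theta> P.Dl_def P.YZ_def)
      then show "inv\<^bsub>daha_Z N l\<^esub> hpi N l \<otimes>\<^bsub>daha_Z N l\<^esub> hYZ N l \<in> P.h0 ` carrier P.FA.F"
        using imageI[OF P.FA.F_mult[OF FT(2) P.FA_gen(3)[OF P.one_mem]], of P.h0] by simp
    qed
  qed
  then show "has_presentation (cyc_daha N l) (Zqt_coeffs l) (hscal N) (cyc_gens N) (cyc_value N l) (cyc_rels N l \<union> Y_inverse_rels N)"
    using P.presentation[of "cyc_daha N l"] unfolding RG by (simp add: cyc_daha_def)
qed

end
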